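(* Let $(X_t)_{t\ge0}$ be a $d$-dimensional $G$-Lévy process on a sublinear expectation space $(\Omega,\mathcal{H},\hat{\mathbb{E}})$, and let $\mathcal{U}$ be a set that represents $G_X$ (in the sense given in the context). For each bounded Lipschitz $\varphi\in C_{b.Lip}(\mathbb{R}^d)$, define $u(t,x)=\hat{\mathbb{E}}[\varphi(x+X_t)]$ for $(t,x)\in[0,\infty)\times\mathbb{R}^d$. Then $u$ is the unique viscosity solution of the integro-partial differential equation $$\partial_tu(t,x)-\sup_{(v,q,Q)\in\mathcal{U}}\Big\{\int_{\mathbb{R}^d\setminus\{0\}}(u(t,x+z)-u(t,x))\,v(dz)+\langle Du(t,x),q\rangle+\tfrac12\mathrm{tr}[D^2u(t,x)QQ^T]\Big\}=0$$ with initial condition $u(0,x)=\varphi(x)$.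
   Context: Sublinear expectation space. $\Omega$ is a set, $\mathcal{H}$ is a linear space of real functions on $\Omega$ such that $\varphi(X_1,\dots,X_n)\in\mathcal{H}$ whenever $X_1,\dots,X_n\in\mathcal{H}$ and $\varphi\in C_{Lip}(\mathbb{R}^n)$ (the Lipschitz functions); in particular $\mathcal{H}$ contains the constants. A sublinear expectation is a functional $\hat{\mathbb{E}}:\mathcal{H}\to\mathbb{R}$ with (a) $\hat{\mathbb{E}}[X]\ge\hat{\mathbb{E}}[Y]$ if $X\ge Y$; (b) $\hat{\mathbb{E}}[c]=c$ for $c\in\mathbb{R}$; (c) $\hat{\mathbb{E}}[X]-\hat{\mathbb{E}}[Y]\le\hat{\mathbb{E}}[X-Y]$; (d) $\hat{\mathbb{E}}[\lambda X]=\lambda\hat{\mathbb{E}}[X]$ for $\lambda\ge0$. Random vectors $X_1,X_2$ in $\mathbb{R}^n$ (with components in the respective $\mathcal{H}$'s, possibly on different spaces) are identically distributed if $\hat{\mathbb{E}}_1[\varphi(X_1)]=\hat{\mathbb{E}}_2[\varphi(X_2)]$ for all $\varphi\in C_{Lip}(\mathbb{R}^n)$. $Y\in\mathcal{H}^n$ is independent from $X\in\mathcal{H}^m$ if $\hat{\mathbb{E}}[\varphi(X,Y)]=\hat{\mathbb{E}}\big[\hat{\mathbb{E}}[\varphi(x,Y)]_{x=X}\big]$ for all $\varphi\in C_{Lip}(\mathbb{R}^m\times\mathbb{R}^n)$. Lévy process. A $d$-dimensional process is a family $(X_t)_{t\ge0}$ with $X_t\in\mathcal{H}^d$; it is càdlàg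 if all paths $t\mapsto X_t(\omega)$ are right-continuous with left limits. A $d$-dimensional càdlàg process is a Lévy process if (i) $X_0=0$; (ii) for all $t,s>0$, $X_{t+s}-X_t$ is independent from $(X_{t_1},\dots,X_{t_n})$ for every $n$ and $0\le t_1\le\dots\le t_n\le t$; (iii) the distribution of $X_{t+s}-X_t$ does not depend on $t$. $G$-Lévy process. A $d$-dimensional Lévy process $(X_t)$ is a $G$-Lévy process if there is a decomposition $X_t=X_t^c+X_t^d$, $t\ge0$, where $(X_t^c,X_t^d)_{t\ge0}$ is a $2d$-dimensional Lévy process with $$\lim_{t\downarrow0}\hat{\mathbb{E}}[|X_t^c|^3]t^{-1}=0,\qquad \hat{\mathbb{E}}[|X_t^d|]\le Ct\ \text{ for } t\ge0,$$ for some constant $C$. The decomposition is understood up to distribution: $(X^c,X^d)$ may live on another sublinear expectation space, provided $(X^c_t+X^d_t)_{t\ge0}$ has the same finite-dimensional distributions as $(X_t)_{t\ge 0}$. Integrability convention: $\mathcal{H}$ (of the space carrying $(X^c,X^d)$) contains $\psi(\xi^c,\xi^d)$ whenever $\xi^c$, $\xi^d$ are finite families of values of $X^c$, $X^d$ and $\psi$ is locally Lipschitz with $|\psi(x,y)|\le K(1+|x|^3+|y|)$ for some constant $K$. Function spaces. $C_{b.Lip}(\mathbb{R}^d)$: bounded Lipschitz functions. $C_b^k(\mathbb{R}^d)$: bounded $k$-times continuously differentiable functions with bounded derivatives of all orders $\le k$. $C_b^{2,3}$: bounded functions $\psi(t,x)$ on $(0,\infty)\times\mathbb{R}^d$, twice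 continuously differentiable in $t$ and three times in $x$, with bounded derivatives. Representation of $G_X$. $G_X[f(\cdot)]:=\lim_{\delta\downarrow0}\hat{\mathbb{E}}[f(X_\delta)]\delta^{-1}$ for $f\in C_b^3(\mathbb{R}^d)$ with $f(0)=0$ (the limit exists). A nonempty set $\mathcal{U}$ of triples $(v,q,Q)$, with $v$ a measure on the Borel sets of $\mathbb{R}^d\setminus\{0\}$, $q\in\mathbb{R}^d$, $Q\in\mathbb{R}^{d\times d}$, represents $G_X$ if $\sup_{(v,q,Q)\in\mathcal{U}}\{\int|z|v(dz)+|q|+\mathrm{tr}[QQ^T]\}<\infty$ and $G_X[f(\cdot)]=\sup_{(v,q,Q)\in\mathcal{U}}\{\int_{\mathbb{R}^d\setminus\{0\}}f(z)v(dz)+\langle Df(0),q\rangle+\frac12\mathrm{tr}[D^2f(0)QQ^T]\}$ for all $f\in C_b^3(\mathbb{R}^d)$ with $f(0)=0$. Such a set exists. Viscosity solution. A bounded upper semicontinuous (lower semicontinuous) function $u$ on $[0,\infty)\times\mathbb{R}^d$ is a viscosity subsolution (supersolution) of the equation if $u(0,x)\le\varphi(x)$ ($\ge\varphi(x)$) and for each $(t,x)\in(0,\infty)\times\mathbb{R}^d$ and each $\psi\in C_b^{2,3}$ with $\psi\ge u$ ($\psi\le u$) and $\psi(t,x)=u(t,x)$, the left-hand side of the equation with $u$ replaced by $\psi$, evaluated at $(t,x)$, is $\le0$ ($\ge0$). A bounded continuous function is a viscosity solution if it is both a viscosity subsolution and a viscosity supersolution. *)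

theory Defs
  imports "HOL-Analysis.Analysis"
begin

section \<open>Lipschitz functions of finite tuples\<close>

text \<open>
  The number of arguments of a test function varies inside the definitions, so an $n$-tuple is
  represented by a function on \<^typ>\<open>nat\<close> of which only the values at $i < n$ count.  Since
  \<open>tuple_dist n\<close> ignores the other indices, the Lipschitz conditions below force the test
  functions to ignore them as well.
\<close>

definition tuple_dist :: "nat \<Rightarrow> (nat \<Rightarrow> 'a::metric_space) \<Rightarrow> (nat \<Rightarrow> 'a) \<Rightarrow> real" where
  "tuple_dist n x y = L2_set (\<lambda>i. dist (x i) (y i)) {..<n}"

definition tuple_norm :: "nat \<Rightarrow> (nat \<Rightarrow> 'a::real_normed_vector) \<Rightarrow> real" where
  "tuple_norm n x = L2_set (\<lambda>i. norm (x i)) {..<n}"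

definition C_Lip :: "('a::metric_space \<Rightarrow> real) set" where
  "C_Lip = {\<phi>. \<exists>L. L-lipschitz_on UNIV \<phi>}"

definition C_b_Lip :: "('a::metric_space \<Rightarrow> real) set" where
  "C_b_Lip = {\<phi> \<in> C_Lip. bounded (range \<phi>)}"

definition C_Lip_tuple :: "nat \<Rightarrow> ((nat \<Rightarrow> 'a::metric_space) \<Rightarrow> real) set" where
  "C_Lip_tuple n = {\<phi>. \<exists>L. \<forall>x y. \<bar>\<phi> x - \<phi> y\<bar> \<le> L * tuple_dist n x y}"

text \<open>Lipschitz functions $\varphi(x, y)$ of an $n$-tuple $x$ and a single vector $y$.\<close>

definition C_Lip_tuple_vec ::
    "nat \<Rightarrow> ((nat \<Rightarrow> 'a::metric_space) \<Rightarrow> 'b::metric_space \<Rightarrow> real) set" where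
  "C_Lip_tuple_vec n =
     {\<phi>. \<exists>L. \<forall>x x' y y'.
        \<bar>\<phi> x y - \<phi> x' y'\<bar> \<le> L * sqrt ((tuple_dist n x x')\<^sup>2 + (dist y y')\<^sup>2)}"

text \<open>
  Locally Lipschitz functions $\psi(x, y)$ of an $m$-tuple $x$ and an $n$-tuple $y$ with
  $|\psi(x, y)| \le K (1 + |x|^3 + |y|)$.
\<close>

definition C_loc_Lip_growth ::
    "nat \<Rightarrow> nat \<Rightarrow>
      ((nat \<Rightarrow> 'a::real_normed_vector) \<Rightarrow> (nat \<Rightarrow> 'b::real_normed_vector) \<Rightarrow> real) set" where
  "C_loc_Lip_growth m n =
     {\<psi>. (\<forall>x y. \<exists>\<epsilon>>0. \<exists>L. \<forall>x1 y1 x2 y2.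
            tuple_dist m x x1 < \<epsilon> \<and> tuple_dist n y y1 < \<epsilon> \<and>
            tuple_dist m x x2 < \<epsilon> \<and> tuple_dist n y y2 < \<epsilon> \<longrightarrow>
            \<bar>\<psi> x1 y1 - \<psi> x2 y2\<bar>
              \<le> L * sqrt ((tuple_dist m x1 x2)\<^sup>2 + (tuple_dist n y1 y2)\<^sup>2)) \<and>
         (\<exists>K. \<forall>x y. \<bar>\<psi> x y\<bar> \<le> K * (1 + tuple_norm m x ^ 3 + tuple_norm n y))}"


section \<open>Sublinear expectation spaces\<close>

text \<open>
  The sample space is the whole type \<^typ>\<open>'w\<close>.  The functional \<open>E\<close> is total in the logic;
  its values outside \<open>H\<close> are unconstrained.
\<close>

locale sublinear_expectation_space =
  fixes H :: "('w \<Rightarrow> real) set" and E :: "('w \<Rightarrow> real) \<Rightarrow> real"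
  assumes zero_closed: "(\<lambda>\<omega>. 0) \<in> H"
    and add_closed: "\<lbrakk>X \<in> H; Y \<in> H\<rbrakk> \<Longrightarrow> (\<lambda>\<omega>. X \<omega> + Y \<omega>) \<in> H"
    and scale_closed: "X \<in> H \<Longrightarrow> (\<lambda>\<omega>. c * X \<omega>) \<in> H"
    and Lip_closed:
      "\<lbrakk>\<phi> \<in> C_Lip_tuple n; \<forall>i<n. \<xi> i \<in> H\<rbrakk> \<Longrightarrow> (\<lambda>\<omega>. \<phi> (\<lambda>i. \<xi> i \<omega>)) \<in> H"
    and mono: "\<lbrakk>X \<in> H; Y \<in> H; \<forall>\<omega>. X \<omega> \<ge> Y \<omega>\<rbrakk> \<Longrightarrow> E X \<ge> E Y"
    and const: "E (\<lambda>\<omega>. c) = c"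
    and sub_additive: "\<lbrakk>X \<in> H; Y \<in> H\<rbrakk> \<Longrightarrow> E X - E Y \<le> E (\<lambda>\<omega>. X \<omega> - Y \<omega>)"
    and pos_homogeneous: "\<lbrakk>X \<in> H; c \<ge> 0\<rbrakk> \<Longrightarrow> E (\<lambda>\<omega>. c * X \<omega>) = c * E X"

definition random_vector :: "('w \<Rightarrow> real) set \<Rightarrow> ('w \<Rightarrow> 'a::euclidean_space) \<Rightarrow> bool" where
  "random_vector H X \<longleftrightarrow> (\<forall>b\<in>Basis. (\<lambda>\<omega>. X \<omega> \<bullet> b) \<in> H)"

definition identically_distributed ::
    "(('w1 \<Rightarrow> real) \<Rightarrow> real) \<Rightarrow> ('w1 \<Rightarrow> 'a::euclidean_space) \<Rightarrow>
     (('w2 \<Rightarrow> real) \<Rightarrow> real) \<Rightarrow> ('w2 \<Rightarrow> 'a) \<Rightarrow> bool" where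
  "identically_distributed E1 X1 E2 X2 \<longleftrightarrow>
     (\<forall>\<phi>\<in>C_Lip. E1 (\<lambda>\<omega>. \<phi> (X1 \<omega>)) = E2 (\<lambda>\<omega>. \<phi> (X2 \<omega>)))"

text \<open>The random vector \<open>Y\<close> is independent from the random $n$-tuple \<open>X\<close>.\<close>

definition independent_from ::
    "(('w \<Rightarrow> real) \<Rightarrow> real) \<Rightarrow> ('w \<Rightarrow> 'b::euclidean_space) \<Rightarrow>
     nat \<Rightarrow> (nat \<Rightarrow> 'w \<Rightarrow> 'a::euclidean_space) \<Rightarrow> bool" where
  "independent_from E Y n X \<longleftrightarrow>
     (\<forall>\<phi>\<in>C_Lip_tuple_vec n.
        E (\<lambda>\<omega>. \<phi> (\<lambda>i. X i \<omega>) (Y \<omega>)) =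
        E (\<lambda>\<omega>. E (\<lambda>\<omega>'. \<phi> (\<lambda>i. X i \<omega>) (Y \<omega>'))))"


section \<open>Levy processes and G-Levy processes\<close>

text \<open>Processes are indexed by all reals, but only their values at times $t \ge 0$ count.\<close>

definition cadlag :: "(real \<Rightarrow> 'w \<Rightarrow> 'a::topological_space) \<Rightarrow> bool" where
  "cadlag X \<longleftrightarrow>
     (\<forall>\<omega>. (\<forall>t\<ge>0. ((\<lambda>s. X s \<omega>) \<longlongrightarrow> X t \<omega>) (at_right t)) \<and>
          (\<forall>t>0. \<exists>l. ((\<lambda>s. X s \<omega>) \<longlongrightarrow> l) (at_left t)))"

definition Levy_process ::
    "('w \<Rightarrow> real) set \<Rightarrow> (('w \<Rightarrow> real) \<Rightarrow> real) \<Rightarrow> (real \<Rightarrow> 'w \<Rightarrow> 'a::euclidean_space) \<Rightarrow> bool"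
  where
  "Levy_process H E X \<longleftrightarrow>
     (\<forall>t\<ge>0. random_vector H (X t)) \<and>
     cadlag X \<and>
     (\<forall>\<omega>. X 0 \<omega> = 0) \<and>
     (\<forall>t>0. \<forall>s>0. \<forall>n \<tau>.
        (\<forall>i<n. 0 \<le> \<tau> i \<and> \<tau> i \<le> t) \<and> (\<forall>i j. i \<le> j \<and> j < n \<longrightarrow> \<tau> i \<le> \<tau> j) \<longrightarrow>
        independent_from E (\<lambda>\<omega>. X (t + s) \<omega> - X t \<omega>) n (\<lambda>i. X (\<tau> i))) \<and>
     (\<forall>s>0. \<forall>t\<ge>0. \<forall>t'\<ge>0.
        identically_distributed E (\<lambda>\<omega>. X (t + s) \<omega> - X t \<omega>) E (\<lambda>\<omega>. X (t' + s) \<omega> - X t' \<omega>))"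

definition same_finite_dim_distributions ::
    "(('w1 \<Rightarrow> real) \<Rightarrow> real) \<Rightarrow> (real \<Rightarrow> 'w1 \<Rightarrow> 'a::euclidean_space) \<Rightarrow>
     (('w2 \<Rightarrow> real) \<Rightarrow> real) \<Rightarrow> (real \<Rightarrow> 'w2 \<Rightarrow> 'a) \<Rightarrow> bool" where
  "same_finite_dim_distributions E1 X1 E2 X2 \<longleftrightarrow>
     (\<forall>n \<tau>. (\<forall>i<n. 0 \<le> \<tau> i) \<longrightarrow>
        (\<forall>\<phi>\<in>C_Lip_tuple n.
           E1 (\<lambda>\<omega>. \<phi> (\<lambda>i. X1 (\<tau> i) \<omega>)) = E2 (\<lambda>\<omega>. \<phi> (\<lambda>i. X2 (\<tau> i) \<omega>))))"

definition integrability_convention ::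
    "('w \<Rightarrow> real) set \<Rightarrow> (real \<Rightarrow> 'w \<Rightarrow> 'a::euclidean_space) \<Rightarrow> (real \<Rightarrow> 'w \<Rightarrow> 'a) \<Rightarrow> bool" where
  "integrability_convention H Xc Xd \<longleftrightarrow>
     (\<forall>m n \<sigma> \<tau>. (\<forall>i<m. 0 \<le> \<sigma> i) \<and> (\<forall>j<n. 0 \<le> \<tau> j) \<longrightarrow>
        (\<forall>\<psi>\<in>C_loc_Lip_growth m n.
           (\<lambda>\<omega>. \<psi> (\<lambda>i. Xc (\<sigma> i) \<omega>) (\<lambda>j. Xd (\<tau> j) \<omega>)) \<in> H))"

definition G_Levy_decomposition ::
    "('w \<Rightarrow> real) set \<Rightarrow> (('w \<Rightarrow> real) \<Rightarrow> real) \<Rightarrow>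
     (real \<Rightarrow> 'w \<Rightarrow> 'a::euclidean_space) \<Rightarrow> (real \<Rightarrow> 'w \<Rightarrow> 'a) \<Rightarrow> bool" where
  "G_Levy_decomposition H E Xc Xd \<longleftrightarrow>
     Levy_process H E (\<lambda>t \<omega>. (Xc t \<omega>, Xd t \<omega>)) \<and>
     integrability_convention H Xc Xd \<and>
     ((\<lambda>t. E (\<lambda>\<omega>. norm (Xc t \<omega>) ^ 3) / t) \<longlongrightarrow> 0) (at_right 0) \<and>
     (\<exists>C. \<forall>t\<ge>0. E (\<lambda>\<omega>. norm (Xd t \<omega>)) \<le> C * t)"

text \<open>
  The decomposition may live on another space, whose sample space is the type \<^typ>\<open>'v\<close>.
  HOL cannot quantify existentially over types, so this type is a parameter: a theorem that
  assumes \<open>G_Levy_process TYPE('v) H E X\<close> for a type variable \<^typ>\<open>'v\<close> covers a decomposition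
  on any sample space.
\<close>

definition G_Levy_process ::
    "'v itself \<Rightarrow> ('w \<Rightarrow> real) set \<Rightarrow> (('w \<Rightarrow> real) \<Rightarrow> real) \<Rightarrow>
     (real \<Rightarrow> 'w \<Rightarrow> 'a::euclidean_space) \<Rightarrow> bool" where
  "G_Levy_process _ H E X \<longleftrightarrow>
     Levy_process H E X \<and>
     (\<exists>(H' :: ('v \<Rightarrow> real) set) E' Xc Xd.
        sublinear_expectation_space H' E' \<and>
        G_Levy_decomposition H' E' Xc Xd \<and>
        same_finite_dim_distributions E' (\<lambda>t \<omega>. Xc t \<omega> + Xd t \<omega>) E X)"


section \<open>Derivatives and spaces of smooth functions\<close>

definition gradient :: "(real^'d \<Rightarrow> real) \<Rightarrow> real^'d \<Rightarrow> real^'d" where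
  "gradient f x = (\<chi> i. frechet_derivative f (at x) (axis i 1))"

definition hessian :: "(real^'d \<Rightarrow> real) \<Rightarrow> real^'d \<Rightarrow> real^'d^'d" where
  "hessian f x = (\<chi> i j. gradient (\<lambda>y. gradient f y $ i) x $ j)"

primrec C_b :: "nat \<Rightarrow> (real^'d \<Rightarrow> real) set" where
  "C_b 0 = {f. bounded (range f) \<and> continuous_on UNIV f}"
| "C_b (Suc k) =
     {f. bounded (range f) \<and> (\<forall>x. f differentiable (at x)) \<and>
         (\<forall>i. (\<lambda>x. gradient f x $ i) \<in> C_b k)}"

text \<open>
  Functions $\psi(t, x)$ on $(0, \infty) \times \mathbb{R}^d$; their values at $t \le 0$ do not
  count.  In \<open>C_b_time k\<close> (\<open>C_b_space k\<close>) all derivatives in $t$ (in $x$) of order at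
  most $k$ exist, are bounded, and are jointly continuous in $(t, x)$.
\<close>

definition C_b_cylinder :: "(real \<Rightarrow> real^'d \<Rightarrow> real) set" where
  "C_b_cylinder =
     {\<psi>. bounded ((\<lambda>(t, x). \<psi> t x) ` ({0<..} \<times> UNIV)) \<and>
         continuous_on ({0<..} \<times> UNIV) (\<lambda>(t, x). \<psi> t x)}"

primrec C_b_time :: "nat \<Rightarrow> (real \<Rightarrow> real^'d \<Rightarrow> real) set" where
  "C_b_time 0 = C_b_cylinder"
| "C_b_time (Suc k) =
     {\<psi> \<in> C_b_cylinder.
        (\<forall>t>0. \<forall>x. (\<lambda>s. \<psi> s x) differentiable (at t)) \<and>
        (\<lambda>t x. deriv (\<lambda>s. \<psi> s x) t) \<in> C_b_time k}"

primrec C_b_space :: "nat \<Rightarrow> (real \<Rightarrow> real^'d \<Rightarrow> real) set" where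
  "C_b_space 0 = C_b_cylinder"
| "C_b_space (Suc k) =
     {\<psi> \<in> C_b_cylinder.
        (\<forall>t>0. \<forall>x. \<psi> t differentiable (at x)) \<and>
        (\<forall>i. (\<lambda>t x. gradient (\<psi> t) x $ i) \<in> C_b_space k)}"

definition C_b_2_3 :: "(real \<Rightarrow> real^'d \<Rightarrow> real) set" where
  "C_b_2_3 = C_b_time 2 \<inter> C_b_space 3"


section \<open>Representation of the generator\<close>

type_synonym 'd triple = "(real^'d) measure \<times> (real^'d) \<times> (real^'d^'d)"

text \<open>
  $\sup_{(v,q,Q) \in U} \{ \int g \, dv + \langle p, q \rangle
    + \frac12 \mathrm{tr}[A Q Q^T] \}$
\<close>

definition sup_triples ::
    "'d::finite triple set \<Rightarrow> (real^'d \<Rightarrow> real) \<Rightarrow> real^'d \<Rightarrow> real^'d^'d \<Rightarrow> real" where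
  "sup_triples U g p A =
     (SUP (v, q, Q)\<in>U.
        (\<integral>z. g z \<partial>v) + p \<bullet> q + 1 / 2 * trace (A ** (Q ** transpose Q)))"

definition G_X ::
    "(('w \<Rightarrow> real) \<Rightarrow> real) \<Rightarrow> (real \<Rightarrow> 'w \<Rightarrow> real^'d) \<Rightarrow> (real^'d \<Rightarrow> real) \<Rightarrow> real" where
  "G_X E X f = Lim (at_right 0) (\<lambda>\<delta>. E (\<lambda>\<omega>. f (X \<delta> \<omega>)) / \<delta>)"

definition represents_G_X ::
    "(('w \<Rightarrow> real) \<Rightarrow> real) \<Rightarrow> (real \<Rightarrow> 'w \<Rightarrow> real^'d) \<Rightarrow> 'd::finite triple set \<Rightarrow> bool" where
  "represents_G_X E X U \<longleftrightarrow>
     U \<noteq> {} \<and>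
     (\<forall>(v, q, Q)\<in>U. space v = - {0} \<and> sets v = sets (restrict_space borel (- {0}))) \<and>
     (SUP (v, q, Q)\<in>U.
        (\<integral>\<^sup>+z. ennreal (norm z) \<partial>v) + ennreal (norm q + trace (Q ** transpose Q))) < \<infinity> \<and>
     (\<forall>f\<in>C_b 3. f 0 = 0 \<longrightarrow> G_X E X f = sup_triples U f (gradient f 0) (hessian f 0))"


section \<open>Viscosity solutions\<close>

definition upper_semicontinuous_on :: "'a::topological_space set \<Rightarrow> ('a \<Rightarrow> real) \<Rightarrow> bool" where
  "upper_semicontinuous_on S f \<longleftrightarrow>
     (\<forall>x\<in>S. \<forall>c>f x. \<forall>\<^sub>F y in at x within S. f y < c)"

definition lower_semicontinuous_on :: "'a::topological_space set \<Rightarrow> ('a \<Rightarrow> real) \<Rightarrow> bool" where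
  "lower_semicontinuous_on S f \<longleftrightarrow>
     (\<forall>x\<in>S. \<forall>c<f x. \<forall>\<^sub>F y in at x within S. c < f y)"

text \<open>Left-hand side of the integro-partial differential equation.\<close>

definition pde_lhs ::
    "'d::finite triple set \<Rightarrow> (real \<Rightarrow> real^'d \<Rightarrow> real) \<Rightarrow> real \<Rightarrow> real^'d \<Rightarrow> real" where
  "pde_lhs U \<psi> t x =
     deriv (\<lambda>s. \<psi> s x) t
     - sup_triples U (\<lambda>z. \<psi> t (x + z) - \<psi> t x) (gradient (\<psi> t) x) (hessian (\<psi> t) x)"

definition viscosity_subsolution ::
    "'d::finite triple set \<Rightarrow> (real^'d \<Rightarrow> real) \<Rightarrow> (real \<Rightarrow> real^'d \<Rightarrow> real) \<Rightarrow> bool" where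
  "viscosity_subsolution U \<phi> u \<longleftrightarrow>
     bounded ((\<lambda>(t, x). u t x) ` ({0..} \<times> UNIV)) \<and>
     upper_semicontinuous_on ({0..} \<times> UNIV) (\<lambda>(t, x). u t x) \<and>
     (\<forall>x. u 0 x \<le> \<phi> x) \<and>
     (\<forall>t>0. \<forall>x. \<forall>\<psi>\<in>C_b_2_3.
        (\<forall>s>0. \<forall>y. u s y \<le> \<psi> s y) \<and> \<psi> t x = u t x \<longrightarrow> pde_lhs U \<psi> t x \<le> 0)"

definition viscosity_supersolution ::
    "'d::finite triple set \<Rightarrow> (real^'d \<Rightarrow> real) \<Rightarrow> (real \<Rightarrow> real^'d \<Rightarrow> real) \<Rightarrow> bool" where
  "viscosity_supersolution U \<phi> u \<longleftrightarrow>
     bounded ((\<lambda>(t, x). u t x) ` ({0..} \<times> UNIV)) \<and>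
     lower_semicontinuous_on ({0..} \<times> UNIV) (\<lambda>(t, x). u t x) \<and>
     (\<forall>x. \<phi> x \<le> u 0 x) \<and>
     (\<forall>t>0. \<forall>x. \<forall>\<psi>\<in>C_b_2_3.
        (\<forall>s>0. \<forall>y. \<psi> s y \<le> u s y) \<and> \<psi> t x = u t x \<longrightarrow> 0 \<le> pde_lhs U \<psi> t x)"

definition viscosity_solution ::
    "'d::finite triple set \<Rightarrow> (real^'d \<Rightarrow> real) \<Rightarrow> (real \<Rightarrow> real^'d \<Rightarrow> real) \<Rightarrow> bool" where
  "viscosity_solution U \<phi> u \<longleftrightarrow>
     bounded ((\<lambda>(t, x). u t x) ` ({0..} \<times> UNIV)) \<and>
     continuous_on ({0..} \<times> UNIV) (\<lambda>(t, x). u t x) \<and>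
     viscosity_subsolution U \<phi> u \<and> viscosity_supersolution U \<phi> u"

end

theory Submission
  imports Defs
begin

text \<open>
  The theorem has two halves: the value function \<open>u\<close> solves the equation, and the equation has no
  other bounded continuous solution.

  Uniqueness is a comparison principle, \<open>viscosity_comparison\<close>.  The nonlinear part of the equation
  is a supremum of \<^emph>\<open>linear\<close> translation invariant operators whose coefficients are bounded
  uniformly, and this allows a proof without a doubling of variables.  For a triple \<open>p\<close> let \<open>A\<close> be its
  Levy generator minus the time derivative.  Extend a continuous supersolution \<open>w\<close> to negative
  times by a lower bound and mollify it in space and time, to \<open>W\<close>.  Formally \<open>A W \<le> 0\<close>, since \<open>A\<close>
  is linear and commutes with convolutions; but \<open>A w \<le> 0\<close> holds only in the viscosity sense.
  The way around this is the resolvent equation \<open>l * P - A P = l * f\<close>, with \<open>f \<le> w\<close> smooth: a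
  maximum principle, with \<open>P\<close> as test function, gives \<open>P \<le> w\<close> (\<open>resolvent_le_supersolution\<close>).
  Convolving this inequality is harmless, so the resolvent of the mollified \<open>f\<close> lies below \<open>W\<close>, and
  if \<open>A W\<close> were positive at some point, then an explicit barrier slightly above \<open>W\<close> would lie below
  that resolvent (\<open>mollified_supersolution\<close>).  In order to solve the resolvent equation by a mere
  geometric series, \<open>A\<close> is replaced by a bounded operator: finite differences instead of derivatives
  and large jumps instead of all jumps (\<open>generator_approximation\<close>).  The approximation is uniform on
  functions with three bounded derivatives, which is all that the argument asks for.  Now \<open>W\<close>, moved
  slightly in time and raised slightly to dominate the initial value, is a smooth
  supersolution for all triples at once, and comparing it with a viscosity subsolution is the
  classical maximum principle, made rigorous on the unbounded domain by a flat penalty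
  (\<open>subsolution_le_smooth_supersolution\<close>).

  For existence, independence and stationarity of the increments give the dynamic programming
  principle \<open>u (t + s) x = E (u t (x + X s))\<close>.  When a test function \<open>\<psi>\<close> touches \<open>u\<close> at \<open>(t, x)\<close>, this
  determines the sign of \<open>E (\<psi> (t - \<delta>) (x + X \<delta>)) - \<psi> t x\<close>; dividing by \<open>\<delta>\<close> and letting \<open>\<delta>\<close> tend to
  \<open>0\<close> produces the equation for \<open>\<psi>\<close>, provided that \<open>E (f (X \<delta>)) / \<delta>\<close> converges.  Since \<open>G_X\<close> is only a
  name for this limit, its existence is a separate matter (\<open>generator_limit_exists\<close>): the function
  \<open>a t = E (f (X t))\<close> is additive up to an error \<open>C * s * w t\<close> with \<open>w\<close> vanishing at \<open>0\<close>, because the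
  mixed second difference of \<open>f\<close> is controlled by moments of the two increments, and for such
  functions \<open>a s / s\<close> converges.  The moments are where the two conditions on the decomposition
  enter.  The linear bound on the jump part is assumed; for the continuous part the cubic condition
  only makes the third moment finite at small times, and additivity of the means and a kind of
  superadditivity of the second moments turn this into bounds linear in time.
\<close>

section \<open>Functions with bounded derivatives\<close>

text \<open>Directional instead of coordinate derivatives, over any Euclidean space: the equation lives on
  space, but mollification takes place in space-time.\<close>

definition pd :: "'a::euclidean_space \<Rightarrow> ('a \<Rightarrow> real) \<Rightarrow> 'a \<Rightarrow> real" where
  "pd a f x = frechet_derivative f (at x) a"

text \<open>All partial derivatives up to order \<open>k\<close> exist, are continuous, and are bounded by the \<^emph>\<open>same\<close>
  constant \<open>K\<close>.  A single explicit constant is what the later estimates, uniform over large families of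
  functions, are stated in.\<close>

primrec Sm :: "nat \<Rightarrow> real \<Rightarrow> ('a::euclidean_space \<Rightarrow> real) \<Rightarrow> bool" where
  "Sm 0 K f \<longleftrightarrow> continuous_on UNIV f \<and> (\<forall>x. \<bar>f x\<bar> \<le> K)"
| "Sm (Suc k) K f \<longleftrightarrow> (\<forall>x. \<bar>f x\<bar> \<le> K) \<and> (\<forall>x. f differentiable (at x)) \<and>
     (\<forall>b\<in>Basis. Sm k K (pd b f))"

lemma Sm_bound: "Sm k K f \<Longrightarrow> \<bar>f x\<bar> \<le> K"
  by (cases k) auto

lemma Sm_nonneg: "Sm k K f \<Longrightarrow> 0 \<le> K"
  using Sm_bound[of k K f undefined] by linarith

lemma Sm_differentiable: "Sm (Suc k) K f \<Longrightarrow> f differentiable (at x)"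
  by auto

lemma Sm_pd_Basis: "Sm (Suc k) K f \<Longrightarrow> b \<in> Basis \<Longrightarrow> Sm k K (pd b f)"
  by auto

lemma Sm_continuous: "Sm k K f \<Longrightarrow> continuous_on UNIV f"
  by (cases k) (auto intro!: differentiable_imp_continuous_on simp: differentiable_on_def
      intro: differentiable_at_withinI)

lemma Sm_mono: "Sm k K f \<Longrightarrow> K \<le> K' \<Longrightarrow> Sm k K' f"
  by (induction k arbitrary: f) (auto intro: order_trans)

lemma Sm_Suc_lower: "Sm (Suc k) K f \<Longrightarrow> Sm k K f"
proof (induction k arbitrary: f)
  case 0
  then show ?case using Sm_continuous[OF 0] by simp
next
  case (Suc k)
  then show ?case by (metis Sm.simps(2))
qed

lemma Sm_lower: "Sm k K f \<Longrightarrow> j \<le> k \<Longrightarrow> Sm j K f"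
proof (induction k)
  case (Suc k)
  then show ?case by (cases "j = Suc k") (auto intro: Sm_Suc_lower simp del: Sm.simps)
qed simp

lemma pd_has_derivative:
  assumes "(f has_derivative f') (at x)" shows "pd a f x = f' a"
  using frechet_derivative_at[OF assms] by (simp add: pd_def)

lemma has_derivative_pd:
  "f differentiable (at x) \<Longrightarrow> (f has_derivative (\<lambda>a. pd a f x)) (at x)"
  by (simp add: frechet_derivative_works pd_def[abs_def])

lemma pd_add:
  assumes "f differentiable (at x)" "g differentiable (at x)"
  shows "pd a (\<lambda>x. f x + g x) x = pd a f x + pd a g x"
  by (rule pd_has_derivative) (intro has_derivative_add has_derivative_pd assms)

lemma pd_cmult:
  assumes "f differentiable (at x)"
  shows "pd a (\<lambda>x. c * f x) x = c * pd a f x"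
  by (rule pd_has_derivative[of _ "\<lambda>a. c * pd a f x"]) (intro has_derivative_mult_right has_derivative_pd assms)

lemma pd_mult:
  assumes "f differentiable (at x)" "g differentiable (at x)"
  shows "pd a (\<lambda>x. f x * g x) x = f x * pd a g x + pd a f x * g x"
  by (rule pd_has_derivative[of _ "\<lambda>a. f x * pd a g x + pd a f x * g x"])
     (intro has_derivative_mult has_derivative_pd assms)

lemma pd_const [simp]: "pd a (\<lambda>x. c) x = 0"
  by (simp add: pd_def)

lemma Sm_const [simp]: "Sm k K (\<lambda>x. c) \<longleftrightarrow> \<bar>c\<bar> \<le> K"
proof -
  have z: "Sm k K (\<lambda>x::'a. 0)" if "0 \<le> K" for k K
    using that by (induction k) (auto simp: pd_def[abs_def])
  show ?thesis by (cases k) (auto simp: pd_def[abs_def] z intro: z)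
qed

lemma Sm_add: "Sm k K f \<Longrightarrow> Sm k L g \<Longrightarrow> Sm k (K + L) (\<lambda>x. f x + g x)"
proof (induction k arbitrary: f g)
  case 0
  then show ?case by (auto intro!: continuous_intros order_trans[OF abs_triangle_ineq] add_mono)
next
  case (Suc k)
  have "pd b (\<lambda>x. f x + g x) = (\<lambda>x. pd b f x + pd b g x)" for b
    using Suc.prems by (auto intro!: ext pd_add)
  then show ?case using Suc
    by (auto intro!: order_trans[OF abs_triangle_ineq] add_mono differentiable_add)
qed

lemma Sm_cmult: "Sm k K f \<Longrightarrow> Sm k (\<bar>c\<bar> * K) (\<lambda>x. c * f x)"
proof (induction k arbitrary: f)
  case 0
  then show ?case by (auto intro!: continuous_intros mult_left_mono simp: abs_mult)
next
  case (Suc k)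
  have "pd b (\<lambda>x. c * f x) = (\<lambda>x. c * pd b f x)" for b
    using Suc.prems by (auto intro!: ext pd_cmult)
  then show ?case using Suc
    by (auto intro!: mult_left_mono differentiable_mult simp: abs_mult)
qed

lemma Sm_mult: "Sm k K f \<Longrightarrow> Sm k L g \<Longrightarrow> Sm k (2^k * (K * L)) (\<lambda>x. f x * g x)"
proof (induction k arbitrary: f g)
  case 0
  then show ?case
    using Sm_nonneg[of 0 K f] by (auto intro!: continuous_intros mult_mono simp: abs_mult)
next
  case (Suc k)
  have eq: "pd b (\<lambda>x. f x * g x) = (\<lambda>x. f x * pd b g x + pd b f x * g x)" for b
    using Suc.prems by (auto intro!: ext pd_mult)
  have nn: "0 \<le> K" "0 \<le> L" using Sm_nonneg Suc.prems by blast+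
  have "\<bar>f x * g x\<bar> \<le> 2^Suc k * (K * L)" for x
  proof -
    have "\<bar>f x * g x\<bar> \<le> K * L"
      unfolding abs_mult using Suc.prems nn by (intro mult_mono) auto
    also have "\<dots> = 1 * (K * L)" by simp
    also have "\<dots> \<le> 2^Suc k * (K * L)"
      using nn by (intro mult_right_mono one_le_power) auto
    finally show ?thesis .
  qed
  moreover have "Sm k (2^Suc k * (K * L)) (pd b (\<lambda>x. f x * g x))" if b: "b \<in> Basis" for b
  proof -
    have 1: "Sm k (2^k * (K * L)) (\<lambda>x. f x * pd b g x)"
      by (rule Suc.IH[OF Sm_Suc_lower[OF Suc.prems(1)] Sm_pd_Basis[OF Suc.prems(2) b]])
    have 2: "Sm k (2^k * (K * L)) (\<lambda>x. pd b f x * g x)"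
      by (rule Suc.IH[OF Sm_pd_Basis[OF Suc.prems(1) b] Sm_Suc_lower[OF Suc.prems(2)]])
    show ?thesis
      unfolding eq using Sm_add[OF 1 2] by (simp add: algebra_simps)
  qed
  ultimately show ?case using Suc.prems
    by (auto intro!: differentiable_mult)
qed

lemma Sm_sum:
  "finite S \<Longrightarrow> (\<And>i. i \<in> S \<Longrightarrow> Sm k (K i) (f i)) \<Longrightarrow> Sm k (\<Sum>i\<in>S. K i) (\<lambda>x. \<Sum>i\<in>S. f i x)"
  by (induction S rule: finite_induct) (auto intro!: Sm_add)

lemma pd_Basis_sum:
  assumes "f differentiable (at x)"
  shows "pd a f x = (\<Sum>b\<in>Basis. (a \<bullet> b) * pd b f x)"
proof -
  have lin: "linear (\<lambda>a. pd a f x)"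
    using has_derivative_linear[OF has_derivative_pd[OF assms]] .
  have "pd a f x = pd (\<Sum>b\<in>Basis. (a \<bullet> b) *\<^sub>R b) f x" by (simp add: euclidean_representation)
  also have "\<dots> = (\<Sum>b\<in>Basis. pd ((a \<bullet> b) *\<^sub>R b) f x)"
    using linear_sum[OF lin] by blast
  also have "\<dots> = (\<Sum>b\<in>Basis. (a \<bullet> b) * pd b f x)"
    using linear_scale[OF lin] by simp
  finally show ?thesis .
qed

text \<open>With coordinatewise derivative bounds, the natural norm for increments is the sum of the absolute
  coordinates.\<close>

definition norm_l1 :: "'a::euclidean_space \<Rightarrow> real" where
  "norm_l1 a = (\<Sum>b\<in>Basis. \<bar>a \<bullet> b\<bar>)"

lemma norm_l1_nonneg [simp]: "0 \<le> norm_l1 a"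
  by (auto simp: norm_l1_def intro: sum_nonneg)

lemma norm_l1_le: "norm_l1 (a::'a::euclidean_space) \<le> DIM('a) * norm a"
  unfolding norm_l1_def using sum_bounded_above[of Basis "\<lambda>b. \<bar>a \<bullet> b\<bar>" "norm a"]
  by (auto simp: Basis_le_norm)

lemma norm_l1_scaleR: "norm_l1 (c *\<^sub>R a) = \<bar>c\<bar> * norm_l1 a"
  by (simp add: norm_l1_def abs_mult sum_distrib_left)

lemma norm_l1_minus [simp]: "norm_l1 (- a) = norm_l1 a"
  by (simp add: norm_l1_def)

lemma Sm_pd: assumes "Sm (Suc k) K f" shows "Sm k (norm_l1 a * K) (pd a f)"
proof -
  have "pd a f = (\<lambda>x. \<Sum>b\<in>Basis. (a \<bullet> b) * pd b f x)"
    using pd_Basis_sum Sm_differentiable[OF assms] by blast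
  moreover have "Sm k (\<Sum>b\<in>Basis. \<bar>a \<bullet> b\<bar> * K) (\<lambda>x. \<Sum>b\<in>Basis. (a \<bullet> b) * pd b f x)"
    using assms by (intro Sm_sum Sm_cmult) auto
  ultimately show ?thesis by (simp add: norm_l1_def sum_distrib_right)
qed

lemma line_derivative:
  assumes "f differentiable (at (x + s *\<^sub>R a))"
  shows "((\<lambda>s. f (x + s *\<^sub>R a)) has_real_derivative pd a f (x + s *\<^sub>R a)) (at s)"
proof -
  have d: "(f has_derivative (\<lambda>h. pd h f (x + s *\<^sub>R a))) (at (x + s *\<^sub>R a))"
    by (rule has_derivative_pd[OF assms])
  have "((\<lambda>s. f (x + s *\<^sub>R a)) has_derivative (\<lambda>h. pd (h *\<^sub>R a) f (x + s *\<^sub>R a))) (at s)"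
    by (rule has_derivative_compose[of "\<lambda>s. x + s *\<^sub>R a" "\<lambda>h. h *\<^sub>R a" s UNIV f, OF _ d])
       (auto intro!: derivative_eq_intros)
  moreover have "pd (h *\<^sub>R a) f (x + s *\<^sub>R a) = pd a f (x + s *\<^sub>R a) * h" for h
    using linear_scale[OF has_derivative_linear[OF d]] by simp
  ultimately show ?thesis by (simp add: has_field_derivative_def)
qed

lemma Taylor_one:
  assumes d: "\<And>x. f differentiable (at x)" and B: "\<And>y. \<bar>pd a f y\<bar> \<le> B"
  shows "\<bar>f (x + a) - f x\<bar> \<le> B"
proof -
  obtain s where "f (x + 1 *\<^sub>R a) - f (x + 0 *\<^sub>R a) = (1 - 0) * pd a f (x + s *\<^sub>R a)"
    using MVT2[of 0 1 "\<lambda>s. f (x + s *\<^sub>R a)" "\<lambda>s. pd a f (x + s *\<^sub>R a)"] line_derivative d by force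
  then show ?thesis using B by simp
qed

lemma Taylor_two:
  assumes d: "\<And>x. f differentiable (at x)" and d2: "\<And>x. pd a f differentiable (at x)"
    and B: "\<And>y. \<bar>pd a (pd a f) y\<bar> \<le> B"
  shows "\<bar>f (x + a) - f x - pd a f x\<bar> \<le> B"
proof -
  obtain s where "f (x + 1 *\<^sub>R a) - f (x + 0 *\<^sub>R a) = (1 - 0) * pd a f (x + s *\<^sub>R a)"
    and s: "0 < s" "s < 1"
    using MVT2[of 0 1 "\<lambda>s. f (x + s *\<^sub>R a)" "\<lambda>s. pd a f (x + s *\<^sub>R a)"] line_derivative d by force
  moreover obtain r where "pd a f (x + s *\<^sub>R a) - pd a f (x + 0 *\<^sub>R a)
      = (s - 0) * pd a (pd a f) (x + r *\<^sub>R a)"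
    using MVT2[of 0 s "\<lambda>s. pd a f (x + s *\<^sub>R a)" "\<lambda>s. pd a (pd a f) (x + s *\<^sub>R a)"]
      line_derivative d2 s by metis
  ultimately have "f (x + a) - f x - pd a f x = s * pd a (pd a f) (x + r *\<^sub>R a)" by simp
  moreover have "s * \<bar>pd a (pd a f) (x + r *\<^sub>R a)\<bar> \<le> 1 * B"
    using s B by (intro mult_mono) auto
  ultimately show ?thesis using s by (simp add: abs_mult)
qed

text \<open>The third order remainder of the symmetric second difference has a bounded factor, so the
  difference quotients that replace second derivatives converge with a rate.\<close>

lemma Taylor_two_sided:
  assumes d: "\<And>x. f differentiable (at x)" and d2: "\<And>x. pd a f differentiable (at x)"
    and d3: "\<And>x. pd a (pd a f) differentiable (at x)"
    and B: "\<And>y. \<bar>pd a (pd a (pd a f)) y\<bar> \<le> B"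
  shows "\<bar>f (x + a) + f (x - a) - 2 * f x - pd a (pd a f) x\<bar> \<le> 2 * B"
proof -
  let ?g = "pd a (pd a f)"
  let ?p = "\<lambda>s. f (x + s *\<^sub>R a) + f (x - s *\<^sub>R a) - s\<^sup>2 * ?g x"
  let ?q = "\<lambda>s. pd a f (x + s *\<^sub>R a) - pd a f (x - s *\<^sub>R a) - 2 * s * ?g x"
  have m: "((\<lambda>s. g (x - s *\<^sub>R a)) has_real_derivative - pd a g (x - s *\<^sub>R a)) (at s)"
    if "\<And>x. g differentiable (at x)" for g s
  proof -
    have "((\<lambda>s. g (x + s *\<^sub>R a)) has_real_derivative pd a g (x + (- s) *\<^sub>R a)) (at (- s))"
      by (rule line_derivative) (rule that)
    from DERIV_chain2[OF this DERIV_minus[OF DERIV_ident]] show ?thesis by simp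
  qed
  have p': "(?p has_real_derivative ?q s) (at s)" for s
    by (rule derivative_eq_intros line_derivative[OF d] m[OF d] refl | simp)+
  have q': "(?q has_real_derivative ?g (x + s *\<^sub>R a) + ?g (x - s *\<^sub>R a) - 2 * ?g x) (at s)" for s
    by (rule derivative_eq_intros line_derivative[OF d2] m[OF d2] refl | simp)+
  obtain s where s: "0 < s" "s < 1" and 1: "?p 1 - ?p 0 = (1 - 0) * ?q s"
    using MVT2[of 0 1 ?p ?q, OF zero_less_one p'] by blast
  obtain r where r: "0 < r" "r < s" and 2: "?q s - ?q 0 =
     (s - 0) * (?g (x + r *\<^sub>R a) + ?g (x - r *\<^sub>R a) - 2 * ?g x)"
    using MVT2[of 0 s ?q "\<lambda>r. ?g (x + r *\<^sub>R a) + ?g (x - r *\<^sub>R a) - 2 * ?g x", OF s(1) q'] by blast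
  have T: "\<bar>?g (x + t *\<^sub>R a) - ?g x\<bar> \<le> \<bar>t\<bar> * B" for t
  proof -
    have l: "pd (t *\<^sub>R a) ?g y = t * pd a ?g y" for y
      using linear_scale[OF has_derivative_linear[OF has_derivative_pd[OF d3]]] by simp
    show ?thesis using Taylor_one[of ?g "t *\<^sub>R a" "\<bar>t\<bar> * B" x] d3 B
      by (simp add: l abs_mult mult_left_mono)
  qed
  have "B \<ge> 0" using B[of x] by linarith
  have rB: "r * B \<le> 1 * B" using r s \<open>B \<ge> 0\<close> by (intro mult_right_mono) auto
  have "\<bar>?g (x + r *\<^sub>R a) + ?g (x - r *\<^sub>R a) - 2 * ?g x\<bar> \<le> 2 * B"
    using T[of r] T[of "- r"] r rB by simp
  then have "s * \<bar>?g (x + r *\<^sub>R a) + ?g (x - r *\<^sub>R a) - 2 * ?g x\<bar> \<le> 1 * (2 * B)"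
    using s by (intro mult_mono) auto
  moreover have "f (x + a) + f (x - a) - 2 * f x - ?g x = s * (?g (x + r *\<^sub>R a) + ?g (x - r *\<^sub>R a) - 2 * ?g x)"
    using 1 2 by simp
  ultimately show ?thesis using s by (simp only: abs_mult)
qed

lemma pd_affine:
  assumes "\<And>x. f differentiable (at x)"
  shows "pd b (\<lambda>y. f (e *\<^sub>R y + c)) = (\<lambda>y. e * pd b f (e *\<^sub>R y + c))"
    and "(\<lambda>y. f (e *\<^sub>R y + c)) differentiable (at y)"
proof -
  have d: "((\<lambda>y. f (e *\<^sub>R y + c)) has_derivative (\<lambda>h. pd (e *\<^sub>R h) f (e *\<^sub>R y + c))) (at y)" for y
    by (rule has_derivative_compose[of "\<lambda>y. e *\<^sub>R y + c" "\<lambda>h. e *\<^sub>R h" y UNIV f, OF _ has_derivative_pd[OF assms]])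
       (auto intro!: derivative_eq_intros)
  have "pd (e *\<^sub>R b) f y = e * pd b f y" for y
    using linear_scale[OF has_derivative_linear[OF has_derivative_pd[OF assms]]] by simp
  then show "pd b (\<lambda>y. f (e *\<^sub>R y + c)) = (\<lambda>y. e * pd b f (e *\<^sub>R y + c))"
    using pd_has_derivative[OF d] by auto
  show "(\<lambda>y. f (e *\<^sub>R y + c)) differentiable (at y)"
    using d unfolding differentiable_def by blast
qed

lemma Sm_affine:
  assumes "Sm k K f" "\<bar>e\<bar> \<le> B" "1 \<le> B"
  shows "Sm k (B ^ k * K) (\<lambda>y. f (e *\<^sub>R y + c))"
  using assms(1)
proof (induction k arbitrary: f)
  case 0
  then have "continuous_on UNIV (\<lambda>y. f (e *\<^sub>R y + c))"
    by (auto intro!: continuous_intros continuous_on_compose2[of UNIV f])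
  then show ?case using 0 by auto
next
  case (Suc k)
  have "Sm k (B ^ Suc k * K) (pd b (\<lambda>y. f (e *\<^sub>R y + c)))" if "b \<in> Basis" for b
  proof -
    have "Sm k (\<bar>e\<bar> * (B ^ k * K)) (\<lambda>y. e * pd b f (e *\<^sub>R y + c))"
      using Suc that by (intro Sm_cmult) auto
    moreover have "\<bar>e\<bar> * (B ^ k * K) \<le> B * (B ^ k * K)"
      using assms Sm_nonneg[OF Suc.prems] by (intro mult_right_mono) auto
    moreover have "pd b (\<lambda>y. f (e *\<^sub>R y + c)) = (\<lambda>y. e * pd b f (e *\<^sub>R y + c))"
      using Suc.prems by (intro pd_affine) auto
    ultimately show ?thesis by (simp add: Sm_mono mult.assoc)
  qed
  moreover have "\<bar>f (e *\<^sub>R y + c)\<bar> \<le> B ^ Suc k * K" for y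
  proof -
    have "\<bar>f (e *\<^sub>R y + c)\<bar> \<le> 1 * K" using Sm_bound[OF Suc.prems] by simp
    also have "\<dots> \<le> B ^ Suc k * K"
      using assms Sm_nonneg[OF Suc.prems] by (intro mult_right_mono one_le_power)
    finally show ?thesis .
  qed
  moreover have "(\<lambda>y. f (e *\<^sub>R y + c)) differentiable (at y)" for y
    using Suc.prems by (intro pd_affine(2)) auto
  ultimately show ?case by (simp add: mult.assoc)
qed

lemma Sm_translate: "Sm k K f \<Longrightarrow> Sm k K (\<lambda>y. f (y + c))"
  using Sm_affine[of k K f 1 1 c] by simp

lemma Sm_pd_contract:
  assumes "Sm (Suc k) K f" "0 \<le> e" "e \<le> 1" "b \<in> Basis"
  shows "Sm k (e * K) (pd b (\<lambda>y. f (e *\<^sub>R y + c)))"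
proof -
  have "Sm k (\<bar>e\<bar> * (1 ^ k * K)) (\<lambda>y. e * pd b f (e *\<^sub>R y + c))"
    using assms by (intro Sm_cmult Sm_affine) auto
  moreover have "pd b (\<lambda>y. f (e *\<^sub>R y + c)) = (\<lambda>y. e * pd b f (e *\<^sub>R y + c))"
    using assms by (intro pd_affine) auto
  ultimately show ?thesis using assms by simp
qed

section \<open>A smooth bump\<close>

definition hump :: "'a::euclidean_space \<Rightarrow> real" where
  "hump y = max 0 (1 - y \<bullet> y)"

lemma hump_range: "0 \<le> hump y" "hump y \<le> 1"
  by (auto simp: hump_def)

lemma hump_outside: "1 \<le> norm y \<Longrightarrow> hump y = 0"
  using power_mono[of 1 "norm y" 2] by (simp add: hump_def power2_norm_eq_inner)

lemma DERIV_max_power: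
  fixes t :: real
  assumes "n \<ge> 1"
  shows "((\<lambda>t. max 0 t ^ Suc n) has_real_derivative (real (Suc n) * max 0 t ^ n)) (at t)"
proof -
  consider "t < 0" | "t > 0" | "t = 0" by linarith
  then show ?thesis
  proof cases
    case 1
    have ev: "\<forall>\<^sub>F s in nhds t. max 0 s ^ Suc n = 0"
      using eventually_nhds_in_open[of "{..<0}" t] 1 by (auto elim!: eventually_mono)
    then show ?thesis using 1 assms by (simp add: DERIV_cong_ev[OF refl ev refl] power_0_left del: power_Suc)
  next
    case 2
    have d: "((\<lambda>t. t ^ Suc n) has_real_derivative (real (Suc n) * t ^ n)) (at t)"
      by (auto intro!: derivative_eq_intros simp del: power_Suc)
    have ev: "\<forall>\<^sub>F s in nhds t. max 0 s ^ Suc n = s ^ Suc n"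
      using eventually_nhds_in_open[of "{0<..}" t] 2 by (auto elim!: eventually_mono)
    show ?thesis using iffD2[OF DERIV_cong_ev[OF refl ev refl] d] 2
      by (simp add: max_absorb2 del: power_Suc of_nat_Suc)
  next
    case 3
    have "((\<lambda>h. max 0 h ^ n) \<longlongrightarrow> max 0 0 ^ n) (at (0::real))"
      by (intro tendsto_intros)
    then have "((\<lambda>h. max 0 h ^ n) \<longlongrightarrow> 0) (at (0::real))" using assms
      by (simp only: max.idem power_0_left) (simp split: if_splits)
    then have "((\<lambda>h. (max 0 h ^ Suc n - 0) / h) \<longlongrightarrow> 0) (at (0::real))"
    proof (rule Lim_null_comparison[rotated])
      show "\<forall>\<^sub>F h in at 0. norm ((max 0 h ^ Suc n - 0) / h) \<le> max 0 (h::real) ^ n"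
        using assms by (auto simp: eventually_at_filter abs_mult divide_simps power_0_left intro!: always_eventually split: split_max)
    qed
    then show ?thesis using 3 assms by (simp add: DERIV_def power_0_left)
  qed
qed

lemma hump_power_has_derivative:
  assumes "n \<ge> 1"
  shows "((\<lambda>y. hump y ^ Suc n) has_derivative (\<lambda>h. - 2 * real (Suc n) * (y \<bullet> h) * hump y ^ n)) (at y)"
proof -
  have "((\<lambda>y. 1 - y \<bullet> y) has_derivative (\<lambda>h. - 2 * (y \<bullet> h))) (at y)"
    by (auto intro!: derivative_eq_intros simp: inner_commute)
  from DERIV_compose_FDERIV[OF DERIV_max_power[OF assms] this]
  show ?thesis unfolding hump_def by (rule has_derivative_eq_rhs) (auto simp: algebra_simps)
qed

text \<open>The exponents \<open>4 ^ Suc k\<close> leave room for the product of two coordinates that a derivative of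
  \<open>(y \<bullet> b) * hump y ^ n\<close> produces: the remaining power is split evenly between the two.\<close>

lemma hump_power_smooth:
  assumes "4 ^ Suc k \<le> n"
  shows "\<exists>K. Sm k K (\<lambda>y::'a::euclidean_space. hump y ^ n) \<and>
     (\<forall>b\<in>Basis. Sm k K (\<lambda>y::'a. (y \<bullet> b) * hump y ^ n))"
  using assms
proof (induction k arbitrary: n)
  case 0
  have c: "continuous_on UNIV (\<lambda>y::'a. hump y ^ n)" "continuous_on UNIV (\<lambda>y. (y \<bullet> b) * hump y ^ n)" for b :: 'a
    unfolding hump_def by (intro continuous_intros)+
  have b1: "\<bar>hump y ^ n\<bar> \<le> 1" for y :: 'a using hump_range[of y] by (simp add: power_le_one)
  have b2: "\<bar>(y \<bullet> b) * hump y ^ n\<bar> \<le> 1" if "b \<in> Basis" for b y :: 'a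
  proof (cases "1 \<le> norm y")
    case True then show ?thesis using hump_outside[of y] 0 by (simp add: power_0_left)
  next
    case False
    then have "\<bar>y \<bullet> b\<bar> \<le> 1" using Basis_le_norm[OF that, of y] by linarith
    then show ?thesis using hump_range[of y] by (auto simp: abs_mult power_le_one intro!: mult_le_one)
  qed
  have "Sm 0 1 (\<lambda>y::'a. hump y ^ n)" "b \<in> Basis \<Longrightarrow> Sm 0 1 (\<lambda>y::'a. (y \<bullet> b) * hump y ^ n)" for b
    using c(1) c(2)[of b] b1 b2[of b] by (simp_all only: Sm.simps simp_thms)
  then show ?case by blast
next
  case (Suc k)
  define p q where "p = (n - 1) div 2" and "q = n - 1 - p"
  define m :: nat where "m = 4 ^ k"
  have m: "1 \<le> m" "16 * m \<le> n" using Suc.prems by (simp_all add: m_def)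
  have n: "n = Suc (n - 1)" "n - 1 = p + q" "n - 1 \<ge> 1" "4 ^ Suc k \<le> n - 1" "4 ^ Suc k \<le> p" "4 ^ Suc k \<le> q"
    using m by (auto simp: p_def q_def m_def[symmetric])
  obtain K1 where K1: "Sm k K1 (\<lambda>y::'a. hump y ^ n)" using Suc.IH[of n] Suc.prems by auto
  obtain K2 where K2: "Sm k K2 (\<lambda>y::'a. hump y ^ (n - 1))"
      "\<And>b. b \<in> Basis \<Longrightarrow> Sm k K2 (\<lambda>y::'a. (y \<bullet> b) * hump y ^ (n - 1))"
    using Suc.IH[of "n - 1"] n by auto
  obtain K3 where K3: "\<And>b. b \<in> Basis \<Longrightarrow> Sm k K3 (\<lambda>y::'a. (y \<bullet> b) * hump y ^ p)"
    using Suc.IH[of p] n by auto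
  obtain K4 where K4: "\<And>b. b \<in> Basis \<Longrightarrow> Sm k K4 (\<lambda>y::'a. (y \<bullet> b) * hump y ^ q)"
    using Suc.IH[of q] n by auto
  obtain K0 where K0: "Sm 0 K0 (\<lambda>y::'a. hump y ^ n)" "\<And>b. b \<in> Basis \<Longrightarrow> Sm 0 K0 (\<lambda>y::'a. (y \<bullet> b) * hump y ^ n)"
  proof -
    obtain K where "Sm k K (\<lambda>y::'a. hump y ^ n)" "\<And>b. b \<in> Basis \<Longrightarrow> Sm k K (\<lambda>y::'a. (y \<bullet> b) * hump y ^ n)"
      using Suc.IH[of n] Suc.prems by auto
    then show ?thesis using that[of K] Sm_lower[of k K _ 0] by blast
  qed
  have D: "((\<lambda>y. hump y ^ n) has_derivative (\<lambda>h. - 2 * real n * (y \<bullet> h) * hump y ^ (n - 1))) (at y)" for y :: 'a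
    using hump_power_has_derivative[of "n - 1" y] n by simp
  have D2: "((\<lambda>y. (y \<bullet> b) * hump y ^ n) has_derivative
      (\<lambda>h. (y \<bullet> b) * (- 2 * real n * (y \<bullet> h) * hump y ^ (n - 1)) + (h \<bullet> b) * hump y ^ n)) (at y)" for b y :: 'a
    by (intro has_derivative_mult D has_derivative_inner_left has_derivative_ident)
  have P: "pd c (\<lambda>y::'a. hump y ^ n) = (\<lambda>y. (- 2 * real n) * ((y \<bullet> c) * hump y ^ (n - 1)))" for c
    using pd_has_derivative[OF D] by (auto simp: mult_ac)
  have P2: "pd c (\<lambda>y::'a. (y \<bullet> b) * hump y ^ n) =
     (\<lambda>y. (- 2 * real n) * (((y \<bullet> b) * hump y ^ p) * ((y \<bullet> c) * hump y ^ q)) + (c \<bullet> b) * hump y ^ n)" for b c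
    using pd_has_derivative[OF D2] n by (auto simp: power_add)
  define K where "K = K0 + 2 * real n * K2 + (2 * real n * (2 ^ k * (K3 * K4)) + K1)"
  obtain b0 :: 'a where b0: "b0 \<in> Basis" using nonempty_Basis by blast
  have nn: "0 \<le> K0" "0 \<le> K1" "0 \<le> K2" "0 \<le> K3" "0 \<le> K4"
    using Sm_nonneg K0(1) K1 K2(1) K3[OF b0] K4[OF b0] by blast+
  have le: "K0 \<le> K" "2 * real n * K2 \<le> K" "2 * real n * (2 ^ k * (K3 * K4)) + K1 \<le> K"
    using nn by (auto simp: K_def)
  have 1: "Sm (Suc k) K (\<lambda>y::'a. hump y ^ n)"
  proof -
    have "Sm k K (pd c (\<lambda>y::'a. hump y ^ n))" if "c \<in> Basis" for c
      unfolding P using Sm_mono[OF Sm_cmult[OF K2(2)[OF that], of "- 2 * real n"]] le by simp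
    moreover have "\<bar>hump y ^ n\<bar> \<le> K" for y :: 'a using Sm_bound[OF K0(1), of y] le by linarith
    ultimately show ?thesis using D by (auto simp: differentiable_def)
  qed
  have 2: "Sm (Suc k) K (\<lambda>y::'a. (y \<bullet> b) * hump y ^ n)" if b: "b \<in> Basis" for b
  proof -
    have "Sm k K (pd c (\<lambda>y::'a. (y \<bullet> b) * hump y ^ n))" if c: "c \<in> Basis" for c
    proof -
      have "\<bar>c \<bullet> b\<bar> * K1 \<le> 1 * K1" using b c nn by (intro mult_right_mono) (auto simp: inner_Basis)
      then have l: "\<bar>- 2 * real n\<bar> * (2 ^ k * (K3 * K4)) + \<bar>c \<bullet> b\<bar> * K1 \<le> K" using le by simp
      show ?thesis unfolding P2
        by (rule Sm_mono[OF Sm_add[OF Sm_cmult[OF Sm_mult[OF K3[OF b] K4[OF c]]] Sm_cmult[OF K1]] l])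
    qed
    moreover have "\<bar>(y \<bullet> b) * hump y ^ n\<bar> \<le> K" for y :: 'a
      using Sm_bound[OF K0(2)[OF b], of y] le by linarith
    ultimately show ?thesis using D2 unfolding Sm.simps differentiable_def by blast
  qed
  show ?case using 1 2 by blast
qed

text \<open>By \<open>hump_power_smooth\<close> this exponent yields five bounded derivatives.\<close>

definition bump :: "'a::euclidean_space \<Rightarrow> real" where
  "bump y = hump y ^ (4 ^ 6)"

lemma bump_0 [simp]: "bump 0 = 1"
  by (simp add: bump_def hump_def)

lemma bump_range: "0 \<le> bump y" "bump y \<le> 1"
  using hump_range[of y] by (auto simp: bump_def power_le_one)

lemma bump_outside: "1 \<le> norm y \<Longrightarrow> bump y = 0"
  by (simp add: bump_def hump_outside)

lemma bump_smooth: "\<exists>K. Sm 5 K (bump :: 'a::euclidean_space \<Rightarrow> real)"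
proof -
  have "\<exists>K. Sm 5 K (\<lambda>y::'a. hump y ^ 4 ^ Suc 5)" using hump_power_smooth[of 5 "4 ^ Suc 5"] by blast
  then show ?thesis by (simp add: bump_def[abs_def])
qed

section \<open>Mollification\<close>

definition bounded_borel :: "real \<Rightarrow> ('a::euclidean_space \<Rightarrow> real) \<Rightarrow> bool" where
  "bounded_borel M g \<longleftrightarrow> g \<in> borel_measurable borel \<and> (\<forall>x. \<bar>g x\<bar> \<le> M)"

lemma bounded_borelD:
  assumes "bounded_borel M g"
  shows "g \<in> borel_measurable borel" "\<bar>g x\<bar> \<le> M" "0 \<le> M"
  using assms abs_ge_zero[of "g undefined"] order_trans unfolding bounded_borel_def by blast+

lemma Sm_bounded_borel: "Sm k K f \<Longrightarrow> bounded_borel K f"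
  by (auto simp: bounded_borel_def Sm_bound intro: borel_measurable_continuous_onI Sm_continuous)

definition conv :: "('a::euclidean_space \<Rightarrow> real) \<Rightarrow> ('a \<Rightarrow> real) \<Rightarrow> 'a \<Rightarrow> real" where
  "conv \<eta> g x = (\<integral>y. \<eta> (x - y) * g y \<partial>lborel)"

definition vol :: "'a::euclidean_space itself \<Rightarrow> real \<Rightarrow> real" where
  "vol _ r = measure lborel (cball (0::'a) r)"

lemma measure_cball_vol: "measure lborel (cball (c::'a::euclidean_space) r) = vol TYPE('a) r"
  by (cases "0 \<le> r") (simp_all add: vol_def content_cball)

lemma vol_nonneg [simp]: "0 \<le> vol t r"
  by (simp add: vol_def)

lemma integral_on_ball:
  fixes f :: "'a::euclidean_space \<Rightarrow> real"
  assumes m: "f \<in> borel_measurable borel" and b: "\<And>y. y \<in> cball x r \<Longrightarrow> \<bar>f y\<bar> \<le> B"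
    and z: "\<And>y. y \<notin> cball x r \<Longrightarrow> f y = 0" and "0 \<le> B"
  shows "integrable lborel f" "\<bar>\<integral>y. f y \<partial>lborel\<bar> \<le> B * vol TYPE('a) r"
proof -
  have fin: "emeasure lborel (cball x r) < \<infinity>"
    using emeasure_lborel_cball_finite by blast
  show i: "integrable lborel f"
    by (rule integrableI_bounded_set[of "cball x r" _ _ B]) (use m b z fin in auto)
  have "\<bar>\<integral>y. f y \<partial>lborel\<bar> \<le> (\<integral>y. \<bar>f y\<bar> \<partial>lborel)"
    using integral_norm_bound[of lborel f] by simp
  also have "\<dots> \<le> (\<integral>y. B * indicator (cball x r) y \<partial>lborel)"
  proof (rule integral_mono)
    show "integrable lborel (\<lambda>y. B * indicator (cball x r) y)"
      using fin by (intro integrable_mult_right) (auto simp: integrable_indicator_iff)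
    show "\<bar>f y\<bar> \<le> B * indicator (cball x r) y" for y
      using b[of y] z[of y] by (auto split: split_indicator)
  qed (use i in simp)
  also have "\<dots> = B * vol TYPE('a) r"
    using fin by (simp add: measure_cball_vol)
  finally show "\<bar>\<integral>y. f y \<partial>lborel\<bar> \<le> B * vol TYPE('a) r" .
qed

definition supp_in :: "real \<Rightarrow> ('a::euclidean_space \<Rightarrow> real) \<Rightarrow> bool" where
  "supp_in r \<eta> \<longleftrightarrow> (\<forall>y. r < norm y \<longrightarrow> \<eta> y = 0)"

lemma supp_inD: "supp_in r \<eta> \<Longrightarrow> r < norm y \<Longrightarrow> \<eta> y = 0"
  by (simp add: supp_in_def)

lemma conv_integrand:
  fixes \<eta> :: "'a::euclidean_space \<Rightarrow> real"
  assumes "Sm k K \<eta>" "supp_in r \<eta>" "bounded_borel M g"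
  shows "integrable lborel (\<lambda>y. \<eta> (x - y) * g y)" "\<bar>conv \<eta> g x\<bar> \<le> K * M * vol TYPE('a) r"
proof -
  have [measurable]: "\<eta> \<in> borel_measurable borel" "g \<in> borel_measurable borel"
    using assms Sm_bounded_borel bounded_borelD by blast+
  have b: "\<bar>\<eta> (x - y) * g y\<bar> \<le> K * M" for y
    unfolding abs_mult using Sm_bound[OF assms(1)] bounded_borelD[OF assms(3)] Sm_nonneg[OF assms(1)]
    by (intro mult_mono) auto
  have z: "y \<notin> cball x r \<Longrightarrow> \<eta> (x - y) * g y = 0" for y
    using supp_inD[OF assms(2)] by (auto simp: dist_norm)
  have n: "0 \<le> K * M" using Sm_nonneg[OF assms(1)] bounded_borelD[OF assms(3)] by simp
  have m: "(\<lambda>y. \<eta> (x - y) * g y) \<in> borel_measurable borel" by measurable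
  show "integrable lborel (\<lambda>y. \<eta> (x - y) * g y)" by (rule integral_on_ball(1)[OF m b z n])
  show "\<bar>conv \<eta> g x\<bar> \<le> K * M * vol TYPE('a) r"
    unfolding conv_def by (rule integral_on_ball(2)[OF m b z n])
qed

lemma quadratic_remainder_has_derivative:
  fixes f :: "'a::euclidean_space \<Rightarrow> real"
  assumes "linear f'" and q: "\<And>h. norm h \<le> 1 \<Longrightarrow> \<bar>f (x + h) - f x - f' h\<bar> \<le> C * (norm h)\<^sup>2"
  shows "(f has_derivative f') (at x)"
proof (rule has_derivativeI)
  show "bounded_linear f'" using assms(1) linear_conv_bounded_linear by blast
  have "((\<lambda>y. \<bar>C\<bar> * norm (y - x)) \<longlongrightarrow> \<bar>C\<bar> * norm (x - x)) (at x)"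
    by (intro tendsto_intros)
  then have l: "((\<lambda>y. \<bar>C\<bar> * norm (y - x)) \<longlongrightarrow> 0) (at x)" by simp
  show "((\<lambda>y. (f y - f x - f' (y - x)) /\<^sub>R norm (y - x)) \<longlongrightarrow> 0) (at x)"
  proof (rule Lim_null_comparison[OF _ l])
    show "\<forall>\<^sub>F y in at x. norm ((f y - f x - f' (y - x)) /\<^sub>R norm (y - x)) \<le> \<bar>C\<bar> * norm (y - x)"
      unfolding eventually_at
    proof (intro exI[of _ 1] conjI ballI impI)
      fix y assume y: "y \<noteq> x \<and> dist y x < 1"
      then have "\<bar>f (x + (y - x)) - f x - f' (y - x)\<bar> \<le> C * (norm (y - x))\<^sup>2"
        by (intro q) (auto simp: dist_norm)
      also have "\<dots> \<le> \<bar>C\<bar> * (norm (y - x))\<^sup>2" by (intro mult_right_mono) auto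
      finally show "norm ((f y - f x - f' (y - x)) /\<^sub>R norm (y - x)) \<le> \<bar>C\<bar> * norm (y - x)"
        using y by (simp add: divide_simps power2_eq_square mult_ac)
    qed auto
  qed
qed

lemma Sm_pd_pd:
  fixes f :: "'a::euclidean_space \<Rightarrow> real"
  assumes "Sm (Suc (Suc k)) K f"
  shows "Sm k (norm_l1 a * (norm_l1 a * K)) (pd a (pd a f))"
  by (rule Sm_pd[OF Sm_pd[OF assms]])

lemma Sm_quadratic:
  fixes f :: "'a::euclidean_space \<Rightarrow> real"
  assumes "Sm 2 K f"
  shows "\<bar>f (x + h) - f x - pd h f x\<bar> \<le> (norm_l1 h)\<^sup>2 * K"
proof (rule Taylor_two)
  have s: "Sm (Suc (Suc 0)) K f" using assms by (simp add: numeral_2_eq_2 del: Sm.simps)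
  show "f differentiable (at x)" for x using Sm_differentiable[OF s] .
  show "pd h f differentiable (at x)" for x using Sm_differentiable[OF Sm_pd[OF s]] .
  show "\<bar>pd h (pd h f) y\<bar> \<le> (norm_l1 h)\<^sup>2 * K" for y
    using Sm_bound[OF Sm_pd_pd[OF s]] by (simp add: power2_eq_square mult_ac)
qed

lemma Sm_Lipschitz:
  fixes f :: "'a::euclidean_space \<Rightarrow> real"
  assumes "Sm (Suc k) K f"
  shows "\<bar>f (x + h) - f x\<bar> \<le> norm_l1 h * K"
  by (rule Taylor_one) (use Sm_differentiable[OF assms] Sm_bound[OF Sm_pd[OF assms]] in auto)

lemma norm_l1_sq_le: "(norm_l1 (h::'a::euclidean_space))\<^sup>2 \<le> (real DIM('a))\<^sup>2 * (norm h)\<^sup>2"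
  using power_mono[OF norm_l1_le[of h] norm_l1_nonneg, of 2] by (simp add: power_mult_distrib)

lemma supp_in_pd:
  fixes \<eta> :: "'a::euclidean_space \<Rightarrow> real"
  assumes "supp_in r \<eta>" shows "supp_in r (pd b \<eta>)"
  unfolding supp_in_def
proof (intro allI impI)
  fix y :: 'a assume y: "r < norm y"
  have o: "open {y::'a. r < norm y}" by (intro open_Collect_less continuous_intros)
  have "((\<lambda>y::'a. 0::real) has_derivative (\<lambda>h. 0)) (at y)" by simp
  then have "(\<eta> has_derivative (\<lambda>h. 0)) (at y)"
    by (rule has_derivative_transform_within_open[OF _ o]) (use y supp_inD[OF assms] in simp_all)
  from pd_has_derivative[OF this, of b] show "pd b \<eta> y = 0" .
qed

lemma conv_diff_bound:
  fixes \<eta> :: "'a::euclidean_space \<Rightarrow> real"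
  assumes m: "\<phi> \<in> borel_measurable borel" and b: "\<And>y. \<bar>\<phi> (x - y)\<bar> \<le> B" and z: "\<And>y. R < norm (x - y) \<Longrightarrow> \<phi> (x - y) = 0"
    and g: "bounded_borel M g" and B: "0 \<le> B"
  shows "\<bar>conv \<phi> g (x::'a)\<bar> \<le> B * M * vol TYPE('a) R"
  unfolding conv_def
proof (rule integral_on_ball[of _ x R "B * M"])
  have [measurable]: "g \<in> borel_measurable borel" "\<phi> \<in> borel_measurable borel" using g m bounded_borelD by blast+
  show "(\<lambda>y. \<phi> (x - y) * g y) \<in> borel_measurable borel" by measurable
  show "\<bar>\<phi> (x - y) * g y\<bar> \<le> B * M" for y
    unfolding abs_mult using b bounded_borelD[OF g] B by (intro mult_mono) auto
  show "\<phi> (x - y) * g y = 0" if "y \<notin> cball x R" for y using z[of y] that by (auto simp: dist_norm)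
  show "0 \<le> B * M" using B bounded_borelD[OF g] by simp
qed

lemma conv_has_derivative:
  fixes \<eta> :: "'a::euclidean_space \<Rightarrow> real"
  assumes \<eta>: "Sm (Suc (Suc k)) K \<eta>" and s: "supp_in r \<eta>" and g: "bounded_borel M g"
  shows "(conv \<eta> g has_derivative (\<lambda>h. conv (pd h \<eta>) g x)) (at x)"
proof (rule quadratic_remainder_has_derivative)
  have K: "Sm 2 K \<eta>" using Sm_lower[OF \<eta>, of 2] by simp
  note i = conv_integrand(1)[OF \<eta> s g]
  have ip: "integrable lborel (\<lambda>y. pd a \<eta> (x - y) * g y)" for a x
    by (rule conv_integrand(1)[OF Sm_pd[OF \<eta>] supp_in_pd[OF s] g])
  show "linear (\<lambda>h. conv (pd h \<eta>) g x)"
  proof (rule linearI)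
    have l: "linear (\<lambda>h. pd h \<eta> z)" for z
      by (rule has_derivative_linear[OF has_derivative_pd[OF Sm_differentiable[OF \<eta>]]])
    show "conv (pd (a + b) \<eta>) g x = conv (pd a \<eta>) g x + conv (pd b \<eta>) g x" for a b
    proof -
      have "conv (pd (a + b) \<eta>) g x = (\<integral>y. pd a \<eta> (x - y) * g y + pd b \<eta> (x - y) * g y \<partial>lborel)"
        unfolding conv_def
        by (rule Bochner_Integration.integral_cong[OF refl]) (simp only: linear_add[OF l] distrib_right)
      then show ?thesis using Bochner_Integration.integral_add[OF ip[of a x] ip[of b x]]
        by (simp only: conv_def)
    qed
    show "conv (pd (c *\<^sub>R a) \<eta>) g x = c *\<^sub>R conv (pd a \<eta>) g x" for a c
    proof -
      have "conv (pd (c *\<^sub>R a) \<eta>) g x = (\<integral>y. c * (pd a \<eta> (x - y) * g y) \<partial>lborel)"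
        unfolding conv_def
        by (rule Bochner_Integration.integral_cong[OF refl]) (simp only: linear_scale[OF l] real_scaleR_def mult.assoc)
      then show ?thesis by (simp only: conv_def integral_mult_right_zero real_scaleR_def)
    qed
  qed
  fix h :: 'a assume h: "norm h \<le> 1"
  let ?\<phi> = "\<lambda>z. \<eta> (z + h) - \<eta> z - pd h \<eta> z"
  have [measurable]: "g \<in> borel_measurable borel" "\<eta> \<in> borel_measurable borel" "pd h \<eta> \<in> borel_measurable borel"
    using g bounded_borelD Sm_bounded_borel \<eta> Sm_pd[OF \<eta>] by blast+
  have "conv \<eta> g (x + h) - conv \<eta> g x - conv (pd h \<eta>) g x = 
     (\<integral>y. \<eta> (x + h - y) * g y - \<eta> (x - y) * g y - pd h \<eta> (x - y) * g y \<partial>lborel)"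
    unfolding conv_def using i ip by simp
  also have "\<dots> = conv ?\<phi> g x" unfolding conv_def
    by (intro Bochner_Integration.integral_cong) (auto simp: algebra_simps)
  also have "\<bar>\<dots>\<bar> \<le> ((norm_l1 h)\<^sup>2 * K) * M * vol TYPE('a) (r + 1)"
  proof (rule conv_diff_bound[OF _ _ _ g])
    show "?\<phi> \<in> borel_measurable borel" by measurable
    show "\<bar>?\<phi> (x - y)\<bar> \<le> (norm_l1 h)\<^sup>2 * K" for y using Sm_quadratic[OF K] .
    show "?\<phi> (x - y) = 0" if "r + 1 < norm (x - y)" for y
      using that h supp_inD[OF s, of "x - y"] supp_inD[OF s, of "x - y + h"] supp_inD[OF supp_in_pd[OF s], of "x - y"]
        norm_diff_ineq[of "x - y" h] by auto
    show "0 \<le> (norm_l1 h)\<^sup>2 * K" using Sm_nonneg[OF K] by simp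
  qed
  also have "\<dots> = (K * M * vol TYPE('a) (r + 1)) * (norm_l1 h)\<^sup>2" by (simp add: mult_ac)
  also have "\<dots> \<le> (K * M * vol TYPE('a) (r + 1)) * ((real DIM('a))\<^sup>2 * (norm h)\<^sup>2)"
    using Sm_nonneg[OF K] bounded_borelD[OF g] by (intro mult_left_mono norm_l1_sq_le) auto
  finally show "\<bar>conv \<eta> g (x + h) - conv \<eta> g x - conv (pd h \<eta>) g x\<bar>
     \<le> (K * M * vol TYPE('a) (r + 1) * (real DIM('a))\<^sup>2) * (norm h)\<^sup>2" by (simp add: mult_ac)
qed

lemma pd_conv:
  assumes "Sm (Suc (Suc k)) K \<eta>" "supp_in r \<eta>" "bounded_borel M g"
  shows "pd h (conv \<eta> g) = conv (pd h \<eta>) g"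
  using pd_has_derivative[OF conv_has_derivative[OF assms]] by blast

lemma conv_continuous:
  fixes \<eta> :: "'a::euclidean_space \<Rightarrow> real"
  assumes \<eta>: "Sm (Suc k) K \<eta>" and s: "supp_in r \<eta>" and g: "bounded_borel M g"
  shows "continuous_on UNIV (conv \<eta> g)"
proof -
  have "isCont (conv \<eta> g) x" for x
  proof -
    define C where "C = real DIM('a) * K * M * vol TYPE('a) (r + 1)"
    have C: "0 \<le> C" using Sm_nonneg[OF \<eta>] bounded_borelD[OF g] by (simp add: C_def)
    have le: "\<bar>conv \<eta> g (x + h) - conv \<eta> g x\<bar> \<le> C * norm h" if h: "norm h \<le> 1" for h
    proof -
      let ?\<phi> = "\<lambda>z. \<eta> (z + h) - \<eta> z"
      have [measurable]: "g \<in> borel_measurable borel" "\<eta> \<in> borel_measurable borel"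
        using g bounded_borelD Sm_bounded_borel \<eta> by blast+
      have "conv \<eta> g (x + h) - conv \<eta> g x = (\<integral>y. \<eta> (x + h - y) * g y - \<eta> (x - y) * g y \<partial>lborel)"
        unfolding conv_def using conv_integrand(1)[OF \<eta> s g] by simp
      also have "\<dots> = conv ?\<phi> g x" unfolding conv_def
        by (intro Bochner_Integration.integral_cong) (auto simp: algebra_simps)
      also have "\<bar>\<dots>\<bar> \<le> (norm_l1 h * K) * M * vol TYPE('a) (r + 1)"
      proof (rule conv_diff_bound[OF _ _ _ g])
        show "?\<phi> \<in> borel_measurable borel" by measurable
        show "\<bar>?\<phi> (x - y)\<bar> \<le> norm_l1 h * K" for y using Sm_Lipschitz[OF \<eta>] .
        show "?\<phi> (x - y) = 0" if "r + 1 < norm (x - y)" for y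
          using that h supp_inD[OF s, of "x - y"] supp_inD[OF s, of "x - y + h"]
            norm_diff_ineq[of "x - y" h] by auto
        show "0 \<le> norm_l1 h * K" using Sm_nonneg[OF \<eta>] by simp
      qed
      also have "\<dots> = (K * M * vol TYPE('a) (r + 1)) * norm_l1 h" by (simp add: mult_ac)
      also have "\<dots> \<le> (K * M * vol TYPE('a) (r + 1)) * (real DIM('a) * norm h)"
        using Sm_nonneg[OF \<eta>] bounded_borelD[OF g] by (intro mult_left_mono norm_l1_le) auto
      finally show ?thesis by (simp add: C_def mult_ac)
    qed
    have l: "((\<lambda>h::'a. C * norm h) \<longlongrightarrow> 0) (at 0)"
      by (rule tendsto_mult_right_zero[OF tendsto_norm_zero[OF tendsto_ident_at]])
    have "((\<lambda>h. conv \<eta> g (x + h) - conv \<eta> g x) \<longlongrightarrow> 0) (at 0)"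
    proof (rule Lim_null_comparison[OF _ l])
      show "\<forall>\<^sub>F h in at 0. norm (conv \<eta> g (x + h) - conv \<eta> g x) \<le> C * norm h"
        unfolding eventually_at using le by (intro exI[of _ 1]) (simp add: dist_norm)
    qed
    then show ?thesis unfolding isCont_iff using LIM_zero_iff by blast
  qed
  then show ?thesis by (simp add: continuous_at_imp_continuous_on)
qed

text \<open>A derivative of a convolution falls on the kernel, so one order of smoothness of the kernel
  is spent on the continuity of the highest derivative.  The bound depends on \<open>g\<close> only through its
  supremum, which makes mollified families uniformly smooth.\<close>

theorem conv_smooth:
  fixes \<eta> :: "'a::euclidean_space \<Rightarrow> real"
  assumes "Sm (Suc k) K \<eta>" "supp_in r \<eta>" "bounded_borel M g"
  shows "Sm k (K * M * vol TYPE('a) r) (conv \<eta> g)"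
  using assms
proof (induction k arbitrary: \<eta>)
  case 0
  then show ?case using conv_continuous[OF 0] conv_integrand(2)[OF 0] by simp
next
  case (Suc k)
  have "Sm k (K * M * vol TYPE('a) r) (pd b (conv \<eta> g))" if "b \<in> Basis" for b
    unfolding pd_conv[OF Suc.prems] using Suc.prems that by (intro Suc.IH supp_in_pd) auto
  then show ?case
    using conv_integrand(2)[OF Suc.prems] conv_has_derivative[OF Suc.prems]
    unfolding Sm.simps differentiable_def by blast
qed


lemma integral_translate:
  fixes f :: "'a::euclidean_space \<Rightarrow> real"
  assumes [measurable]: "f \<in> borel_measurable borel"
  shows "(\<integral>y. f (y + c) \<partial>lborel) = (\<integral>y. f y \<partial>lborel)"
proof -
  have "(\<integral>y. f y \<partial>lborel) = (\<integral>y. f y \<partial>distr lborel borel ((+) c))"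
    by (simp add: lborel_distr_plus)
  also have "\<dots> = (\<integral>y. f (c + y) \<partial>lborel)"
    by (subst integral_distr) auto
  finally show ?thesis by (simp add: add.commute)
qed

text \<open>By \<open>conv_smooth\<close>, five derivatives of the kernel leave four for the mollified function, enough for
  \<open>generator_approximation\<close> to apply.\<close>

definition mollifier :: "real \<Rightarrow> ('a::euclidean_space \<Rightarrow> real) \<Rightarrow> bool" where
  "mollifier r \<eta> \<longleftrightarrow> (\<exists>K. Sm 5 K \<eta>) \<and> (\<forall>y. 0 \<le> \<eta> y) \<and> (\<forall>y. \<eta> (- y) = \<eta> y) \<and> supp_in r \<eta> \<and>
     (\<integral>y. \<eta> y \<partial>lborel) = 1"

lemma mollifier_Sm: assumes "mollifier r \<eta>" obtains K where "Sm 5 K \<eta>"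
  using assms by (auto simp: mollifier_def)

lemma mollifier_supp: "mollifier r \<eta> \<Longrightarrow> supp_in r \<eta>"
  and mollifier_nonneg: "mollifier r \<eta> \<Longrightarrow> 0 \<le> \<eta> y"
  by (auto simp: mollifier_def)

lemma conv_const:
  fixes \<eta> :: "'a::euclidean_space \<Rightarrow> real"
  assumes m: "mollifier r \<eta>"
  shows "conv \<eta> (\<lambda>_. c) x = c"
proof -
  obtain K where K: "Sm 5 K \<eta>" using mollifier_Sm[OF m] .
  have [measurable]: "\<eta> \<in> borel_measurable borel" using bounded_borelD(1)[OF Sm_bounded_borel[OF K]] .
  have e: "\<eta> (x - y) = \<eta> (y + (- x))" for y
    using m unfolding mollifier_def by (metis minus_diff_eq uminus_add_conv_diff add.commute)
  have "(\<integral>y. \<eta> (y + (- x)) \<partial>lborel) = 1"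
    using integral_translate[of \<eta> "- x"] m by (simp add: mollifier_def)
  then show ?thesis unfolding conv_def e by simp
qed

lemma conv_integrable:
  assumes m: "mollifier r \<eta>" and "bounded_borel M g"
  shows "integrable lborel (\<lambda>y. \<eta> (x - y) * g y)"
  using mollifier_Sm[OF m] conv_integrand(1)[OF _ mollifier_supp[OF m] assms(2)] by blast

lemma bounded_borel_const: "bounded_borel \<bar>c\<bar> (\<lambda>_. c)"
  by (simp add: bounded_borel_def)

lemma bounded_borel_lincomb:
  assumes "bounded_borel M g" "bounded_borel M' g'"
  shows "bounded_borel (M + \<bar>a\<bar> * M') (\<lambda>z. g z + a * g' z)"
proof -
  have [measurable]: "g \<in> borel_measurable borel" "g' \<in> borel_measurable borel" using assms bounded_borelD by blast+
  have "\<bar>g z + a * g' z\<bar> \<le> M + \<bar>a\<bar> * M'" for z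
    using bounded_borelD(2)[OF assms(1), of z] mult_left_mono[OF bounded_borelD(2)[OF assms(2), of z], of "\<bar>a\<bar>"]
    by (simp add: abs_mult[symmetric] order_trans[OF abs_triangle_ineq])
  then show ?thesis by (simp add: bounded_borel_def)
qed

lemma conv_lincomb:
  assumes m: "mollifier r \<eta>" and g: "bounded_borel M g" "bounded_borel M' g'"
  shows "conv \<eta> (\<lambda>z. g z + a * g' z) x = conv \<eta> g x + a * conv \<eta> g' x"
proof -
  have "conv \<eta> (\<lambda>z. g z + a * g' z) x = (\<integral>y. \<eta> (x - y) * g y + a * (\<eta> (x - y) * g' y) \<partial>lborel)"
    unfolding conv_def by (rule Bochner_Integration.integral_cong[OF refl]) (simp add: algebra_simps)
  then show ?thesis
    using conv_integrable[OF m g(1), of x] conv_integrable[OF m g(2), of x] by (simp add: conv_def)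
qed

text \<open>The kernel is nonnegative and sees only a ball, so pointwise bounds on that ball survive
  convolution.\<close>

lemma conv_local_mono:
  assumes m: "mollifier r \<eta>" and g: "bounded_borel M g" "bounded_borel M' g'"
    and le: "\<And>y. dist x y \<le> r \<Longrightarrow> g y \<le> g' y"
  shows "conv \<eta> g x \<le> conv \<eta> g' x"
  unfolding conv_def
proof (rule integral_mono[OF conv_integrable[OF m g(1)] conv_integrable[OF m g(2)]])
  fix y
  show "\<eta> (x - y) * g y \<le> \<eta> (x - y) * g' y"
  proof (cases "dist x y \<le> r")
    case True then show ?thesis using le mollifier_nonneg[OF m] by (intro mult_left_mono) auto
  next
    case False
    then have "\<eta> (x - y) = 0" using supp_inD[OF mollifier_supp[OF m], of "x - y"] by (simp add: dist_norm)
    then show ?thesis by simp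
  qed
qed

lemma conv_bounds:
  assumes m: "mollifier r \<eta>" and g: "bounded_borel M g"
  shows "(\<And>y. dist x y \<le> r \<Longrightarrow> g y \<le> c) \<Longrightarrow> conv \<eta> g x \<le> c"
    and "(\<And>y. dist x y \<le> r \<Longrightarrow> c \<le> g y) \<Longrightarrow> c \<le> conv \<eta> g x"
  using conv_local_mono[OF m g bounded_borel_const[of c], of x] conv_local_mono[OF m bounded_borel_const[of c] g, of x]
    conv_const[OF m, of c x] by auto

lemma conv_mollifier_Sm:
  fixes \<eta> :: "'a::euclidean_space \<Rightarrow> real"
  assumes m: "mollifier r \<eta>"
  obtains C where "0 \<le> C" "\<And>g M. bounded_borel M g \<Longrightarrow> Sm 4 (C * M) (conv \<eta> g)"
proof -
  obtain K where K: "Sm (Suc 4) K \<eta>" using mollifier_Sm[OF m] by (auto simp: numeral_eq_Suc)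
  have "Sm 4 (K * vol TYPE('a) r * M) (conv \<eta> g)" if "bounded_borel M g" for g M
    using conv_smooth[OF K mollifier_supp[OF m] that] by (simp add: mult_ac)
  moreover have "0 \<le> K * vol TYPE('a) r" using Sm_nonneg[OF K] by simp
  ultimately show ?thesis using that by blast
qed

lemma conv_bounded_borel:
  assumes m: "mollifier r \<eta>" and g: "bounded_borel M g"
  shows "bounded_borel M (conv \<eta> g)"
proof -
  obtain C where "Sm 4 (C * M) (conv \<eta> g)" using conv_mollifier_Sm[OF m] g by blast
  then have "conv \<eta> g \<in> borel_measurable borel" using bounded_borelD(1)[OF Sm_bounded_borel] by blast
  moreover have "conv \<eta> g x \<le> M" "- M \<le> conv \<eta> g x" for x
    using bounded_borelD(2)[OF g] by (intro conv_bounds[OF m g]; simp add: abs_le_iff minus_le_iff)+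
  ultimately show ?thesis by (simp add: bounded_borel_def abs_le_iff minus_le_iff)
qed

lemma conv_tendsto:
  assumes m: "mollifier r \<eta>" and g: "\<And>n. bounded_borel M (G n)" "bounded_borel M' g"
    and lim: "\<And>y. (\<lambda>n. G n y) \<longlonglongrightarrow> g y"
  shows "(\<lambda>n. conv \<eta> (G n) x) \<longlonglongrightarrow> conv \<eta> g x"
  unfolding conv_def
proof (rule integral_dominated_convergence[where w = "\<lambda>y. \<eta> (x - y) * M"])
  show "integrable lborel (\<lambda>y. \<eta> (x - y) * M)"
    by (rule conv_integrable[OF m bounded_borel_const])
  show "(\<lambda>y. \<eta> (x - y) * g y) \<in> borel_measurable lborel" "\<And>n. (\<lambda>y. \<eta> (x - y) * G n y) \<in> borel_measurable lborel"
    using borel_measurable_integrable[OF conv_integrable[OF m]] g by blast+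
  show "AE y in lborel. (\<lambda>n. \<eta> (x - y) * G n y) \<longlonglongrightarrow> \<eta> (x - y) * g y"
    by (intro AE_I2 tendsto_intros lim)
  show "AE y in lborel. norm (\<eta> (x - y) * G n y) \<le> \<eta> (x - y) * M" for n
    using bounded_borelD(2)[OF g(1)] mollifier_nonneg[OF m] by (intro AE_I2) (auto simp: abs_mult intro!: mult_left_mono)
qed

lemma bump_uminus: "bump (- y) = bump y"
  by (simp add: bump_def hump_def)

lemma mollifier_exists:
  assumes r: "0 < r"
  shows "\<exists>\<eta> :: 'a::euclidean_space \<Rightarrow> real. mollifier r \<eta>"
proof -
  define b where "b = (\<lambda>y::'a. bump ((1 / r) *\<^sub>R y + 0))"
  obtain K where K: "Sm 5 K (bump :: 'a \<Rightarrow> real)" using bump_smooth by blast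
  have S: "Sm 5 (max 1 (1 / r) ^ 5 * K) b"
    unfolding b_def by (rule Sm_affine[OF K]) (use r in auto)
  have [measurable]: "b \<in> borel_measurable borel" using bounded_borelD(1)[OF Sm_bounded_borel[OF S]] .
  have r01: "0 \<le> b y" "b y \<le> 1" for y using bump_range by (auto simp: b_def)
  have sup: "supp_in r b"
    using r by (auto simp: supp_in_def b_def divide_simps intro!: bump_outside)
  have int: "integrable lborel b"
    by (rule integral_on_ball(1)[of _ 0 r 1]) (use r01 supp_inD[OF sup] in auto)
  have "isCont b 0" using Sm_continuous[OF S] by (simp add: continuous_on_eq_continuous_at)
  then have "\<forall>\<^sub>F y in at 0. 1/2 < b y" 
    by (intro order_tendstoD(1)[of _ "b 0"]) (auto simp: isCont_def b_def)
  then obtain d where d: "d > 0" "\<And>y. y \<noteq> 0 \<Longrightarrow> norm y < d \<Longrightarrow> 1/2 < b y" 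
    by (auto simp: eventually_at)
  have d': "1/2 \<le> b y" if "norm y < d" for y using d(2)[OF _ that] by (cases "y = 0") (auto simp: b_def)
  have "0 < 1/2 * measure lborel (ball (0::'a) d)" using content_ball_pos[OF d(1)] by simp
  also have "\<dots> = (\<integral>y. 1/2 * indicator (ball (0::'a) d) y \<partial>lborel)"
    using emeasure_lborel_ball_finite[of "0::'a" d] by simp
  also have "\<dots> \<le> (\<integral>y. b y \<partial>lborel)"
    by (rule integral_mono) (use int d' r01 emeasure_lborel_ball_finite[of "0::'a" d] in
        \<open>auto simp: integrable_indicator_iff split: split_indicator\<close>)
  finally have pos: "0 < (\<integral>y. b y \<partial>lborel)" .
  define c where "c = 1 / (\<integral>y. b y \<partial>lborel)"
  have c: "0 < c" using pos by (simp add: c_def)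
  have "mollifier r (\<lambda>y. c * b y)"
    unfolding mollifier_def
  proof (intro conjI allI exI)
    show "Sm 5 (\<bar>c\<bar> * (max 1 (1 / r) ^ 5 * K)) (\<lambda>y. c * b y)" by (rule Sm_cmult[OF S])
    show "0 \<le> c * b y" for y using c r01 by simp
    show "c * b (- y) = c * b y" for y using bump_uminus[of "(1 / r) *\<^sub>R y"] by (simp add: b_def)
    show "supp_in r (\<lambda>y. c * b y)" using sup by (simp add: supp_in_def)
    show "(\<integral>y. c * b y \<partial>lborel) = 1" using pos by (simp add: c_def)
  qed
  then show ?thesis by blast
qed

section \<open>Bounded jump operators\<close>

text \<open>The operators \<open>g \<mapsto> (\<lambda>z. \<integral>a. g (z + a) \<partial>N)\<close> for finite measures \<open>N\<close> of mass \<open>c\<close> on space-time jumps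
  that never go forward in time, so that \<open>T - c\<close> generates a compound Poisson process with the
  clock running backwards.  Instead of the measure, the definition lists the properties that the
  resolvent uses: positivity, total mass, continuity under bounded pointwise convergence,
  commutation with convolutions, and causality (values at nonpositive times depend only on values at
  nonpositive times).  In this form sums and multiples need no manipulation of measures.\<close>

definition jump_op :: "real \<Rightarrow> ((real \<times> 'a::euclidean_space \<Rightarrow> real) \<Rightarrow> real \<times> 'a \<Rightarrow> real) \<Rightarrow> bool" where
  "jump_op c T \<longleftrightarrow> 0 \<le> c \<and>
    (\<forall>g M. bounded_borel M g \<longrightarrow> T g \<in> borel_measurable borel) \<and>
    (\<forall>g g' M M' a. bounded_borel M g \<longrightarrow> bounded_borel M' g' \<longrightarrow>
       T (\<lambda>z. g z + a * g' z) = (\<lambda>z. T g z + a * T g' z)) \<and>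
    (\<forall>g M. bounded_borel M g \<longrightarrow> (\<forall>z. 0 \<le> g z) \<longrightarrow> (\<forall>z. 0 \<le> T g z)) \<and>
    T (\<lambda>_. 1) = (\<lambda>_. c) \<and>
    (\<forall>G g M. (\<forall>n. bounded_borel M (G n)) \<longrightarrow> bounded_borel M g \<longrightarrow> (\<forall>z. (\<lambda>n. G n z) \<longlonglongrightarrow> g z) \<longrightarrow>
       (\<forall>z. (\<lambda>n. T (G n) z) \<longlonglongrightarrow> T g z)) \<and>
    (\<forall>\<eta> r g M. mollifier r \<eta> \<longrightarrow> bounded_borel M g \<longrightarrow> conv \<eta> (T g) = T (conv \<eta> g)) \<and>
    (\<forall>g M S. bounded_borel M g \<longrightarrow> (\<forall>t\<le>0. \<forall>x. g (t, x) \<le> S) \<longrightarrow> (\<forall>t\<le>0. \<forall>x. T g (t, x) \<le> c * S))"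

lemma jump_opD:
  assumes "jump_op c T"
  shows "0 \<le> c"
    and "\<forall>g M. bounded_borel M g \<longrightarrow> T g \<in> borel_measurable borel"
    and "\<forall>g g' M M' a. bounded_borel M g \<longrightarrow> bounded_borel M' g' \<longrightarrow>
       T (\<lambda>z. g z + a * g' z) = (\<lambda>z. T g z + a * T g' z)"
    and "\<forall>g M. bounded_borel M g \<longrightarrow> (\<forall>z. 0 \<le> g z) \<longrightarrow> (\<forall>z. 0 \<le> T g z)"
    and "T (\<lambda>_. 1) = (\<lambda>_. c)"
    and "\<forall>G g M. (\<forall>n. bounded_borel M (G n)) \<longrightarrow> bounded_borel M g \<longrightarrow> (\<forall>z. (\<lambda>n. G n z) \<longlonglongrightarrow> g z) \<longrightarrow>
       (\<forall>z. (\<lambda>n. T (G n) z) \<longlonglongrightarrow> T g z)"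
    and "\<forall>\<eta> r g M. mollifier r \<eta> \<longrightarrow> bounded_borel M g \<longrightarrow> conv \<eta> (T g) = T (conv \<eta> g)"
    and "\<forall>g M S. bounded_borel M g \<longrightarrow> (\<forall>t\<le>0. \<forall>x. g (t, x) \<le> S) \<longrightarrow> (\<forall>t\<le>0. \<forall>x. T g (t, x) \<le> c * S)"
  by (insert assms[unfolded jump_op_def], elim conjE, assumption)+

lemmas jump_op_rate = jump_opD(1)
  and jump_op_measurable = jump_opD(2)[rule_format]
  and jump_op_lincomb = jump_opD(3)[rule_format]
  and jump_op_nonneg = jump_opD(4)[rule_format]
  and jump_op_one = jump_opD(5)
  and jump_op_tendsto = jump_opD(6)[rule_format]
  and jump_op_conv = jump_opD(7)[rule_format]
  and jump_op_causal = jump_opD(8)[rule_format]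

lemma jump_op_const: assumes "jump_op c T" shows "T (\<lambda>_. a) = (\<lambda>_. c * a)"
proof -
  have "T (\<lambda>z. 0 + a * 1) = (\<lambda>z. T (\<lambda>z. 0) z + a * T (\<lambda>z. 1) z)"
    using jump_op_lincomb[OF assms bounded_borel_const bounded_borel_const] .
  moreover have "T (\<lambda>z. 0 + 0 * 0) = (\<lambda>z. T (\<lambda>z. 0) z + 0 * T (\<lambda>z. 0) z)"
    using jump_op_lincomb[OF assms bounded_borel_const bounded_borel_const] .
  moreover have "T (\<lambda>z. 1 + (-1) * 1) = (\<lambda>z. T (\<lambda>z. 1) z + (-1) * T (\<lambda>z. 1) z)"
    using jump_op_lincomb[OF assms bounded_borel_const bounded_borel_const] .
  ultimately show ?thesis using jump_op_one[OF assms] by (simp add: mult.commute)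
qed

lemma jump_op_mono:
  assumes T: "jump_op c T" and g: "bounded_borel M g" "bounded_borel M' g'" and le: "\<And>z. g z \<le> g' z"
  shows "T g z \<le> T g' z"
proof -
  have b: "bounded_borel (M' + \<bar>-1\<bar> * M) (\<lambda>z. g' z + (-1) * g z)" by (rule bounded_borel_lincomb[OF g(2,1)])
  have "0 \<le> T (\<lambda>z. g' z + (-1) * g z) z" by (rule jump_op_nonneg[OF T b]) (use le in simp)
  then show ?thesis using fun_cong[OF jump_op_lincomb[OF T g(2,1), of "-1"], of z] by simp
qed

lemma jump_op_bounded:
  assumes T: "jump_op c T" and g: "bounded_borel M g"
  shows "bounded_borel (c * M) (T g)"
proof -
  have "g z \<le> M" "- M \<le> g z" for z using bounded_borelD(2)[OF g, of z] by auto
  then have "T g z \<le> T (\<lambda>_. M) z" "T (\<lambda>_. - M) z \<le> T g z" for z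
    by (auto intro!: jump_op_mono[OF T g bounded_borel_const] jump_op_mono[OF T bounded_borel_const g])
  then show ?thesis using jump_op_measurable[OF T g]
    unfolding jump_op_const[OF T] bounded_borel_def by (auto simp: abs_le_iff minus_le_iff)
qed

lemma jump_op_shift:
  fixes a :: "real \<times> 'a::euclidean_space"
  assumes "fst a \<le> 0"
  shows "jump_op 1 (\<lambda>g z. g (z + a))"
proof -
  have "conv \<eta> (\<lambda>z. g (z + a)) x = conv \<eta> g (x + a)" if m: "mollifier r \<eta>" and g: "bounded_borel M g" for r \<eta> M and g :: "real \<times> 'a \<Rightarrow> real" and x
  proof -
    obtain K where K: "Sm 5 K \<eta>" using mollifier_Sm[OF m] .
    have [measurable]: "\<eta> \<in> borel_measurable borel" "g \<in> borel_measurable borel"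
      using bounded_borelD(1)[OF Sm_bounded_borel[OF K]] bounded_borelD(1)[OF g] by auto
    have "conv \<eta> (\<lambda>z. g (z + a)) x = (\<integral>y. \<eta> (x + a - (y + a)) * g (y + a) \<partial>lborel)"
      by (simp add: conv_def)
    also have "\<dots> = conv \<eta> g (x + a)" unfolding conv_def
      by (rule integral_translate[of "\<lambda>y. \<eta> (x + a - y) * g y"]) measurable
    finally show ?thesis .
  qed
  moreover have "g (t + fst a, x + snd a) \<le> S" if "\<forall>t\<le>0. \<forall>x. g (t, x) \<le> S" "t \<le> 0" for g t S and x :: 'a
    using assms that by simp
  moreover have "(\<lambda>z. g (z + a)) \<in> borel_measurable borel" if "bounded_borel M g" for M and g :: "real \<times> 'a \<Rightarrow> real"
  proof -
    have [measurable]: "g \<in> borel_measurable borel" using bounded_borelD(1)[OF that] .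
    show ?thesis by measurable
  qed
  ultimately show ?thesis unfolding jump_op_def by (auto simp: plus_prod_def fun_eq_iff)
qed

text \<open>Commutation with convolutions is Fubini's theorem.\<close>

lemma jump_op_integral:
  fixes N :: "(real \<times> 'a::euclidean_space) measure"
  assumes N: "finite_measure N" and S[measurable_cong, simp]: "sets N = sets borel"
    and causal: "AE a in N. fst a \<le> 0"
  shows "jump_op (measure N UNIV) (\<lambda>g z. \<integral>a. g (z + a) \<partial>N)"
proof -
  interpret N: finite_measure N by (rule N)
  have sp[simp]: "space N = UNIV" using sets_eq_imp_space_eq[OF S] by simp
  interpret P: pair_sigma_finite N "lborel :: (real \<times> 'a) measure" ..
  have mz[measurable]: "(\<lambda>a. g (z + a)) \<in> borel_measurable N" if "bounded_borel M g" for M z and g :: "real \<times> 'a \<Rightarrow> real"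
  proof -
    have [measurable]: "g \<in> borel_measurable borel" using bounded_borelD(1)[OF that] .
    show ?thesis by measurable
  qed
  have int: "integrable N (\<lambda>a. g (z + a))" if "bounded_borel M g" for M z and g :: "real \<times> 'a \<Rightarrow> real"
    by (rule N.integrable_const_bound[of _ M]) (use bounded_borelD(2)[OF that] mz[OF that] in auto)
  have 1: "(\<lambda>z. \<integral>a. g (z + a) \<partial>N) \<in> borel_measurable borel" if "bounded_borel M g" for M and g :: "real \<times> 'a \<Rightarrow> real"
  proof -
    have [measurable]: "g \<in> borel_measurable borel" using bounded_borelD(1)[OF that] .
    show ?thesis by measurable
  qed
  have 2: "(\<lambda>z. \<integral>a. (g (z + a) + s * g' (z + a)) \<partial>N) = (\<lambda>z. (\<integral>a. g (z + a) \<partial>N) + s * (\<integral>a. g' (z + a) \<partial>N))"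
    if "bounded_borel M g" "bounded_borel M' g'" for M M' s and g g' :: "real \<times> 'a \<Rightarrow> real"
    using int[OF that(1)] int[OF that(2)] by auto
  have 3: "(\<lambda>n. \<integral>a. G n (z + a) \<partial>N) \<longlonglongrightarrow> (\<integral>a. g (z + a) \<partial>N)"
    if "\<And>n. bounded_borel M (G n)" "bounded_borel M g" "\<And>z. (\<lambda>n. G n z) \<longlonglongrightarrow> g z"
    for G M z and g :: "real \<times> 'a \<Rightarrow> real"
  proof (rule integral_dominated_convergence[where w = "\<lambda>_. M"])
    show "AE a in N. norm (G n (z + a)) \<le> M" for n using bounded_borelD(2)[OF that(1)] by simp
    show "AE a in N. (\<lambda>n. G n (z + a)) \<longlonglongrightarrow> g (z + a)" using that(3) by simp
  qed (use mz that(1,2) in auto)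
  have 4: "conv \<eta> (\<lambda>z. \<integral>a. g (z + a) \<partial>N) x = (\<integral>a. conv \<eta> g (x + a) \<partial>N)"
    if m: "mollifier r \<eta>" and g: "bounded_borel M g" for r \<eta> M x and g :: "real \<times> 'a \<Rightarrow> real"
  proof -
    obtain K where K: "Sm 5 K \<eta>" using mollifier_Sm[OF m] .
    have [measurable]: "\<eta> \<in> borel_measurable borel" "g \<in> borel_measurable borel"
      using bounded_borelD(1)[OF Sm_bounded_borel[OF K]] bounded_borelD(1)[OF g] by auto
    have I: "integrable (N \<Otimes>\<^sub>M lborel) (\<lambda>(a, y). \<eta> (x - y) * g (y + a))"
    proof (rule integrableI_bounded_set[where A = "UNIV \<times> cball x r" and B = "K * M"])
      show "UNIV \<times> cball x r \<in> sets (N \<Otimes>\<^sub>M lborel)" by (rule pair_measureI) auto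
      show "(\<lambda>(a, y). \<eta> (x - y) * g (y + a)) \<in> borel_measurable (N \<Otimes>\<^sub>M lborel)" by measurable
      have "emeasure (N \<Otimes>\<^sub>M lborel) (UNIV \<times> cball x r) = emeasure N UNIV * emeasure lborel (cball x r)"
        by (rule lborel.emeasure_pair_measure_Times) auto
      also have "\<dots> < \<infinity>"
      proof -
        have "emeasure N UNIV < top" by (simp add: less_top[symmetric])
        then show ?thesis using emeasure_lborel_cball_finite[of x r] by (simp add: ennreal_mult_less_top)
      qed
      finally show "emeasure (N \<Otimes>\<^sub>M lborel) (UNIV \<times> cball x r) < \<infinity>" .
      have "norm (\<eta> (x - y) * g (y + a)) \<le> K * M" for a y
        unfolding real_norm_def abs_mult
        using Sm_bound[OF K, of "x - y"] Sm_nonneg[OF K] bounded_borelD(2)[OF g, of "y + a"] by (intro mult_mono) auto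
      then show "AE z in N \<Otimes>\<^sub>M lborel. z \<in> UNIV \<times> cball x r \<longrightarrow> norm (case z of (a, y) \<Rightarrow> \<eta> (x - y) * g (y + a)) \<le> K * M"
        by (intro AE_I2) (simp add: case_prod_unfold)
      have "\<eta> (x - y) * g (y + a) = 0" if "y \<notin> cball x r" for a y
        using supp_inD[OF mollifier_supp[OF m], of "x - y"] that by (simp add: dist_norm)
      then show "AE z in N \<Otimes>\<^sub>M lborel. z \<notin> UNIV \<times> cball x r \<longrightarrow> (case z of (a, y) \<Rightarrow> \<eta> (x - y) * g (y + a)) = 0"
        by (intro AE_I2) (simp add: case_prod_unfold mem_Times_iff)
    qed
    have "conv \<eta> (\<lambda>z. \<integral>a. g (z + a) \<partial>N) x = (\<integral>y. (\<integral>a. \<eta> (x - y) * g (y + a) \<partial>N) \<partial>lborel)"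
      unfolding conv_def by simp
    also have "\<dots> = (\<integral>a. (\<integral>y. \<eta> (x - y) * g (y + a) \<partial>lborel) \<partial>N)"
      by (rule P.Fubini_integral[OF I])
    also have "\<dots> = (\<integral>a. conv \<eta> g (x + a) \<partial>N)"
    proof (rule Bochner_Integration.integral_cong[OF refl])
      fix a
      have "(\<integral>y. \<eta> (x - y) * g (y + a) \<partial>lborel) = (\<integral>y. \<eta> (x + a - (y + a)) * g (y + a) \<partial>lborel)" by simp
      also have "\<dots> = conv \<eta> g (x + a)" unfolding conv_def
        by (rule integral_translate[of "\<lambda>y. \<eta> (x + a - y) * g y"]) measurable
      finally show "(\<integral>y. \<eta> (x - y) * g (y + a) \<partial>lborel) = conv \<eta> g (x + a)" .
    qed
    finally show ?thesis .
  qed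
  have 5: "(\<integral>a. g ((t, x) + a) \<partial>N) \<le> measure N UNIV * S"
    if g: "bounded_borel M g" and le: "\<forall>t\<le>0. \<forall>x. g (t, x) \<le> S" and t: "t \<le> 0" for M S t x and g :: "real \<times> 'a \<Rightarrow> real"
  proof -
    have "(\<integral>a. g ((t, x) + a) \<partial>N) \<le> (\<integral>a. S \<partial>N)"
    proof (rule integral_mono_AE[OF int[OF g]])
      show "AE a in N. g ((t, x) + a) \<le> S"
        using causal by eventually_elim (use le t in \<open>auto simp: plus_prod_def\<close>)
    qed simp
    then show ?thesis by simp
  qed
  show ?thesis unfolding jump_op_def
  proof (intro conjI allI impI)
    show "conv \<eta> (\<lambda>z. \<integral>a. g (z + a) \<partial>N) = (\<lambda>z. \<integral>a. conv \<eta> g (z + a) \<partial>N)"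
      if "mollifier r \<eta>" "bounded_borel M g" for \<eta> r g M
      using 4[OF that] by (rule ext)
    show "(\<integral>a. g ((t, x) + a) \<partial>N) \<le> measure N UNIV * S"
      if "bounded_borel M g" "\<forall>t\<le>0. \<forall>x. g (t, x) \<le> S" "t \<le> 0" for g M S t x
      using 5[OF that] .
    show "0 \<le> (\<integral>a. g (z + a) \<partial>N)" if "\<forall>z. 0 \<le> g z" for g :: "real \<times> 'a \<Rightarrow> real" and z
      using that by (intro Bochner_Integration.integral_nonneg) blast
    show "(\<lambda>n. \<integral>a. G n (z + a) \<partial>N) \<longlonglongrightarrow> (\<integral>a. g (z + a) \<partial>N)"
      if "\<forall>n. bounded_borel M (G n)" "bounded_borel M g" "\<forall>z. (\<lambda>n. G n z) \<longlonglongrightarrow> g z" for G g M z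
      using 3[of M G g z] that by blast
  qed (use 1 2 in simp_all)
qed

lemma jump_op_add:
  assumes S: "jump_op c S" and T: "jump_op d T"
  shows "jump_op (c + d) (\<lambda>g z. S g z + T g z)"
proof -
  have 4: "conv \<eta> (\<lambda>z. S g z + T g z) = (\<lambda>z. S (conv \<eta> g) z + T (conv \<eta> g) z)"
    if m: "mollifier r \<eta>" and g: "bounded_borel M g" for r \<eta> M g
    using conv_lincomb[OF m jump_op_bounded[OF S g] jump_op_bounded[OF T g], of 1]
      jump_op_conv[OF S m g] jump_op_conv[OF T m g] by (auto simp: fun_eq_iff)
  show ?thesis
    unfolding jump_op_def
  proof (intro conjI allI impI)
    show "0 \<le> c + d" using jump_op_rate[OF S] jump_op_rate[OF T] by simp
    show "(\<lambda>z. S g z + T g z) \<in> borel_measurable borel" if "bounded_borel M g" for g M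
      using jump_op_measurable[OF S that] jump_op_measurable[OF T that] by measurable
    show "(\<lambda>z. S (\<lambda>z. g z + a * g' z) z + T (\<lambda>z. g z + a * g' z) z) = (\<lambda>z. S g z + T g z + a * (S g' z + T g' z))"
      if "bounded_borel M g" "bounded_borel M' g'" for g g' M M' a
      using jump_op_lincomb[OF S that, of a] jump_op_lincomb[OF T that, of a] by (auto simp: algebra_simps fun_eq_iff)
    show "0 \<le> S g z + T g z" if "bounded_borel M g" "\<forall>z. 0 \<le> g z" for M g z
      using jump_op_nonneg[OF S that(1)] jump_op_nonneg[OF T that(1)] that by simp
    show "(\<lambda>z. S (\<lambda>_. 1) z + T (\<lambda>_. 1) z) = (\<lambda>_. c + d)" using jump_op_one[OF S] jump_op_one[OF T] by simp
    show "(\<lambda>n. S (G n) z + T (G n) z) \<longlonglongrightarrow> S g z + T g z"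
      if "\<forall>n. bounded_borel M (G n)" "bounded_borel M g" "\<forall>z. (\<lambda>n. G n z) \<longlonglongrightarrow> g z" for G g M z
      using jump_op_tendsto[OF S, of M G g z] jump_op_tendsto[OF T, of M G g z] that by (intro tendsto_add) auto
    show "S g (t, x) + T g (t, x) \<le> (c + d) * r"
      if "bounded_borel M g" "\<forall>t\<le>0. \<forall>x. g (t, x) \<le> r" "t \<le> 0" for M g t x r
      using jump_op_causal[OF S that(1), of r t x] jump_op_causal[OF T that(1), of r t x] that by (simp add: algebra_simps)
  qed (use 4 in blast)
qed

lemma jump_op_scale:
  assumes T: "jump_op d T" and k: "0 \<le> k"
  shows "jump_op (k * d) (\<lambda>g z. k * T g z)"
proof -
  have 4: "conv \<eta> (\<lambda>z. k * T g z) = (\<lambda>z. k * T (conv \<eta> g) z)"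
    if m: "mollifier r \<eta>" and g: "bounded_borel M g" for r \<eta> M g
    using conv_lincomb[OF m bounded_borel_const[of 0] jump_op_bounded[OF T g], of k]
      jump_op_conv[OF T m g] conv_const[OF m, of 0] by (auto simp: fun_eq_iff)
  show ?thesis
    unfolding jump_op_def
  proof (intro conjI allI impI)
    show "0 \<le> k * d" using k jump_op_rate[OF T] by simp
    show "(\<lambda>z. k * T g z) \<in> borel_measurable borel" if "bounded_borel M g" for g M
      using jump_op_measurable[OF T that] by measurable
    show "(\<lambda>z. k * T (\<lambda>z. g z + a * g' z) z) = (\<lambda>z. k * T g z + a * (k * T g' z))"
      if "bounded_borel M g" "bounded_borel M' g'" for g g' M M' a
      using jump_op_lincomb[OF T that, of a] by (auto simp: algebra_simps fun_eq_iff)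
    show "0 \<le> k * T g z" if "bounded_borel M g" "\<forall>z. 0 \<le> g z" for M g z
      using jump_op_nonneg[OF T that(1)] that k by simp
    show "(\<lambda>z. k * T (\<lambda>_. 1) z) = (\<lambda>_. k * d)" using jump_op_one[OF T] by simp
    show "(\<lambda>n. k * T (G n) z) \<longlonglongrightarrow> k * T g z"
      if "\<forall>n. bounded_borel M (G n)" "bounded_borel M g" "\<forall>z. (\<lambda>n. G n z) \<longlonglongrightarrow> g z" for G g M z
      using jump_op_tendsto[OF T, of M G g z] that by (intro tendsto_mult_left) auto
    show "k * T g (t, x) \<le> k * d * r"
      if "bounded_borel M g" "\<forall>t\<le>0. \<forall>x. g (t, x) \<le> r" "t \<le> 0" for M g t x r
      using mult_left_mono[OF jump_op_causal[OF T that(1), of r t x] k] that by (simp add: mult.assoc)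
  qed (use 4 in blast)
qed

lemma jump_op_sum:
  assumes "finite I" "\<And>i. i \<in> I \<Longrightarrow> jump_op (c i) (T i)" "I \<noteq> {}"
  shows "jump_op (\<Sum>i\<in>I. c i) (\<lambda>g z. \<Sum>i\<in>I. T i g z)"
  using assms(1,3,2)
proof (induction I rule: finite_ne_induct)
  case (insert i I)
  then show ?case using jump_op_add[of "c i" "T i" "\<Sum>i\<in>I. c i" "\<lambda>g z. \<Sum>i\<in>I. T i g z"] by simp
qed simp

section \<open>Resolvents of jump operators\<close>

text \<open>A maximum principle on the half space of nonpositive times: by causality the supremum over
  this half space satisfies the scalar inequality \<open>(l + c) * S \<le> l * b + c * S\<close>.\<close>

lemma resolvent_half_bound:
  assumes T: "jump_op c T" and l: "0 < l" and P: "bounded_borel M P"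
    and le: "\<And>t x. t \<le> 0 \<Longrightarrow> (l + c) * P (t, x) \<le> l * b + T P (t, x)" and t: "t \<le> 0"
  shows "P (t, x) \<le> b"
proof -
  define H where "H = {z :: real \<times> 'a. fst z \<le> 0}"
  define S where "S = (SUP z\<in>H. P z)"
  have c: "0 \<le> c" using jump_op_rate[OF T] .
  have bdd: "bdd_above (P ` H)" using bounded_borelD(2)[OF P] by (intro bdd_aboveI[of _ M]) (auto simp: abs_le_iff)
  have ne: "H \<noteq> {}" by (auto simp: H_def)
  have S: "P (s, y) \<le> S" if "s \<le> 0" for s y unfolding S_def
    using cSUP_upper[OF _ bdd, of "(s, y)"] that by (simp add: H_def)
  have TS: "T P (s, y) \<le> c * S" if "s \<le> 0" for s y
    by (rule jump_op_causal[OF T P]) (use S that in auto)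
  have "P z \<le> (l * b + c * S) / (l + c)" if "z \<in> H" for z
  proof -
    have "(l + c) * P z \<le> l * b + c * S"
      using le[of "fst z" "snd z"] TS[of "fst z" "snd z"] that by (simp add: H_def)
    then show ?thesis using l c by (simp add: pos_le_divide_eq mult.commute)
  qed
  then have "S \<le> (l * b + c * S) / (l + c)" unfolding S_def by (intro cSUP_least[OF ne])
  then have "l * S \<le> l * b" using l c by (simp add: pos_le_divide_eq algebra_simps)
  then have "S \<le> b" using l by simp
  then show ?thesis using S[OF t, of x] by linarith
qed

lemma resolvent_nonpos:
  assumes T: "jump_op c T" and l: "0 < l" and P: "bounded_borel M P"
    and le: "\<And>z. (l + c) * P z \<le> T P z"
  shows "P z \<le> 0"
proof -
  define S where "S = (SUP z. P z)"
  have c: "0 \<le> c" using jump_op_rate[OF T] .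
  have bdd: "bdd_above (range P)" using bounded_borelD(2)[OF P] by (intro bdd_aboveI[of _ M]) (auto simp: abs_le_iff)
  have S: "P z \<le> S" for z unfolding S_def by (rule cSUP_upper[OF _ bdd]) simp
  have TS: "T P z \<le> c * S" for z
    using jump_op_mono[OF T P bounded_borel_const, of S z] S jump_op_const[OF T, of S] by simp
  have "P z \<le> (c * S) / (l + c)" for z
    using le[of z] TS[of z] l c by (simp add: pos_le_divide_eq mult.commute)
  then have "S \<le> (c * S) / (l + c)" unfolding S_def by (intro cSUP_least) auto
  then have "l * S \<le> 0" using l c by (simp add: pos_le_divide_eq algebra_simps)
  then have "S \<le> 0" using l by (simp add: mult_le_0_iff)
  then show ?thesis using S[of z] by linarith
qed

lemma resolvent_comparison:
  assumes T: "jump_op c T" and l: "0 < l" and B: "bounded_borel M B" and P: "bounded_borel M' P"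
    and B': "\<And>z. (l + c) * B z - T B z \<le> (l + c) * P z - T P z"
  shows "B z \<le> P z"
proof -
  have b: "bounded_borel (M + \<bar>-1\<bar> * M') (\<lambda>z. B z + (-1) * P z)" by (rule bounded_borel_lincomb[OF B P])
  have "B z + (-1) * P z \<le> 0"
  proof (rule resolvent_nonpos[OF T l b])
    fix z
    show "(l + c) * (B z + (-1) * P z) \<le> T (\<lambda>z. B z + (-1) * P z) z"
      unfolding jump_op_lincomb[OF T B P] using B'[of z] by (simp add: algebra_simps)
  qed
  then show ?thesis by simp
qed

text \<open>Fixed point iteration: \<open>f \<mapsto> (l * g + T f) / (l + c)\<close> contracts the supremum norm by the factor
  \<open>c / (l + c) < 1\<close> and preserves the bound \<open>M\<close>.\<close>

lemma resolvent_exists: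
  assumes T: "jump_op c T" and l: "0 < l" and g: "bounded_borel M g"
  obtains P where "bounded_borel M P" "\<And>z. (l + c) * P z = l * g z + T P z"
proof -
  have c: "0 \<le> c" using jump_op_rate[OF T] .
  have [measurable]: "g \<in> borel_measurable borel" using bounded_borelD(1)[OF g] .
  define p where "p = rec_nat (\<lambda>_. 0) (\<lambda>n f z. (l * g z + T f z) / (l + c))"
  have p0: "p 0 = (\<lambda>_. 0)" and pS: "p (Suc n) = (\<lambda>z. (l * g z + T (p n) z) / (l + c))" for n
    by (simp_all add: p_def)
  have b: "bounded_borel M (p n)" for n
  proof (induction n)
    case 0
    then show ?case using bounded_borelD(3)[OF g] by (simp add: p0 bounded_borel_def)
  next
    case (Suc n)
    have [measurable]: "T (p n) \<in> borel_measurable borel" by (rule jump_op_measurable[OF T Suc])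
    have "\<bar>l * g z + T (p n) z\<bar> \<le> l * M + c * M" for z
      using mult_left_mono[OF bounded_borelD(2)[OF g, of z], of l] l bounded_borelD(2)[OF jump_op_bounded[OF T Suc], of z]
      by (simp add: abs_mult order_trans[OF abs_triangle_ineq add_mono])
    then have "\<bar>(l * g z + T (p n) z) / (l + c)\<bar> \<le> M" for z
      using l c by (simp add: abs_divide pos_divide_le_eq algebra_simps)
    then show ?case by (simp add: pS bounded_borel_def)
  qed
  define k where "k = c / (l + c)"
  have k: "0 \<le> k" "k < 1" using l c by (auto simp: k_def)
  have d: "\<bar>p (Suc n) z - p n z\<bar> \<le> k ^ n * M" for n z
  proof (induction n arbitrary: z)
    case 0
    then show ?case using bounded_borelD(2)[OF b[of "Suc 0"], of z] by (simp add: p0)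
  next
    case (Suc n)
    have bb: "bounded_borel (k ^ n * M) (\<lambda>z. p (Suc n) z + (-1) * p n z)"
      using Suc bounded_borelD(1)[OF bounded_borel_lincomb[OF b[of "Suc n"] b[of n], of "-1"]] by (simp add: bounded_borel_def)
    have "\<bar>T (p (Suc n)) z - T (p n) z\<bar> \<le> c * (k ^ n * M)"
      using bounded_borelD(2)[OF jump_op_bounded[OF T bb], of z]
        fun_cong[OF jump_op_lincomb[OF T b[of "Suc n"] b[of n], of "-1"], of z] by simp
    then have "\<bar>T (p (Suc n)) z - T (p n) z\<bar> / (l + c) \<le> k * (k ^ n * M)"
      using l c by (simp add: k_def divide_right_mono)
    moreover have "p (Suc (Suc n)) z - p (Suc n) z = (T (p (Suc n)) z - T (p n) z) / (l + c)"
      unfolding pS[of "Suc n"] pS[of n] by (simp add: diff_divide_distrib[symmetric])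
    ultimately show ?case using l c by (simp add: abs_divide mult.assoc)
  qed
  have "convergent (\<lambda>n. p n z)" for z
  proof -
    have "summable (\<lambda>n. k ^ n * M)" using k by (intro summable_mult2 summable_geometric) auto
    then have "summable (\<lambda>n. p (Suc n) z - p n z)"
      by (rule summable_comparison_test'[where N = 0]) (use d in auto)
    then have "convergent (\<lambda>n. \<Sum>i<n. p (Suc i) z - p i z)" by (rule summable_LIMSEQ[THEN convergentI])
    moreover have "(\<Sum>i<n. p (Suc i) z - p i z) = p n z" for n
      using sum_lessThan_telescope[of "\<lambda>i. p i z" n] by (simp add: p0)
    ultimately show ?thesis by simp
  qed
  then obtain P where P: "\<And>z. (\<lambda>n. p n z) \<longlonglongrightarrow> P z" unfolding convergent_def by metis
  have PM: "P \<in> borel_measurable borel"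
    by (rule borel_measurable_LIMSEQ_real[OF P bounded_borelD(1)[OF b]])
  have "\<bar>P z\<bar> \<le> M" for z
    by (rule LIMSEQ_le_const2[OF tendsto_rabs[OF P]]) (use bounded_borelD(2)[OF b] in auto)
  then have bP: "bounded_borel M P" using PM by (simp add: bounded_borel_def)
  have "(l + c) * P z = l * g z + T P z" for z
  proof -
    have "(\<lambda>n. (l + c) * p (Suc n) z) \<longlonglongrightarrow> (l + c) * P z" by (intro tendsto_intros LIMSEQ_Suc P)
    moreover have "(\<lambda>n. l * g z + T (p n) z) \<longlonglongrightarrow> l * g z + T P z"
      by (intro tendsto_intros jump_op_tendsto[OF T b bP P])
    moreover have "(l + c) * p (Suc n) z = l * g z + T (p n) z" for n using l c by (simp add: pS)
    ultimately show ?thesis by (simp add: LIMSEQ_unique)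
  qed
  with bP show ?thesis using that by blast
qed

text \<open>Bounds for the derivatives only.  A wide and flat penalty has tiny derivatives but large values,
  and the generators see only the derivatives.\<close>

definition smooth_bd :: "nat \<Rightarrow> real \<Rightarrow> ('a::euclidean_space \<Rightarrow> real) \<Rightarrow> bool" where
  "smooth_bd k K f \<longleftrightarrow> (\<forall>x. f differentiable (at x)) \<and> (\<forall>b\<in>Basis. Sm k K (pd b f))"

lemma Sm_smooth_bd: "Sm (Suc k) K f \<Longrightarrow> smooth_bd k K f"
  by (simp add: smooth_bd_def)

declare Sm.simps [simp del]

lemma smooth_bd_nonneg:
  fixes f :: "'a::euclidean_space \<Rightarrow> real"
  assumes "smooth_bd k K f" shows "0 \<le> K"
proof -
  obtain b :: 'a where "b \<in> Basis" using nonempty_Basis by blast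
  then have "Sm k K (pd b f)" using assms by (simp add: smooth_bd_def)
  then show ?thesis by (rule Sm_nonneg)
qed

lemma smooth_bd_pd:
  assumes "smooth_bd k K f"
  shows "Sm k (norm_l1 a * K) (pd a f)"
proof -
  have "pd a f = (\<lambda>x. \<Sum>b\<in>Basis. (a \<bullet> b) * pd b f x)"
    using pd_Basis_sum assms by (fastforce simp: smooth_bd_def)
  moreover have "Sm k (\<Sum>b\<in>Basis. \<bar>a \<bullet> b\<bar> * K) (\<lambda>x. \<Sum>b\<in>Basis. (a \<bullet> b) * pd b f x)"
    using assms by (intro Sm_sum Sm_cmult) (auto simp: smooth_bd_def)
  ultimately show ?thesis by (simp add: norm_l1_def sum_distrib_right)
qed

lemma smooth_bd_Lipschitz:
  assumes "smooth_bd k K f"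
  shows "\<bar>f (x + h) - f x\<bar> \<le> norm_l1 h * K"
  by (rule Taylor_one) (use assms Sm_bound[OF smooth_bd_pd[OF assms]] in \<open>auto simp: smooth_bd_def\<close>)

lemma smooth_bd_pd_pd:
  assumes "smooth_bd (Suc k) K f"
  shows "\<bar>pd a (pd a f) x\<bar> \<le> (norm_l1 a)\<^sup>2 * K"
  using Sm_bound[OF Sm_pd[OF smooth_bd_pd[OF assms]]] by (simp add: power2_eq_square mult_ac)

section \<open>The generators\<close>

definition levy_gen :: "'d::finite triple \<Rightarrow> (real^'d \<Rightarrow> real) \<Rightarrow> real^'d \<Rightarrow> real" where
  "levy_gen p f x = (case p of (v, q, Q) \<Rightarrow> (\<integral>z. (f (x + z) - f x) \<partial>v) + gradient f x \<bullet> q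
     + 1 / 2 * trace (hessian f x ** (Q ** transpose Q)))"

text \<open>The coefficient bounds behind the supremum condition on a representing set, in terms of
  integrals instead of extended nonnegative integrals.\<close>

definition triple_bound :: "real \<Rightarrow> 'd::finite triple \<Rightarrow> bool" where
  "triple_bound M p \<longleftrightarrow> (case p of (v, q, Q) \<Rightarrow> space v = - {0} \<and> sets v = sets (restrict_space borel (- {0})) \<and>
     integrable v norm \<and> (\<integral>z. norm z \<partial>v) \<le> M \<and> norm q \<le> M \<and> trace (Q ** transpose Q) \<le> M)"

lemma pd_axis_sum:
  fixes f :: "real^'d::finite \<Rightarrow> real"
  assumes "f differentiable (at x)"
  shows "pd a f x = (\<Sum>i\<in>UNIV. a $ i * pd (axis i 1) f x)"
proof -
  have "a = (\<Sum>i\<in>UNIV. a $ i *\<^sub>R axis i 1)" by (simp add: basis_expansion[symmetric] scalar_mult_eq_scaleR[symmetric])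
  moreover have lin: "linear (\<lambda>a. pd a f x)"
    using has_derivative_linear[OF has_derivative_pd[OF assms]] .
  ultimately have "pd a f x = (\<Sum>i\<in>UNIV. pd (a $ i *\<^sub>R axis i 1) f x)" using linear_sum[OF lin] by metis
  then show ?thesis using linear_scale[OF lin] by simp
qed

lemma gradient_inner:
  fixes f :: "real^'d::finite \<Rightarrow> real"
  assumes "f differentiable (at x)"
  shows "gradient f x \<bullet> q = pd q f x"
  using pd_axis_sum[OF assms, of q] by (simp add: gradient_def inner_vec_def pd_def mult.commute)

lemma gradient_nth: "gradient f x $ i = pd (axis i 1) f x"
  by (simp add: gradient_def pd_def)

lemma hessian_nth: "hessian f x $ i $ j = pd (axis j 1) (pd (axis i 1) f) x"
  by (simp add: hessian_def gradient_def pd_def[abs_def])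

lemma second_pd_sum:
  fixes f :: "real^'d::finite \<Rightarrow> real"
  assumes "smooth_bd (Suc 0) K f"
  shows "pd a (pd a f) x = (\<Sum>i\<in>UNIV. \<Sum>j\<in>UNIV. a $ i * a $ j * hessian f x $ i $ j)"
proof -
  have D: "\<And>y. f differentiable (at y)" using assms by (simp add: smooth_bd_def)
  have s: "Sm (Suc 0) (norm_l1 b * K) (pd b f)" for b using smooth_bd_pd[OF assms] .
  have "pd a (pd a f) x = (\<Sum>j\<in>UNIV. a $ j * pd (axis j 1) (pd a f) x)"
    by (rule pd_axis_sum[OF Sm_differentiable[OF s]])
  also have "\<dots> = (\<Sum>j\<in>UNIV. a $ j * (\<Sum>i\<in>UNIV. a $ i * pd (axis j 1) (pd (axis i 1) f) x))"
  proof (intro sum.cong refl arg_cong2[of _ _ _ _ "(*)"])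
    fix j
    have e: "pd a f = (\<lambda>y. \<Sum>i\<in>UNIV. a $ i * pd (axis i 1) f y)" using pd_axis_sum[OF D] by blast
    show "pd (axis j 1) (pd a f) x = (\<Sum>i\<in>UNIV. a $ i * pd (axis j 1) (pd (axis i 1) f) x)"
      unfolding e by (rule pd_has_derivative)
        (intro has_derivative_sum has_derivative_mult_right has_derivative_pd Sm_differentiable[OF s])
  qed
  also have "\<dots> = (\<Sum>j\<in>UNIV. \<Sum>i\<in>UNIV. a $ i * a $ j * hessian f x $ i $ j)"
    by (simp add: hessian_nth sum_distrib_left mult_ac)
  finally show ?thesis by (subst sum.swap) 
qed

text \<open>The second order term is a sum of second derivatives along the columns of \<open>Q\<close>; in this form
  it can be replaced by symmetric second differences.\<close>

lemma trace_hessian: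
  fixes f :: "real^'d::finite \<Rightarrow> real"
  assumes "smooth_bd (Suc 0) K f"
  shows "trace (hessian f x ** (Q ** transpose Q)) = (\<Sum>k\<in>UNIV. pd (column k Q) (pd (column k Q) f) x)"
proof -
  have "trace (hessian f x ** (Q ** transpose Q)) =
      (\<Sum>i\<in>UNIV. \<Sum>j\<in>UNIV. \<Sum>k\<in>UNIV. hessian f x $ i $ j * (Q $ j $ k * Q $ i $ k))"
    by (simp add: trace_def matrix_matrix_mult_def transpose_def sum_distrib_left)
  also have "\<dots> = (\<Sum>i\<in>UNIV. \<Sum>k\<in>UNIV. \<Sum>j\<in>UNIV. hessian f x $ i $ j * (Q $ j $ k * Q $ i $ k))"
    by (intro sum.cong refl sum.swap)
  also have "\<dots> = (\<Sum>k\<in>UNIV. \<Sum>i\<in>UNIV. \<Sum>j\<in>UNIV. hessian f x $ i $ j * (Q $ j $ k * Q $ i $ k))"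
    by (rule sum.swap)
  also have "\<dots> = (\<Sum>k\<in>UNIV. pd (column k Q) (pd (column k Q) f) x)"
    by (intro sum.cong refl) (simp add: second_pd_sum[OF assms] column_def mult_ac)
  finally show ?thesis .
qed

lemma trace_square: "trace (Q ** transpose Q) = (\<Sum>k\<in>UNIV. (norm (column k (Q :: real^'d^'d)))\<^sup>2)"
proof -
  have "trace (Q ** transpose Q) = (\<Sum>i\<in>UNIV. \<Sum>k\<in>UNIV. Q $ i $ k * Q $ i $ k)"
    by (simp add: trace_def matrix_matrix_mult_def transpose_def)
  also have "\<dots> = (\<Sum>k\<in>UNIV. \<Sum>i\<in>UNIV. Q $ i $ k * Q $ i $ k)" by (rule sum.swap)
  finally show ?thesis by (simp add: power2_norm_eq_inner inner_vec_def column_def)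
qed

lemma triple_measurable:
  assumes "triple_bound M (v, q, Q)" "f \<in> borel_measurable borel"
  shows "f \<in> borel_measurable v"
proof -
  have "sets v = sets (restrict_space borel (- {0}))" using assms by (simp add: triple_bound_def)
  then show ?thesis using measurable_restrict_space1[OF assms(2), of "- {0}"] measurable_cong_sets[of v] by blast
qed

lemma levy_increment_integrable:
  fixes f :: "real^'d::finite \<Rightarrow> real"
  assumes v: "triple_bound M (v, q, Q)" and f: "smooth_bd k K f"
  shows "integrable v (\<lambda>z. f (x + z) - f x)" "\<bar>\<integral>z. (f (x + z) - f x) \<partial>v\<bar> \<le> real CARD('d) * M * K"
proof -
  have cont: "continuous_on UNIV f" using f
    by (auto intro!: differentiable_imp_continuous_on simp: differentiable_on_def smooth_bd_def intro: differentiable_at_withinI)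
  have "(\<lambda>z. f (x + z) - f x) \<in> borel_measurable borel"
    by (intro borel_measurable_continuous_onI continuous_intros continuous_on_compose2[OF cont]) auto
  then have m: "(\<lambda>z. f (x + z) - f x) \<in> borel_measurable v" by (rule triple_measurable[OF v])
  have nI: "integrable v norm" and nM: "(\<integral>z. norm z \<partial>v) \<le> M" using v by (auto simp: triple_bound_def)
  have K: "0 \<le> K" by (rule smooth_bd_nonneg[OF f])
  have le: "\<bar>f (x + z) - f x\<bar> \<le> (real CARD('d) * K) * norm z" for z
    using smooth_bd_Lipschitz[OF f, of x z] mult_right_mono[OF norm_l1_le[of z] K] by (simp add: mult_ac)
  have I: "integrable v (\<lambda>z. (real CARD('d) * K) * norm z)" using nI by simp
  show i: "integrable v (\<lambda>z. f (x + z) - f x)"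
    by (rule Bochner_Integration.integrable_bound[OF I m]) (use le K in \<open>auto simp: abs_mult\<close>)
  have "\<bar>\<integral>z. (f (x + z) - f x) \<partial>v\<bar> \<le> (\<integral>z. \<bar>f (x + z) - f x\<bar> \<partial>v)"
    using integral_norm_bound[of v "\<lambda>z. f (x + z) - f x"] by simp
  also have "\<dots> \<le> (\<integral>z. (real CARD('d) * K) * norm z \<partial>v)"
    by (rule integral_mono) (use i I le in auto)
  also have "\<dots> = (real CARD('d) * K) * (\<integral>z. norm z \<partial>v)" by simp
  also have "\<dots> \<le> (real CARD('d) * K) * M" using nM K by (intro mult_left_mono) auto
  finally show "\<bar>\<integral>z. (f (x + z) - f x) \<partial>v\<bar> \<le> real CARD('d) * M * K" by (simp add: mult_ac)
qed

lemma levy_gen_eq: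
  assumes "smooth_bd (Suc 0) K f"
  shows "levy_gen (v, q, Q) f x = (\<integral>z. (f (x + z) - f x) \<partial>v) + pd q f x
    + 1 / 2 * (\<Sum>k\<in>UNIV. pd (column k Q) (pd (column k Q) f) x)"
  using assms by (simp add: levy_gen_def trace_hessian[OF assms] gradient_inner smooth_bd_def)

lemma smooth_bd_lower: "smooth_bd (Suc k) K f \<Longrightarrow> smooth_bd k K f"
  by (auto simp: smooth_bd_def intro: Sm_Suc_lower simp del: Sm.simps)

text \<open>The increments in the integral are uncompensated, so first derivatives and the first moment of the
  jump measure bound them, both for small and for large jumps.\<close>

lemma levy_gen_bound:
  fixes f :: "real^'d::finite \<Rightarrow> real"
  assumes p: "triple_bound M p" and f: "smooth_bd (Suc 0) K f"
  shows "\<bar>levy_gen p f x\<bar> \<le> 3 * (real CARD('d))\<^sup>2 * M * K"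
proof -
  obtain v q Q where [simp]: "p = (v, q, Q)" by (cases p)
  define d where "d = real CARD('d)"
  have v: "triple_bound M (v, q, Q)" using p by simp
  have d: "1 \<le> d" by (simp add: d_def Suc_leI)
  have K: "0 \<le> K" by (rule smooth_bd_nonneg[OF f])
  have q: "norm q \<le> M" and Q: "(\<Sum>k\<in>UNIV. (norm (column k Q))\<^sup>2) \<le> M" using v by (auto simp: triple_bound_def trace_square)
  have M: "0 \<le> M" using q norm_ge_zero[of q] by linarith
  have 1: "\<bar>\<integral>z. (f (x + z) - f x) \<partial>v\<bar> \<le> d * M * K"
    using levy_increment_integrable(2)[OF v f] by (simp add: d_def)
  have "norm_l1 q \<le> d * M"
    by (rule order_trans[OF norm_l1_le]) (use q in \<open>simp add: d_def mult_left_mono\<close>)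
  then have "norm_l1 q * K \<le> d * M * K" by (intro mult_right_mono K)
  then have 2: "\<bar>pd q f x\<bar> \<le> d * M * K"
    using Sm_bound[OF smooth_bd_pd[OF f], of q x] by linarith
  have "\<bar>pd (column k Q) (pd (column k Q) f) x\<bar> \<le> d\<^sup>2 * K * (norm (column k Q))\<^sup>2" for k
  proof -
    have "(norm_l1 (column k Q))\<^sup>2 * K \<le> (d\<^sup>2 * (norm (column k Q))\<^sup>2) * K"
      by (intro mult_right_mono K) (use norm_l1_sq_le[of "column k Q"] in \<open>simp add: d_def\<close>)
    then show ?thesis using smooth_bd_pd_pd[OF f, of "column k Q" x] by (simp add: mult_ac)
  qed
  then have "\<bar>\<Sum>k\<in>UNIV. pd (column k Q) (pd (column k Q) f) x\<bar> \<le> (\<Sum>k\<in>UNIV. d\<^sup>2 * K * (norm (column k Q))\<^sup>2)"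
    by (intro order_trans[OF sum_abs] sum_mono) auto
  also have "\<dots> \<le> d\<^sup>2 * K * M" unfolding sum_distrib_left[symmetric] using Q K by (intro mult_left_mono) auto
  finally have 3: "\<bar>\<Sum>k\<in>UNIV. pd (column k Q) (pd (column k Q) f) x\<bar> \<le> d\<^sup>2 * K * M" .
  have "d * (M * K) \<le> d\<^sup>2 * (M * K)" using d M K by (intro mult_right_mono) (auto simp: power2_eq_square)
  then have "\<bar>levy_gen p f x\<bar> \<le> 3 * (d\<^sup>2 * (M * K))"
    using 1 2 3 unfolding \<open>p = _\<close> levy_gen_eq[OF f] by (simp add: mult_ac)
  then show ?thesis by (simp add: d_def mult_ac)
qed

lemma levy_gen_lincomb:
  fixes f g :: "real^'d::finite \<Rightarrow> real"
  assumes p: "triple_bound M p" and f: "smooth_bd (Suc 0) K f" and g: "smooth_bd (Suc 0) L g"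
  shows "levy_gen p (\<lambda>x. f x + a * g x) x = levy_gen p f x + a * levy_gen p g x"
proof -
  obtain v q Q where [simp]: "p = (v, q, Q)" by (cases p)
  have v: "triple_bound M (v, q, Q)" using p by simp
  have Df: "\<And>y. f differentiable (at y)" and Dg: "\<And>y. g differentiable (at y)" using f g by (auto simp: smooth_bd_def)
  have 1: "pd b (\<lambda>x. f x + a * g x) = (\<lambda>x. pd b f x + a * pd b g x)" for b
    using Df Dg by (auto simp: pd_add pd_cmult)
  have Sf: "Sm (Suc 0) (norm_l1 b * K) (pd b f)" for b using smooth_bd_pd[OF f] .
  have Sg: "Sm (Suc 0) (norm_l1 b * L) (pd b g)" for b using smooth_bd_pd[OF g] .
  have Df2: "\<And>b y. pd b f differentiable (at y)" and Dg2: "\<And>b y. pd b g differentiable (at y)"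
    using Sm_differentiable[OF Sf] Sm_differentiable[OF Sg] by auto
  have 2: "pd b (pd b (\<lambda>x. f x + a * g x)) x = pd b (pd b f) x + a * pd b (pd b g) x" for b
    unfolding 1 using Df2 Dg2 by (subst pd_add) (auto simp: pd_cmult)
  have fg: "smooth_bd (Suc 0) (K + \<bar>a\<bar> * L) (\<lambda>x. f x + a * g x)"
    unfolding smooth_bd_def 1 using f g Df Dg
    by (auto intro!: Sm_add Sm_cmult differentiable_add differentiable_mult simp: smooth_bd_def simp del: Sm.simps)
  have "(\<integral>z. (f (x + z) + a * g (x + z) - (f x + a * g x)) \<partial>v) = (\<integral>z. (f (x + z) - f x) + a * (g (x + z) - g x) \<partial>v)"
    by (rule Bochner_Integration.integral_cong) (auto simp: algebra_simps)
  also have "\<dots> = (\<integral>z. (f (x + z) - f x) \<partial>v) + a * (\<integral>z. (g (x + z) - g x) \<partial>v)"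
    using levy_increment_integrable(1)[OF v f, of x] levy_increment_integrable(1)[OF v g, of x] by simp
  finally show ?thesis
    unfolding \<open>p = _\<close> levy_gen_eq[OF f] levy_gen_eq[OF g] levy_gen_eq[OF fg] 
    by (simp add: 1 2[unfolded 1] sum.distrib sum_distrib_left algebra_simps)
qed

section \<open>Approximation of the space-time generator by jump operators\<close>

lemma pd_scaleR:
  assumes "f differentiable (at x)" shows "pd (c *\<^sub>R a) f x = c * pd a f x"
  using linear_scale[OF has_derivative_linear[OF has_derivative_pd[OF assms]]] by simp

lemma slice_has_derivative:
  fixes F :: "real \<times> 'a::euclidean_space \<Rightarrow> real"
  assumes "\<And>z. F differentiable (at z)"
  shows "((\<lambda>x. F (t, x)) has_derivative (\<lambda>h. pd (0, h) F (t, x))) (at x)"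
  by (rule has_derivative_compose[of "\<lambda>x. (t, x)" "\<lambda>h. (0, h)" x UNIV F, OF _ has_derivative_pd[OF assms]])
     (auto intro!: derivative_eq_intros)

lemma pd_slice:
  fixes F :: "real \<times> 'a::euclidean_space \<Rightarrow> real"
  assumes "\<And>z. F differentiable (at z)"
  shows "pd a (\<lambda>x. F (t, x)) = (\<lambda>x. pd (0, a) F (t, x))"
  using pd_has_derivative[OF slice_has_derivative[OF assms]] by blast

lemma Sm_slice:
  fixes F :: "real \<times> 'a::euclidean_space \<Rightarrow> real"
  shows "Sm k K F \<Longrightarrow> Sm k K (\<lambda>x. F (t, x))"
proof (induction k arbitrary: F)
  case 0
  then show ?case by (auto simp: Sm.simps intro!: continuous_on_compose2[of UNIV F] continuous_intros)
next
  case (Suc k)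
  have D: "\<And>z. F differentiable (at z)" using Sm_differentiable[OF Suc.prems] .
  have "Sm k K (pd b (\<lambda>x. F (t, x)))" if "b \<in> Basis" for b
    unfolding pd_slice[OF D] using that
    by (intro Suc.IH Sm_pd_Basis[OF Suc.prems]) (auto simp: Basis_prod_def)
  moreover have "(\<lambda>x. F (t, x)) differentiable (at x)" for x
    using slice_has_derivative[OF D] unfolding differentiable_def by blast
  ultimately show ?case using Sm_bound[OF Suc.prems] by (simp add: Sm.simps)
qed

text \<open>The generator of the process with an additional time coordinate running backwards.  A classical
  supersolution satisfies \<open>st_gen p F \<le> 0\<close> for all triples \<open>p\<close>.\<close>

definition st_gen :: "'d::finite triple \<Rightarrow> (real \<times> (real^'d) \<Rightarrow> real) \<Rightarrow> real \<times> (real^'d) \<Rightarrow> real" where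
  "st_gen p F z = levy_gen p (\<lambda>x. F (fst z, x)) (snd z) - pd (1, 0) F z"

lemma st_gen_eq:
  fixes F :: "real \<times> (real^'d::finite) \<Rightarrow> real"
  assumes F: "Sm (Suc (Suc k)) K F"
  shows "st_gen (v, q, Q) F z = (\<integral>\<zeta>. (F (z + (0, \<zeta>)) - F z) \<partial>v) + pd (0, q) F z - pd (1, 0) F z
    + 1 / 2 * (\<Sum>k\<in>UNIV. pd (0, column k Q) (pd (0, column k Q) F) z)"
proof -
  obtain t x where z: "z = (t, x)" by (cases z)
  have s: "smooth_bd (Suc 0) K (\<lambda>x. F (t, x))"
    by (rule Sm_smooth_bd[OF Sm_slice[OF Sm_lower[OF F]]]) simp
  have D: "\<And>z. F differentiable (at z)" using Sm_differentiable[OF F] .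
  have D2: "\<And>a z. pd a F differentiable (at z)" using Sm_differentiable[OF Sm_pd[OF F]] .
  show ?thesis unfolding st_gen_def z fst_conv snd_conv levy_gen_eq[OF s]
    by (simp add: pd_slice[OF D] pd_slice[OF D2])
qed

lemma forward_difference:
  fixes F :: "'a::euclidean_space \<Rightarrow> real"
  assumes F: "Sm 2 K F" and h: "0 < h"
  shows "\<bar>(F (z + h *\<^sub>R a) - F z) / h - pd a F z\<bar> \<le> h * (norm_l1 a)\<^sup>2 * K"
proof -
  have D: "F differentiable (at z)" using F Sm_differentiable[of 1 K F z] by (simp add: numeral_2_eq_2)
  have "\<bar>F (z + h *\<^sub>R a) - F z - h * pd a F z\<bar> \<le> h * (h * (norm_l1 a)\<^sup>2 * K)"
    using Sm_quadratic[OF F, of z "h *\<^sub>R a"] h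
    by (simp add: pd_scaleR[OF D] norm_l1_scaleR power_mult_distrib power2_eq_square mult_ac)
  moreover have "(F (z + h *\<^sub>R a) - F z) / h - pd a F z = (F (z + h *\<^sub>R a) - F z - h * pd a F z) / h"
    using h by (simp add: field_simps)
  ultimately show ?thesis using h by (simp add: abs_divide pos_divide_le_eq mult_ac)
qed

lemma second_difference:
  fixes F :: "'a::euclidean_space \<Rightarrow> real"
  assumes F: "Sm 3 K F" and h: "0 < h"
  shows "\<bar>(F (z + h *\<^sub>R a) + F (z - h *\<^sub>R a) - 2 * F z) / (2 * h\<^sup>2) - 1 / 2 * pd a (pd a F) z\<bar> \<le> h * (norm_l1 a)^3 * K"
proof -
  have F3: "Sm (Suc (Suc (Suc 0))) K F" using F by (simp add: numeral_3_eq_3)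
  note F2 = Sm_pd[OF F3] note F1 = Sm_pd[OF F2]
  have D: "F differentiable (at z)" for z using Sm_differentiable[OF F3] .
  have D2: "pd a F differentiable (at z)" for a z using Sm_differentiable[OF F2] .
  have D3: "pd a (pd a F) differentiable (at z)" for a z using Sm_differentiable[OF F1] .
  have e1: "pd (h *\<^sub>R a) F = (\<lambda>z. h * pd a F z)" using pd_scaleR[OF D] by blast
  have e2: "pd (h *\<^sub>R a) (pd (h *\<^sub>R a) F) z = h\<^sup>2 * pd a (pd a F) z" for z
    unfolding e1 by (simp add: pd_cmult[OF D2] pd_scaleR[OF D2] power2_eq_square)
  have B: "\<bar>pd (h *\<^sub>R a) (pd (h *\<^sub>R a) (pd (h *\<^sub>R a) F)) y\<bar> \<le> h^3 * (norm_l1 a)^3 * K" for y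
    using Sm_bound[OF Sm_pd[OF Sm_pd[OF Sm_pd[OF F3, of "h *\<^sub>R a"], of "h *\<^sub>R a"], of "h *\<^sub>R a"], of y] h
    by (simp add: norm_l1_scaleR power3_eq_cube mult_ac)
  have "\<bar>F (z + h *\<^sub>R a) + F (z - h *\<^sub>R a) - 2 * F z - h\<^sup>2 * pd a (pd a F) z\<bar> \<le> 2 * (h^3 * (norm_l1 a)^3 * K)"
    using Taylor_two_sided[OF D D2 D3 B, of z] by (simp add: e2)
  also have "\<dots> = (2 * h\<^sup>2) * (h * (norm_l1 a)^3 * K)" by (simp add: power3_eq_cube power2_eq_square)
  finally have "\<bar>F (z + h *\<^sub>R a) + F (z - h *\<^sub>R a) - 2 * F z - h\<^sup>2 * pd a (pd a F) z\<bar> / (2 * h\<^sup>2)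
      \<le> h * (norm_l1 a)^3 * K"
    using h by (simp add: pos_divide_le_eq mult.commute)
  moreover have "(F (z + h *\<^sub>R a) + F (z - h *\<^sub>R a) - 2 * F z) / (2 * h\<^sup>2) - 1 / 2 * pd a (pd a F) z
     = (F (z + h *\<^sub>R a) + F (z - h *\<^sub>R a) - 2 * F z - h\<^sup>2 * pd a (pd a F) z) / (2 * h\<^sup>2)"
    using h by (simp add: diff_divide_distrib)
  ultimately show ?thesis using h by (simp add: abs_divide)
qed

text \<open>The jump measure may be infinite near the origin, but dominated convergence makes the first
  moment of the small jumps arbitrarily small.\<close>

lemma small_jumps:
  assumes v: "integrable v (norm :: 'a::euclidean_space \<Rightarrow> real)" and e: "0 < e"
  obtains h where "0 < h" "h \<le> e" "(\<integral>z. indicator {z. norm z \<le> h} z * norm z \<partial>v) \<le> e"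
proof -
  have m[measurable]: "(norm :: 'a \<Rightarrow> real) \<in> borel_measurable v" using v by (rule borel_measurable_integrable)
  have mi[measurable]: "(\<lambda>z. indicator {z. norm z \<le> h} z :: real) \<in> borel_measurable v" for h
  proof -
    have "(\<lambda>z. indicator {..h} (norm z :: real) :: real) \<in> borel_measurable v" by measurable
    moreover have "(\<lambda>z. indicator {..h} (norm z) :: real) = indicator {z :: 'a. norm z \<le> h}" by (auto split: split_indicator)
    ultimately show ?thesis by simp
  qed
  have "(\<lambda>n. \<integral>z. indicator {z. norm z \<le> inverse (real (Suc n))} z * norm z \<partial>v) \<longlonglongrightarrow> (\<integral>z. 0 \<partial>v)"
  proof (rule integral_dominated_convergence[where w = norm])
    show "AE z in v. (\<lambda>n. indicator {z. norm z \<le> inverse (real (Suc n))} z * norm z) \<longlonglongrightarrow> 0"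
    proof (intro AE_I2)
      fix z :: 'a
      show "(\<lambda>n. indicator {z. norm z \<le> inverse (real (Suc n))} z * norm z) \<longlonglongrightarrow> 0"
      proof (rule Lim_null_comparison[OF _ LIMSEQ_inverse_real_of_nat])
        show "\<forall>\<^sub>F n in sequentially. norm (indicator {z. norm z \<le> inverse (real (Suc n))} z * norm z) \<le> inverse (real (Suc n))"
          by (intro always_eventually allI) (auto split: split_indicator)
      qed
    qed
  qed (use v in \<open>auto split: split_indicator\<close>)
  then have "\<forall>\<^sub>F n in sequentially. (\<integral>z. indicator {z. norm z \<le> inverse (real (Suc n))} z * norm z \<partial>v) < e"
    using e by (intro order_tendstoD(2)) auto
  moreover have "\<forall>\<^sub>F n in sequentially. inverse (real (Suc n)) < e"
    by (rule order_tendstoD(2)[OF LIMSEQ_inverse_real_of_nat e])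
  ultimately have "\<forall>\<^sub>F n in sequentially. (\<integral>z. indicator {z. norm z \<le> inverse (real (Suc n))} z * norm z \<partial>v) < e \<and> inverse (real (Suc n)) < e"
    by (rule eventually_conj)
  then obtain n where "(\<integral>z. indicator {z. norm z \<le> inverse (real (Suc n))} z * norm z \<partial>v) < e" "inverse (real (Suc n)) < e"
    by (auto simp: eventually_sequentially)
  then show ?thesis using that[of "inverse (real (Suc n))"] by simp
qed

text \<open>By Markov's inequality the jumps larger than \<open>h\<close> have finite total mass; the jumps that are dropped
  contribute at most their first moment times the Lipschitz constant.\<close>

lemma large_jump_op:
  fixes v :: "(real^'d::finite) measure"
  assumes p: "triple_bound M (v, q, Q)" and h: "0 < h"
  obtains c T where "jump_op c T"
    "\<And>F K z. Sm 1 K F \<Longrightarrow> \<bar>T F z - c * F z - (\<integral>\<zeta>. (F (z + (0, \<zeta>)) - F z) \<partial>v)\<bar>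
       \<le> real (CARD('d) + 1) * K * (\<integral>z. indicator {z. norm z \<le> h} z * norm z \<partial>v)"
proof -
  note tm[measurable (raw)] = triple_measurable[OF p]
  have nI: "integrable v norm" using p by (simp add: triple_bound_def)
  have sp: "space v = - {0}" and sv: "sets v = sets (restrict_space borel (- {0}))" using p by (auto simp: triple_bound_def)
  define A where "A = {\<zeta> :: real^'d. h < norm \<zeta>}"
  define ind where "ind = (\<lambda>\<zeta>. indicator A \<zeta> :: real)"
  have "open A" unfolding A_def by (intro open_Collect_less continuous_intros)
  then have mA: "A \<in> sets borel" by simp
  have mi: "ind \<in> borel_measurable v"
    unfolding ind_def by (rule triple_measurable[OF p]) (use mA in simp)
  \<comment> \<open>The large jumps, embedded into space-time as jumps that leave the time unchanged.\<close>
  define N where "N = distr (density v (\<lambda>\<zeta>. ennreal (ind \<zeta>))) borel (\<lambda>\<zeta>. (0 :: real, \<zeta>))"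
  have mp: "(\<lambda>\<zeta>. (0 :: real, \<zeta>)) \<in> measurable v borel"
  proof -
    have "(\<lambda>\<zeta> :: real^'d. (0 :: real, \<zeta>)) \<in> borel_measurable borel" by (intro borel_measurable_continuous_onI continuous_intros)
    then show ?thesis using measurable_restrict_space1[of _ borel borel "- {0}"] measurable_cong_sets[OF sv refl] by blast
  qed
  have le: "ind \<zeta> \<le> norm \<zeta> / h" for \<zeta> using h by (auto simp: ind_def A_def split: split_indicator)
  have ind0: "0 \<le> ind \<zeta>" for \<zeta> by (simp add: ind_def)
  have ii: "integrable v ind"
    by (rule Bochner_Integration.integrable_bound[of v "\<lambda>\<zeta>. norm \<zeta> / h"]) (use nI mi le ind0 h in auto)
  have eN: "emeasure N UNIV = ennreal (\<integral>\<zeta>. ind \<zeta> \<partial>v)"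
  proof -
    have "emeasure N UNIV = emeasure (density v (\<lambda>\<zeta>. ennreal (ind \<zeta>))) (space v)"
      unfolding N_def using mp by (subst emeasure_distr) auto
    also have "\<dots> = (\<integral>\<^sup>+\<zeta>. ennreal (ind \<zeta>) \<partial>v)"
      using mi by (subst emeasure_density) (auto intro!: nn_integral_cong)
    also have "\<dots> = ennreal (\<integral>\<zeta>. ind \<zeta> \<partial>v)" by (rule nn_integral_eq_integral[OF ii]) (use ind0 in simp)
    finally show ?thesis .
  qed
  have spN: "space N = UNIV" by (simp add: N_def)
  have fN: "finite_measure N" by (rule finite_measureI) (simp add: spN eN)
  have mN: "measure N UNIV = (\<integral>\<zeta>. ind \<zeta> \<partial>v)" unfolding measure_def eN using ind0 by (simp add: integral_nonneg)
  have "{a :: real \<times> (real^'d). fst a \<le> 0} \<in> sets borel"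
    by (intro borel_closed closed_Collect_le continuous_intros)
  then have "AE a in N. fst a \<le> 0" unfolding N_def
    using mp by (subst AE_distr_iff) auto
  then have J: "jump_op (measure N UNIV) (\<lambda>g z. \<integral>a. g (z + a) \<partial>N)"
    by (intro jump_op_integral[OF fN]) (simp_all add: N_def)
  show ?thesis
  proof (rule that[OF J])
    fix F :: "real \<times> (real^'d) \<Rightarrow> real" and K and z :: "real \<times> (real^'d)"
    assume F: "Sm 1 K F"
    have F1: "smooth_bd 0 K (\<lambda>x. F (fst z, x))"
      using Sm_smooth_bd[of 0 K "\<lambda>x. F (fst z, x)"] Sm_slice[of 1 K F "fst z"] F by simp
    have K: "0 \<le> K" using Sm_nonneg[OF F] .
    define D where "D = (\<lambda>\<zeta>. F (z + (0, \<zeta>)) - F z)"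
    have zz: "F (z + (0, \<zeta>)) = F (fst z, snd z + \<zeta>)" for \<zeta> by (cases z) simp
    have ID: "integrable v D"
      using levy_increment_integrable(1)[OF p F1, of "snd z"] by (simp add: D_def zz)
    have mF: "F \<in> borel_measurable borel" using bounded_borelD(1)[OF Sm_bounded_borel[OF F]] .
    have mD: "D \<in> borel_measurable v" using ID by (rule borel_measurable_integrable)
    have mFz: "(\<lambda>a. F (z + a)) \<in> borel_measurable borel" using mF by measurable
    have "(\<integral>a. F (z + a) \<partial>N) = (\<integral>\<zeta>. F (z + (0, \<zeta>)) \<partial>density v (\<lambda>\<zeta>. ennreal (ind \<zeta>)))"
      unfolding N_def using mp mFz by (subst integral_distr) auto
    also have "\<dots> = (\<integral>\<zeta>. ind \<zeta> * F (z + (0, \<zeta>)) \<partial>v)"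
      using measurable_compose[OF mp mFz] mi ind0 by (subst integral_density) auto
    finally have 1: "(\<integral>a. F (z + a) \<partial>N) = (\<integral>\<zeta>. ind \<zeta> * F (z + (0, \<zeta>)) \<partial>v)" .
    have IF: "integrable v (\<lambda>\<zeta>. ind \<zeta> * F (z + (0, \<zeta>)))"
    proof (rule Bochner_Integration.integrable_bound[of v "\<lambda>\<zeta>. K * ind \<zeta>"])
      show "AE \<zeta> in v. norm (ind \<zeta> * F (z + (0, \<zeta>))) \<le> norm (K * ind \<zeta>)"
      proof (rule AE_I2)
        fix \<zeta>
        have "ind \<zeta> * \<bar>F (z + (0, \<zeta>))\<bar> \<le> ind \<zeta> * K" by (intro mult_left_mono Sm_bound[OF F] ind0)
        then show "norm (ind \<zeta> * F (z + (0, \<zeta>))) \<le> norm (K * ind \<zeta>)"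
          using ind0[of \<zeta>] K by (simp add: abs_mult mult.commute)
      qed
      show "(\<lambda>\<zeta>. ind \<zeta> * F (z + (0, \<zeta>))) \<in> borel_measurable v"
        by (rule borel_measurable_times[OF mi measurable_compose[OF mp mFz]])
    qed (use ii in simp)
    have ID': "integrable v (\<lambda>\<zeta>. ind \<zeta> * D \<zeta>)"
      using Bochner_Integration.integrable_diff[OF IF integrable_mult_left[OF ii, of "F z"]]
      by (simp add: D_def algebra_simps)
    have "(\<integral>a. F (z + a) \<partial>N) - measure N UNIV * F z = (\<integral>\<zeta>. ind \<zeta> * D \<zeta> \<partial>v)"
      unfolding 1 mN integral_mult_left_zero[symmetric]
      using Bochner_Integration.integral_diff[OF IF integrable_mult_left[OF ii, of "F z"]]
      by (simp add: D_def algebra_simps)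
    then have "(\<integral>a. F (z + a) \<partial>N) - measure N UNIV * F z - (\<integral>\<zeta>. D \<zeta> \<partial>v) = (\<integral>\<zeta>. ind \<zeta> * D \<zeta> - D \<zeta> \<partial>v)"
      using ID ID' by simp
    also have "\<bar>\<dots>\<bar> \<le> (\<integral>\<zeta>. \<bar>ind \<zeta> * D \<zeta> - D \<zeta>\<bar> \<partial>v)"
      using integral_norm_bound[of v "\<lambda>\<zeta>. ind \<zeta> * D \<zeta> - D \<zeta>"] by simp
    also have "\<dots> \<le> (\<integral>\<zeta>. (real (CARD('d) + 1) * K) * (indicator {z. norm z \<le> h} \<zeta> * norm \<zeta>) \<partial>v)"
    proof (rule integral_mono)
      show "integrable v (\<lambda>\<zeta>. \<bar>ind \<zeta> * D \<zeta> - D \<zeta>\<bar>)" using ID ID' by simp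
      have e0: "(\<lambda>\<zeta>. indicator {z. norm z \<le> h} \<zeta> * norm \<zeta>) = (\<lambda>\<zeta>. norm \<zeta> - ind \<zeta> * norm \<zeta>)"
        by (auto simp: ind_def A_def split: split_indicator)
      have "integrable v (\<lambda>\<zeta>. ind \<zeta> * norm \<zeta>)"
        by (rule Bochner_Integration.integrable_bound[OF nI])
           (use mi borel_measurable_integrable[OF nI] in \<open>auto simp: ind_def split: split_indicator\<close>)
      then have "integrable v (\<lambda>\<zeta>. indicator {z. norm z \<le> h} \<zeta> * norm \<zeta>)"
        unfolding e0 by (rule Bochner_Integration.integrable_diff[OF nI])
      then show "integrable v (\<lambda>\<zeta>. (real (CARD('d) + 1) * K) * (indicator {z. norm z \<le> h} \<zeta> * norm \<zeta>))"
        by (rule integrable_mult_right)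
      fix \<zeta>
      have "\<bar>D \<zeta>\<bar> \<le> norm_l1 \<zeta> * K" unfolding D_def zz using smooth_bd_Lipschitz[OF F1, of "snd z" \<zeta>] by simp
      also have "\<dots> \<le> (real (CARD('d) + 1) * norm \<zeta>) * K"
        by (intro mult_right_mono K order_trans[OF norm_l1_le]) auto
      finally show "\<bar>ind \<zeta> * D \<zeta> - D \<zeta>\<bar> \<le> (real (CARD('d) + 1) * K) * (indicator {z. norm z \<le> h} \<zeta> * norm \<zeta>)"
        by (auto simp: ind_def A_def mult_ac split: split_indicator)
    qed
    finally show "\<bar>(\<integral>a. F (z + a) \<partial>N) - measure N UNIV * F z - (\<integral>\<zeta>. (F (z + (0, \<zeta>)) - F z) \<partial>v)\<bar>
       \<le> real (CARD('d) + 1) * K * (\<integral>z. indicator {z. norm z \<le> h} z * norm z \<partial>v)"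
      by (simp add: D_def)
  qed
qed

text \<open>Jumps along \<open>h q\<close>, along \<open>- h\<close> in time, and along \<open>\<plusminus> h\<close> times the columns of \<open>Q\<close>, with the rates of the
  corresponding difference quotients, together with the large jumps of the Levy measure.  For a
  fixed triple all errors are a small factor times the derivative bound.\<close>

theorem generator_approximation:
  fixes p :: "'d::finite triple"
  assumes p: "triple_bound M p" and e: "0 < e"
  obtains c T where "jump_op c T" "\<And>F K z. Sm 3 K F \<Longrightarrow> \<bar>T F z - c * F z - st_gen p F z\<bar> \<le> e * K"
proof -
  obtain v q Q where pq: "p = (v, q, Q)" by (cases p)
  have v: "triple_bound M (v, q, Q)" using p pq by simp
  define a where "a = (\<lambda>k. (0 :: real, column k Q))"
  define B where "B = real (CARD('d) + 1) + (norm_l1 (0::real, q))\<^sup>2 + (norm_l1 (-1::real, 0::real^'d))\<^sup>2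
    + (\<Sum>k\<in>UNIV. (norm_l1 (a k))^3)"
  have B: "0 < B" unfolding B_def by (intro add_pos_nonneg sum_nonneg) auto
  have "integrable v norm" using v by (simp add: triple_bound_def)
  then obtain h where h: "0 < h" "h \<le> e / B" and hi: "(\<integral>z. indicator {z. norm z \<le> h} z * norm z \<partial>v) \<le> e / B"
    using small_jumps[of v "e / B"] e B by auto
  obtain c0 T0 where T0: "jump_op c0 T0" "\<And>F K z. Sm 1 K F \<Longrightarrow> \<bar>T0 F z - c0 * F z - (\<integral>\<zeta>. (F (z + (0, \<zeta>)) - F z) \<partial>v)\<bar>
       \<le> real (CARD('d) + 1) * K * (\<integral>z. indicator {z. norm z \<le> h} z * norm z \<partial>v)"
    using large_jump_op[OF v h(1)] by blast
  let ?q = "\<lambda>g :: real \<times> (real^'d) \<Rightarrow> real. \<lambda>z. 1 / h * g (z + h *\<^sub>R (0, q))"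
  let ?t = "\<lambda>g :: real \<times> (real^'d) \<Rightarrow> real. \<lambda>z. 1 / h * g (z + h *\<^sub>R (-1, 0))"
  let ?k = "\<lambda>k g z. 1 / (2 * h\<^sup>2) * (g (z + h *\<^sub>R a k) + g (z + (- (h *\<^sub>R a k))) :: real)"
  have Jq: "jump_op (1 / h * 1) ?q" by (rule jump_op_scale[OF jump_op_shift]) (use h in auto)
  have Jt: "jump_op (1 / h * 1) ?t" by (rule jump_op_scale[OF jump_op_shift]) (use h in auto)
  have Jk: "jump_op (1 / (2 * h\<^sup>2) * (1 + 1)) (?k k)" for k
    by (rule jump_op_scale[OF jump_op_add[OF jump_op_shift jump_op_shift]]) (auto simp: a_def)
  have Jk': "jump_op (\<Sum>k\<in>(UNIV :: 'd set). 1 / (2 * h\<^sup>2) * (1 + 1)) (\<lambda>g z. \<Sum>k\<in>UNIV. ?k k g z)"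
    by (rule jump_op_sum) (use Jk in auto)
  define T where "T = (\<lambda>g z. T0 g z + ?q g z + ?t g z + (\<Sum>k\<in>UNIV. ?k k g z))"
  define c where "c = c0 + 1 / h * 1 + 1 / h * 1 + (\<Sum>k\<in>(UNIV :: 'd set). 1 / (2 * h\<^sup>2) * (1 + 1))"
  have J: "jump_op c T" unfolding c_def T_def
    by (rule jump_op_add[OF jump_op_add[OF jump_op_add[OF T0(1) Jq] Jt] Jk'])
  show ?thesis
  proof (rule that[OF J])
    fix F :: "real \<times> (real^'d) \<Rightarrow> real" and K and z :: "real \<times> (real^'d)"
    assume F: "Sm 3 K F"
    have F1: "Sm 1 K F" and F2: "Sm 2 K F" using Sm_lower[OF F] by auto
    have K: "0 \<le> K" using Sm_nonneg[OF F] .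
    let ?I = "\<integral>\<zeta>. (F (z + (0, \<zeta>)) - F z) \<partial>v"
    let ?j = "\<integral>z. indicator {z. norm z \<le> h} z * norm z \<partial>v"
    define X1 where "X1 = T0 F z - c0 * F z - ?I"
    define X2 where "X2 = (F (z + h *\<^sub>R (0, q)) - F z) / h - pd (0, q) F z"
    define X3 where "X3 = (F (z + h *\<^sub>R (-1, 0)) - F z) / h - pd (-1, 0) F z"
    define X4 where "X4 = (\<lambda>k. (F (z + h *\<^sub>R a k) + F (z - h *\<^sub>R a k) - 2 * F z) / (2 * h\<^sup>2) - 1 / 2 * pd (a k) (pd (a k) F) z)"
    have m1: "pd (-1, 0) F z = - pd (1, 0) F z"
      using pd_scaleR[of F z "-1" "(1, 0)"] Sm_differentiable[of 2 K F z] F by (simp add: numeral_3_eq_3 numeral_2_eq_2)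
    have F4: "Sm (Suc (Suc 1)) K F" using F by (simp add: numeral_3_eq_3)
    have s4: "(\<Sum>k\<in>UNIV. X4 k) = (\<Sum>k\<in>UNIV. ?k k F z) - (\<Sum>k\<in>(UNIV :: 'd set). 1 / (2 * h\<^sup>2) * (1 + 1)) * F z
        - 1 / 2 * (\<Sum>k\<in>UNIV. pd (a k) (pd (a k) F) z)"
    proof -
      have "X4 k = ?k k F z - 1 / (2 * h\<^sup>2) * (1 + 1) * F z - 1 / 2 * pd (a k) (pd (a k) F) z" for k
        unfolding X4_def using h(1) by (simp add: field_simps)
      then show ?thesis by (simp only: sum_subtractf sum_distrib_left sum_distrib_right)
    qed
    have "T F z - c * F z - st_gen p F z = X1 + X2 + X3 + (\<Sum>k\<in>UNIV. X4 k)"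
      unfolding pq st_gen_eq[OF F4] s4 T_def c_def X1_def X2_def X3_def m1 a_def by (simp add: algebra_simps diff_divide_distrib)
    also have "\<bar>\<dots>\<bar> \<le> \<bar>X1\<bar> + \<bar>X2\<bar> + \<bar>X3\<bar> + (\<Sum>k\<in>UNIV. \<bar>X4 k\<bar>)"
      using sum_abs[of X4 UNIV] by linarith
    also have "\<dots> \<le> real (CARD('d) + 1) * K * ?j + h * (norm_l1 (0::real, q))\<^sup>2 * K + h * (norm_l1 (-1::real, 0::real^'d))\<^sup>2 * K
        + (\<Sum>k\<in>UNIV. h * (norm_l1 (a k))^3 * K)"
      unfolding X1_def X2_def X3_def X4_def
      by (intro add_mono sum_mono T0(2)[OF F1] forward_difference[OF F2 h(1)] second_difference[OF F h(1)])
    also have "\<dots> \<le> real (CARD('d) + 1) * K * (e / B) + (e / B) * (norm_l1 (0::real, q))\<^sup>2 * K + (e / B) * (norm_l1 (-1::real, 0::real^'d))\<^sup>2 * K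
        + (\<Sum>k\<in>UNIV. (e / B) * (norm_l1 (a k))^3 * K)"
      using h hi K by (intro add_mono sum_mono mult_left_mono mult_right_mono mult_nonneg_nonneg zero_le_power) auto
    also have "\<dots> = (e / B) * (real (CARD('d) + 1) + (norm_l1 (0::real, q))\<^sup>2 + (norm_l1 (-1::real, 0::real^'d))\<^sup>2
        + (\<Sum>k\<in>UNIV. (norm_l1 (a k))^3)) * K"
    proof -
      have "n * K * r + r * x * K + r * y * K + (\<Sum>k\<in>UNIV. r * s k * K) = r * (n + x + y + (\<Sum>k\<in>UNIV. s k)) * K"
        for n r x y and s :: "'d \<Rightarrow> real"
        by (simp add: algebra_simps sum_distrib_left)
      then show ?thesis .
    qed
    also have "\<dots> = (e / B) * B * K" unfolding B_def[symmetric] ..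
    also have "\<dots> = e * K" using B by simp
    finally show "\<bar>T F z - c * F z - st_gen p F z\<bar> \<le> e * K" .
  qed
qed

section \<open>Test functions\<close>

lemma time_has_derivative:
  fixes F :: "real \<times> 'a::euclidean_space \<Rightarrow> real"
  assumes "F differentiable (at (t, x))"
  shows "((\<lambda>s. F (s, x)) has_real_derivative pd (1, 0) F (t, x)) (at t)"
  using line_derivative[of F "(0, x)" t "(1, 0)"] assms by simp

lemma C_b_cylinderI:
  assumes "Sm k K F" "0 \<le> b"
  shows "(\<lambda>t x. F (t, x) + c0 + c1 * exp (- b * t)) \<in> C_b_cylinder"
  unfolding C_b_cylinder_def
proof (intro CollectI conjI)
  have "\<bar>F (t, x) + c0 + c1 * exp (- b * t)\<bar> \<le> K + \<bar>c0\<bar> + \<bar>c1\<bar>" if "0 < t" for t x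
  proof -
    have "\<bar>c1 * exp (- b * t)\<bar> \<le> \<bar>c1\<bar> * 1" unfolding abs_mult
      using that assms by (intro mult_left_mono) auto
    then show ?thesis using Sm_bound[OF assms(1), of "(t, x)"] by linarith
  qed
  then show "bounded ((\<lambda>(t, x). F (t, x) + c0 + c1 * exp (- b * t)) ` ({0<..} \<times> UNIV))"
    by (intro boundedI[of _ "K + \<bar>c0\<bar> + \<bar>c1\<bar>"]) auto
  show "continuous_on ({0<..} \<times> UNIV) (\<lambda>(t, x). F (t, x) + c0 + c1 * exp (- b * t))"
    unfolding case_prod_unfold
    by (intro continuous_intros continuous_on_subset[OF Sm_continuous[OF assms(1)], THEN continuous_on_compose2[of _ F]]) auto
qed

lemma C_b_timeI:
  fixes F :: "real \<times> (real^'d::finite) \<Rightarrow> real"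
  assumes "Sm k K F" "0 \<le> b"
  shows "(\<lambda>t x. F (t, x) + c0 + c1 * exp (- b * t)) \<in> C_b_time k"
  using assms(1)
proof (induction k arbitrary: F c0 c1)
  case 0
  then show ?case using C_b_cylinderI[OF 0 assms(2)] by simp
next
  case (Suc k)
  have D: "((\<lambda>s. F (s, x) + c0 + c1 * exp (- b * s)) has_real_derivative
     pd (1, 0) F (t, x) + 0 + (- b * c1) * exp (- b * t)) (at t)" for t x
    by (rule derivative_eq_intros time_has_derivative[OF Sm_differentiable[OF Suc.prems]] refl | simp)+
  have b1: "(1 :: real, 0 :: real^'d) \<in> Basis" by (simp add: Basis_prod_def)
  have "(\<lambda>t x. pd (1, 0) F (t, x) + 0 + (- b * c1) * exp (- b * t)) \<in> C_b_time k"
    by (rule Suc.IH[OF Sm_pd_Basis[OF Suc.prems b1]])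
  moreover have "(\<lambda>t x. deriv (\<lambda>s. F (s, x) + c0 + c1 * exp (- b * s)) t) =
     (\<lambda>t x. pd (1, 0) F (t, x) + 0 + (- b * c1) * exp (- b * t))"
    using DERIV_imp_deriv[OF D] by auto
  moreover have "(\<lambda>s. F (s, x) + c0 + c1 * exp (- b * s)) differentiable (at t)" for t x
    using D real_differentiable_def by blast
  ultimately show ?case using C_b_cylinderI[OF Suc.prems assms(2)] by auto
qed

lemma gradient_slice:
  fixes F :: "real \<times> (real^'d::finite) \<Rightarrow> real"
  assumes "\<And>z. F differentiable (at z)"
  shows "gradient (\<lambda>x. F (t, x) + c) x $ i = pd (0, axis i 1) F (t, x)"
    and "(\<lambda>x. F (t, x) + c) differentiable (at x)"
proof -
  have D: "((\<lambda>x. F (t, x) + c) has_derivative (\<lambda>h. pd (0, h) F (t, x))) (at x)"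
    using has_derivative_add[OF slice_has_derivative[OF assms] has_derivative_const] by simp
  show "gradient (\<lambda>x. F (t, x) + c) x $ i = pd (0, axis i 1) F (t, x)"
    unfolding gradient_nth by (rule pd_has_derivative[OF D])
  show "(\<lambda>x. F (t, x) + c) differentiable (at x)" using D by (auto simp: differentiable_def)
qed

lemma C_b_spaceI:
  fixes F :: "real \<times> (real^'d::finite) \<Rightarrow> real"
  assumes "Sm k K F" "0 \<le> b"
  shows "(\<lambda>t x. F (t, x) + c0 + c1 * exp (- b * t)) \<in> C_b_space k"
  using assms(1)
proof (induction k arbitrary: F c0 c1)
  case 0
  then show ?case using C_b_cylinderI[OF 0 assms(2)] by simp
next
  case (Suc k)
  have D: "\<And>z. F differentiable (at z)" using Sm_differentiable[OF Suc.prems] .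
  have g: "gradient (\<lambda>x. F (t, x) + c0 + c1 * exp (- b * t)) x $ i = pd (0, axis i 1) F (t, x)" for t x i
    using gradient_slice(1)[OF D, where c = "c0 + c1 * exp (- b * t)"] by (simp add: add.assoc)
  have d: "(\<lambda>x. F (t, x) + c0 + c1 * exp (- b * t)) differentiable (at x)" for t x
    using gradient_slice(2)[OF D, where c = "c0 + c1 * exp (- b * t)"] by (simp add: add.assoc)
  have IH: "(\<lambda>t x. pd (0, axis i 1) F (t, x)) \<in> C_b_space k" for i
    using Suc.IH[OF Sm_pd_Basis[OF Suc.prems, of "(0, axis i 1)"], of 0 0]
    by (simp add: Basis_prod_def axis_in_Basis_iff)
  show ?case unfolding C_b_space.simps
  proof (intro CollectI conjI allI impI)
    show "(\<lambda>t x. F (t, x) + c0 + c1 * exp (- b * t)) \<in> C_b_cylinder" by (rule C_b_cylinderI[OF Suc.prems assms(2)])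
    show "(\<lambda>x. F (t, x) + c0 + c1 * exp (- b * t)) differentiable (at x)" for t x by (rule d)
    show "(\<lambda>t x. gradient (\<lambda>x. F (t, x) + c0 + c1 * exp (- b * t)) x $ i) \<in> C_b_space k" for i
      unfolding g by (rule IH)
  qed
qed

text \<open>The exponential is the form of all time penalties below.  It stays bounded, as the
  class of test functions demands.\<close>

lemma test_function:
  fixes F :: "real \<times> (real^'d::finite) \<Rightarrow> real"
  assumes "Sm 3 K F" "0 \<le> b"
  shows "(\<lambda>t x. F (t, x) + c0 + c1 * exp (- b * t)) \<in> C_b_2_3"
  unfolding C_b_2_3_def using C_b_timeI[OF Sm_lower[OF assms(1), of 2] assms(2)] C_b_spaceI[OF assms] by simp

lemma Sm_space:
  fixes f :: "'a::euclidean_space \<Rightarrow> real"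
  shows "Sm k K f \<Longrightarrow> Sm k K (\<lambda>z :: real \<times> 'a. f (snd z))"
proof (induction k arbitrary: f)
  case 0
  then show ?case by (auto simp: Sm.simps intro!: continuous_on_compose2[of UNIV f] continuous_intros)
next
  case (Suc k)
  have D: "((\<lambda>z :: real \<times> 'a. f (snd z)) has_derivative (\<lambda>h. pd (snd h) f (snd z))) (at z)" for z
    by (rule has_derivative_compose[of snd snd z UNIV f, OF _ has_derivative_pd[OF Sm_differentiable[OF Suc.prems]]])
       (auto intro!: derivative_eq_intros)
  have p: "pd b (\<lambda>z :: real \<times> 'a. f (snd z)) = (\<lambda>z. pd (snd b) f (snd z))" for b
    using pd_has_derivative[OF D] by blast
  have "Sm k K (pd b (\<lambda>z :: real \<times> 'a. f (snd z)))" if b: "b \<in> Basis" for b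
  proof (cases "snd b = 0")
    case True
    have "pd 0 f x = 0" for x using pd_scaleR[OF Sm_differentiable[OF Suc.prems], of 0 0] by simp
    then show ?thesis unfolding p True using Sm_nonneg[OF Suc.prems] by simp
  next
    case False
    then have "snd b \<in> Basis" using b by (auto simp: Basis_prod_def)
    then show ?thesis unfolding p by (intro Suc.IH Sm_pd_Basis[OF Suc.prems])
  qed
  then show ?case using Sm_bound[OF Suc.prems] D unfolding Sm.simps differentiable_def by blast
qed

lemma pd_time_space:
  fixes f :: "'a::euclidean_space \<Rightarrow> real"
  assumes "f differentiable (at (snd z))"
  shows "pd (1, 0) (\<lambda>z :: real \<times> 'a. f (snd z)) z = 0"
proof -
  have D: "((\<lambda>z :: real \<times> 'a. f (snd z)) has_derivative (\<lambda>h. pd (snd h) f (snd z))) (at z)"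
    by (rule has_derivative_compose[of snd snd z UNIV f, OF _ has_derivative_pd[OF assms]])
       (auto intro!: derivative_eq_intros)
  show ?thesis using pd_has_derivative[OF D, of "(1, 0)"] pd_scaleR[OF assms, of 0 0] by simp
qed

lemma sup_triples_levy_gen:
  fixes F :: "real \<times> (real^'d::finite) \<Rightarrow> real"
  assumes "\<And>z. F differentiable (at z)"
  shows "sup_triples U (\<lambda>z. (F (t, x + z) + c) - (F (t, x) + c)) (gradient (\<lambda>x. F (t, x) + c) x) (hessian (\<lambda>x. F (t, x) + c) x)
    = (SUP p\<in>U. levy_gen p (\<lambda>x. F (t, x)) x)"
proof -
  have g: "gradient (\<lambda>x. F (t, x) + c) = gradient (\<lambda>x. F (t, x))"
    using gradient_slice(1)[OF assms, of t c] gradient_slice(1)[OF assms, of t 0] by (auto simp: vec_eq_iff)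
  then have h: "hessian (\<lambda>x. F (t, x) + c) = hessian (\<lambda>x. F (t, x))" by (intro ext) (simp add: hessian_def)
  show ?thesis unfolding sup_triples_def levy_gen_def g h by (simp add: case_prod_unfold)
qed

lemma pde_lhs_test:
  fixes F :: "real \<times> (real^'d::finite) \<Rightarrow> real"
  assumes D: "\<And>z. F differentiable (at z)"
  shows "pde_lhs U (\<lambda>t x. F (t, x) + c0 + c1 * exp (- b * t)) t x =
    pd (1, 0) F (t, x) - b * c1 * exp (- b * t) - (SUP p\<in>U. levy_gen p (\<lambda>x. F (t, x)) x)"
proof -
  have "((\<lambda>s. F (s, x) + c0 + c1 * exp (- b * s)) has_real_derivative
     pd (1, 0) F (t, x) - b * c1 * exp (- b * t)) (at t)"
    by (rule derivative_eq_intros time_has_derivative[OF D] refl | simp)+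
  then have d: "deriv (\<lambda>s. F (s, x) + c0 + c1 * exp (- b * s)) t = pd (1, 0) F (t, x) - b * c1 * exp (- b * t)"
    by (rule DERIV_imp_deriv)
  show ?thesis unfolding pde_lhs_def d
    using sup_triples_levy_gen[OF D, of U t x "c0 + c1 * exp (- b * t)"] by (simp add: add.assoc)
qed

definition bounded_triples :: "real \<Rightarrow> 'd::finite triple set \<Rightarrow> bool" where
  "bounded_triples M U \<longleftrightarrow> U \<noteq> {} \<and> (\<forall>p\<in>U. triple_bound M p)"

lemma levy_gen_bdd_above:
  assumes "bounded_triples M U" "smooth_bd (Suc 0) K f"
  shows "bdd_above ((\<lambda>p. levy_gen p f x) ` U)"
  using levy_gen_bound[OF _ assms(2)] assms(1)
  by (intro bdd_aboveI[of _ "3 * (real CARD('a))\<^sup>2 * M * K"]) (force simp: bounded_triples_def abs_le_iff)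

lemma represents_bounded_triples:
  assumes "represents_G_X E X U"
  obtains M where "0 \<le> M" "bounded_triples M U"
proof -
  let ?s = "\<lambda>(v, q, Q). (\<integral>\<^sup>+z. ennreal (norm z) \<partial>v) + ennreal (norm q + trace (Q ** transpose Q))"
  have ne: "U \<noteq> {}" and sp: "\<forall>(v, q, Q)\<in>U. space v = - {0} \<and> sets v = sets (restrict_space borel (- {0}))"
    and fin: "(SUP p\<in>U. ?s p) < \<infinity>"
    using assms unfolding represents_G_X_def by auto
  define M where "M = enn2real (SUP p\<in>U. ?s p)"
  have M: "(SUP p\<in>U. ?s p) = ennreal M" "0 \<le> M" unfolding M_def using fin by auto
  have "triple_bound M p" if p: "p \<in> U" for p
  proof -
    obtain v q Q where pq: "p = (v, q, Q)" by (cases p)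
    have s: "space v = - {0}" "sets v = sets (restrict_space borel (- {0}))" using sp p pq by auto
    have "?s p \<le> ennreal M" unfolding M(1)[symmetric] by (rule SUP_upper[OF p])
    then have le: "(\<integral>\<^sup>+z. ennreal (norm z) \<partial>v) + ennreal (norm q + trace (Q ** transpose Q)) \<le> ennreal M" by (simp add: pq)
    have le1: "(\<integral>\<^sup>+z. ennreal (norm z) \<partial>v) \<le> ennreal M" using le by (meson dual_order.trans le_add_same_cancel1 zero_le add_increasing2 order_refl)
    have "ennreal (norm q + trace (Q ** transpose Q)) \<le> ennreal M" using le by (meson order_trans add_increasing zero_le order_refl)
    then have le2: "norm q + trace (Q ** transpose Q) \<le> M" using M(2) by simp
    have tr: "0 \<le> trace (Q ** transpose Q)" unfolding trace_square by (intro sum_nonneg) auto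
    have nm: "norm \<in> borel_measurable v"
    proof -
      have "(norm :: real^'b \<Rightarrow> real) \<in> borel_measurable borel" by measurable
      then show ?thesis using measurable_restrict_space1[of norm borel borel "- {0}"] measurable_cong_sets[OF s(2) refl] by blast
    qed
    have i: "integrable v norm"
      by (rule integrableI_bounded[OF nm]) (use le1 in \<open>simp add: le_less_trans[OF _ ennreal_less_top]\<close>)
    have "(\<integral>z. norm z \<partial>v) \<le> M"
      using nn_integral_eq_integral[OF i] le1 M(2) by simp
    moreover have "norm q \<le> M" "trace (Q ** transpose Q) \<le> M" using le2 tr norm_ge_zero[of q] by linarith+
    ultimately show ?thesis unfolding triple_bound_def pq using s i by auto
  qed
  then show ?thesis using that[OF M(2)] ne by (auto simp: bounded_triples_def)
qed

section \<open>A penalized maximum\<close>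

lemma usc_attains_sup:
  fixes f :: "'a::metric_space \<Rightarrow> real"
  assumes C: "compact C" "C \<noteq> {}" "C \<subseteq> S" and u: "upper_semicontinuous_on S f" and b: "bdd_above (f ` C)"
  obtains x where "x \<in> C" "\<And>y. y \<in> C \<Longrightarrow> f y \<le> f x"
proof -
  define s where "s = (SUP x\<in>C. f x)"
  have "\<exists>y\<in>C. s - inverse (real (Suc n)) < f y" for n
    using less_cSUP_iff[OF C(2) b, of "s - inverse (real (Suc n))"] by (simp add: s_def)
  then obtain y where y: "\<And>n. y n \<in> C" "\<And>n. s - inverse (real (Suc n)) < f (y n)" by metis
  obtain l r where l: "l \<in> C" and r: "strict_mono (r :: nat \<Rightarrow> nat)" "(y \<circ> r) \<longlonglongrightarrow> l"
    using C(1) y(1) unfolding compact_def by metis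
  have "s \<le> f l"
  proof (rule ccontr)
    assume "\<not> s \<le> f l"
    define c where "c = (f l + s) / 2"
    have c: "f l < c" "c < s" using \<open>\<not> s \<le> f l\<close> by (auto simp: c_def)
    have "\<forall>\<^sub>F y in at l within S. f y < c" using u l C(3) c(1) by (auto simp: upper_semicontinuous_on_def)
    then have "\<forall>\<^sub>F y in nhds l. y \<in> S \<longrightarrow> f y < c"
      unfolding eventually_at_filter by eventually_elim (use c in auto)
    then have "\<forall>\<^sub>F n in sequentially. (y \<circ> r) n \<in> S \<longrightarrow> f ((y \<circ> r) n) < c"
      by (rule eventually_compose_filterlim[OF _ r(2)])
    moreover have "\<forall>\<^sub>F n in sequentially. inverse (real (Suc n)) < s - c"
      using c by (intro order_tendstoD(2)[OF LIMSEQ_inverse_real_of_nat]) simp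
    ultimately have "\<forall>\<^sub>F n in sequentially. False"
    proof eventually_elim
      case (elim n)
      have "n \<le> r n" using r(1) by (rule seq_suble)
      then have "inverse (real (Suc (r n))) \<le> inverse (real (Suc n))" by (simp add: divide_simps)
      moreover have "f (y (r n)) < c" using elim(1) y(1)[of "r n"] C(3) by auto
      ultimately show ?case using elim(2) y(2)[of "r n"] by linarith
    qed
    then show False by simp
  qed
  moreover have "f z \<le> s" if "z \<in> C" for z unfolding s_def by (rule cSUP_upper[OF that b])
  ultimately show ?thesis using that[OF l] by force
qed

lemma usc_diff_continuous:
  fixes f g :: "'a::metric_space \<Rightarrow> real"
  assumes f: "upper_semicontinuous_on S f" and g: "continuous_on S g"
  shows "upper_semicontinuous_on S (\<lambda>x. f x - g x)"
  unfolding upper_semicontinuous_on_def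
proof (intro ballI allI impI)
  fix x c assume x: "x \<in> S" and c: "f x - g x < c"
  define m where "m = (c - (f x - g x)) / 2"
  have m: "0 < m" using c by (simp add: m_def)
  have "\<forall>\<^sub>F y in at x within S. f y < f x + m" using f x m by (auto simp: upper_semicontinuous_on_def)
  moreover have "\<forall>\<^sub>F y in at x within S. g x - m < g y"
    using g x m by (intro order_tendstoD(1)[of g "g x"]) (auto simp: continuous_on_def)
  ultimately show "\<forall>\<^sub>F y in at x within S. f y - g y < c"
  proof eventually_elim
    case (elim y)
    have "2 * m = c - (f x - g x)" by (simp add: m_def)
    then show ?case using elim by linarith
  qed
qed

text \<open>A bump of a large radius \<open>R\<close>: its derivatives are of the order \<open>A / R\<close>, which is at most \<open>\<epsilon>\<close> for large \<open>R\<close>,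
  although it reaches the height \<open>A\<close>.\<close>

lemma space_penalty:
  fixes x0 :: "'a::euclidean_space"
  assumes A: "0 \<le> A" and e: "0 < \<epsilon>"
  obtains K q R where "Sm 3 K q" "smooth_bd (Suc 0) \<epsilon> q" "\<And>y. 0 \<le> q y" "q x0 = 0" "0 < R"
    "\<And>y. R \<le> dist x0 y \<Longrightarrow> q y = A"
proof -
  obtain K where K: "Sm 5 K (bump :: 'a \<Rightarrow> real)" using bump_smooth by blast
  have K3: "Sm 3 K (bump :: 'a \<Rightarrow> real)" and K2: "Sm (Suc (Suc 0)) K (bump :: 'a \<Rightarrow> real)" using Sm_lower[OF K] by auto
  have K0: "0 \<le> K" using Sm_nonneg[OF K] .
  define R where "R = max 1 (A * K / \<epsilon>)"
  have R: "1 \<le> R" "A * K / R \<le> \<epsilon>"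
    using e A K0 by (auto simp: R_def max_def divide_simps mult_ac)
  define b where "b = (\<lambda>y::'a. bump ((1 / R) *\<^sub>R y + - ((1 / R) *\<^sub>R x0)))"
  define q where "q = (\<lambda>y. A + (- A) * b y)"
  have b3: "Sm 3 (1 ^ 3 * K) b" unfolding b_def by (rule Sm_affine[OF K3]) (use R in auto)
  have bd: "b differentiable (at y)" for y using b3 Sm_differentiable[of 2 _ b] by (simp add: numeral_3_eq_3 numeral_2_eq_2)
  have be: "b y = bump ((1 / R) *\<^sub>R (y - x0))" for y by (simp add: b_def scaleR_diff_right)
  have "Sm 3 (A + \<bar>- A\<bar> * (1 ^ 3 * K)) q" unfolding q_def
    by (rule Sm_add[OF _ Sm_cmult[OF b3]]) (use A in simp)
  moreover have "smooth_bd (Suc 0) \<epsilon> q"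
    unfolding smooth_bd_def
  proof (intro conjI allI ballI)
    show "q differentiable (at y)" for y unfolding q_def using bd by (intro differentiable_add differentiable_mult) auto
    fix c :: 'a assume c: "c \<in> Basis"
    have "Sm (Suc 0) (1 / R * K) (pd c b)" unfolding b_def by (rule Sm_pd_contract[OF K2]) (use R c in auto)
    then have "Sm (Suc 0) (\<bar>- A\<bar> * (1 / R * K)) (\<lambda>y. (- A) * pd c b y)" by (rule Sm_cmult)
    moreover have "pd c q = (\<lambda>y. (- A) * pd c b y)"
    proof
      fix y
      have "(q has_derivative (\<lambda>h. 0 + (- A) * pd h b y)) (at y)"
        unfolding q_def by (intro has_derivative_add has_derivative_const has_derivative_mult_right has_derivative_pd bd)
      from pd_has_derivative[OF this, of c] show "pd c q y = (- A) * pd c b y" by simp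
    qed
    ultimately show "Sm (Suc 0) \<epsilon> (pd c q)" using R A by (auto elim!: Sm_mono)
  qed
  moreover have "0 \<le> q y" for y
    using mult_left_mono[OF bump_range(2) A, of "(1 / R) *\<^sub>R (y - x0)"] by (simp add: q_def be)
  moreover have "q x0 = 0" by (simp add: q_def be)
  moreover have "q y = A" if "R \<le> dist x0 y" for y
  proof -
    have "1 \<le> norm ((1 / R) *\<^sub>R (y - x0))" using that R by (simp add: dist_norm norm_minus_commute)
    from bump_outside[OF this] show ?thesis by (simp only: q_def be mult_zero_right add_0_right)
  qed
  ultimately show ?thesis using that[of _ q R] R by auto
qed

text \<open>Test functions must touch globally and be bounded, so \<open>F\<close> is confined by bounded penalties.  The
  height \<open>A\<close> is twice the bound of \<open>F\<close> plus one: where the space penalty is fully grown, or the time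
  penalty \<open>A * (1 - exp (- b * s))\<close> is at least half grown, the penalized function is negative, so the
  maximum lies in a compact set, at a time with \<open>exp (- b * t) > 1 / 2\<close>.  The initial slope
  \<open>b * A\<close> of the time penalty slightly exceeds \<open>2 * e\<close>: then its slope at the maximum is at least
  \<open>e\<close>, while the penalty at time \<open>T\<close> stays below the excess of \<open>F T x0\<close> over \<open>c\<close>.\<close>

lemma penalized_maximum:
  fixes F :: "real \<Rightarrow> 'a::euclidean_space \<Rightarrow> real"
  assumes bd: "\<And>t x. 0 \<le> t \<Longrightarrow> \<bar>F t x\<bar> \<le> A0"
    and usc: "upper_semicontinuous_on ({0..} \<times> UNIV) (\<lambda>(t, x). F t x)"
    and F0: "\<And>x. F 0 x \<le> 0" and T: "0 < T" and c: "0 \<le> c" and e: "0 \<le> e"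
    and big: "c + 2 * e * T < F T x0" and eps: "0 < \<epsilon>"
  obtains A b K q t x where "0 < t" "0 \<le> b" "0 \<le> A" "Sm 3 K q" "smooth_bd (Suc 0) \<epsilon> q" "\<And>y. 0 \<le> q y"
    "\<And>s y. 0 \<le> s \<Longrightarrow> F s y - A * (1 - exp (- b * s)) - q y \<le> F t x - A * (1 - exp (- b * t)) - q x"
    "c < F t x - A * (1 - exp (- b * t)) - q x" "e \<le> b * A * exp (- b * t)"
proof -
  have A0: "0 \<le> A0" using bd[of 0 x0] by linarith
  define A where "A = 2 * A0 + 1"
  define e' where "e' = e + (F T x0 - c - 2 * e * T) / (4 * T)"
  have "2 * e' * T = 2 * e * T + (F T x0 - c - 2 * e * T) / 2" using T by (simp add: e'_def field_simps)
  moreover have "e < e'" using big T by (simp add: e'_def)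
  moreover have "Q + c < r" if "Q = P + (r - c - P) / 2" "c + P < r" for P Q r :: real
    using that by (simp add: field_simps)
  ultimately have e': "e < e'" "2 * e' * T + c < F T x0" using big by blast+
  define b where "b = 2 * e' / A"
  have Ab: "0 < A" "0 < b" "b * A = 2 * e'" using A0 e e' by (auto simp: A_def b_def)
  obtain K q R where q: "Sm 3 K q" "smooth_bd (Suc 0) \<epsilon> q" "\<And>y. 0 \<le> q y" "q x0 = 0" "0 < R" "\<And>y. R \<le> dist x0 y \<Longrightarrow> q y = A"
    using space_penalty[of A \<epsilon> x0] Ab eps by (metis less_imp_le)
  define p where "p = (\<lambda>s. A * (1 - exp (- b * s)))"
  define G where "G = (\<lambda>(s, y). F s y - p s - q y)"
  have p0: "0 \<le> p s" if "0 \<le> s" for s using Ab that by (auto simp: p_def)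
  have pT: "p T \<le> 2 * e' * T"
  proof -
    have "1 - exp (- b * T) \<le> b * T" using exp_ge_add_one_self[of "- b * T"] by simp
    then have "p T \<le> A * (b * T)" unfolding p_def using Ab by (intro mult_left_mono) auto
    also have "\<dots> = 2 * e' * T" using Ab(3) by (simp add: mult_ac)
    finally show ?thesis .
  qed
  have GT: "c < G (T, x0)" using e'(2) pT q(4) by (simp add: G_def)
  define C where "C = {0..ln 2 / b} \<times> cball x0 R"
  have out: "G (s, y) < 0" if s: "0 \<le> s" and o: "(s, y) \<notin> C \<or> A / 2 \<le> p s" for s y
  proof (cases "A / 2 \<le> p s \<or> R \<le> dist x0 y")
    case True
    then show ?thesis using bd[OF s, of y] q(3)[of y] q(6)[of y] p0[OF s] by (auto simp: G_def A_def)
  next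
    case False
    then have "ln 2 / b < s" using o s by (auto simp: C_def)
    then have "exp (- b * s) \<le> exp (- ln 2)" using Ab by (simp add: pos_divide_less_eq mult.commute)
    then have "exp (- b * s) \<le> 1 / 2" by (simp add: exp_minus)
    then have "A * (1 / 2) \<le> p s" unfolding p_def using Ab by (intro mult_left_mono) auto
    then show ?thesis using False by simp
  qed
  have TC: "(T, x0) \<in> C" using out[of T x0] GT c T by force
  have Cc: "compact C" unfolding C_def by (intro compact_Times) auto
  have "continuous_on UNIV (\<lambda>z. p (fst z) + q (snd z))"
    unfolding p_def by (intro continuous_intros continuous_on_compose2[OF Sm_continuous[OF q(1)]]) auto
  then have "upper_semicontinuous_on ({0..} \<times> UNIV) (\<lambda>z. (\<lambda>(t, x). F t x) z - (p (fst z) + q (snd z)))"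
    by (intro usc_diff_continuous usc) (rule continuous_on_subset, auto)
  then have uG: "upper_semicontinuous_on ({0..} \<times> UNIV) G"
    by (simp add: G_def case_prod_unfold algebra_simps)
  have bG: "bdd_above (G ` C)"
  proof (rule bdd_aboveI[of _ A0], safe)
    fix s y assume "(s, y) \<in> C"
    then have "0 \<le> s" by (simp add: C_def)
    then show "G (s, y) \<le> A0" using bd[of s y] p0[of s] q(3)[of y] by (simp add: G_def)
  qed
  obtain z where z: "z \<in> C" "\<And>y. y \<in> C \<Longrightarrow> G y \<le> G z"
    by (rule usc_attains_sup[OF Cc _ _ uG bG]) (use TC in \<open>auto simp: C_def\<close>)
  obtain t x where tx: "z = (t, x)" by (cases z)
  have t0: "0 \<le> t" using z(1) by (simp add: tx C_def)
  have big': "c < G (t, x)" using z(2)[OF TC] GT by (simp add: tx)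
  have max: "G (s, y) \<le> G (t, x)" if "0 \<le> s" for s y
  proof (cases "(s, y) \<in> C")
    case True then show ?thesis using z(2) by (simp add: tx)
  next
    case False then show ?thesis using out[OF that, of y] big' c by simp
  qed
  have "t \<noteq> 0"
  proof
    assume "t = 0"
    then have "G (t, x) \<le> 0" using F0[of x] q(3)[of x] by (simp add: G_def p_def)
    then show False using big' c by linarith
  qed
  then have tp: "0 < t" using t0 by simp
  have "p t < A / 2" using out[OF t0, of x] big' c by force
  then have "A * (1 / 2) < A * exp (- b * t)" by (simp add: p_def algebra_simps)
  then have "b * (A * (1 / 2)) \<le> b * (A * exp (- b * t))" using Ab by (intro mult_left_mono) auto
  then have "e \<le> b * A * exp (- b * t)" using Ab(3) e'(1) by (simp add: mult.assoc[symmetric])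
  then show ?thesis
    using that[of t b A K q x] tp Ab q max big' by (simp add: G_def p_def)
qed

section \<open>Comparison with smooth functions\<close>

text \<open>The constant of \<open>levy_gen_bound\<close> for the coefficient bound \<open>M\<close>.\<close>

definition gen_const :: "real \<Rightarrow> 'd::finite itself \<Rightarrow> real" where
  "gen_const M _ = 3 * (real CARD('d))\<^sup>2 * M"

text \<open>At a penalized maximum of \<open>a - W\<close> the function \<open>W\<close> plus the penalties is a test function
  touching \<open>a\<close> from above.  The time penalty contributes the slope \<open>e\<close>, the space penalty
  changes the generators by less than \<open>e\<close>, and \<open>W\<close> itself has the right sign, uniformly over
  the triples: a contradiction.\<close>

theorem subsolution_le_smooth_supersolution:
  fixes W :: "real \<times> (real^'d::finite) \<Rightarrow> real"
  assumes U: "bounded_triples M U" and M: "0 \<le> M" and a: "viscosity_subsolution U \<phi> a" and W: "Sm 3 K W"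
    and gen: "\<And>p t x. p \<in> U \<Longrightarrow> 0 < t \<Longrightarrow> st_gen p W (t, x) \<le> 0"
    and init: "\<And>x. \<phi> x \<le> W (0, x)" and T: "0 \<le> T"
  shows "a T x0 \<le> W (T, x0)"
proof (rule ccontr)
  assume contra: "\<not> a T x0 \<le> W (T, x0)"
  define F where "F = (\<lambda>t x. a t x - W (t, x))"
  obtain B where B: "\<And>t x. 0 \<le> t \<Longrightarrow> \<bar>a t x\<bar> \<le> B"
    using a unfolding viscosity_subsolution_def bounded_iff by (auto simp: image_iff)
  have a0: "a 0 x \<le> \<phi> x" for x using a by (auto simp: viscosity_subsolution_def)
  have F0: "F 0 x \<le> 0" for x using a0[of x] init[of x] by (simp add: F_def)
  have Tp: "0 < T" using T contra F0[of x0] by (cases "T = 0") (auto simp: F_def)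
  define e where "e = F T x0 / (4 * T)"
  have e: "0 < e" "0 + 2 * e * T < F T x0" using contra Tp by (auto simp: e_def F_def)
  define g where "g = gen_const M TYPE('d)"
  have g: "0 \<le> g" using M by (simp add: g_def gen_const_def)
  define \<epsilon> where "\<epsilon> = e / (g + 1)"
  have "0 < \<epsilon>" "(g + 1) * \<epsilon> = e" using e(1) g by (simp_all add: \<epsilon>_def)
  then have eps: "0 < \<epsilon>" "g * \<epsilon> < e" by (simp_all add: algebra_simps)
  have usc: "upper_semicontinuous_on ({0..} \<times> UNIV) (\<lambda>(t, x). F t x)"
    using usc_diff_continuous[of "{0..} \<times> UNIV" "\<lambda>(t, x). a t x" W] a continuous_on_subset[OF Sm_continuous[OF W]]
    by (auto simp: viscosity_subsolution_def F_def case_prod_unfold)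
  have bd: "\<bar>F t x\<bar> \<le> B + K" if "0 \<le> t" for t x
    using B[OF that, of x] Sm_bound[OF W, of "(t, x)"] by (simp add: F_def)
  obtain A b K' q t x where 1: "0 < t" "0 \<le> b" "0 \<le> A" "Sm 3 K' q" "smooth_bd (Suc 0) \<epsilon> q" "\<And>y. 0 \<le> q y"
    and max: "\<And>s y. 0 \<le> s \<Longrightarrow> F s y - A * (1 - exp (- b * s)) - q y \<le> F t x - A * (1 - exp (- b * t)) - q x"
    and cc: "0 < F t x - A * (1 - exp (- b * t)) - q x"
    and ee: "e \<le> b * A * exp (- b * t)"
    by (rule penalized_maximum[where F = F and e = e, OF bd usc F0 Tp order_refl less_imp_le[OF e(1)] e(2) eps(1)], assumption, rule that)
  define m where "m = F t x - A * (1 - exp (- b * t)) - q x"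
  define V where "V = (\<lambda>z. W z + q (snd z))"
  have V: "Sm 3 (K + K') V" unfolding V_def by (rule Sm_add[OF W Sm_space[OF 1(4)]])
  have W3: "Sm (Suc (Suc (Suc 0))) K W" and V3: "Sm (Suc (Suc (Suc 0))) (K + K') V" and q3: "Sm (Suc (Suc (Suc 0))) K' q"
    using W V 1(4) by (simp_all add: numeral_3_eq_3)
  have DW: "\<And>z. W differentiable (at z)" and DV: "\<And>z. V differentiable (at z)" and Dq: "\<And>z. q differentiable (at z)"
    using Sm_differentiable[OF W3] Sm_differentiable[OF V3] Sm_differentiable[OF q3] by auto
  define \<psi> where "\<psi> = (\<lambda>t x. V (t, x) + (A + m) + (- A) * exp (- b * t))"
  have "\<psi> \<in> C_b_2_3" unfolding \<psi>_def by (rule test_function[OF V 1(2)])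
  moreover have "a s y \<le> \<psi> s y" if "0 < s" for s y
    using max[of s y] that by (simp add: \<psi>_def V_def F_def m_def algebra_simps)
  moreover have "\<psi> t x = a t x" by (simp add: \<psi>_def V_def F_def m_def algebra_simps)
  ultimately have "pde_lhs U \<psi> t x \<le> 0" using a 1(1) by (auto simp: viscosity_subsolution_def)
  then have L: "pd (1, 0) V (t, x) + b * A * exp (- b * t) \<le> (SUP p\<in>U. levy_gen p (\<lambda>x. V (t, x)) x)"
    unfolding \<psi>_def pde_lhs_test[OF DV] by simp
  have ptV: "pd (1, 0) V (t, x) = pd (1, 0) W (t, x)"
    using Dq differentiableI[OF Sm_space[OF q3, THEN Sm_differentiable, THEN has_derivative_pd]]
    unfolding V_def by (subst pd_add) (auto simp: DW pd_time_space)
  have "(SUP p\<in>U. levy_gen p (\<lambda>x. V (t, x)) x) \<le> pd (1, 0) W (t, x) + g * \<epsilon>"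
  proof (rule cSUP_least)
    show "U \<noteq> {}" using U by (simp add: bounded_triples_def)
    fix p assume p: "p \<in> U"
    then have pM: "triple_bound M p" using U by (simp add: bounded_triples_def)
    have sW: "smooth_bd (Suc 0) K (\<lambda>x. W (t, x))"
      by (rule Sm_smooth_bd[OF Sm_slice[OF Sm_lower[OF W]]]) simp
    have "levy_gen p (\<lambda>x. V (t, x)) x = levy_gen p (\<lambda>x. W (t, x)) x + levy_gen p q x"
      using levy_gen_lincomb[OF pM sW 1(5), of 1 x] by (simp add: V_def)
    moreover have "levy_gen p (\<lambda>x. W (t, x)) x \<le> pd (1, 0) W (t, x)"
      using gen[OF p 1(1), of x] by (simp add: st_gen_def)
    moreover have "levy_gen p q x \<le> g * \<epsilon>"
      using levy_gen_bound[OF pM 1(5), of x] by (simp add: g_def gen_const_def)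
    ultimately show "levy_gen p (\<lambda>x. V (t, x)) x \<le> pd (1, 0) W (t, x) + g * \<epsilon>" by linarith
  qed
  then show False using L ee eps(2) ptV by linarith
qed

text \<open>For a supersolution the supremum over the triples may be estimated from below by any single
  triple, so a smooth function that exceeds \<open>w\<close> somewhere has, at a point of excess, an almost
  nonpositive linear generator.  The parameter \<open>c\<close> records how large the excess at that point is, and \<open>e\<close> trades
  part of the excess for a negative sign.\<close>

theorem supersolution_penalized:
  fixes \<Psi> :: "real \<times> (real^'d::finite) \<Rightarrow> real"
  assumes U: "bounded_triples M U" and M: "0 \<le> M" and w: "viscosity_supersolution U \<phi> w" and p: "p \<in> U"
    and \<Psi>: "Sm 3 K \<Psi>" and init: "\<And>x. \<Psi> (0, x) \<le> w 0 x" and T: "0 < T" and c: "0 \<le> c" and e: "0 \<le> e"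
    and big: "c + 2 * e * T < \<Psi> (T, x0) - w T x0" and eps: "0 < \<epsilon>"
  obtains t x where "0 < t" "c < \<Psi> (t, x) - w t x" "st_gen p \<Psi> (t, x) \<le> \<epsilon> - e"
proof -
  define F where "F = (\<lambda>t x. \<Psi> (t, x) - w t x)"
  obtain B where B: "\<And>t x. 0 \<le> t \<Longrightarrow> \<bar>w t x\<bar> \<le> B"
    using w unfolding viscosity_supersolution_def bounded_iff by (auto simp: image_iff)
  have F0: "F 0 x \<le> 0" for x using init[of x] by (simp add: F_def)
  define g where "g = gen_const M TYPE('d)"
  have g: "0 \<le> g" using M by (simp add: g_def gen_const_def)
  define \<epsilon>' where "\<epsilon>' = \<epsilon> / (g + 1)"
  have eps': "0 < \<epsilon>'" "g * \<epsilon>' \<le> \<epsilon>"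
    using eps g by (auto simp: \<epsilon>'_def field_simps)
  have "upper_semicontinuous_on ({0..} \<times> UNIV) (\<lambda>z. - (case z of (t, x) \<Rightarrow> w t x))"
    unfolding upper_semicontinuous_on_def
  proof (intro ballI allI impI)
    fix z c assume z: "z \<in> {0..} \<times> (UNIV :: (real^'d) set)" and "- (case z of (t, x) \<Rightarrow> w t x) < c"
    then have "- c < (case z of (t, x) \<Rightarrow> w t x)" by simp
    then have "\<forall>\<^sub>F y in at z within {0..} \<times> UNIV. - c < (case y of (t, x) \<Rightarrow> w t x)"
      using w z unfolding viscosity_supersolution_def lower_semicontinuous_on_def by blast
    then show "\<forall>\<^sub>F y in at z within {0..} \<times> UNIV. - (case y of (t, x) \<Rightarrow> w t x) < c"
      by eventually_elim simp
  qed
  from usc_diff_continuous[OF this, of "\<lambda>z. - \<Psi> z"]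
  have usc: "upper_semicontinuous_on ({0..} \<times> UNIV) (\<lambda>(t, x). F t x)"
    using continuous_on_subset[OF Sm_continuous[OF \<Psi>]]
    by (auto simp: F_def case_prod_unfold intro!: continuous_intros)
  have bd: "\<bar>F t x\<bar> \<le> B + K" if "0 \<le> t" for t x
    using B[OF that, of x] Sm_bound[OF \<Psi>, of "(t, x)"] by (simp add: F_def)
  have big': "c + 2 * e * T < F T x0" using big by (simp add: F_def)
  obtain A b K' q t x where 1: "0 < t" "0 \<le> b" "0 \<le> A" "Sm 3 K' q" "smooth_bd (Suc 0) \<epsilon>' q" "\<And>y. 0 \<le> q y"
    and max: "\<And>s y. 0 \<le> s \<Longrightarrow> F s y - A * (1 - exp (- b * s)) - q y \<le> F t x - A * (1 - exp (- b * t)) - q x"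
    and cc: "c < F t x - A * (1 - exp (- b * t)) - q x"
    and ee: "e \<le> b * A * exp (- b * t)"
    by (rule penalized_maximum[where F = F, OF bd usc F0 T c e big' eps'(1)], assumption, rule that)
  define m where "m = F t x - A * (1 - exp (- b * t)) - q x"
  define V where "V = (\<lambda>z. \<Psi> z + (-1) * q (snd z))"
  have Sq: "Sm 3 K' (\<lambda>z :: real \<times> (real^'d). q (snd z))" by (rule Sm_space[OF 1(4)])
  have V: "Sm 3 (K + \<bar>-1\<bar> * K') V" unfolding V_def by (rule Sm_add[OF \<Psi> Sm_cmult[OF Sq]])
  have W3: "Sm (Suc (Suc (Suc 0))) K \<Psi>" and V3: "Sm (Suc (Suc (Suc 0))) (K + \<bar>-1\<bar> * K') V" and q3: "Sm (Suc (Suc (Suc 0))) K' q"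
    and Sq3: "Sm (Suc (Suc (Suc 0))) K' (\<lambda>z :: real \<times> (real^'d). q (snd z))"
    using \<Psi> V 1(4) Sq by (simp_all add: numeral_3_eq_3)
  have DW: "\<And>z. \<Psi> differentiable (at z)" and DV: "\<And>z. V differentiable (at z)" and Dq: "\<And>z. q differentiable (at z)"
    and DSq: "\<And>z. (\<lambda>z :: real \<times> (real^'d). q (snd z)) differentiable (at z)"
    using Sm_differentiable[OF W3] Sm_differentiable[OF V3] Sm_differentiable[OF q3] Sm_differentiable[OF Sq3] by auto
  define \<psi> where "\<psi> = (\<lambda>t x. V (t, x) + (- A - m) + A * exp (- b * t))"
  have "\<psi> \<in> C_b_2_3" unfolding \<psi>_def by (rule test_function[OF V 1(2)])
  moreover have "\<psi> s y \<le> w s y" if "0 < s" for s y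
    using max[of s y] that by (simp add: \<psi>_def V_def F_def m_def algebra_simps)
  moreover have "\<psi> t x = w t x" by (simp add: \<psi>_def V_def F_def m_def algebra_simps)
  ultimately have "0 \<le> pde_lhs U \<psi> t x" using w 1(1) by (auto simp: viscosity_supersolution_def)
  then have L: "(SUP p\<in>U. levy_gen p (\<lambda>x. V (t, x)) x) \<le> pd (1, 0) V (t, x) - b * A * exp (- b * t)"
    unfolding \<psi>_def pde_lhs_test[OF DV] by simp
  have "pd (1, 0) V (t, x) = pd (1, 0) \<Psi> (t, x) + pd (1, 0) (\<lambda>z. (-1) * q (snd z)) (t, x)"
    unfolding V_def by (rule pd_add[OF DW]) (intro differentiable_mult differentiable_const DSq)
  also have "pd (1, 0) (\<lambda>z. (-1) * q (snd z)) (t, x) = 0"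
    unfolding pd_cmult[OF DSq] by (simp add: pd_time_space Dq)
  finally have ptV: "pd (1, 0) V (t, x) = pd (1, 0) \<Psi> (t, x)" by simp
  have sV: "smooth_bd (Suc 0) (K + \<bar>-1\<bar> * K') (\<lambda>x. V (t, x))"
    by (rule Sm_smooth_bd[OF Sm_slice[OF Sm_lower[OF V]]]) simp
  have sW: "smooth_bd (Suc 0) K (\<lambda>x. \<Psi> (t, x))"
    by (rule Sm_smooth_bd[OF Sm_slice[OF Sm_lower[OF \<Psi>]]]) simp
  have pM: "triple_bound M p" using U p by (simp add: bounded_triples_def)
  have "levy_gen p (\<lambda>x. V (t, x)) x \<le> (SUP p\<in>U. levy_gen p (\<lambda>x. V (t, x)) x)"
    by (rule cSUP_upper[OF p levy_gen_bdd_above[OF U sV]])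
  moreover have "levy_gen p (\<lambda>x. V (t, x)) x = levy_gen p (\<lambda>x. \<Psi> (t, x)) x + (-1) * levy_gen p q x"
    using levy_gen_lincomb[OF pM sW 1(5), of "-1" x] by (simp add: V_def)
  moreover have "levy_gen p q x \<le> g * \<epsilon>'"
    using levy_gen_bound[OF pM 1(5), of x] by (simp add: g_def gen_const_def)
  ultimately have gg: "st_gen p \<Psi> (t, x) \<le> \<epsilon> - e"
    using L ee eps'(2) ptV by (simp add: st_gen_def)
  have "0 \<le> A * (1 - exp (- b * t))" using 1 by simp
  then have "c < \<Psi> (t, x) - w t x" using cc 1(6)[of x] by (simp add: F_def)
  then show ?thesis using that[OF 1(1) _ gg] by blast
qed

section \<open>The space-time generator\<close>

lemma smooth_bd_slice:
  fixes F :: "real \<times> 'a::euclidean_space \<Rightarrow> real"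
  assumes "smooth_bd k K F"
  shows "smooth_bd k K (\<lambda>x. F (t, x))"
proof -
  have D: "\<And>z. F differentiable (at z)" using assms unfolding smooth_bd_def by blast
  show ?thesis unfolding smooth_bd_def pd_slice[OF D]
  proof (intro conjI allI ballI)
    show "(\<lambda>x. F (t, x)) differentiable (at x)" for x
      using slice_has_derivative[OF D] unfolding differentiable_def by blast
    fix b :: 'a assume "b \<in> Basis"
    then have "(0 :: real, b) \<in> Basis" by (simp add: Basis_prod_def)
    then have "Sm k K (pd (0, b) F)" using assms by (simp add: smooth_bd_def)
    then show "Sm k K (\<lambda>x. pd (0, b) F (t, x))" by (rule Sm_slice)
  qed
qed

lemma st_gen_bound:
  fixes F :: "real \<times> (real^'d::finite) \<Rightarrow> real"
  assumes p: "triple_bound M p" and F: "smooth_bd (Suc 0) K F"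
  shows "\<bar>st_gen p F z\<bar> \<le> (gen_const M TYPE('d) + 1) * K"
proof -
  have b: "(1 :: real, 0 :: real^'d) \<in> Basis" by (simp add: Basis_prod_def)
  have "Sm (Suc 0) K (pd (1, 0) F)" using F b by (simp add: smooth_bd_def)
  then have "\<bar>pd (1, 0) F z\<bar> \<le> K" by (rule Sm_bound)
  moreover have "\<bar>levy_gen p (\<lambda>x. F (fst z, x)) (snd z)\<bar> \<le> gen_const M TYPE('d) * K"
    using levy_gen_bound[OF p smooth_bd_slice[OF F]] by (simp add: gen_const_def)
  moreover have "\<bar>st_gen p F z\<bar> \<le> \<bar>levy_gen p (\<lambda>x. F (fst z, x)) (snd z)\<bar> + \<bar>pd (1, 0) F z\<bar>"
    unfolding st_gen_def by (rule abs_triangle_ineq4)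
  ultimately show ?thesis by (simp add: algebra_simps)
qed

lemma st_gen_translate:
  fixes F :: "real \<times> (real^'d::finite) \<Rightarrow> real"
  assumes F: "Sm (Suc (Suc k)) K F"
  shows "st_gen p (\<lambda>z. F (z + a) + b) z = st_gen p F (z + a)"
proof -
  obtain v q Q where pq: "p = (v, q, Q)" by (cases p)
  define G where "G = (\<lambda>z. F (z + a) + b)"
  have SG: "Sm (Suc (Suc k)) (K + \<bar>b\<bar>) G" unfolding G_def
    by (rule Sm_add[OF Sm_translate[OF F]]) simp
  have D: "F differentiable (at z)" for z using Sm_differentiable[OF F] .
  have D2: "pd e F differentiable (at z)" for e z using Sm_differentiable[OF Sm_pd[OF F]] .
  have tr: "pd e (\<lambda>z. f (z + a)) = (\<lambda>z. pd e f (z + a))" "(\<lambda>z. f (z + a)) differentiable (at z)"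
    if "\<And>z. f differentiable (at z)" for f :: "real \<times> (real^'d) \<Rightarrow> real" and e z
    using pd_affine(1)[OF that, where b = e and e = 1 and c = a] pd_affine(2)[OF that, where e = 1 and c = a] by simp_all
  have 1: "pd e G = (\<lambda>z. pd e F (z + a))" for e
  proof
    fix y
    show "pd e G y = pd e F (y + a)"
      unfolding G_def pd_add[OF tr(2)[OF D] differentiable_const] by (simp only: tr(1)[OF D] pd_const add_0_right)
  qed
  have 2: "pd e (pd e G) z = pd e (pd e F) (z + a)" for e
    unfolding 1 tr(1)[OF D2] ..
  have s: "z + (0, \<zeta>) + a = z + a + (0, \<zeta>)" for \<zeta> by (simp add: add_ac)
  show ?thesis
    unfolding G_def[symmetric] pq st_gen_eq[OF F] st_gen_eq[OF SG] 2 1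
    by (simp add: G_def s tr(1)[OF D2])
qed

text \<open>Dominated convergence; the Lipschitz bound dominates the jump integrand.\<close>

lemma st_gen_continuous:
  fixes F :: "real \<times> (real^'d::finite) \<Rightarrow> real"
  assumes p: "triple_bound M p" and F: "Sm (Suc (Suc (Suc 0))) K F"
  shows "isCont (st_gen p F) z"
proof -
  obtain v q Q where pq: "p = (v, q, Q)" by (cases p)
  have v: "triple_bound M (v, q, Q)" using p pq by simp
  have ic: "isCont f y" if "continuous_on UNIV f" for f :: "real \<times> (real^'d) \<Rightarrow> real" and y
    using that continuous_on_eq_continuous_at[OF open_UNIV, of f] by blast
  have c0: "isCont F z" and c1: "isCont (pd e F) z" and c2: "isCont (pd e (pd e F)) z" for e z
    by (rule ic[OF Sm_continuous[OF F]], rule ic[OF Sm_continuous[OF Sm_pd[OF F]]],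
        rule ic[OF Sm_continuous[OF Sm_pd[OF Sm_pd[OF F]]]])
  have F1: "smooth_bd 0 K F" by (rule smooth_bd_lower[OF smooth_bd_lower[OF Sm_smooth_bd[OF F]]])
  have K: "0 \<le> K" using Sm_nonneg[OF F] .
  have meas: "(\<lambda>\<zeta>. F (y + (0, \<zeta>)) - F y) \<in> borel_measurable v" for y
    using borel_measurable_integrable[OF levy_increment_integrable(1)[OF v smooth_bd_slice[OF F1], where x = "snd y" and t1 = "fst y"]]
    by (cases y) simp
  have "isCont (\<lambda>y. \<integral>\<zeta>. (F (y + (0, \<zeta>)) - F y) \<partial>v) z"
    unfolding continuous_at_sequentially o_def
  proof (intro allI impI)
    fix y assume y: "y \<longlonglongrightarrow> z"
    show "(\<lambda>n. \<integral>\<zeta>. (F (y n + (0, \<zeta>)) - F (y n)) \<partial>v) \<longlonglongrightarrow> (\<integral>\<zeta>. (F (z + (0, \<zeta>)) - F z) \<partial>v)"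
    proof (rule integral_dominated_convergence[where w = "\<lambda>\<zeta>. (real (CARD('d) + 1) * K) * norm \<zeta>"])
      show "integrable v (\<lambda>\<zeta>. (real (CARD('d) + 1) * K) * norm \<zeta>)" using v by (simp add: triple_bound_def)
      show "AE \<zeta> in v. (\<lambda>n. F (y n + (0, \<zeta>)) - F (y n)) \<longlonglongrightarrow> F (z + (0, \<zeta>)) - F z"
        by (intro AE_I2 tendsto_diff isCont_tendsto_compose[OF c0] tendsto_add tendsto_const y)
      have le: "\<bar>F (u + (0, \<zeta>)) - F u\<bar> \<le> (real (CARD('d) + 1) * K) * norm \<zeta>" for u \<zeta>
      proof -
        have "\<bar>F (u + (0, \<zeta>)) - F u\<bar> \<le> norm_l1 (0 :: real, \<zeta>) * K" by (rule smooth_bd_Lipschitz[OF F1])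
        also have "\<dots> \<le> (real (CARD('d) + 1) * norm \<zeta>) * K"
          using norm_l1_le[of "(0 :: real, \<zeta>)"] by (intro mult_right_mono K) (simp add: norm_Pair algebra_simps)
        finally show ?thesis by (simp add: mult_ac)
      qed
      show "AE \<zeta> in v. norm (F (y n + (0, \<zeta>)) - F (y n)) \<le> (real (CARD('d) + 1) * K) * norm \<zeta>" for n
        using le by simp
    qed (use meas in auto)
  qed
  then have "isCont (\<lambda>z. (\<integral>\<zeta>. (F (z + (0, \<zeta>)) - F z) \<partial>v) + pd (0, q) F z - pd (1, 0) F z
    + 1 / 2 * (\<Sum>k\<in>UNIV. pd (0, column k Q) (pd (0, column k Q) F) z)) z"
    by (intro continuous_intros c0 c1 c2)
  then show ?thesis unfolding pq using st_gen_eq[OF F] by presburger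
qed

text \<open>In contrast to \<open>space_penalty\<close>, the radius is prescribed and the derivative bound is not.\<close>

lemma local_penalty:
  fixes z0 :: "'a::euclidean_space"
  assumes A: "0 \<le> A" and r: "0 < r"
  obtains K q where "Sm 3 K q" "\<And>y. 0 \<le> q y" "q z0 = 0" "\<And>y. r \<le> dist z0 y \<Longrightarrow> q y = A"
proof -
  obtain K where K: "Sm 5 K (bump :: 'a \<Rightarrow> real)" using bump_smooth by blast
  define b where "b = (\<lambda>y::'a. bump ((1 / r) *\<^sub>R y + - ((1 / r) *\<^sub>R z0)))"
  define q where "q = (\<lambda>y. A + (- A) * b y)"
  have b3: "Sm 3 (max 1 (1 / r) ^ 3 * K) b" unfolding b_def
    by (rule Sm_affine[OF Sm_lower[OF K]]) (use r in auto)
  have be: "b y = bump ((1 / r) *\<^sub>R (y - z0))" for y by (simp add: b_def scaleR_diff_right)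
  have "Sm 3 (A + \<bar>- A\<bar> * (max 1 (1 / r) ^ 3 * K)) q" unfolding q_def
    by (rule Sm_add[OF _ Sm_cmult[OF b3]]) (use A in simp)
  moreover have "0 \<le> q y" for y
    using mult_left_mono[OF bump_range(2) A, of "(1 / r) *\<^sub>R (y - z0)"] by (simp add: q_def be)
  moreover have "q z0 = 0" by (simp add: q_def be)
  moreover have "q y = A" if "r \<le> dist z0 y" for y
  proof -
    have "1 \<le> norm ((1 / r) *\<^sub>R (y - z0))" using that r by (simp add: dist_norm norm_minus_commute)
    from bump_outside[OF this] show ?thesis by (simp only: q_def be mult_zero_right add_0_right)
  qed
  ultimately show ?thesis using that by blast
qed

section \<open>Lipschitz approximation from below\<close>

text \<open>The largest \<open>k\<close>-Lipschitz minorant of \<open>g\<close>, also called its Pasch-Hausdorff envelope.\<close>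

definition inf_conv :: "real \<Rightarrow> ('a::metric_space \<Rightarrow> real) \<Rightarrow> 'a \<Rightarrow> real" where
  "inf_conv k g z = (INF y. g y + k * dist z y)"

lemma inf_conv_facts:
  assumes g: "\<forall>y. \<bar>g y\<bar> \<le> M" and k: "0 \<le> k"
  shows "inf_conv k g z \<le> g z" "- M \<le> inf_conv k g z" "inf_conv k g x \<le> inf_conv k g y + k * dist x y"
proof -
  have lb: "- M \<le> g y + k * dist z y" for z y
    using g[rule_format, of y] mult_nonneg_nonneg[OF k zero_le_dist[of z y]] by linarith
  have bdd: "bdd_below (range (\<lambda>y. g y + k * dist z y))" for z
    by (rule bdd_belowI[of _ "- M"]) (use lb in auto)
  show "inf_conv k g z \<le> g z" unfolding inf_conv_def
    using cINF_lower[OF bdd, of z z] by simp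
  show "- M \<le> inf_conv k g z" unfolding inf_conv_def by (rule cINF_greatest) (use lb in auto)
  have "inf_conv k g x - k * dist x y \<le> g u + k * dist y u" for u
  proof -
    have "inf_conv k g x \<le> g u + k * dist x u" unfolding inf_conv_def by (rule cINF_lower[OF bdd]) simp
    also have "\<dots> \<le> g u + k * (dist x y + dist y u)"
      using k dist_triangle[of x u y] by (intro add_left_mono mult_left_mono) auto
    finally show ?thesis by (simp add: algebra_simps)
  qed
  then have "inf_conv k g x - k * dist x y \<le> inf_conv k g y"
    unfolding inf_conv_def[of k g y] by (intro cINF_greatest) auto
  then show "inf_conv k g x \<le> inf_conv k g y + k * dist x y" by simp
qed

lemma inf_conv_bounded_borel:
  fixes g :: "'a::euclidean_space \<Rightarrow> real"
  assumes g: "\<forall>y. \<bar>g y\<bar> \<le> M" and k: "0 \<le> k"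
  shows "bounded_borel M (inf_conv k g)"
proof -
  have "k-lipschitz_on UNIV (inf_conv k g)"
  proof (rule lipschitz_onI[OF _ k])
    fix x y
    show "dist (inf_conv k g x) (inf_conv k g y) \<le> k * dist x y"
      using inf_conv_facts(3)[OF g k, of x y] inf_conv_facts(3)[OF g k, of y x]
      by (simp add: dist_real_def dist_commute abs_le_iff algebra_simps)
  qed
  then have "continuous_on UNIV (inf_conv k g)" by (rule lipschitz_on_continuous_on)
  then have "inf_conv k g \<in> borel_measurable borel" by (rule borel_measurable_continuous_onI)
  moreover have "\<bar>inf_conv k g z\<bar> \<le> M" for z
    using inf_conv_facts(1,2)[OF g k, of z] g[rule_format, of z] by linarith
  ultimately show ?thesis by (simp add: bounded_borel_def)
qed

lemma inf_conv_tendsto: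
  assumes g: "\<forall>y. \<bar>g y\<bar> \<le> M" and lsc: "\<And>c. c < g z \<Longrightarrow> \<forall>\<^sub>F y in at z. c < g y"
  shows "(\<lambda>n. inf_conv (real n) g z) \<longlonglongrightarrow> g z"
proof (rule order_tendstoI)
  fix c assume c: "c < g z"
  define c' where "c' = (c + g z) / 2"
  have c': "c < c'" "c' < g z" using c by (auto simp: c'_def)
  obtain r where r: "0 < r" "\<And>y. y \<noteq> z \<Longrightarrow> dist y z < r \<Longrightarrow> c' < g y"
    using lsc[OF c'(2)] by (auto simp: eventually_at)
  have "\<forall>\<^sub>F n in sequentially. (c' + M) / r \<le> real n" by (rule eventually_ge_at_top[THEN filterlim_real_sequentially[unfolded filterlim_iff, rule_format]])
  then show "\<forall>\<^sub>F n in sequentially. c < inf_conv (real n) g z"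
  proof eventually_elim
    case (elim n)
    have "c' \<le> g y + real n * dist z y" for y
    proof (cases "dist y z < r")
      case True
      then have "c' \<le> g y" using r(2)[of y] c'(2) by (cases "y = z") auto
      then show ?thesis by (simp add: add_increasing2)
    next
      case False
      then have "real n * r \<le> real n * dist z y" by (intro mult_left_mono) (auto simp: dist_commute)
      then show ?thesis using elim r(1) g[rule_format, of y] by (simp add: pos_divide_le_eq)
    qed
    then have "c' \<le> inf_conv (real n) g z" unfolding inf_conv_def by (intro cINF_greatest) auto
    then show ?case using c'(1) by simp
  qed
next
  fix c assume "g z < c"
  then show "\<forall>\<^sub>F n in sequentially. inf_conv (real n) g z < c"
    using inf_conv_facts(1)[OF g, of "real _" z] by (intro always_eventually) (meson le_less_trans of_nat_0_le_iff)
qed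

text \<open>Mollification turns pointwise bounded convergence into locally uniform convergence: the mollified
  functions have a common Lipschitz constant, so a sequence of counterexamples would accumulate at
  a point where pointwise convergence fails.\<close>

lemma conv_locally_uniform:
  fixes \<eta> :: "'a::euclidean_space \<Rightarrow> real"
  assumes m: "mollifier r \<eta>" and G: "\<And>n. bounded_borel M (G n)" and g: "bounded_borel M g"
    and lim: "\<And>y. (\<lambda>n. G n y) \<longlonglongrightarrow> g y" and d: "0 < d"
  obtains n where "\<And>z. dist z0 z \<le> R \<Longrightarrow> conv \<eta> g z - d \<le> conv \<eta> (G n) z"
proof (rule ccontr)
  assume "\<not> thesis"
  then have "\<forall>n. \<exists>z. dist z0 z \<le> R \<and> conv \<eta> (G n) z < conv \<eta> g z - d" using that by (meson not_le)
  then obtain z where z: "\<And>n. z n \<in> cball z0 R" "\<And>n. conv \<eta> (G n) (z n) < conv \<eta> g (z n) - d" by (metis mem_cball)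
  obtain C where C: "0 \<le> C" "\<And>g M. bounded_borel M g \<Longrightarrow> Sm 4 (C * M) (conv \<eta> g)"
    by (rule conv_mollifier_Sm[OF m], rule that)
  obtain l s where l: "strict_mono (s :: nat \<Rightarrow> nat)" "(z \<circ> s) \<longlonglongrightarrow> l"
    using compact_cball[of z0 R] z(1) unfolding compact_def by metis
  define L where "L = real DIM('a) * (C * M)"
  have L: "0 \<le> L" using C(1) bounded_borelD(3)[OF g] by (simp add: L_def)
  have Lip: "\<bar>conv \<eta> h y - conv \<eta> h x\<bar> \<le> L * norm (y - x)" if "bounded_borel M h" for h x y
  proof -
    have "Sm (Suc 3) (C * M) (conv \<eta> h)" using C(2)[OF that] by (simp add: eval_nat_numeral)
    from Sm_Lipschitz[OF this, of x "y - x"] 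
    have "\<bar>conv \<eta> h y - conv \<eta> h x\<bar> \<le> norm_l1 (y - x) * (C * M)" by simp
    also have "\<dots> \<le> (real DIM('a) * norm (y - x)) * (C * M)"
      using C(1) bounded_borelD(3)[OF g] by (intro mult_right_mono norm_l1_le) auto
    finally show ?thesis by (simp add: L_def mult_ac)
  qed
  have "(\<lambda>n. norm (z (s n) - l)) \<longlonglongrightarrow> 0" using l(2) by (simp add: o_def tendsto_norm_zero_iff LIM_zero_iff)
  then have 1: "(\<lambda>n. 2 * (L * norm (z (s n) - l))) \<longlonglongrightarrow> 2 * (L * 0)" by (intro tendsto_intros)
  have 2: "(\<lambda>n. conv \<eta> (G (s n)) l) \<longlonglongrightarrow> conv \<eta> g l"
    using LIMSEQ_subseq_LIMSEQ[OF conv_tendsto[where G = G, OF m G g lim] l(1)] by (simp add: o_def)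
  have "(\<lambda>n. conv \<eta> (G (s n)) l - conv \<eta> g l - 2 * (L * norm (z (s n) - l))) \<longlonglongrightarrow> conv \<eta> g l - conv \<eta> g l - 2 * (L * 0)"
    by (intro tendsto_diff 1 2 tendsto_const)
  then have "\<forall>\<^sub>F n in sequentially. - d < conv \<eta> (G (s n)) l - conv \<eta> g l - 2 * (L * norm (z (s n) - l))"
    using d by (intro order_tendstoD(1)) auto
  then obtain n where n: "- d < conv \<eta> (G (s n)) l - conv \<eta> g l - 2 * (L * norm (z (s n) - l))"
    by (auto simp: eventually_sequentially)
  show False using n z(2)[of "s n"] Lip[OF G, of "s n" "z (s n)" l] Lip[OF g, of "z (s n)" l] by linarith
qed

section \<open>Mollified supersolutions\<close>

text \<open>Mollification in time needs values at negative times.  The lower bound \<open>- B\<close> is the right choice: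
  it keeps the extension lower semicontinuous, and a resolvent below \<open>- B\<close> in the past cannot violate
  the comparison there.\<close>

definition past_ext :: "real \<Rightarrow> (real \<Rightarrow> 'a \<Rightarrow> real) \<Rightarrow> real \<times> 'a \<Rightarrow> real" where
  "past_ext B w z = (if 0 < fst z then w (fst z) (snd z) else - B)"

lemma past_ext_lsc:
  fixes w :: "real \<Rightarrow> 'a::euclidean_space \<Rightarrow> real"
  assumes cont: "continuous_on ({0..} \<times> UNIV) (\<lambda>(t, x). w t x)" and B: "\<And>t x. 0 \<le> t \<Longrightarrow> \<bar>w t x\<bar> \<le> B"
    and c: "c < past_ext B w z"
  shows "\<forall>\<^sub>F y in at z. c < past_ext B w y"
proof (cases "0 < fst z")
  case True
  have o: "open ({0<..} \<times> UNIV :: (real \<times> 'a) set)" by (intro open_Times) auto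
  have "continuous_on ({0<..} \<times> UNIV) (\<lambda>(t, x). w t x)" by (rule continuous_on_subset[OF cont]) auto
  then have "isCont (\<lambda>(t, x). w t x) z" using continuous_on_eq_continuous_at[OF o] True by (cases z) auto
  then have "\<forall>\<^sub>F y in at z. c < (\<lambda>(t, x). w t x) y"
    using c True by (intro order_tendstoD(1)[of _ "(\<lambda>(t, x). w t x) z"]) (auto simp: isCont_def past_ext_def case_prod_unfold)
  moreover have "\<forall>\<^sub>F y in at z. y \<in> {0<..} \<times> UNIV"
    by (rule eventually_at_in_open'[OF o]) (use True in \<open>cases z; simp\<close>)
  ultimately show ?thesis by eventually_elim (auto simp: past_ext_def)
next
  case False
  then have "c < - B" using c by (simp add: past_ext_def)
  have "c < past_ext B w y" for y
    using B[of "fst y" "snd y"] \<open>c < - B\<close> by (auto simp: past_ext_def)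
  then show ?thesis by simp
qed

lemma past_ext_bounded_borel:
  fixes w :: "real \<Rightarrow> 'a::euclidean_space \<Rightarrow> real"
  assumes cont: "continuous_on ({0..} \<times> UNIV) (\<lambda>(t, x). w t x)" and B: "\<And>t x. 0 \<le> t \<Longrightarrow> \<bar>w t x\<bar> \<le> B"
  shows "bounded_borel B (past_ext B w)"
proof -
  have o: "open ({0<..} \<times> UNIV :: (real \<times> 'a) set)" by (intro open_Times) auto
  have "(\<lambda>z. if z \<in> {0<..} \<times> UNIV then (\<lambda>(t, x). w t x) z else - B) \<in> borel_measurable borel"
    by (rule borel_measurable_continuous_on_if)
       (use o in \<open>auto intro: continuous_on_subset[OF cont]\<close>)
  moreover have "(\<lambda>z. if z \<in> {0<..} \<times> UNIV then (\<lambda>(t, x). w t x) z else - B) = past_ext B w"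
    by (auto simp: past_ext_def fun_eq_iff)
  moreover have "\<bar>past_ext B w z\<bar> \<le> B" for z
    using B[of "fst z" "snd z"] B[of 0 undefined] by (auto simp: past_ext_def)
  ultimately show ?thesis by (simp add: bounded_borel_def)
qed

text \<open>For nonpositive times \<open>f\<close> is at most \<open>- B\<close>, and by causality so is \<open>P\<close>.  If \<open>P\<close> exceeded \<open>w\<close> by more than
  \<open>e * K / l\<close> at a positive time, then at a penalized maximum the generator of \<open>P\<close> would be almost
  nonpositive and the resolvent equation would give \<open>l * (P - w) \<le> e * K\<close> up to an arbitrarily
  small error.\<close>

lemma resolvent_le_supersolution:
  fixes P :: "real \<times> (real^'d::finite) \<Rightarrow> real"
  assumes U: "bounded_triples M U" and M: "0 \<le> M" and w: "viscosity_supersolution U \<phi> w" and p: "p \<in> U"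
    and B: "\<And>t x. 0 \<le> t \<Longrightarrow> \<bar>w t x\<bar> \<le> B"
    and T: "jump_op c T" and approx: "\<And>F K z. Sm 3 K F \<Longrightarrow> \<bar>T F z - c * F z - st_gen p F z\<bar> \<le> e * K"
    and l: "0 < l" and e: "0 \<le> e" and f: "\<And>z. f z \<le> past_ext B w z"
    and P: "Sm 3 K P" and eq: "\<And>z. (l + c) * P z = l * f z + T P z"
  shows "P z \<le> past_ext B w z + e * K / l"
proof -
  have K: "0 \<le> K" using Sm_nonneg[OF P] .
  have eK: "0 \<le> e * K / l" using e K l by simp
  have neg: "P (t, x) \<le> - B" if "t \<le> 0" for t x
  proof (rule resolvent_half_bound[OF T l Sm_bounded_borel[OF P] _ that])
    fix t x assume "t \<le> (0 :: real)"
    then have "f (t, x) \<le> - B" using f[of "(t, x)"] by (simp add: past_ext_def)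
    then have "l * f (t, x) \<le> l * - B" using l by (intro mult_left_mono) auto
    then show "(l + c) * P (t, x) \<le> l * - B + T P (t, x)" unfolding eq by simp
  qed
  show ?thesis
  proof (cases "0 < fst z")
    case False
    then show ?thesis using neg[of "fst z" "snd z"] eK by (simp add: past_ext_def)
  next
    case True
    show ?thesis
    proof (rule ccontr)
      assume contra: "\<not> P z \<le> past_ext B w z + e * K / l"
      define h where "h = (P z - past_ext B w z - e * K / l) / 2"
      have h: "0 < h" "e * K / l + h + 2 * 0 * fst z < P (fst z, snd z) - w (fst z) (snd z)"
      proof -
        have "2 * h = P z - w (fst z) (snd z) - e * K / l" using True by (simp add: h_def past_ext_def)
        moreover show "0 < h" using contra by (simp add: h_def)
        ultimately show "e * K / l + h + 2 * 0 * fst z < P (fst z, snd z) - w (fst z) (snd z)" by simp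
      qed
      have init: "P (0, x) \<le> w 0 x" for x using neg[of 0 x] B[of 0 x] by (simp add: abs_le_iff)
      obtain t x where tx: "0 < t" "e * K / l + h < P (t, x) - w t x" "st_gen p P (t, x) \<le> l * h / 2 - 0"
        by (rule supersolution_penalized[OF U M w p P init True _ order_refl h(2), of "l * h / 2"]) (use eK h l in auto)
      have "l * P (t, x) = l * f (t, x) + (T P (t, x) - c * P (t, x))" using eq[of "(t, x)"] by (simp add: algebra_simps)
      also have "\<dots> \<le> l * w t x + (l * h / 2 + e * K)"
        using approx[OF P, of "(t, x)"] tx(3) mult_left_mono[OF f[of "(t, x)"] less_imp_le[OF l]] tx(1)
        by (simp add: past_ext_def abs_le_iff)
      finally have 1: "l * (P (t, x) - w t x) \<le> l * h / 2 + e * K" by (simp add: algebra_simps)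
      have "l * (e * K / l + h) < l * (P (t, x) - w t x)" using tx(2) l by simp
      moreover have "l * (e * K / l + h) = e * K + l * h" using l by (simp add: algebra_simps)
      moreover have "0 < l * h" using l h by simp
      ultimately show False using 1 by simp
    qed
  qed
qed

text \<open>The heart of the uniqueness proof.  Let \<open>u\<close> be the extended supersolution, \<open>W\<close> its mollification, and
  suppose that the generator of \<open>W\<close> at \<open>z0\<close> is \<open>2 * \<alpha> > 0\<close>.  Two penalties localize the
  contradiction: \<open>q1\<close> compensates the loss of positivity of the generator away from \<open>z0\<close>, and \<open>q2\<close>,
  with tiny derivatives, handles infinity, where the approximation of \<open>u\<close> by Lipschitz functions is not
  uniform.  The barrier \<open>W + (\<alpha> / (2 * l) - d) - q1 / l - q2\<close> satisfies
  the resolvent inequality with right hand side \<open>l * (W - d - q2)\<close>, hence lies below the mollified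
  resolvent \<open>Pb\<close>, which in turn is at most \<open>W\<close> plus an error.  At \<open>z0\<close> both
  penalties vanish, so \<open>\<alpha> / (2 * l) - d\<close> is at most that error.  The constants are chosen in the
  order \<open>q1\<close>, \<open>q2\<close>, \<open>l\<close>, \<open>d\<close>, the approximation \<open>f\<close>, and finally the accuracy \<open>e\<close> of the jump operator.\<close>

theorem mollified_supersolution:
  fixes w :: "real \<Rightarrow> real^'d::finite \<Rightarrow> real"
  assumes U: "bounded_triples M U" and M: "0 \<le> M" and w: "viscosity_supersolution U \<phi> w" and p: "p \<in> U"
    and cont: "continuous_on ({0..} \<times> UNIV) (\<lambda>(t, x). w t x)" and B: "\<And>t x. 0 \<le> t \<Longrightarrow> \<bar>w t x\<bar> \<le> B"
    and m: "mollifier r \<eta>"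
  shows "st_gen p (conv \<eta> (past_ext B w)) z0 \<le> 0"
proof (rule ccontr)
  define u where "u = past_ext B w"
  define W where "W = conv \<eta> u"
  define \<alpha> where "\<alpha> = st_gen p W z0 / 2"
  assume "\<not> st_gen p (conv \<eta> (past_ext B w)) z0 \<le> 0"
  then have \<alpha>: "0 < \<alpha>" by (simp add: \<alpha>_def W_def u_def)
  have pM: "triple_bound M p" using U p by (simp add: bounded_triples_def)
  have B0: "0 \<le> B" using B[of 0 undefined] by simp
  have bu: "bounded_borel B u" unfolding u_def by (rule past_ext_bounded_borel[OF cont B])
  have ub: "\<forall>y. \<bar>u y\<bar> \<le> B" using bounded_borelD(2)[OF bu] by blast
  obtain C where C: "0 \<le> C" "\<And>g M. bounded_borel M g \<Longrightarrow> Sm 4 (C * M) (conv \<eta> g)"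
    by (rule conv_mollifier_Sm[OF m], rule that)
  define KW where "KW = C * B"
  have W: "Sm 3 KW W" unfolding W_def KW_def by (rule Sm_lower[OF C(2)[OF bu]]) simp
  have W3: "Sm (Suc (Suc (Suc 0))) KW W" using W by (simp add: numeral_3_eq_3)
  have bW: "bounded_borel B W" unfolding W_def by (rule conv_bounded_borel[OF m bu])
  define g where "g = gen_const M TYPE('d) + 1"
  have g: "0 < g" using M by (simp add: g_def gen_const_def add_nonneg_pos)
  have KW0: "0 \<le> KW" using C B0 by (simp add: KW_def)
  \<comment> \<open>The height \<open>A1\<close> of the first penalty dominates the worst value of the generator outside the ball.\<close>
  have "\<forall>\<^sub>F z in at z0. \<alpha> < st_gen p W z"
    using st_gen_continuous[OF pM W3, of z0] \<alpha> by (intro order_tendstoD(1)[of _ "st_gen p W z0"]) (auto simp: isCont_def \<alpha>_def)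
  then obtain \<rho> where \<rho>: "0 < \<rho>" "\<And>z. z \<noteq> z0 \<Longrightarrow> dist z z0 < \<rho> \<Longrightarrow> \<alpha> < st_gen p W z" by (auto simp: eventually_at)
  have \<rho>': "\<alpha> \<le> st_gen p W z" if "dist z z0 < \<rho>" for z
    using \<rho>(2)[of z] that \<alpha> by (cases "z = z0") (auto simp: \<alpha>_def)
  define A1 where "A1 = g * KW + \<alpha>"
  have A1: "0 \<le> A1" using g KW0 \<alpha> by (simp add: A1_def)
  obtain K1 q1 where q1: "Sm 3 K1 q1" "\<And>y. 0 \<le> q1 y" "q1 z0 = 0" "\<And>y. \<rho> \<le> dist z0 y \<Longrightarrow> q1 y = A1"
    by (rule local_penalty[OF A1 \<rho>(1), where ?z0.0 = z0], rule that)
  have gW: "\<alpha> - q1 z \<le> st_gen p W z" for z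
  proof (cases "dist z z0 < \<rho>")
    case True
    then show ?thesis using \<rho>'[OF True] q1(2)[of z] by linarith
  next
    case False
    then have "q1 z = A1" using q1(4)[of z] by (simp add: dist_commute)
    moreover have "smooth_bd (Suc 0) KW W" by (rule smooth_bd_lower[OF Sm_smooth_bd[OF W3]])
    ultimately show ?thesis using st_gen_bound[OF pM, of KW W z] by (simp add: A1_def g_def abs_le_iff)
  qed
  \<comment> \<open>With height \<open>2 * B + 1\<close> the second penalty brings \<open>W - d - q2\<close> below \<open>- B - d\<close> far away.\<close>
  define A2 where "A2 = 2 * B + 1"
  have A2: "0 \<le> A2" using B0 by (simp add: A2_def)
  define \<epsilon>2 where "\<epsilon>2 = \<alpha> / (8 * g)"
  have \<epsilon>2: "0 < \<epsilon>2" using \<alpha> g by (simp add: \<epsilon>2_def)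
  obtain K2 q2 R where q2: "Sm 3 K2 q2" "smooth_bd (Suc 0) \<epsilon>2 q2" "\<And>y. 0 \<le> q2 y" "q2 z0 = 0"
    "\<And>y. R \<le> dist z0 y \<Longrightarrow> q2 y = A2"
    by (rule space_penalty[OF A2 \<epsilon>2, where ?x0.0 = z0], rule that)
  have gq2: "st_gen p q2 z \<le> \<alpha> / 8" for z
    using st_gen_bound[OF pM q2(2), of z] g by (simp add: \<epsilon>2_def g_def[symmetric] abs_le_iff)
  have K12: "0 \<le> K1" "0 \<le> K2" using Sm_nonneg[OF q1(1)] Sm_nonneg[OF q2(1)] by auto
  have gq1: "st_gen p q1 z \<le> g * K1" for z
  proof -
    have "Sm (Suc (Suc (Suc 0))) K1 q1" using q1(1) by (simp add: numeral_3_eq_3)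
    then have "smooth_bd (Suc 0) K1 q1" by (rule smooth_bd_lower[OF Sm_smooth_bd])
    then show ?thesis using st_gen_bound[OF pM, of K1 q1 z] by (simp add: g_def abs_le_iff)
  qed
  \<comment> \<open>A large \<open>l\<close> makes the contribution of \<open>q1 / l\<close> to the generator small, whatever the size of \<open>K1\<close>.\<close>
  define l where "l = max 1 (16 * (g * K1) / \<alpha>)"
  have l: "1 \<le> l" "g * K1 / l \<le> \<alpha> / 16"
  proof -
    show "1 \<le> l" by (simp add: l_def)
    have "16 * (g * K1) / \<alpha> \<le> l" by (simp add: l_def)
    then have "16 * (g * K1) \<le> l * \<alpha>" using \<alpha> by (simp add: pos_divide_le_eq)
    then show "g * K1 / l \<le> \<alpha> / 16" using \<open>1 \<le> l\<close> by (simp add: pos_divide_le_eq mult.commute)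
  qed
  define d where "d = min 1 (\<alpha> / (8 * l))"
  have d: "0 < d" "d \<le> 1" "l * d \<le> \<alpha> / 8"
  proof -
    show "0 < d" "d \<le> 1" using \<alpha> l by (auto simp: d_def)
    have "l * d \<le> l * (\<alpha> / (8 * l))" using l by (intro mult_left_mono) (auto simp: d_def)
    also have "\<dots> = \<alpha> / 8" using l by simp
    finally show "l * d \<le> \<alpha> / 8" .
  qed
  have bG: "bounded_borel B (inf_conv (real n) u)" for n by (rule inf_conv_bounded_borel[OF ub]) simp
  have lim: "(\<lambda>n. inf_conv (real n) u y) \<longlonglongrightarrow> u y" for y
    by (rule inf_conv_tendsto[OF ub]) (unfold u_def, rule past_ext_lsc[OF cont B])
  obtain n where n0: "\<And>z. dist z0 z \<le> R \<Longrightarrow> conv \<eta> u z - d / 2 \<le> conv \<eta> (inf_conv (real n) u) z"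
  proof -
    have "0 < d / 2" using d by simp
    from conv_locally_uniform[where G = "\<lambda>n. inf_conv (real n) u" and ?z0.0 = z0 and R = R, OF m bG bu lim this]
    show ?thesis using that by blast
  qed
  have n: "\<And>z. dist z0 z \<le> R \<Longrightarrow> W z - d / 2 \<le> conv \<eta> (inf_conv (real n) u) z" using n0 by (simp add: W_def)
  define G where "G = inf_conv (real n) u"
  \<comment> \<open>At this scale mollification changes an \<open>n\<close>-Lipschitz function by at most \<open>d / 4\<close>.\<close>
  define s where "s = d / (4 * (real n + 1))"
  have s: "0 < s" "real n * s \<le> d / 4"
  proof -
    show "0 < s" using d by (simp add: s_def)
    have "real n * s \<le> (real n + 1) * s" using \<open>0 < s\<close> by (simp add: algebra_simps)
    also have "\<dots> = d / 4"
    proof -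
      have "x * (d / (4 * x)) = d / 4" if "x \<noteq> 0" for x :: real using that by simp
      from this[of "real n + 1"] show ?thesis unfolding s_def by simp
    qed
    finally show "real n * s \<le> d / 4" .
  qed
  obtain \<eta>' :: "real \<times> (real^'d) \<Rightarrow> real" where m': "mollifier s \<eta>'" using mollifier_exists[OF s(1)] by blast
  obtain C' where C': "0 \<le> C'" "\<And>g M. bounded_borel M g \<Longrightarrow> Sm 4 (C' * M) (conv \<eta>' g)"
    by (rule conv_mollifier_Sm[OF m'], rule that)
  define k where "k = real n * s"
  have k: "0 \<le> k" "k \<le> d / 4" using s by (auto simp: k_def)
  have bG': "bounded_borel B G" unfolding G_def by (rule bG)
  have GL: "\<bar>conv \<eta>' G z - G z\<bar> \<le> k" for z
  proof -
    have "G y \<le> G z + k" "G z - k \<le> G y" if "dist z y \<le> s" for y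
      using inf_conv_facts(3)[OF ub, of "real n" z y] inf_conv_facts(3)[OF ub, of "real n" y z] mult_left_mono[OF that, of "real n"]
      by (auto simp: G_def k_def dist_commute)
    then have "conv \<eta>' G z \<le> G z + k" "G z - k \<le> conv \<eta>' G z" using conv_bounds[OF m' bG'] by blast+
    then show ?thesis by linarith
  qed
  \<comment> \<open>The subtraction of \<open>k\<close> restores \<open>f \<le> u\<close>, which mollification may destroy.\<close>
  define f where "f = (\<lambda>z. conv \<eta>' G z + k * (-1))"
  have bc: "bounded_borel B (conv \<eta>' h)" if "bounded_borel B h" for h by (rule conv_bounded_borel[OF m' that])
  have bf: "bounded_borel (B + \<bar>k\<bar> * \<bar>-1\<bar>) f" unfolding f_def
    by (rule bounded_borel_lincomb[OF bc[OF bG'] bounded_borel_const])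
  have fu: "f z \<le> u z" for z using GL[of z] inf_conv_facts(1)[OF ub, of "real n" z] by (simp add: f_def G_def abs_le_iff)
  define K3 where "K3 = C' * B + k"
  have K3: "0 \<le> K3" using C' B0 k by (simp add: K3_def)
  define e where "e = \<alpha> / (16 * (KW + K1 + K2 + K3 + 1))"
  have S1: "0 < KW + K1 + K2 + K3 + 1" using KW0 K12 K3 by simp
  have e: "0 < e" "e * (KW + K1 + K2 + K3 + 1) = \<alpha> / 16"
  proof -
    have "a / (16 * x) * x = a / 16" if "x \<noteq> 0" for a x :: real using that by simp
    from this[of "KW + K1 + K2 + K3 + 1" \<alpha>] S1 show "e * (KW + K1 + K2 + K3 + 1) = \<alpha> / 16" by (simp only: e_def)
    show "0 < e" using \<alpha> S1 by (simp add: e_def)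
  qed
  have e': "e * KW + e * K1 + e * K2 \<le> \<alpha> / 16" "e * K3 \<le> \<alpha> / 16"
  proof -
    have "0 \<le> e * KW" "0 \<le> e * K1" "0 \<le> e * K2" "0 \<le> e * K3" using e KW0 K12 K3 by auto
    then show "e * KW + e * K1 + e * K2 \<le> \<alpha> / 16" "e * K3 \<le> \<alpha> / 16" using e by (auto simp: algebra_simps)
  qed
  obtain c T where T: "jump_op c T" and approx: "\<And>F K z. Sm 3 K F \<Longrightarrow> \<bar>T F z - c * F z - st_gen p F z\<bar> \<le> e * K"
    using generator_approximation[OF pM e(1)] by blast
  have l0: "0 < l" using l by simp
  \<comment> \<open>The resolvent commutes with mollification, so the smooth \<open>P\<close> is the resolvent of the smooth \<open>f\<close>.\<close>
  obtain P0 where P0: "bounded_borel B P0" "\<And>z. (l + c) * P0 z = l * G z + T P0 z"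
    by (rule resolvent_exists[OF T l0 bG'], rule that)
  have conv_eq: "(l + c) * conv \<mu> h z = l * conv \<mu> h' z + T (conv \<mu> h) z"
    if \<mu>: "mollifier r' \<mu>" and h: "bounded_borel b1 h" "bounded_borel b2 h'" "\<And>z. (l + c) * h z = l * h' z + T h z"
    for \<mu> r' h h' b1 b2 z
  proof -
    have "(\<lambda>z. 0 + (l + c) * h z) = (\<lambda>z. T h z + l * h' z)" using h(3) by (auto simp: fun_eq_iff)
    then have "conv \<mu> (\<lambda>z. 0 + (l + c) * h z) z = conv \<mu> (\<lambda>z. T h z + l * h' z) z" by simp
    then show ?thesis
      unfolding conv_lincomb[OF \<mu> bounded_borel_const h(1)] conv_lincomb[OF \<mu> jump_op_bounded[OF T h(1)] h(2)]
        jump_op_conv[OF T \<mu> h(1)] conv_const[OF \<mu>] by simp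
  qed
  define P where "P = (\<lambda>z. conv \<eta>' P0 z + k * (-1))"
  have bP: "bounded_borel (B + \<bar>k\<bar> * \<bar>-1\<bar>) P" unfolding P_def
    by (rule bounded_borel_lincomb[OF bc[OF P0(1)] bounded_borel_const])
  have SP: "Sm 3 K3 P"
    unfolding P_def K3_def by (rule Sm_add[OF Sm_lower[OF C'(2)[OF P0(1)]]]) (use k in auto)
  have Peq: "(l + c) * P z = l * f z + T P z" for z
    using conv_eq[OF m' P0(1) bG' P0(2), of z]
      fun_cong[OF jump_op_lincomb[OF T bc[OF P0(1)] bounded_borel_const, of k "-1"], of z] jump_op_const[OF T, of "-1"]
    unfolding P_def f_def by (simp add: algebra_simps)
  have Ple: "P z \<le> u z + e * K3 / l" for z
    unfolding u_def
    by (rule resolvent_le_supersolution[where f = f, OF U M w p B T approx l0 less_imp_le[OF e(1)] fu[unfolded u_def] SP Peq])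
  define Pb where "Pb = conv \<eta> P"
  have bPb: "bounded_borel (B + \<bar>k\<bar> * \<bar>-1\<bar>) Pb" unfolding Pb_def by (rule conv_bounded_borel[OF m bP])
  have Pb_le: "Pb z0 \<le> W z0 + e * K3 / l"
  proof -
    have "Pb z0 \<le> conv \<eta> (\<lambda>z. u z + (e * K3 / l) * 1) z0" unfolding Pb_def
      by (rule conv_local_mono[OF m bP bounded_borel_lincomb[OF bu bounded_borel_const]]) (use Ple in simp)
    also have "\<dots> = W z0 + (e * K3 / l) * 1"
      unfolding conv_lincomb[OF m bu bounded_borel_const] conv_const[OF m] W_def ..
    finally show ?thesis by simp
  qed
  have Pbeq: "(l + c) * Pb z - T Pb z = l * conv \<eta> f z" for z
    using conv_eq[OF m bP bf Peq, of z] by (simp add: Pb_def)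
  have f_ge: "conv \<eta> G z - d / 2 \<le> conv \<eta> f z" for z
  proof -
    have "G y + (d / 2) * (-1) \<le> f y" for y using GL[of y] k by (simp add: f_def abs_le_iff)
    then have "conv \<eta> (\<lambda>y. G y + (d / 2) * (-1)) z \<le> conv \<eta> f z"
      by (rule conv_local_mono[OF m bounded_borel_lincomb[OF bG' bounded_borel_const] bf])
    then show ?thesis
      unfolding conv_lincomb[OF m bG' bounded_borel_const] conv_const[OF m] by simp
  qed
  have W_f: "W z - d - q2 z \<le> conv \<eta> f z" for z
  proof (cases "dist z0 z \<le> R")
    case True
    then show ?thesis using n[OF True] f_ge[of z] q2(3)[of z] by (simp add: G_def)
  next
    case False
    then have "q2 z = A2" using q2(5)[of z] by simp
    moreover have "- B \<le> conv \<eta> G z" using bounded_borelD(2)[OF conv_bounded_borel[OF m bG'], of z] by linarith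
    ultimately show ?thesis using bounded_borelD(2)[OF bW, of z] f_ge[of z] d by (simp add: A2_def abs_le_iff)
  qed
  \<comment> \<open>At \<open>z0\<close> the barrier exceeds \<open>W\<close> by \<open>a0\<close>, which is at least \<open>3 * \<alpha> / (8 * l)\<close>.\<close>
  define a0 where "a0 = \<alpha> / 2 / l - d"
  define b1 where "b1 = (\<lambda>z. W z + a0 * 1)"
  define b2 where "b2 = (\<lambda>z. b1 z + (- (1 / l)) * q1 z)"
  define b3 where "b3 = (\<lambda>z. b2 z + (-1) * q2 z)"
  have bb1: "bounded_borel (B + \<bar>a0\<bar> * \<bar>1\<bar>) b1" unfolding b1_def by (rule bounded_borel_lincomb[OF bW bounded_borel_const])
  have bb2: "bounded_borel (B + \<bar>a0\<bar> * \<bar>1\<bar> + \<bar>- (1 / l)\<bar> * K1) b2" unfolding b2_def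
    by (rule bounded_borel_lincomb[OF bb1 Sm_bounded_borel[OF q1(1)]])
  have bb3: "bounded_borel (B + \<bar>a0\<bar> * \<bar>1\<bar> + \<bar>- (1 / l)\<bar> * K1 + \<bar>-1\<bar> * K2) b3" unfolding b3_def
    by (rule bounded_borel_lincomb[OF bb2 Sm_bounded_borel[OF q2(1)]])
  have Tb: "T b3 z = T W z + a0 * c - (1 / l) * T q1 z - T q2 z" for z
    using fun_cong[OF jump_op_lincomb[OF T bb2 Sm_bounded_borel[OF q2(1)], of "-1"], of z]
      fun_cong[OF jump_op_lincomb[OF T bb1 Sm_bounded_borel[OF q1(1)], of "- (1 / l)"], of z]
      fun_cong[OF jump_op_lincomb[OF T bW bounded_borel_const, of a0 1], of z] jump_op_one[OF T]
    unfolding b3_def[symmetric] b2_def[symmetric] b1_def[symmetric] by simp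
  have "b3 z \<le> Pb z" for z
  proof (rule resolvent_comparison[OF T l0 bb3 bPb])
    fix z
    have t1: "\<alpha> - q1 z - e * KW \<le> T W z - c * W z" using approx[OF W, of z] gW[of z] by (simp add: abs_le_iff)
    have "T q1 z - c * q1 z \<le> g * K1 + e * K1" using approx[OF q1(1), of z] gq1[of z] by (simp add: abs_le_iff)
    then have "(T q1 z - c * q1 z) / l \<le> (g * K1 + e * K1) / l" using l0 by (intro divide_right_mono) auto
    also have "\<dots> \<le> \<alpha> / 16 + e * K1"
    proof -
      have "0 \<le> e * K1" using e(1) K12 by simp
      from mult_left_mono[OF l(1) this] have "e * K1 \<le> e * K1 * l" by simp
      then have "e * K1 / l \<le> e * K1" using l0 by (simp add: pos_divide_le_eq)
      then show ?thesis using l(2) unfolding add_divide_distrib by linarith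
    qed
    finally have t2: "(T q1 z - c * q1 z) / l \<le> \<alpha> / 16 + e * K1" .
    have t3: "T q2 z - c * q2 z \<le> \<alpha> / 8 + e * K2" using approx[OF q2(1), of z] gq2[of z] by (simp add: abs_le_iff)
    have la0: "l * a0 = \<alpha> / 2 - l * d" using l0 by (simp add: a0_def algebra_simps)
    have "(l + c) * b3 z - T b3 z = l * W z + l * a0 - l * ((1 / l) * q1 z) - l * q2 z
       - (T W z - c * W z) + (T q1 z - c * q1 z) / l + (T q2 z - c * q2 z)"
      unfolding Tb unfolding b3_def b2_def b1_def using l0
      by (simp add: algebra_simps diff_divide_distrib add_divide_distrib)
    also have "l * ((1 / l) * q1 z) = q1 z" using l0 by simp
    finally have "(l + c) * b3 z - T b3 z \<le> l * W z - l * d - l * q2 z"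
      using t1 t2 t3 la0 e'(1) \<alpha> by linarith
    also have "\<dots> = l * (W z - d - q2 z)" by (simp add: algebra_simps)
    also have "\<dots> \<le> l * conv \<eta> f z" using W_f l0 by (intro mult_left_mono) auto
    finally show "(l + c) * b3 z - T b3 z \<le> (l + c) * Pb z - T Pb z" by (simp add: Pbeq)
  qed
  then have "b3 z0 \<le> Pb z0" .
  moreover have "b3 z0 = W z0 + a0" by (simp add: b3_def b2_def b1_def q1(3) q2(4))
  ultimately have "W z0 + a0 \<le> W z0 + e * K3 / l" using Pb_le by linarith
  then have "a0 \<le> e * K3 / l" by simp
  then have "l * a0 \<le> e * K3" using l0 by (simp add: pos_le_divide_eq mult.commute)
  moreover have "l * a0 = \<alpha> / 2 - l * d" using l0 by (simp add: a0_def algebra_simps)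
  ultimately show False using e'(2) d(3) \<alpha> by linarith
qed

section \<open>Comparison of viscosity solutions\<close>

lemma conv_Lipschitz_near:
  fixes \<eta> :: "'a::euclidean_space \<Rightarrow> real"
  assumes m: "mollifier r \<eta>" and g: "bounded_borel M g" and L: "L-lipschitz_on UNIV g"
  shows "\<bar>conv \<eta> g x - g x\<bar> \<le> L * r"
proof -
  have L0: "0 \<le> L" by (rule lipschitz_on_nonneg[OF L])
  have "\<bar>g y - g x\<bar> \<le> L * r" if "dist x y \<le> r" for y
    using lipschitz_onD[OF L, of y x] mult_left_mono[OF that L0] by (simp add: dist_real_def dist_commute)
  then have "g y \<le> g x + L * r" "g x - L * r \<le> g y" if "dist x y \<le> r" for y
    using that by (fastforce simp: abs_le_iff)+
  then have "conv \<eta> g x \<le> g x + L * r" "g x - L * r \<le> conv \<eta> g x"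
    using conv_bounds[OF m g] by blast+
  then show ?thesis by linarith
qed

text \<open>A supersolution may not drop quickly from its initial value: the stationary function obtained by
  mollifying \<open>\<phi>\<close> has a bounded generator, so lowering it at a linear rate gives a barrier from below.
  This controls mollified values near time \<open>0\<close>.\<close>

lemma supersolution_initial_layer:
  fixes \<phi> :: "real^'d::finite \<Rightarrow> real"
  assumes U: "bounded_triples M U" and M: "0 \<le> M" and w: "viscosity_supersolution U \<phi> w"
    and L: "L-lipschitz_on UNIV \<phi>" and \<phi>: "bounded_borel N \<phi>" and eps: "0 < \<epsilon>"
  obtains C where "0 \<le> C" "\<And>t x. 0 \<le> t \<Longrightarrow> \<phi> x - \<epsilon> - C * t \<le> w t x"
proof -
  obtain p where p: "p \<in> U" using U by (auto simp: bounded_triples_def)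
  then have pM: "triple_bound M p" using U by (simp add: bounded_triples_def)
  have L0: "0 \<le> L" by (rule lipschitz_on_nonneg[OF L])
  define r where "r = \<epsilon> / (2 * (L + 1))"
  have r: "0 < r" using eps L0 by (simp add: r_def)
  have Lr: "2 * (L * r) \<le> \<epsilon>"
  proof -
    have "x * (\<epsilon> / (2 * x)) = \<epsilon> / 2" if "x \<noteq> 0" for x :: real using that by simp
    from this[of "L + 1"] L0 have "(L + 1) * r = \<epsilon> / 2" by (simp only: r_def)
    then have "L * r + r = \<epsilon> / 2" by (simp add: algebra_simps)
    then show ?thesis using r by linarith
  qed
  obtain \<eta> :: "real^'d \<Rightarrow> real" where m: "mollifier r \<eta>" using mollifier_exists[OF r] by blast
  obtain C' where C': "0 \<le> C'" "\<And>g M. bounded_borel M g \<Longrightarrow> Sm 4 (C' * M) (conv \<eta> g)"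
    by (rule conv_mollifier_Sm[OF m], rule that)
  define f where "f = (\<lambda>x. conv \<eta> \<phi> x + - (L * r))"
  define K where "K = C' * N + L * r"
  have f: "Sm 3 K f" unfolding f_def K_def
    by (rule Sm_add[OF Sm_lower[OF C'(2)[OF \<phi>]]]) (use L0 r in auto)
  have fp: "f x \<le> \<phi> x" "\<phi> x - \<epsilon> \<le> f x" for x
    using conv_Lipschitz_near[OF m \<phi> L, of x] Lr by (auto simp: f_def abs_le_iff)
  define g where "g = gen_const M TYPE('d)"
  have K0: "0 \<le> K" using Sm_nonneg[OF f] .
  have g0: "0 \<le> g" using M by (simp add: g_def gen_const_def)
  \<comment> \<open>A lowering rate beyond \<open>g * K\<close>, the bound of the generator of \<open>f\<close>, makes the sign of the generator impossible.\<close>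
  define e where "e = g * K + 1"
  have e: "0 \<le> e" using g0 K0 by (simp add: e_def)
  let ?F = "\<lambda>z :: real \<times> (real^'d). f (snd z)"
  have F: "Sm 3 K ?F" by (rule Sm_space[OF f])
  have f3: "Sm (Suc (Suc (Suc 0))) K f" using f by (simp add: numeral_3_eq_3)
  have gen: "- (g * K) \<le> st_gen p ?F z" for z
    using levy_gen_bound[OF pM smooth_bd_lower[OF Sm_smooth_bd[OF f3]], of "snd z"]
    by (simp add: st_gen_def pd_time_space[OF Sm_differentiable[OF f3]] g_def gen_const_def abs_le_iff)
  have w0: "\<phi> x \<le> w 0 x" for x using w by (simp add: viscosity_supersolution_def)
  have init: "?F (0, x) \<le> w 0 x" for x using fp(1)[of x] w0[of x] by simp
  have "\<phi> x - \<epsilon> - 2 * e * t \<le> w t x" if t: "0 \<le> t" for t x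
  proof (rule ccontr)
    assume "\<not> \<phi> x - \<epsilon> - 2 * e * t \<le> w t x"
    then have big: "0 + 2 * e * t < ?F (t, x) - w t x" using fp(2)[of x] by simp
    then have "t \<noteq> 0" using init[of x] by auto
    then have tp: "0 < t" using t by simp
    obtain s y where "st_gen p ?F (s, y) \<le> 1 / 2 - e"
      by (rule supersolution_penalized[OF U M w p F init tp order_refl e big, of "1 / 2"]) simp
    then show False using gen[of "(s, y)"] by (simp add: e_def)
  qed
  then show ?thesis using that[of "2 * e"] e by simp
qed

text \<open>Mollify with radius \<open>d\<close> and shift by \<open>2 * d\<close> into the future, so that at time \<open>0\<close> only times
  between \<open>d\<close> and \<open>3 * d\<close> are seen.  There \<open>w\<close> is almost at least \<open>\<phi>\<close>, and near \<open>(T, x0)\<close> the mollified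
  function is close to \<open>w T x0\<close> by continuity.\<close>

theorem viscosity_comparison:
  fixes \<phi> :: "real^'d::finite \<Rightarrow> real"
  assumes U: "bounded_triples M U" and M: "0 \<le> M" and a: "viscosity_subsolution U \<phi> a"
    and w: "viscosity_supersolution U \<phi> w" and cont: "continuous_on ({0..} \<times> UNIV) (\<lambda>(t, x). w t x)"
    and L: "L-lipschitz_on UNIV \<phi>" and \<phi>: "bounded_borel N \<phi>" and T: "0 \<le> T"
  shows "a T x0 \<le> w T x0"
proof (cases "T = 0")
  case True
  have "a 0 x0 \<le> \<phi> x0" "\<phi> x0 \<le> w 0 x0" using a w by (auto simp: viscosity_subsolution_def viscosity_supersolution_def)
  then show ?thesis using True by simp
next
  case False
  then have Tp: "0 < T" using T by simp
  obtain B where B: "\<And>t x. 0 \<le> t \<Longrightarrow> \<bar>w t x\<bar> \<le> B"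
    using w unfolding viscosity_supersolution_def bounded_iff by (auto simp: image_iff)
  define u where "u = past_ext B w"
  have bu: "bounded_borel B u" unfolding u_def by (rule past_ext_bounded_borel[OF cont B])
  have L0: "0 \<le> L" by (rule lipschitz_on_nonneg[OF L])
  show ?thesis
  proof (rule field_le_epsilon)
    fix e :: real assume e: "0 < e"
    define \<epsilon> where "\<epsilon> = e / 4"
    have eps: "0 < \<epsilon>" using e by (simp add: \<epsilon>_def)
    obtain C where C: "0 \<le> C" "\<And>t x. 0 \<le> t \<Longrightarrow> \<phi> x - \<epsilon> - C * t \<le> w t x"
      by (rule supersolution_initial_layer[OF U M w L \<phi> eps], rule that)
    have "isCont (\<lambda>(t, x). w t x) (T, x0)"
    proof -
      have o: "open ({0<..} \<times> UNIV :: (real \<times> (real^'d)) set)" by (intro open_Times) auto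
      have "continuous_on ({0<..} \<times> UNIV) (\<lambda>(t, x). w t x)" by (rule continuous_on_subset[OF cont]) auto
      then show ?thesis using continuous_on_eq_continuous_at[OF o] Tp by auto
    qed
    then have "\<forall>\<^sub>F z in at (T, x0). (\<lambda>(t, x). w t x) z < w T x0 + \<epsilon>"
      using eps by (intro order_tendstoD(2)[of _ "w T x0"]) (auto simp: isCont_def)
    then obtain \<rho> where \<rho>: "0 < \<rho>" "\<And>z. z \<noteq> (T, x0) \<Longrightarrow> dist z (T, x0) < \<rho> \<Longrightarrow> w (fst z) (snd z) < w T x0 + \<epsilon>"
      by (auto simp: eventually_at case_prod_unfold)
    \<comment> \<open>The three bounds serve continuity at \<open>(T, x0)\<close>, positivity of the times involved, and the initial layer up to time \<open>3 * d\<close>.\<close>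
    define d where "d = min (min (\<rho> / 4) (T / 2)) (\<epsilon> / (L + 3 * C + 1))"
    have S: "0 < L + 3 * C + 1" using L0 C(1) by simp
    have d1: "0 < d" using \<rho>(1) Tp eps S by (simp add: d_def)
    have d2: "d \<le> \<rho> / 4" unfolding d_def by (rule min.coboundedI1[OF min.cobounded1])
    have d3: "d \<le> T / 2" unfolding d_def by (rule min.coboundedI1[OF min.cobounded2])
    have d4: "d \<le> \<epsilon> / (L + 3 * C + 1)" unfolding d_def by (rule min.cobounded2)
    note d = d1 d2 d3 d4
    have dS: "L * d + 3 * C * d \<le> \<epsilon>"
    proof -
      have "d * (L + 3 * C + 1) \<le> \<epsilon>" using d(4) S by (simp add: pos_le_divide_eq)
      then show ?thesis using d(1) by (simp add: algebra_simps)
    qed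
    obtain \<eta> :: "real \<times> (real^'d) \<Rightarrow> real" where m: "mollifier d \<eta>" using mollifier_exists[OF d(1)] by blast
    obtain C' where C': "0 \<le> C'" "\<And>g M. bounded_borel M g \<Longrightarrow> Sm 4 (C' * M) (conv \<eta> g)"
      by (rule conv_mollifier_Sm[OF m], rule that)
    have S4: "Sm 4 (C' * B) (conv \<eta> u)" by (rule C'(2)[OF bu])
    define W where "W = (\<lambda>z. conv \<eta> u (z + (2 * d, 0)) + 2 * \<epsilon>)"
    have W: "Sm 3 (C' * B + 2 * \<epsilon>) W" unfolding W_def
      by (rule Sm_add[OF Sm_translate[OF Sm_lower[OF S4]]]) (use eps in auto)
    have S2: "Sm (Suc (Suc 2)) (C' * B) (conv \<eta> u)" using S4 by (simp add: eval_nat_numeral)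
    have gen: "st_gen p W (t, x) \<le> 0" if "p \<in> U" for p t x
    proof -
      have "st_gen p (conv \<eta> u) z \<le> 0" for z
        unfolding u_def by (rule mollified_supersolution[OF U M w that cont B m])
      then show ?thesis unfolding W_def st_gen_translate[OF S2] .
    qed
    have near: "dist (fst y) (t + 2 * d) \<le> d" "dist (snd y) x \<le> d" if "dist ((t, x) + (2 * d, 0)) y \<le> d" for t y and x :: "real^'d"
      using that dist_fst_le[of y "(t + 2 * d, x)"] dist_snd_le[of y "(t + 2 * d, x)"]
      by (auto simp: dist_commute)
    have init: "\<phi> x \<le> W (0, x)" for x
    proof -
      have "\<phi> x - 2 * \<epsilon> \<le> u y" if "dist ((0, x) + (2 * d, 0)) y \<le> d" for y
      proof -
        have 1: "d \<le> fst y" "fst y \<le> 3 * d" "dist (snd y) x \<le> d" using near[OF that] by (auto simp: dist_real_def abs_le_iff)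
        then have "0 < fst y" using d(1) by simp
        moreover have "\<phi> (snd y) - \<epsilon> - C * fst y \<le> w (fst y) (snd y)" using C(2) \<open>0 < fst y\<close> by simp
        moreover have "C * fst y \<le> C * (3 * d)" using 1 C(1) by (intro mult_left_mono) auto
        moreover have "\<bar>\<phi> (snd y) - \<phi> x\<bar> \<le> L * d"
          using lipschitz_onD[OF L, of "snd y" x] mult_left_mono[OF 1(3) L0] by (simp add: dist_real_def)
        ultimately show ?thesis using dS by (simp add: u_def past_ext_def abs_le_iff)
      qed
      then have "\<phi> x - 2 * \<epsilon> \<le> conv \<eta> u ((0, x) + (2 * d, 0))" by (rule conv_bounds(2)[OF m bu])
      then show ?thesis by (simp add: W_def)
    qed
    have "a T x0 \<le> W (T, x0)"
      by (rule subsolution_le_smooth_supersolution[OF U M a W gen init T])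
    also have "conv \<eta> u ((T, x0) + (2 * d, 0)) \<le> w T x0 + \<epsilon>"
    proof (rule conv_bounds(1)[OF m bu])
      fix y assume y: "dist ((T, x0) + (2 * d, 0)) y \<le> d"
      have 1: "0 < fst y" using near(1)[OF y] d Tp by (auto simp: dist_real_def abs_le_iff)
      have "dist y (T, x0) \<le> dist y (T + 2 * d, x0) + dist (T + 2 * d, x0) (T, x0)" by (rule dist_triangle)
      also have "dist (T + 2 * d, x0) (T, x0) = 2 * d"
        using d(1) by (simp add: dist_Pair_Pair dist_real_def real_sqrt_mult)
      also have "dist y (T + 2 * d, x0) + 2 * d \<le> d + 2 * d" using y by (simp add: dist_commute)
      also have "\<dots> < \<rho>" using d by simp
      finally have "dist y (T, x0) < \<rho>" .
      then have "w (fst y) (snd y) \<le> w T x0 + \<epsilon>" using \<rho>(2)[of y] eps by (cases "y = (T, x0)") auto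
      then show "u y \<le> w T x0 + \<epsilon>" using 1 by (simp add: u_def past_ext_def)
    qed
    then have "W (T, x0) \<le> w T x0 + 3 * \<epsilon>" by (simp add: W_def)
    finally show "a T x0 \<le> w T x0 + e" using e by (simp add: \<epsilon>_def)
  qed
qed

section \<open>Sublinear expectations\<close>

context sublinear_expectation_space
begin

lemma const_closed: "(\<lambda>\<omega>. c) \<in> H"
  using Lip_closed[of "\<lambda>_. c" 0 "\<lambda>_ _. 0"] by (auto simp: C_Lip_tuple_def tuple_dist_def)

lemma E_add_le: assumes "X \<in> H" "Y \<in> H" shows "E (\<lambda>\<omega>. X \<omega> + Y \<omega>) \<le> E X + E Y"
  using sub_additive[OF add_closed[OF assms] assms(2)] by simp

lemma E_dominated:
  assumes "X \<in> H" "Y \<in> H" "Z \<in> H" "\<And>\<omega>. X \<omega> \<le> Y \<omega> + Z \<omega>"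
  shows "E X \<le> E Y + E Z"
  using mono[OF add_closed[OF assms(2,3)] assms(1)] E_add_le[OF assms(2,3)] assms(4) by force

lemma E_add_const: assumes "X \<in> H" shows "E (\<lambda>\<omega>. X \<omega> + c) = E X + c"
proof (rule antisym)
  show "E (\<lambda>\<omega>. X \<omega> + c) \<le> E X + c" using E_add_le[OF assms const_closed, of c] const by simp
  show "E X + c \<le> E (\<lambda>\<omega>. X \<omega> + c)"
    using E_add_le[OF add_closed[OF assms const_closed] const_closed, of c "-c"] const by simp
qed

lemma E_affine: assumes "X \<in> H" "0 \<le> a" shows "E (\<lambda>\<omega>. a * X \<omega> + c) = a * E X + c"
  using E_add_const[OF scale_closed[OF assms(1)], of a c] pos_homogeneous[OF assms] by simp

lemma E_bounds:
  assumes "X \<in> H" shows "(\<And>\<omega>. X \<omega> \<le> c) \<Longrightarrow> E X \<le> c" and "(\<And>\<omega>. c \<le> X \<omega>) \<Longrightarrow> c \<le> E X"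
  using mono[OF const_closed assms, of c] mono[OF assms const_closed, of c] const by auto

lemma E_abs_diff:
  assumes X: "X \<in> H" and Y: "Y \<in> H" and Z: "Z \<in> H" and le: "\<And>\<omega>. \<bar>X \<omega> - Y \<omega>\<bar> \<le> Z \<omega>"
  shows "\<bar>E X - E Y\<bar> \<le> E Z"
proof -
  have "X \<omega> \<le> Y \<omega> + Z \<omega>" "Y \<omega> \<le> X \<omega> + Z \<omega>" for \<omega> using le[of \<omega>] by linarith+
  then show ?thesis using E_dominated[OF X Y Z] E_dominated[OF Y X Z] by force
qed

lemma Lip_vector_closed:
  fixes X :: "'w \<Rightarrow> 'a::euclidean_space"
  assumes X: "random_vector H X" and L: "L-lipschitz_on UNIV \<phi>"
  shows "(\<lambda>\<omega>. \<phi> (X \<omega>)) \<in> H"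
proof -
  obtain h :: "nat \<Rightarrow> 'a" where h: "bij_betw h {0..<DIM('a)} Basis"
    using ex_bij_betw_nat_finite[of "Basis :: 'a set"] by auto
  have h': "bij_betw h {..<DIM('a)} Basis" using h by (simp add: atLeast0LessThan)
  define \<Phi> where "\<Phi> = (\<lambda>x :: nat \<Rightarrow> real. \<phi> (\<Sum>i<DIM('a). x i *\<^sub>R h i))"
  have L0: "0 \<le> L" by (rule lipschitz_on_nonneg[OF L])
  have hB: "h i \<in> Basis" if "i < DIM('a)" for i using h' that by (auto simp: bij_betw_def)
  have "\<bar>\<Phi> x - \<Phi> y\<bar> \<le> (L * DIM('a)) * tuple_dist DIM('a) x y" for x y
  proof -
    have "\<bar>\<Phi> x - \<Phi> y\<bar> \<le> L * norm ((\<Sum>i<DIM('a). x i *\<^sub>R h i) - (\<Sum>i<DIM('a). y i *\<^sub>R h i))"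
      using lipschitz_onD[OF L] by (simp add: \<Phi>_def dist_norm)
    also have "(\<Sum>i<DIM('a). x i *\<^sub>R h i) - (\<Sum>i<DIM('a). y i *\<^sub>R h i) = (\<Sum>i<DIM('a). (x i - y i) *\<^sub>R h i)"
      by (simp add: sum_subtractf scaleR_diff_left)
    also have "norm \<dots> \<le> (\<Sum>i<DIM('a). tuple_dist DIM('a) x y)"
    proof (intro order_trans[OF norm_sum] sum_mono)
      fix i assume i: "i \<in> {..<DIM('a)}"
      have "norm ((x i - y i) *\<^sub>R h i) = dist (x i) (y i)" using hB i by (simp add: dist_real_def)
      also have "\<dots> \<le> tuple_dist DIM('a) x y" unfolding tuple_dist_def using i by (intro member_le_L2_set) auto
      finally show "norm ((x i - y i) *\<^sub>R h i) \<le> tuple_dist DIM('a) x y" .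
    qed
    also have "\<dots> = DIM('a) * tuple_dist DIM('a) x y" by simp
    finally show ?thesis using L0 by (simp add: mult_left_mono mult.assoc)
  qed
  then have "\<Phi> \<in> C_Lip_tuple DIM('a)" by (auto simp: C_Lip_tuple_def)
  moreover have "\<forall>i<DIM('a). (\<lambda>\<omega>. X \<omega> \<bullet> h i) \<in> H" using X hB by (simp add: random_vector_def)
  ultimately have "(\<lambda>\<omega>. \<Phi> (\<lambda>i. X \<omega> \<bullet> h i)) \<in> H" by (rule Lip_closed)
  moreover have "\<Phi> (\<lambda>i. X \<omega> \<bullet> h i) = \<phi> (X \<omega>)" for \<omega>
  proof -
    have "(\<Sum>i<DIM('a). (X \<omega> \<bullet> h i) *\<^sub>R h i) = (\<Sum>b\<in>Basis. (X \<omega> \<bullet> b) *\<^sub>R b)"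
      by (rule sum.reindex_bij_betw[OF h'])
    then show ?thesis by (simp add: \<Phi>_def euclidean_representation)
  qed
  ultimately show ?thesis by simp
qed

lemma norm_closed: "random_vector H X \<Longrightarrow> (\<lambda>\<omega>. norm (X \<omega> :: 'a::euclidean_space)) \<in> H"
  by (rule Lip_vector_closed[of X 1 norm])
     (auto intro!: lipschitz_onI simp: dist_norm dist_real_def norm_triangle_ineq3)

lemma Lipschitz_section:
  assumes "L-lipschitz_on UNIV (\<lambda>(x, y). \<phi> x y :: real)"
  shows "L-lipschitz_on UNIV (\<phi> x)" "L-lipschitz_on UNIV (\<lambda>x. \<phi> x y)"
  using lipschitz_onD[OF assms, of "(x, _)" "(x, _)"] lipschitz_onD[OF assms, of "(_, y)" "(_, y)"] lipschitz_on_nonneg[OF assms]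
  by (auto intro!: lipschitz_onI simp: dist_Pair_Pair)

text \<open>The inner expectation in the definition of independence is again a Lipschitz function, hence
  admissible as an argument of the outer one.\<close>

lemma E_Lipschitz:
  fixes Y :: "'w \<Rightarrow> 'b::euclidean_space" and \<phi> :: "'a::euclidean_space \<Rightarrow> 'b \<Rightarrow> real"
  assumes Y: "random_vector H Y" and L: "L-lipschitz_on UNIV (\<lambda>(x, y). \<phi> x y)"
  shows "L-lipschitz_on UNIV (\<lambda>x. E (\<lambda>\<omega>. \<phi> x (Y \<omega>)))"
proof (rule lipschitz_onI)
  show "0 \<le> L" by (rule lipschitz_on_nonneg[OF L])
  fix x x'
  have "\<bar>E (\<lambda>\<omega>. \<phi> x (Y \<omega>)) - E (\<lambda>\<omega>. \<phi> x' (Y \<omega>))\<bar> \<le> E (\<lambda>\<omega>. L * dist x x')"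
    using lipschitz_onD[OF Lipschitz_section(2)[OF L], of x x']
    by (intro E_abs_diff Lip_vector_closed[OF Y Lipschitz_section(1)[OF L]] const_closed) (auto simp: dist_real_def)
  then show "dist (E (\<lambda>\<omega>. \<phi> x (Y \<omega>))) (E (\<lambda>\<omega>. \<phi> x' (Y \<omega>))) \<le> L * dist x x'"
    by (simp add: const dist_real_def)
qed

lemma tuple_dist_1: "tuple_dist (Suc 0) x y = dist (x 0) (y 0)"
  by (simp add: tuple_dist_def lessThan_Suc)

lemma Levy_increment_law:
  fixes X :: "real \<Rightarrow> 'w \<Rightarrow> 'a::euclidean_space"
  assumes X: "Levy_process H E X" and t: "0 \<le> t" "0 < s" and L: "L-lipschitz_on UNIV \<phi>"
  shows "E (\<lambda>\<omega>. \<phi> (X (t + s) \<omega> - X t \<omega>)) = E (\<lambda>\<omega>. \<phi> (X s \<omega>))"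
proof -
  have "identically_distributed E (\<lambda>\<omega>. X (t + s) \<omega> - X t \<omega>) E (\<lambda>\<omega>. X (0 + s) \<omega> - X 0 \<omega>)"
    using X t unfolding Levy_process_def by blast
  moreover have "X 0 \<omega> = 0" for \<omega> using X by (simp add: Levy_process_def)
  moreover have "\<phi> \<in> C_Lip" using L by (auto simp: C_Lip_def)
  ultimately show ?thesis by (simp add: identically_distributed_def)
qed

text \<open>Independence of the increment together with stationarity: the inner expectation may be computed with \<open>X s\<close>
  itself, since \<open>X 0 = 0\<close>.\<close>

lemma Levy_independent_increment:
  fixes X :: "real \<Rightarrow> 'w \<Rightarrow> 'a::euclidean_space"
  assumes X: "Levy_process H E X" and t: "0 < t" "0 < s" and L: "L-lipschitz_on UNIV (\<lambda>(x, y). \<phi> x y)"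
  shows "E (\<lambda>\<omega>. \<phi> (X t \<omega>) (X (t + s) \<omega> - X t \<omega>)) = E (\<lambda>\<omega>. E (\<lambda>\<omega>'. \<phi> (X t \<omega>) (X s \<omega>')))"
proof -
  have "independent_from E (\<lambda>\<omega>. X (t + s) \<omega> - X t \<omega>) 1 (\<lambda>i. X ((\<lambda>_. t) i))"
    using X t unfolding Levy_process_def by (auto simp del: One_nat_def)
  moreover have "(\<lambda>x y. \<phi> (x 0) y) \<in> C_Lip_tuple_vec (Suc 0)"
    unfolding C_Lip_tuple_vec_def tuple_dist_1
    using lipschitz_onD[OF L] by (auto simp: dist_Pair_Pair dist_real_def intro!: exI[of _ L])
  ultimately have "E (\<lambda>\<omega>. \<phi> (X t \<omega>) (X (t + s) \<omega> - X t \<omega>)) = E (\<lambda>\<omega>. E (\<lambda>\<omega>'. \<phi> (X t \<omega>) (X (t + s) \<omega>' - X t \<omega>')))"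
    unfolding independent_from_def by fastforce
  also have "\<dots> = E (\<lambda>\<omega>. E (\<lambda>\<omega>'. \<phi> (X t \<omega>) (X s \<omega>')))"
    using Levy_increment_law[OF X less_imp_le[OF t(1)] t(2) Lipschitz_section(1)[OF L]] by simp
  finally show ?thesis .
qed

end

lemma random_vector_fst:
  assumes "random_vector H (\<lambda>\<omega>. (X \<omega>, Y \<omega>))"
  shows "random_vector H X" "random_vector H Y"
proof -
  have "(\<lambda>\<omega>. (X \<omega>, Y \<omega>) \<bullet> b) \<in> H" if "b \<in> Basis" for b using assms that by (auto simp: random_vector_def)
  from this[of "(_, 0)"] this[of "(0, _)"] show "random_vector H X" "random_vector H Y"
    by (auto simp: random_vector_def Basis_prod_def)
qed

section \<open>Small-time behaviour of G-Levy processes\<close>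

lemma cube_norm_le: "norm (a + b) ^ 3 \<le> 4 * (norm a ^ 3 + norm b ^ 3)"
proof -
  have c: "(x + y) ^ 3 \<le> 4 * (x ^ 3 + y ^ 3)" if "0 \<le> x" "0 \<le> y" for x y :: real
  proof -
    have "4 * (x ^ 3 + y ^ 3) - (x + y) ^ 3 = 3 * ((x + y) * (x - y)\<^sup>2)" by algebra
    moreover have "0 \<le> 3 * ((x + y) * (x - y)\<^sup>2)" using that by simp
    ultimately show ?thesis by linarith
  qed
  have "norm (a + b) ^ 3 \<le> (norm a + norm b) ^ 3" by (intro power_mono norm_triangle_ineq) simp
  then show ?thesis using c[OF norm_ge_zero norm_ge_zero, of a b] by linarith
qed

lemma subdivision:
  fixes s T :: real
  assumes "0 < s" "s \<le> T"
  obtains n where "1 \<le> n" "real n * s \<le> T" "T - s < real n * s" "T \<le> 2 * (real n * s)"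
proof -
  define n where "n = nat \<lfloor>T / s\<rfloor>"
  have "1 \<le> T / s" using assms by simp
  then have "1 \<le> \<lfloor>T / s\<rfloor>" by simp
  then have n: "1 \<le> n" "real n = of_int \<lfloor>T / s\<rfloor>" unfolding n_def by linarith+
  have "real n \<le> T / s" unfolding n(2) by (rule of_int_floor_le)
  then have 1: "real n * s \<le> T" using assms(1) by (simp only: pos_le_divide_eq)
  have "T / s < real n + 1" using n(2) by linarith
  then have 2: "T - s < real n * s" using assms by (simp add: pos_divide_less_eq algebra_simps)
  have "1 * s \<le> real n * s" using n(1) assms by (intro mult_right_mono) auto
  then have "T \<le> 2 * (real n * s)" using 2 by linarith
  then show ?thesis using that[of n] n(1) 1 2 by blast
qed

locale G_Levy_decomp = sublinear_expectation_space H E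
  for H :: "('v \<Rightarrow> real) set" and E +
  fixes Xc Xd :: "real \<Rightarrow> 'v \<Rightarrow> 'a::euclidean_space"
  assumes decomp: "G_Levy_decomposition H E Xc Xd"
begin

lemma Levy: "Levy_process H E (\<lambda>t \<omega>. (Xc t \<omega>, Xd t \<omega>))"
  using decomp by (simp add: G_Levy_decomposition_def)

lemma rv: "0 \<le> t \<Longrightarrow> random_vector H (\<lambda>\<omega>. (Xc t \<omega>, Xd t \<omega>))"
  using Levy by (simp add: Levy_process_def)

lemma rv_c: "0 \<le> t \<Longrightarrow> random_vector H (Xc t)" and rv_d: "0 \<le> t \<Longrightarrow> random_vector H (Xd t)"
  using random_vector_fst[OF rv] by auto

text \<open>The powers are not Lipschitz; their membership is what the integrability convention grants.\<close>

lemma Xc_power_closed: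
  assumes t: "0 \<le> t" and k: "k = 2 \<or> k = 3"
  shows "(\<lambda>\<omega>. norm (Xc t \<omega>) ^ k) \<in> H"
proof -
  have pw: "\<bar>a ^ k - b ^ k\<bar> \<le> 3 * (1 + R)\<^sup>2 * \<bar>a - b\<bar>" if "0 \<le> a" "a \<le> R" "0 \<le> b" "b \<le> R" for a b R :: real
  proof -
    have R: "0 \<le> R" using that by simp
    have "a ^ k - b ^ k = (a - b) * (if k = 2 then a + b else a * a + a * b + b * b)"
      using k by (auto simp: power2_eq_square power3_eq_cube algebra_simps)
    moreover have "\<bar>if k = 2 then a + b else a * a + a * b + b * b\<bar> \<le> 3 * (1 + R)\<^sup>2"
    proof -
      have "a * a \<le> R * R" "a * b \<le> R * R" "b * b \<le> R * R" using that by (auto intro!: mult_mono)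
      moreover have "0 \<le> R * R" "0 \<le> a * a" "0 \<le> a * b" "0 \<le> b * b" using that by auto
      moreover have "3 * (1 + R)\<^sup>2 = 3 + 6 * R + 3 * (R * R)" by (simp add: power2_eq_square algebra_simps)
      ultimately have "\<bar>a + b\<bar> \<le> 3 * (1 + R)\<^sup>2" "\<bar>a * a + a * b + b * b\<bar> \<le> 3 * (1 + R)\<^sup>2"
        using that R by linarith+
      then show ?thesis by simp
    qed
    ultimately show ?thesis by (simp add: abs_mult mult.commute mult_left_mono)
  qed
  have "(\<lambda>(x :: nat \<Rightarrow> 'a) (y :: nat \<Rightarrow> 'a). norm (x 0) ^ k) \<in> C_loc_Lip_growth 1 0"
    unfolding C_loc_Lip_growth_def mem_Collect_eq
  proof (intro conjI allI)
    fix x :: "nat \<Rightarrow> 'a" and y :: "nat \<Rightarrow> 'a"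
    define R where "R = norm (x 0) + 1"
    have "\<bar>norm (x1 0) ^ k - norm (x2 0) ^ k\<bar> \<le> (3 * (1 + R)\<^sup>2) * sqrt ((tuple_dist 1 x1 x2)\<^sup>2 + (tuple_dist 0 y1 y2)\<^sup>2)"
      if "tuple_dist 1 x x1 < 1" "tuple_dist 1 x x2 < 1" for x1 x2 and y1 y2 :: "nat \<Rightarrow> 'a"
    proof -
      have "norm (x1 0) \<le> R" "norm (x2 0) \<le> R"
        using that norm_triangle_ineq2[of "x1 0" "x 0"] norm_triangle_ineq2[of "x2 0" "x 0"]
        by (auto simp: R_def tuple_dist_1 dist_norm norm_minus_commute)
      then have "\<bar>norm (x1 0) ^ k - norm (x2 0) ^ k\<bar> \<le> 3 * (1 + R)\<^sup>2 * \<bar>norm (x1 0) - norm (x2 0)\<bar>" by (intro pw) auto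
      also have "\<dots> \<le> 3 * (1 + R)\<^sup>2 * dist (x1 0) (x2 0)"
        by (intro mult_left_mono) (auto simp: dist_norm norm_triangle_ineq3)
      finally show ?thesis by (simp add: tuple_dist_1) (simp add: tuple_dist_def)
    qed
    then show "\<exists>\<epsilon>>0. \<exists>L. \<forall>x1 y1 x2 y2. tuple_dist 1 x x1 < \<epsilon> \<and> tuple_dist 0 y y1 < \<epsilon> \<and>
            tuple_dist 1 x x2 < \<epsilon> \<and> tuple_dist 0 y y2 < \<epsilon> \<longrightarrow>
            \<bar>norm (x1 0) ^ k - norm (x2 0) ^ k\<bar>
              \<le> L * sqrt ((tuple_dist 1 x1 x2)\<^sup>2 + (tuple_dist 0 y1 y2)\<^sup>2)"
      by (intro exI[of _ 1] conjI exI[of _ "3 * (1 + R)\<^sup>2"]) auto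
  next
    have "r ^ k \<le> 1 + r ^ 3" if "0 \<le> r" for r :: real
    proof (cases "r \<le> 1")
      case True
      then have "r ^ k \<le> 1" using that by (intro power_le_one)
      then show ?thesis using that by (simp add: add_increasing2)
    next
      case False
      then have "r ^ k \<le> r ^ 3" using k by (intro power_increasing) auto
      then show ?thesis by simp
    qed
    then show "\<exists>K. \<forall>x y. \<bar>norm (x 0 :: 'a) ^ k\<bar> \<le> K * (1 + tuple_norm 1 x ^ 3 + tuple_norm 0 (y :: nat \<Rightarrow> 'a))"
      by (intro exI[of _ 1]) (simp add: tuple_norm_def lessThan_Suc)
  qed
  moreover have "integrability_convention H Xc Xd" using decomp by (simp add: G_Levy_decomposition_def)
  then have "\<forall>\<psi>\<in>C_loc_Lip_growth 1 0. (\<lambda>\<omega>. \<psi> (\<lambda>i. Xc t \<omega>) (\<lambda>j. Xd t \<omega>)) \<in> H"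
    unfolding integrability_convention_def
    by (elim allE[of _ 1] allE[of _ 0] allE[of _ "\<lambda>_. t"]) (use t in simp)
  ultimately have "(\<lambda>\<omega>. (\<lambda>(x :: nat \<Rightarrow> 'a) (y :: nat \<Rightarrow> 'a). norm (x 0) ^ k) (\<lambda>i. Xc t \<omega>) (\<lambda>j. Xd t \<omega>)) \<in> H"
    by (rule bspec[rotated])
  then show ?thesis by simp
qed

definition m1 where "m1 t = E (\<lambda>\<omega>. norm (Xc t \<omega>))"
definition m2 where "m2 t = E (\<lambda>\<omega>. norm (Xc t \<omega>) ^ 2)"
definition m3 where "m3 t = E (\<lambda>\<omega>. norm (Xc t \<omega>) ^ 3)"
definition md where "md t = E (\<lambda>\<omega>. norm (Xd t \<omega>))"

lemma m3_small: "((\<lambda>t. m3 t / t) \<longlongrightarrow> 0) (at_right 0)"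
  using decomp by (simp add: G_Levy_decomposition_def m3_def)

lemma md_bound: obtains C where "0 \<le> C" "\<And>t. 0 \<le> t \<Longrightarrow> md t \<le> C * t"
proof -
  obtain C where "\<And>t. 0 \<le> t \<Longrightarrow> md t \<le> C * t" using decomp by (auto simp: G_Levy_decomposition_def md_def)
  then have "md t \<le> max C 0 * t" if "0 \<le> t" for t
    using that by (meson max.cobounded1 mult_right_mono order_trans)
  then show ?thesis using that[of "max C 0"] by simp
qed

lemma moments_nonneg: assumes "0 \<le> t" shows "0 \<le> m1 t" "0 \<le> m2 t" "0 \<le> m3 t" "0 \<le> md t"
  unfolding m1_def m2_def m3_def md_def using assms
  by (auto intro!: E_bounds(2) norm_closed rv_c rv_d Xc_power_closed)

lemma short_time: obtains T where "0 < T" "T \<le> 1" "\<And>t. 0 < t \<Longrightarrow> t \<le> T \<Longrightarrow> m3 t \<le> 1"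
proof -
  have "\<forall>\<^sub>F t in at_right 0. m3 t / t < 1" using m3_small by (rule order_tendstoD) simp
  then obtain b where b: "0 < b" "\<And>t. 0 < t \<Longrightarrow> t < b \<Longrightarrow> m3 t / t < 1"
    by (auto simp: eventually_at_right_field)
  have "m3 t \<le> 1" if "0 < t" "t \<le> min 1 (b / 2)" for t
  proof -
    have "m3 t / t < 1" using that b by (intro b(2)) auto
    then have "m3 t < t" using that by (simp add: pos_divide_less_eq)
    then show ?thesis using that by simp
  qed
  then show ?thesis using that[of "min 1 (b / 2)"] b(1) by simp
qed

lemma m1_le: assumes "0 \<le> t" "0 < \<delta>" shows "m1 t \<le> \<delta> + m3 t / \<delta>\<^sup>2"
proof -
  \<comment> \<open>Either \<open>r \<le> \<delta>\<close>, or the cubic term alone exceeds \<open>r\<close>.\<close>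
  have "r \<le> (1 / \<delta>\<^sup>2) * r ^ 3 + \<delta>" if "0 \<le> r" for r :: real
  proof (cases "r \<le> \<delta>")
    case True then show ?thesis using that by (simp add: add_increasing)
  next
    case False
    then have "r * \<delta>\<^sup>2 \<le> r * r\<^sup>2" using that assms by (intro mult_left_mono power_mono) auto
    then have "r \<le> (1 / \<delta>\<^sup>2) * r ^ 3" using assms by (simp add: field_simps power2_eq_square power3_eq_cube)
    then show ?thesis using assms by simp
  qed
  then have "m1 t \<le> E (\<lambda>\<omega>. (1 / \<delta>\<^sup>2) * norm (Xc t \<omega>) ^ 3 + \<delta>)"
    unfolding m1_def using assms
    by (intro mono add_closed scale_closed const_closed norm_closed rv_c Xc_power_closed) auto
  also have "\<dots> = (1 / \<delta>\<^sup>2) * m3 t + \<delta>" unfolding m3_def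
    using assms by (intro E_affine Xc_power_closed) auto
  finally show ?thesis by simp
qed

lemma m2_le: assumes "0 \<le> t" shows "m2 t \<le> 1 + m3 t"
proof -
  have "r ^ 2 \<le> 1 * r ^ 3 + 1" if "0 \<le> r" for r :: real
  proof (cases "r \<le> 1")
    case True
    then have "r ^ 2 \<le> 1" using that by (intro power_le_one)
    then show ?thesis using that by (simp add: add_increasing)
  next
    case False
    then have "r ^ 2 \<le> r ^ 3" by (intro power_increasing) auto
    then show ?thesis by simp
  qed
  then have "m2 t \<le> E (\<lambda>\<omega>. 1 * norm (Xc t \<omega>) ^ 3 + 1)"
    unfolding m2_def using assms by (intro mono add_closed scale_closed const_closed Xc_power_closed) auto
  also have "\<dots> = 1 * m3 t + 1" unfolding m3_def using assms by (intro E_affine Xc_power_closed) auto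
  finally show ?thesis by simp
qed

lemma moments_tendsto_0: "((\<lambda>t. m1 t + md t) \<longlongrightarrow> 0) (at_right 0)"
proof (rule tendstoI)
  fix e :: real assume e: "0 < e"
  obtain C where C: "0 \<le> C" "\<And>t. 0 \<le> t \<Longrightarrow> md t \<le> C * t" by (rule md_bound, rule that)
  \<comment> \<open>For small \<open>t\<close> the third moment is below \<open>\<delta> ^ 3\<close>, so \<open>m1_le\<close> gives \<open>2 * \<delta>\<close>.\<close>
  define \<delta> where "\<delta> = e / 4"
  have \<delta>: "0 < \<delta>" using e by (simp add: \<delta>_def)
  have 1: "\<forall>\<^sub>F t in at_right 0. m3 t / t < \<delta> ^ 3" using m3_small by (rule order_tendstoD) (use \<delta> in simp)
  have 2: "\<forall>\<^sub>F t in at_right 0. t < (1 :: real)"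
    by (auto simp: eventually_at_right_field intro!: exI[of _ 1])
  have 3: "\<forall>\<^sub>F t in at_right 0. t < \<delta> / (C + 1)"
    using \<delta> C by (auto simp: eventually_at_right_field intro!: exI[of _ "\<delta> / (C + 1)"])
  have 4: "\<forall>\<^sub>F t in at_right 0. (0 :: real) < t" by (rule eventually_at_right_less)
  from 1 2 3 4 show "\<forall>\<^sub>F t in at_right 0. dist (m1 t + md t) 0 < e"
  proof eventually_elim
    case (elim t)
    have "m3 t < \<delta> ^ 3 * t" using elim by (simp add: pos_divide_less_eq)
    also have "\<dots> \<le> \<delta> ^ 3 * 1" using elim \<delta> by (intro mult_left_mono) auto
    finally have "m3 t / \<delta>\<^sup>2 \<le> \<delta>" using \<delta> by (simp add: pos_divide_le_eq power2_eq_square power3_eq_cube)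
    then have "m1 t \<le> 2 * \<delta>" using m1_le[of t \<delta>] elim \<delta> by simp
    moreover have "md t < \<delta>"
    proof -
      have "md t \<le> C * t" using C elim by simp
      also have "\<dots> \<le> (C + 1) * t" using elim by simp
      also have "\<dots> < \<delta>" using elim(3) C by (simp add: pos_less_divide_eq mult.commute)
      finally show ?thesis .
    qed
    ultimately show ?case using moments_nonneg[of t] elim \<delta> by (simp add: \<delta>_def)
  qed
qed

lemma inner_Lipschitz: "(norm p)-lipschitz_on UNIV (\<lambda>x :: 'a. p \<bullet> x)"
proof (rule lipschitz_onI)
  fix x y :: 'a
  have "p \<bullet> x - p \<bullet> y = p \<bullet> (x - y)" by (simp add: inner_diff_right)
  then show "dist (p \<bullet> x) (p \<bullet> y) \<le> norm p * dist x y"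
    using Cauchy_Schwarz_ineq2[of p "x - y"] by (simp add: dist_norm)
qed simp

lemma inner_closed: "0 \<le> t \<Longrightarrow> (\<lambda>\<omega>. p \<bullet> Xc t \<omega>) \<in> H"
  by (rule Lip_vector_closed[OF rv_c inner_Lipschitz])

text \<open>The functional is not linear, but the inner expectation over the later increment is
  a constant added to the earlier value, so means are exactly additive.\<close>

lemma mean_additive:
  assumes "0 < t" "0 < s"
  shows "E (\<lambda>\<omega>. p \<bullet> Xc (t + s) \<omega>) = E (\<lambda>\<omega>. p \<bullet> Xc t \<omega>) + E (\<lambda>\<omega>. p \<bullet> Xc s \<omega>)"
proof -
  let ?\<phi> = "\<lambda>(x :: 'a \<times> 'a) (y :: 'a \<times> 'a). p \<bullet> (fst x + fst y)"
  have L: "(norm p * 2)-lipschitz_on UNIV (\<lambda>(x, y). ?\<phi> x y)"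
  proof (rule lipschitz_onI)
    fix a b :: "('a \<times> 'a) \<times> ('a \<times> 'a)"
    obtain x y where a: "a = (x, y)" by (cases a)
    obtain x' y' where b: "b = (x', y')" by (cases b)
    have "dist (fst x) (fst x') \<le> dist a b" "dist (fst y) (fst y') \<le> dist a b"
      using dist_fst_le[of x x'] dist_fst_le[of y y'] dist_fst_le[of a b] dist_snd_le[of a b] by (auto simp: a b)
    moreover have "norm (fst x + fst y - (fst x' + fst y')) \<le> dist (fst x) (fst x') + dist (fst y) (fst y')"
      using norm_triangle_ineq[of "fst x - fst x'" "fst y - fst y'"] by (simp add: dist_norm algebra_simps)
    ultimately have "dist (fst x + fst y) (fst x' + fst y') \<le> 2 * dist a b" by (simp add: dist_norm)
    then have "norm p * dist (fst x + fst y) (fst x' + fst y') \<le> norm p * (2 * dist a b)" by (intro mult_left_mono) auto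
    then show "dist ((\<lambda>(x, y). ?\<phi> x y) a) ((\<lambda>(x, y). ?\<phi> x y) b) \<le> (norm p * 2) * dist a b"
      using lipschitz_onD[OF inner_Lipschitz[of p], of "fst x + fst y" "fst x' + fst y'"] by (simp add: a b)
  qed simp
  from Levy_independent_increment[OF Levy assms this]
  have "E (\<lambda>\<omega>. p \<bullet> Xc (t + s) \<omega>) = E (\<lambda>\<omega>. E (\<lambda>\<omega>'. p \<bullet> (Xc t \<omega> + Xc s \<omega>')))" by simp
  also have "\<dots> = E (\<lambda>\<omega>. E (\<lambda>\<omega>'. p \<bullet> Xc s \<omega>' + p \<bullet> Xc t \<omega>))" by (simp add: inner_add_right add.commute)
  also have "\<dots> = E (\<lambda>\<omega>. p \<bullet> Xc t \<omega> + E (\<lambda>\<omega>'. p \<bullet> Xc s \<omega>'))"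
    using inner_closed[of s p] assms by (simp add: E_add_const add.commute)
  finally show ?thesis using inner_closed[of t p] assms by (simp add: E_add_const)
qed

lemma mean_multiple:
  assumes "0 < s" "1 \<le> n"
  shows "E (\<lambda>\<omega>. p \<bullet> Xc (real n * s) \<omega>) = real n * E (\<lambda>\<omega>. p \<bullet> Xc s \<omega>)"
  using assms(2)
proof (induction n rule: dec_induct)
  case (step n)
  have "E (\<lambda>\<omega>. p \<bullet> Xc (real n * s + s) \<omega>) = E (\<lambda>\<omega>. p \<bullet> Xc (real n * s) \<omega>) + E (\<lambda>\<omega>. p \<bullet> Xc s \<omega>)"
    using step assms by (intro mean_additive) auto
  then show ?case using step by (simp add: algebra_simps)
qed simp

text \<open>Additivity transports a bound of the mean at times between \<open>T / 2\<close> and \<open>T\<close> to all smaller times \<open>s\<close>: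
  some multiple of \<open>s\<close> lies in that range.\<close>

lemma first_moment:
  obtains C T where "0 \<le> C" "0 < T" "\<And>p s. 0 < s \<Longrightarrow> s \<le> T \<Longrightarrow> E (\<lambda>\<omega>. p \<bullet> Xc s \<omega>) \<le> C * norm p * s"
proof -
  obtain T where T: "0 < T" "T \<le> 1" "\<And>t. 0 < t \<Longrightarrow> t \<le> T \<Longrightarrow> m3 t \<le> 1" by (rule short_time, rule that)
  have "E (\<lambda>\<omega>. p \<bullet> Xc s \<omega>) \<le> (4 / T) * norm p * s" if s: "0 < s" "s \<le> T" for p s
  proof -
    obtain n where n: "1 \<le> n" "real n * s \<le> T" "T \<le> 2 * (real n * s)" using subdivision[OF s] by blast
    have ns: "0 < real n * s" using n(1) s by simp
    have "E (\<lambda>\<omega>. p \<bullet> Xc (real n * s) \<omega>) \<le> E (\<lambda>\<omega>. norm p * norm (Xc (real n * s) \<omega>))"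
      using ns by (intro mono scale_closed norm_closed rv_c inner_closed) (auto simp: norm_cauchy_schwarz)
    also have "\<dots> = norm p * m1 (real n * s)" unfolding m1_def using ns by (intro pos_homogeneous norm_closed rv_c) auto
    also have "\<dots> \<le> norm p * 2" using m1_le[of "real n * s" 1] T(3)[OF ns n(2)] ns by (intro mult_left_mono) auto
    finally have "real n * E (\<lambda>\<omega>. p \<bullet> Xc s \<omega>) \<le> norm p * 2" using mean_multiple[OF s(1) n(1)] by simp
    then have "E (\<lambda>\<omega>. p \<bullet> Xc s \<omega>) \<le> norm p * 2 / real n" using n(1) by (simp add: pos_le_divide_eq mult.commute)
    also have "\<dots> \<le> norm p * 2 / (T / (2 * s))"
      using n s T(1) by (intro divide_left_mono mult_pos_pos divide_pos_pos) (auto simp: pos_divide_le_eq mult_ac)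
    also have "\<dots> = (4 / T) * norm p * s" by simp
    finally show ?thesis .
  qed
  then show ?thesis using that[of "4 / T" T] T(1) by simp
qed

text \<open>The square is not Lipschitz, so independence applies only to its truncation; the third moments pay
  for the difference, with a factor that vanishes as \<open>N\<close> grows.\<close>

lemma truncated_square:
  fixes a z :: 'a
  assumes N: "0 < N"
  shows "norm z ^ 2 \<le> (min (norm (a + z)) N)\<^sup>2 - norm a ^ 2 + ((- 2) *\<^sub>R a) \<bullet> z + (4 / N) * norm a ^ 3 + (4 / N) * norm z ^ 3"
proof -
  have "r\<^sup>2 \<le> (min r N)\<^sup>2 + r ^ 3 / N" if "0 \<le> r" for r
  proof (cases "r \<le> N")
    case True then show ?thesis using that N by (simp add: min_absorb1)
  next
    case False
    then have "N * r\<^sup>2 \<le> r * r\<^sup>2" by (intro mult_right_mono) auto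
    then have "r\<^sup>2 \<le> r ^ 3 / N" using N by (simp add: pos_le_divide_eq power2_eq_square power3_eq_cube mult_ac)
    then show ?thesis by (simp add: add_increasing)
  qed
  from this[of "norm (a + z)"]
  have "(norm (a + z))\<^sup>2 \<le> (min (norm (a + z)) N)\<^sup>2 + norm (a + z) ^ 3 / N" by simp
  moreover have "norm (a + z) ^ 3 / N \<le> (4 * (norm a ^ 3 + norm z ^ 3)) / N"
    using cube_norm_le N by (intro divide_right_mono) auto
  moreover have "(norm (a + z))\<^sup>2 = norm a ^ 2 + 2 * (a \<bullet> z) + norm z ^ 2"
    by (simp add: power2_norm_eq_inner inner_add_left inner_add_right inner_commute)
  ultimately show ?thesis by (simp add: add_divide_distrib)
qed

text \<open>Expand the square of the sum of two increments.  The cross term has a mean of order \<open>s\<close> by the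
  first moment bound, and the truncation error vanishes in the limit.\<close>

lemma second_moment_superadditive:
  assumes C: "0 \<le> C" "\<And>p. E (\<lambda>\<omega>. p \<bullet> Xc s \<omega>) \<le> C * norm p * s" and t: "0 < t" "0 < s"
  shows "m2 t + m2 s \<le> m2 (t + s) + 2 * C * s * m1 t"
proof -
  have step: "m2 t + m2 s \<le> m2 (t + s) + 2 * C * s * m1 t + (4 * (m3 t + m3 s)) * (1 / N)" if N: "0 < N" for N
  proof -
    let ?\<phi> = "\<lambda>(x :: 'a \<times> 'a) (y :: 'a \<times> 'a). (min (norm (fst x + fst y)) N)\<^sup>2"
    have L: "(4 * N)-lipschitz_on UNIV (\<lambda>(x, y). ?\<phi> x y)"
    proof (rule lipschitz_onI)
      fix a b :: "('a \<times> 'a) \<times> ('a \<times> 'a)"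
      obtain x y where a: "a = (x, y)" by (cases a)
      obtain x' y' where b: "b = (x', y')" by (cases b)
      have "dist (fst x) (fst x') \<le> dist a b" "dist (fst y) (fst y') \<le> dist a b"
        using dist_fst_le[of x x'] dist_fst_le[of y y'] dist_fst_le[of a b] dist_snd_le[of a b] by (auto simp: a b)
      moreover have "norm (fst x + fst y - (fst x' + fst y')) \<le> dist (fst x) (fst x') + dist (fst y) (fst y')"
        using norm_triangle_ineq[of "fst x - fst x'" "fst y - fst y'"] by (simp add: dist_norm algebra_simps)
      moreover have "\<bar>norm (fst x + fst y) - norm (fst x' + fst y')\<bar> \<le> norm (fst x + fst y - (fst x' + fst y'))"
        by (rule norm_triangle_ineq3)
      ultimately have d: "\<bar>min (norm (fst x + fst y)) N - min (norm (fst x' + fst y')) N\<bar> \<le> 2 * dist a b"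
        by (auto simp: min_def)
      have "\<bar>(min u N)\<^sup>2 - (min v N)\<^sup>2\<bar> \<le> (2 * N) * \<bar>min u N - min v N\<bar>" if "0 \<le> u" "0 \<le> v" for u v
      proof -
        have "(min u N)\<^sup>2 - (min v N)\<^sup>2 = (min u N + min v N) * (min u N - min v N)" by (simp add: power2_eq_square algebra_simps)
        moreover have "\<bar>min u N + min v N\<bar> \<le> 2 * N" using that N by auto
        ultimately show ?thesis by (simp add: abs_mult mult_right_mono)
      qed
      from this[of "norm (fst x + fst y)" "norm (fst x' + fst y')"]
      have "\<bar>(min (norm (fst x + fst y)) N)\<^sup>2 - (min (norm (fst x' + fst y')) N)\<^sup>2\<bar> \<le> (2 * N) * (2 * dist a b)"
        by (rule order_trans[OF _ mult_left_mono[OF d]]) (use N in auto)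
      then show "dist ((\<lambda>(x, y). ?\<phi> x y) a) ((\<lambda>(x, y). ?\<phi> x y) b) \<le> (4 * N) * dist a b"
        by (simp add: a b dist_real_def)
    qed (use N in simp)
    define \<Phi> where "\<Phi> = (\<lambda>x. E (\<lambda>\<omega>'. ?\<phi> x (Xc s \<omega>', Xd s \<omega>')))"
    have \<Phi>H: "(\<lambda>\<omega>. \<Phi> (Xc t \<omega>, Xd t \<omega>)) \<in> H" unfolding \<Phi>_def
      by (rule Lip_vector_closed[OF rv E_Lipschitz[OF rv L]]) (use t in auto)
    have \<phi>H: "(\<lambda>\<omega>'. ?\<phi> x (Xc s \<omega>', Xd s \<omega>')) \<in> H" for x
      by (rule Lip_vector_closed[OF rv Lipschitz_section(1)[OF L]]) (use t in auto)
    note cl = add_closed scale_closed const_closed norm_closed rv_c Xc_power_closed inner_closed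
    have inner: "norm a ^ 2 + m2 s \<le> \<Phi> (a, a') + 2 * C * s * norm a + (4 / N) * norm a ^ 3 + (4 / N) * m3 s" for a a'
    proof -
      let ?c = "- (norm a ^ 2) + (4 / N) * norm a ^ 3"
      have "m2 s \<le> E (\<lambda>\<omega>'. ?\<phi> (a, a') (Xc s \<omega>', Xd s \<omega>') + ?c)
          + E (\<lambda>\<omega>'. ((- 2) *\<^sub>R a) \<bullet> Xc s \<omega>' + (4 / N) * norm (Xc s \<omega>') ^ 3)"
        unfolding m2_def
      proof (rule E_dominated[OF _ add_closed[OF \<phi>H const_closed]])
        show "(\<lambda>\<omega>. norm (Xc s \<omega>) ^ 2) \<in> H" using t by (intro cl) auto
        show "(\<lambda>\<omega>'. ((- 2) *\<^sub>R a) \<bullet> Xc s \<omega>' + (4 / N) * norm (Xc s \<omega>') ^ 3) \<in> H" using t by (intro cl) auto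
        show "norm (Xc s \<omega>') ^ 2 \<le> ?\<phi> (a, a') (Xc s \<omega>', Xd s \<omega>') + ?c
            + (((- 2) *\<^sub>R a) \<bullet> Xc s \<omega>' + (4 / N) * norm (Xc s \<omega>') ^ 3)" for \<omega>'
          using truncated_square[OF N, where a = a and z = "Xc s \<omega>'"] by simp
      qed
      moreover have "E (\<lambda>\<omega>'. ?\<phi> (a, a') (Xc s \<omega>', Xd s \<omega>') + ?c) = \<Phi> (a, a') + ?c"
        unfolding \<Phi>_def by (rule E_add_const[OF \<phi>H])
      moreover have "E (\<lambda>\<omega>'. ((- 2) *\<^sub>R a) \<bullet> Xc s \<omega>' + (4 / N) * norm (Xc s \<omega>') ^ 3)
          \<le> E (\<lambda>\<omega>'. ((- 2) *\<^sub>R a) \<bullet> Xc s \<omega>') + E (\<lambda>\<omega>'. (4 / N) * norm (Xc s \<omega>') ^ 3)"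
        using t by (intro E_add_le cl) auto
      moreover have "E (\<lambda>\<omega>'. ((- 2) *\<^sub>R a) \<bullet> Xc s \<omega>') \<le> 2 * C * s * norm a"
        using C(2)[of "(- 2) *\<^sub>R a"] by (simp add: mult_ac)
      moreover have "E (\<lambda>\<omega>'. (4 / N) * norm (Xc s \<omega>') ^ 3) = (4 / N) * m3 s"
        unfolding m3_def using t N by (intro pos_homogeneous cl) auto
      ultimately show ?thesis by linarith
    qed
    have "m2 t + m2 s = E (\<lambda>\<omega>. norm (Xc t \<omega>) ^ 2 + m2 s)"
      unfolding m2_def[of t] using t by (subst E_add_const) (auto intro!: cl)
    also have "\<dots> \<le> E (\<lambda>\<omega>. \<Phi> (Xc t \<omega>, Xd t \<omega>) + (4 / N) * m3 s)
        + E (\<lambda>\<omega>. (2 * C * s) * norm (Xc t \<omega>) + (4 / N) * norm (Xc t \<omega>) ^ 3)"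
    proof (rule E_dominated[OF _ add_closed[OF \<Phi>H const_closed]])
      show "(\<lambda>\<omega>. norm (Xc t \<omega>) ^ 2 + m2 s) \<in> H" using t by (intro cl) auto
      show "(\<lambda>\<omega>. (2 * C * s) * norm (Xc t \<omega>) + (4 / N) * norm (Xc t \<omega>) ^ 3) \<in> H" using t by (intro cl) auto
      show "norm (Xc t \<omega>) ^ 2 + m2 s \<le> \<Phi> (Xc t \<omega>, Xd t \<omega>) + (4 / N) * m3 s
          + ((2 * C * s) * norm (Xc t \<omega>) + (4 / N) * norm (Xc t \<omega>) ^ 3)" for \<omega>
        using inner[of "Xc t \<omega>" "Xd t \<omega>"] by simp
    qed
    also have "E (\<lambda>\<omega>. \<Phi> (Xc t \<omega>, Xd t \<omega>) + (4 / N) * m3 s) = E (\<lambda>\<omega>. \<Phi> (Xc t \<omega>, Xd t \<omega>)) + (4 / N) * m3 s"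
      by (rule E_add_const[OF \<Phi>H])
    also have "E (\<lambda>\<omega>. (2 * C * s) * norm (Xc t \<omega>) + (4 / N) * norm (Xc t \<omega>) ^ 3)
        \<le> E (\<lambda>\<omega>. (2 * C * s) * norm (Xc t \<omega>)) + E (\<lambda>\<omega>. (4 / N) * norm (Xc t \<omega>) ^ 3)"
      using t by (intro E_add_le cl) auto
    also have "E (\<lambda>\<omega>. (2 * C * s) * norm (Xc t \<omega>)) = (2 * C * s) * m1 t"
      unfolding m1_def using t C by (intro pos_homogeneous cl) auto
    also have "E (\<lambda>\<omega>. (4 / N) * norm (Xc t \<omega>) ^ 3) = (4 / N) * m3 t"
      unfolding m3_def using t N by (intro pos_homogeneous cl) auto
    also have "E (\<lambda>\<omega>. \<Phi> (Xc t \<omega>, Xd t \<omega>)) = E (\<lambda>\<omega>. (min (norm (Xc (t + s) \<omega>)) N)\<^sup>2)"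
      using Levy_independent_increment[OF Levy t L] by (simp add: \<Phi>_def)
    also have "E (\<lambda>\<omega>. (min (norm (Xc (t + s) \<omega>)) N)\<^sup>2) \<le> m2 (t + s)"
    proof -
      have "(\<lambda>\<omega>. ?\<phi> 0 (Xc (t + s) \<omega>, Xd (t + s) \<omega>)) \<in> H"
        by (rule Lip_vector_closed[OF rv Lipschitz_section(1)[OF L]]) (use t in auto)
      then show ?thesis unfolding m2_def using t N by (intro mono cl) (auto intro!: power_mono)
    qed
    finally show ?thesis by (simp add: algebra_simps add_divide_distrib)
  qed
  have "((\<lambda>N. m2 (t + s) + 2 * C * s * m1 t + (4 * (m3 t + m3 s)) * (1 / N)) \<longlongrightarrow>
      m2 (t + s) + 2 * C * s * m1 t + (4 * (m3 t + m3 s)) * 0) at_top"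
    by (intro tendsto_intros tendsto_divide_0[OF tendsto_const] filterlim_at_top_imp_at_infinity filterlim_ident)
  moreover have "\<forall>\<^sub>F N in at_top. m2 t + m2 s \<le> m2 (t + s) + 2 * C * s * m1 t + (4 * (m3 t + m3 s)) * (1 / N)"
    using eventually_gt_at_top[of "0 :: real"] by eventually_elim (rule step)
  ultimately show ?thesis using tendsto_lowerbound[OF _ _ trivial_limit_at_top_linorder] by fastforce
qed

text \<open>Superadditivity bounds \<open>n\<close> times the second moment at time \<open>s\<close> by the one at time
  \<open>n * s\<close>, which is of order one, so the former is of order \<open>1 / n\<close>, that is, of order \<open>s\<close>.\<close>

lemma second_moment:
  obtains C T where "0 \<le> C" "0 < T" "\<And>s. 0 < s \<Longrightarrow> s \<le> T \<Longrightarrow> m2 s \<le> C * s"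
proof -
  obtain C1 T1 where C1: "0 \<le> C1" "0 < T1" "\<And>p s. 0 < s \<Longrightarrow> s \<le> T1 \<Longrightarrow> E (\<lambda>\<omega>. p \<bullet> Xc s \<omega>) \<le> C1 * norm p * s"
    by (rule first_moment, rule that)
  obtain T2 where T2: "0 < T2" "T2 \<le> 1" "\<And>t. 0 < t \<Longrightarrow> t \<le> T2 \<Longrightarrow> m3 t \<le> 1" by (rule short_time, rule that)
  define T where "T = min T1 T2"
  have T: "0 < T" "T \<le> T1" "T \<le> T2" using C1(2) T2(1) by (auto simp: T_def)
  have m1: "m1 t \<le> 2" if "0 < t" "t \<le> T" for t using m1_le[of t 1] T2(3)[of t] that T by simp
  have "m2 s \<le> (4 / T + 4 * C1) * s" if s: "0 < s" "s \<le> T" for s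
  proof -
    have CC: "E (\<lambda>\<omega>. p \<bullet> Xc s \<omega>) \<le> C1 * norm p * s" for p using C1(3) s T by simp
    have mult: "real n * s \<le> T \<longrightarrow> real n * m2 s \<le> m2 (real n * s) + real n * (4 * C1 * s)" if "1 \<le> n" for n
      using that
    proof (induction n rule: dec_induct)
      case base
      show ?case using C1(1) s by simp
    next
      case (step n)
      show ?case
      proof
        assume le: "real (Suc n) * s \<le> T"
        have ns: "0 < real n * s" "real n * s \<le> T" using step(1) s le by (auto simp: algebra_simps)
        have "m2 (real n * s) + m2 s \<le> m2 (real n * s + s) + 2 * C1 * s * m1 (real n * s)"
          by (rule second_moment_superadditive[OF C1(1) CC ns(1) s(1)])
        also have "2 * C1 * s * m1 (real n * s) \<le> 2 * C1 * s * 2"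
          using m1[OF ns] C1(1) s by (intro mult_left_mono) auto
        finally have "m2 (real n * s) + m2 s \<le> m2 (real n * s + s) + 4 * C1 * s" by simp
        moreover have "real n * m2 s \<le> m2 (real n * s) + real n * (4 * C1 * s)" using step(3) ns(2) by simp
        moreover have e: "real (Suc n) * s = real n * s + s" "real (Suc n) * m2 s = real n * m2 s + m2 s"
          "real (Suc n) * (4 * C1 * s) = real n * (4 * C1 * s) + 4 * C1 * s" by (auto simp: algebra_simps)
        ultimately show "real (Suc n) * m2 s \<le> m2 (real (Suc n) * s) + real (Suc n) * (4 * C1 * s)"
          unfolding e by linarith
      qed
    qed
    obtain n where n: "1 \<le> n" "real n * s \<le> T" "T \<le> 2 * (real n * s)" using subdivision[OF s] by blast
    have ns: "0 < real n * s" using n(1) s by simp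
    have "m2 (real n * s) \<le> 2" using m2_le[of "real n * s"] T2(3)[OF ns] n(2) T ns by simp
    then have "real n * m2 s \<le> 2 + real n * (4 * C1 * s)" using mult[OF n(1)] n(2) by simp
    also have "2 \<le> real n * (4 / T * s)" using n(3) T(1) by (simp add: pos_le_divide_eq mult.commute mult.left_commute)
    finally have "real n * m2 s \<le> real n * ((4 / T + 4 * C1) * s)" by (simp add: algebra_simps)
    then show ?thesis using n(1) by simp
  qed
  moreover have "0 \<le> 4 / T + 4 * C1" using T C1(1) by simp
  ultimately show ?thesis using that T(1) by blast
qed

end

section \<open>Existence of the generator limit\<close>

lemma Sm_increment: "Sm (Suc k) K h \<Longrightarrow> Sm k (norm_l1 y * K) (\<lambda>x. h (y + x) - h x)"
proof (induction k arbitrary: h)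
  case 0
  have "continuous_on UNIV (\<lambda>x. h (y + x) - h x)"
    by (intro continuous_intros continuous_on_compose2[OF Sm_continuous[OF 0]]) auto
  then show ?case using Sm_Lipschitz[OF 0, of _ y] by (simp add: Sm.simps add.commute)
next
  case (Suc k)
  have D: "h differentiable (at x)" for x using Sm_differentiable[OF Suc.prems] .
  have der: "((\<lambda>x. h (y + x) - h x) has_derivative (\<lambda>b. pd b h (y + x) - pd b h x)) (at x)" for x
    by (intro has_derivative_diff has_derivative_pd[OF D]
          has_derivative_compose[of "\<lambda>x. y + x" "\<lambda>b. b" x UNIV h, OF _ has_derivative_pd[OF D]])
       (auto intro!: derivative_eq_intros)
  have "pd b (\<lambda>x. h (y + x) - h x) = (\<lambda>x. pd b h (y + x) - pd b h x)" for b
    using pd_has_derivative[OF der] by blast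
  then have "Sm k (norm_l1 y * K) (pd b (\<lambda>x. h (y + x) - h x))" if "b \<in> Basis" for b
    using Suc.IH[OF Sm_pd_Basis[OF Suc.prems that]] by simp
  moreover have "\<bar>h (y + x) - h x\<bar> \<le> norm_l1 y * K" for x
    using Sm_Lipschitz[OF Suc.prems, of x y] by (simp add: add.commute)
  ultimately show ?case using der unfolding Sm.simps differentiable_def by blast
qed

lemma Sm_Lipschitz_on:
  fixes f :: "'a::euclidean_space \<Rightarrow> real"
  assumes "Sm (Suc k) K f"
  shows "(real DIM('a) * K)-lipschitz_on UNIV f"
proof (rule lipschitz_onI)
  have K: "0 \<le> K" by (rule Sm_nonneg[OF assms])
  then show "0 \<le> real DIM('a) * K" by simp
  fix x y
  have "\<bar>f x - f y\<bar> \<le> norm_l1 (x - y) * K" using Sm_Lipschitz[OF assms, of y "x - y"] by simp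
  also have "\<dots> \<le> (real DIM('a) * norm (x - y)) * K" by (intro mult_right_mono norm_l1_le K)
  finally show "dist (f x) (f y) \<le> real DIM('a) * K * dist x y" by (simp add: dist_real_def dist_norm mult_ac)
qed

text \<open>The increment \<open>g = f (y + _) - f\<close> is of size \<open>norm y\<close> together with its derivatives.  Expanding it
  to second order in the continuous part \<open>a\<close> of the other increment, but only to first order in the jump
  part \<open>b\<close>, leaves exactly the moments that are of order \<open>s\<close>; the linear term \<open>p \<bullet> a\<close> is kept since only its mean, not its
  absolute value, is small.\<close>

lemma mixed_increment:
  fixes f :: "'a::euclidean_space \<Rightarrow> real"
  assumes f: "Sm 3 K f" and f0: "f 0 = 0"
  obtains p where "norm p \<le> (real DIM('a))^2 * K * norm y"
    "\<And>a b. \<bar>f (y + (a + b)) - f y - f (a + b) - p \<bullet> a\<bar> \<le> (real DIM('a))^3 * K * norm y * (norm a ^ 2 + norm b)"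
proof -
  define d where "d = real DIM('a)"
  have d: "1 \<le> d" by (simp add: d_def Suc_leI)
  have K: "0 \<le> K" by (rule Sm_nonneg[OF f])
  have f3: "Sm (Suc (Suc (Suc 0))) K f" using f by (simp add: numeral_3_eq_3)
  define g where "g = (\<lambda>x. f (y + x) - f x)"
  define M where "M = norm_l1 y * K"
  have M: "0 \<le> M" "M \<le> d * norm y * K"
    using K norm_l1_le[of y] by (auto simp: M_def d_def intro!: mult_right_mono)
  have Df: "f differentiable (at x)" for x using Sm_differentiable[OF f3] .
  have gS: "Sm (Suc (Suc 0)) M g" unfolding g_def M_def by (rule Sm_increment[OF f3])
  have pg: "pd b g x = pd b f (y + x) - pd b f x" for b x
  proof -
    have "((\<lambda>x. f (y + x) - f x) has_derivative (\<lambda>b. pd b f (y + x) - pd b f x)) (at x)"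
      by (intro has_derivative_diff has_derivative_pd[OF Df]
          has_derivative_compose[of "\<lambda>x. y + x" "\<lambda>b. b" x UNIV f, OF _ has_derivative_pd[OF Df]])
         (auto intro!: derivative_eq_intros)
    from pd_has_derivative[OF this] show ?thesis by (simp add: g_def)
  qed
  define p where "p = (\<Sum>b\<in>Basis. (pd b f y - pd b f 0) *\<^sub>R b)"
  have pb: "\<bar>pd b f y - pd b f 0\<bar> \<le> M" if "b \<in> Basis" for b
    using Sm_Lipschitz[OF Sm_pd_Basis[OF f3 that], of 0 y] by (simp add: M_def)
  have "norm p \<le> (\<Sum>b\<in>(Basis :: 'a set). M)" unfolding p_def
    by (rule order_trans[OF norm_sum], rule sum_mono) (use pb in simp)
  also have "\<dots> = d * M" by (simp add: d_def)
  also have "\<dots> \<le> d * (d * norm y * K)" using M d by (intro mult_left_mono) auto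
  finally have np: "norm p \<le> d^2 * K * norm y" by (simp add: power2_eq_square mult_ac)
  have "\<bar>f (y + (a + b)) - f y - f (a + b) - p \<bullet> a\<bar> \<le> d^3 * K * norm y * (norm a ^ 2 + norm b)" for a b
  proof -
    have pa: "p \<bullet> a = pd a g 0"
      by (subst pd_Basis_sum[OF Sm_differentiable[OF gS]], unfold p_def inner_sum_left)
         (intro sum.cong refl, simp add: pg inner_commute mult.commute)
    have 1: "\<bar>g (a + b) - g a\<bar> \<le> norm_l1 b * M" using Sm_Lipschitz[OF gS] .
    have 2: "\<bar>g (0 + a) - g 0 - pd a g 0\<bar> \<le> (norm_l1 a)\<^sup>2 * M"
      by (rule Sm_quadratic) (use gS in \<open>simp add: numeral_2_eq_2\<close>)
    have "f (y + (a + b)) - f y - f (a + b) - p \<bullet> a = (g (a + b) - g a) + (g (0 + a) - g 0 - pd a g 0)"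
      by (simp add: g_def f0 pa)
    also have "\<bar>\<dots>\<bar> \<le> norm_l1 b * M + (norm_l1 a)\<^sup>2 * M" using 1 2 by linarith
    also have "\<dots> \<le> (d^2 * norm b) * M + (d^2 * norm a ^ 2) * M"
    proof (intro add_mono mult_right_mono M(1))
      have "d * norm b \<le> d^2 * norm b" using d by (intro mult_right_mono) (auto simp: power2_eq_square)
      then show "norm_l1 b \<le> d^2 * norm b" using norm_l1_le[of b] by (simp add: d_def)
      show "(norm_l1 a)\<^sup>2 \<le> d^2 * norm a ^ 2" using norm_l1_sq_le[of a] by (simp add: d_def)
    qed
    also have "\<dots> = d^2 * (norm a ^ 2 + norm b) * M" by (simp add: algebra_simps)
    also have "\<dots> \<le> d^2 * (norm a ^ 2 + norm b) * (d * norm y * K)" using M by (intro mult_left_mono) auto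
    finally show ?thesis by (simp add: power2_eq_square power3_eq_cube mult_ac)
  qed
  then show ?thesis using that[of p] np by (simp add: d_def)
qed

lemma limit_from_approximations:
  fixes h :: "'b \<Rightarrow> real"
  assumes F: "F \<noteq> bot" and ap: "\<And>\<epsilon>. 0 < \<epsilon> \<Longrightarrow> \<exists>L. \<forall>\<^sub>F s in F. \<bar>h s - L\<bar> \<le> \<epsilon>"
  shows "\<exists>l. (h \<longlongrightarrow> l) F"
proof -
  have "\<exists>L. \<forall>\<^sub>F s in F. \<bar>h s - L\<bar> \<le> inverse (real (Suc n))" for n by (rule ap) simp
  then obtain L where L: "\<And>n. \<forall>\<^sub>F s in F. \<bar>h s - L n\<bar> \<le> inverse (real (Suc n))" by metis
  have LL: "\<bar>L n - L m\<bar> \<le> inverse (real (Suc n)) + inverse (real (Suc m))" for n m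
  proof -
    have "\<forall>\<^sub>F s in F. \<bar>L n - L m\<bar> \<le> inverse (real (Suc n)) + inverse (real (Suc m))"
      using L[of n] L[of m] by eventually_elim linarith
    then show ?thesis using F by (simp add: eventually_const)
  qed
  have small: "\<exists>N. \<forall>n\<ge>N. inverse (real (Suc n)) < e" if "0 < e" for e :: real
    using order_tendstoD(2)[OF LIMSEQ_inverse_real_of_nat that] by (simp add: eventually_sequentially)
  have "Cauchy L"
  proof (rule CauchyI)
    fix e :: real assume "0 < e"
    then obtain N where N: "\<And>n. n \<ge> N \<Longrightarrow> inverse (real (Suc n)) < e / 2" using small[of "e / 2"] by auto
    have "norm (L m - L n) < e" if "m \<ge> N" "n \<ge> N" for m n
      using LL[of m n] N[OF that(1)] N[OF that(2)] by simp
    then show "\<exists>M. \<forall>m\<ge>M. \<forall>n\<ge>M. norm (L m - L n) < e" by blast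
  qed
  then obtain l where l: "L \<longlonglongrightarrow> l" using Cauchy_convergent convergent_def by blast
  have "(h \<longlongrightarrow> l) F"
  proof (rule tendstoI)
    fix e :: real assume e: "0 < e"
    obtain N1 where N1: "\<And>n. n \<ge> N1 \<Longrightarrow> inverse (real (Suc n)) < e / 2" using small[of "e / 2"] e by auto
    obtain N2 where N2: "\<And>n. n \<ge> N2 \<Longrightarrow> \<bar>L n - l\<bar> < e / 2" using LIMSEQ_D[OF l, of "e / 2"] e by auto
    define n where "n = max N1 N2"
    from L[of n] show "\<forall>\<^sub>F s in F. dist (h s) l < e"
    proof eventually_elim
      case (elim s)
      moreover have "inverse (real (Suc n)) < e / 2" "\<bar>L n - l\<bar> < e / 2"
        by (rule N1, simp add: n_def) (rule N2, simp add: n_def)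
      ultimately show ?case unfolding dist_real_def by linarith
    qed
  qed
  then show ?thesis by blast
qed

text \<open>A variant of Fekete's lemma.  Chaining \<open>n\<close> steps of length \<open>s\<close> inside \<open>[0, \<tau>]\<close> costs at most
  \<open>C * \<tau> * e\<close>, where \<open>e\<close> bounds \<open>w\<close> on \<open>[0, \<tau>]\<close>, so \<open>a s / s\<close> is close to \<open>a \<tau> / \<tau>\<close> for all
  sufficiently small \<open>s\<close>; the remainder, an interval shorter than \<open>s\<close>, is harmless because \<open>a\<close> vanishes
  at \<open>0\<close>.\<close>

lemma almost_additive_limit:
  fixes a w :: "real \<Rightarrow> real"
  assumes T: "0 < T" and C: "0 \<le> C"
    and add: "\<And>t s. 0 < t \<Longrightarrow> 0 < s \<Longrightarrow> s \<le> T \<Longrightarrow> \<bar>a (t + s) - a t - a s\<bar> \<le> C * s * w t"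
    and w0: "(w \<longlongrightarrow> 0) (at_right 0)" and a0: "(a \<longlongrightarrow> 0) (at_right 0)"
  shows "\<exists>l. ((\<lambda>s. a s / s) \<longlongrightarrow> l) (at_right 0)"
proof (rule limit_from_approximations)
  show "at_right (0 :: real) \<noteq> bot" by simp
  fix \<epsilon> :: real assume eps: "0 < \<epsilon>"
  \<comment> \<open>The errors below add up to \<open>2 * C * \<tau> * e + 2 * \<tau> * e\<close>, which is \<open>\<tau> * \<epsilon>\<close>.\<close>
  define e where "e = \<epsilon> / (2 * (C + 1))"
  have e: "0 < e" "2 * (C + 1) * e = \<epsilon>" using eps C by (auto simp: e_def)
  have "\<forall>\<^sub>F t in at_right 0. w t < e" using w0 e(1) by (rule order_tendstoD(2))
  then obtain \<tau>0 where \<tau>0: "0 < \<tau>0" "\<And>t. 0 < t \<Longrightarrow> t < \<tau>0 \<Longrightarrow> w t < e" by (auto simp: eventually_at_right_field)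
  define \<tau> where "\<tau> = min T (\<tau>0 / 2)"
  have \<tau>: "0 < \<tau>" "\<tau> \<le> T" using T \<tau>0 by (auto simp: \<tau>_def)
  have w: "w t \<le> e" if "0 < t" "t \<le> \<tau>" for t
  proof -
    have "t < \<tau>0" using that \<tau>0(1) by (auto simp: \<tau>_def)
    then show ?thesis using \<tau>0(2)[of t] that by simp
  qed
  have "\<forall>\<^sub>F s in at_right 0. \<bar>a s\<bar> < e * \<tau>"
    using tendsto_rabs[OF a0] e(1) \<tau>(1) by (intro order_tendstoD(2)[of _ "\<bar>0\<bar>"]) auto
  then obtain \<sigma> where \<sigma>: "0 < \<sigma>" "\<And>s. 0 < s \<Longrightarrow> s < \<sigma> \<Longrightarrow> \<bar>a s\<bar> < e * \<tau>" by (auto simp: eventually_at_right_field)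
  have main: "\<bar>a s / s - a \<tau> / \<tau>\<bar> \<le> \<epsilon>" if s: "0 < s" "s < min \<sigma> \<tau>" for s
  proof -
    have add': "\<bar>a (t + r) - a t - a r\<bar> \<le> C * r * e" if "0 < t" "t \<le> \<tau>" "0 < r" "r \<le> \<tau>" for t r
    proof -
      have "C * r * w t \<le> C * r * e" using w[OF that(1,2)] C that by (intro mult_left_mono) auto
      then show ?thesis using add[of t r] that \<tau> by simp
    qed
    have mult: "real n * s \<le> \<tau> \<longrightarrow> \<bar>a (real n * s) - real n * a s\<bar> \<le> real n * (C * s * e)" if "1 \<le> n" for n
      using that
    proof (induction n rule: dec_induct)
      case base
      show ?case using C s e by simp
    next
      case (step n)
      show ?case
      proof
        assume le: "real (Suc n) * s \<le> \<tau>"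
        have ns: "0 < real n * s" "real n * s \<le> \<tau>" using step(1) s le by (auto simp: algebra_simps)
        have "\<bar>a (real n * s + s) - a (real n * s) - a s\<bar> \<le> C * s * e" using ns s by (intro add') auto
        moreover have "\<bar>a (real n * s) - real n * a s\<bar> \<le> real n * (C * s * e)" using step(3) ns(2) by simp
        moreover have e: "real (Suc n) * s = real n * s + s" "real (Suc n) * a s = real n * a s + a s"
          "real (Suc n) * (C * s * e) = real n * (C * s * e) + C * s * e" by (auto simp: algebra_simps)
        ultimately show "\<bar>a (real (Suc n) * s) - real (Suc n) * a s\<bar> \<le> real (Suc n) * (C * s * e)"
          unfolding e by linarith
      qed
    qed
    have sT: "s \<le> \<tau>" using s by simp
    obtain n where n: "1 \<le> n" "real n * s \<le> \<tau>" "\<tau> - s < real n * s" using subdivision[OF s(1) sT] by blast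
    have ns: "0 < real n * s" using n(1) s by simp
    define r where "r = \<tau> - real n * s"
    have r: "0 \<le> r" "r < s" using n by (auto simp: r_def)
    have Ce: "0 \<le> C * e" using C e by simp
    have Cs: "C * s * e \<le> C * \<tau> * e" "real n * (C * s * e) \<le> C * \<tau> * e"
    proof -
      show "C * s * e \<le> C * \<tau> * e" using sT C e by (intro mult_right_mono mult_left_mono) auto
      have "(C * e) * (real n * s) \<le> (C * e) * \<tau>" using n(2) Ce by (intro mult_left_mono)
      then show "real n * (C * s * e) \<le> C * \<tau> * e" by (simp add: mult_ac)
    qed
    have rest: "\<bar>a \<tau> - a (real n * s)\<bar> \<le> C * \<tau> * e + e * \<tau>"
    proof (cases "r = 0")
      case True
      then have "\<tau> = real n * s" by (simp add: r_def)
      then show ?thesis using C e \<tau> by simp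
    next
      case False
      then have rp: "0 < r" using r by simp
      have "\<bar>a (real n * s + r) - a (real n * s) - a r\<bar> \<le> C * r * e" using ns n(2) rp r(2) sT by (intro add') auto
      moreover have "real n * s + r = \<tau>" by (simp add: r_def)
      moreover have "C * r * e \<le> C * s * e" using r C e by (intro mult_right_mono mult_left_mono) auto
      moreover have "\<bar>a r\<bar> < e * \<tau>" using rp r(2) s by (intro \<sigma>(2)) auto
      ultimately show ?thesis using Cs(1) by simp
    qed
    have "\<bar>a \<tau> - real n * a s\<bar> \<le> 2 * (C * \<tau> * e) + e * \<tau>" using rest mult[OF n(1)] n(2) Cs(2) by linarith
    moreover have "\<bar>real n * a s - \<tau> * (a s / s)\<bar> \<le> e * \<tau>"
    proof -
      have "real n * a s - \<tau> * (a s / s) = - (r * (a s / s))" using s by (simp add: r_def algebra_simps)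
      moreover have "\<bar>r * (a s / s)\<bar> \<le> \<bar>a s\<bar>"
      proof -
        have "r * \<bar>a s\<bar> \<le> s * \<bar>a s\<bar>" using r by (intro mult_right_mono) auto
        then show ?thesis using s r by (simp add: abs_mult pos_divide_le_eq mult.commute)
      qed
      moreover have "\<bar>a s\<bar> < e * \<tau>" using s by (intro \<sigma>(2)) auto
      ultimately show ?thesis by simp
    qed
    ultimately have "\<bar>a \<tau> - \<tau> * (a s / s)\<bar> \<le> 2 * (C * \<tau> * e) + 2 * (e * \<tau>)" by linarith
    also have "\<dots> = \<tau> * \<epsilon>" unfolding e(2)[symmetric] by (simp add: algebra_simps)
    finally have "\<bar>a \<tau> - \<tau> * (a s / s)\<bar> / \<tau> \<le> \<epsilon>" using \<tau> by (simp add: pos_divide_le_eq mult.commute)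
    moreover have "a s / s - a \<tau> / \<tau> = - ((a \<tau> - \<tau> * (a s / s)) / \<tau>)" using \<tau> by (simp add: diff_divide_distrib)
    ultimately show ?thesis using \<tau> by (simp add: abs_divide)
  qed
  show "\<exists>L. \<forall>\<^sub>F s in at_right 0. \<bar>a s / s - L\<bar> \<le> \<epsilon>"
    unfolding eventually_at_right_field
    by (intro exI[of _ "a \<tau> / \<tau>"] exI[of _ "min \<sigma> \<tau>"]) (use main \<sigma>(1) \<tau>(1) in auto)
qed

context G_Levy_decomp
begin

lemma sum_Lipschitz:
  assumes L: "L-lipschitz_on UNIV (f :: 'a \<Rightarrow> real)"
  shows "(L * 4)-lipschitz_on UNIV (\<lambda>(x :: 'a \<times> 'a, y :: 'a \<times> 'a). f ((fst x + snd x) + (fst y + snd y)))"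
    and "(L * 2)-lipschitz_on UNIV (\<lambda>x :: 'a \<times> 'a. f (fst x + snd x))"
proof -
  have L0: "0 \<le> L" by (rule lipschitz_on_nonneg[OF L])
  have d: "dist (fst x + snd x) (fst x' + snd x') \<le> 2 * dist x x'" for x x' :: "'a \<times> 'a"
    using dist_triangle_add[of "fst x" "snd x" "fst x'" "snd x'"] dist_fst_le[of x x'] dist_snd_le[of x x'] by linarith
  show "(L * 2)-lipschitz_on UNIV (\<lambda>x :: 'a \<times> 'a. f (fst x + snd x))"
  proof (rule lipschitz_onI)
    fix x x' :: "'a \<times> 'a"
    show "dist (f (fst x + snd x)) (f (fst x' + snd x')) \<le> (L * 2) * dist x x'"
      using lipschitz_onD[OF L, of "fst x + snd x" "fst x' + snd x'"] mult_left_mono[OF d[of x x'] L0] by simp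
  qed (use L0 in simp)
  show "(L * 4)-lipschitz_on UNIV (\<lambda>(x :: 'a \<times> 'a, y :: 'a \<times> 'a). f ((fst x + snd x) + (fst y + snd y)))"
  proof (rule lipschitz_onI)
    fix u v :: "('a \<times> 'a) \<times> ('a \<times> 'a)"
    obtain x y where u: "u = (x, y)" by (cases u)
    obtain x' y' where v: "v = (x', y')" by (cases v)
    have "dist ((fst x + snd x) + (fst y + snd y)) ((fst x' + snd x') + (fst y' + snd y')) \<le> 4 * dist u v"
      using dist_triangle_add[of "fst x + snd x" "fst y + snd y" "fst x' + snd x'" "fst y' + snd y'"] d[of x x'] d[of y y']
        dist_fst_le[of u v] dist_snd_le[of u v] unfolding u v fst_conv snd_conv by linarith
    from mult_left_mono[OF this L0]
    show "dist ((\<lambda>(x, y). f ((fst x + snd x) + (fst y + snd y))) u) ((\<lambda>(x, y). f ((fst x + snd x) + (fst y + snd y))) v) \<le> (L * 4) * dist u v"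
      using lipschitz_onD[OF L, of "(fst x + snd x) + (fst y + snd y)" "(fst x' + snd x') + (fst y' + snd y')"]
      unfolding u v by simp
  qed (use L0 in simp)
qed

lemma sum_closed:
  assumes "L-lipschitz_on UNIV (f :: 'a \<Rightarrow> real)" "0 \<le> t"
  shows "(\<lambda>\<omega>. f (Xc t \<omega> + Xd t \<omega>)) \<in> H"
  using Lip_vector_closed[OF rv[OF assms(2)] sum_Lipschitz(2)[OF assms(1)]] by simp

text \<open>Condition on the path up to time \<open>t\<close>: for a fixed value \<open>y\<close> there, \<open>mixed_increment\<close> and the moment
  bounds compare the conditional value with \<open>f y + a s\<close>, with an error \<open>C * s * norm y\<close>.\<close>

lemma almost_additive:
  assumes f: "Sm 3 K f" and f0: "f 0 = 0"
  obtains C T where "0 \<le> C" "0 < T" "\<And>t s. 0 < t \<Longrightarrow> 0 < s \<Longrightarrow> s \<le> T \<Longrightarrow>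
    \<bar>E (\<lambda>\<omega>. f (Xc (t + s) \<omega> + Xd (t + s) \<omega>)) - E (\<lambda>\<omega>. f (Xc t \<omega> + Xd t \<omega>)) - E (\<lambda>\<omega>. f (Xc s \<omega> + Xd s \<omega>))\<bar>
      \<le> C * s * (m1 t + md t)"
proof -
  define a where "a t = E (\<lambda>\<omega>. f (Xc t \<omega> + Xd t \<omega>))" for t
  obtain C1 T1 where C1: "0 \<le> C1" "0 < T1" "\<And>p s. 0 < s \<Longrightarrow> s \<le> T1 \<Longrightarrow> E (\<lambda>\<omega>. p \<bullet> Xc s \<omega>) \<le> C1 * norm p * s"
    by (rule first_moment, rule that)
  obtain C2 T2 where C2: "0 \<le> C2" "0 < T2" "\<And>s. 0 < s \<Longrightarrow> s \<le> T2 \<Longrightarrow> m2 s \<le> C2 * s"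
    by (rule second_moment, rule that)
  obtain C3 where C3: "0 \<le> C3" "\<And>t. 0 \<le> t \<Longrightarrow> md t \<le> C3 * t" by (rule md_bound, rule that)
  have K: "0 \<le> K" by (rule Sm_nonneg[OF f])
  define k1 where "k1 = (real DIM('a))^2 * K"
  define k2 where "k2 = (real DIM('a))^3 * K"
  have k: "0 \<le> k1" "0 \<le> k2" using K by (auto simp: k1_def k2_def)
  define C where "C = C1 * k1 + k2 * (C2 + C3)"
  have C: "0 \<le> C" using C1 C2 C3 k by (simp add: C_def)
  have "Sm (Suc 2) K f" using f by (simp add: numeral_3_eq_3 numeral_2_eq_2)
  then have L: "(real DIM('a) * K)-lipschitz_on UNIV f" by (rule Sm_Lipschitz_on)
  note cl = add_closed scale_closed const_closed norm_closed rv_c rv_d Xc_power_closed inner_closed sum_closed[OF L]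
  have "\<bar>a (t + s) - a t - a s\<bar> \<le> C * s * (m1 t + md t)" if t: "0 < t" and s: "0 < s" "s \<le> min T1 T2" for t s
  proof -
    let ?\<phi> = "\<lambda>(x :: 'a \<times> 'a) (y :: 'a \<times> 'a). f ((fst x + snd x) + (fst y + snd y))"
    have L4: "(real DIM('a) * K * 4)-lipschitz_on UNIV (\<lambda>(x, y). ?\<phi> x y)" by (rule sum_Lipschitz(1)[OF L])
    define \<Phi> where "\<Phi> = (\<lambda>x. E (\<lambda>\<omega>'. ?\<phi> x (Xc s \<omega>', Xd s \<omega>')))"
    have \<Phi>H: "(\<lambda>\<omega>. \<Phi> (Xc t \<omega>, Xd t \<omega>)) \<in> H" unfolding \<Phi>_def
      by (rule Lip_vector_closed[OF rv E_Lipschitz[OF rv L4]]) (use t s in auto)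
    have \<phi>H: "(\<lambda>\<omega>'. ?\<phi> x (Xc s \<omega>', Xd s \<omega>')) \<in> H" for x
      by (rule Lip_vector_closed[OF rv Lipschitz_section(1)[OF L4]]) (use t s in auto)
    have inner: "\<bar>\<Phi> (xc, xd) - (f (xc + xd) + a s)\<bar> \<le> C * s * norm (xc + xd)" for xc xd
    proof -
      define y where "y = xc + xd"
      obtain p where p: "norm p \<le> k1 * norm y"
        "\<And>u v. \<bar>f (y + (u + v)) - f y - f (u + v) - p \<bullet> u\<bar> \<le> k2 * norm y * (norm u ^ 2 + norm v)"
        using mixed_increment[OF f f0, of y] unfolding k1_def k2_def by blast
      define k3 where "k3 = k2 * norm y"
      have k3: "0 \<le> k3" using k by (simp add: k3_def)
      define R where "R = (\<lambda>\<omega>. k3 * norm (Xc s \<omega>) ^ 2 + k3 * norm (Xd s \<omega>))"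
      have RH: "R \<in> H" unfolding R_def using s by (intro cl) auto
      have "E R \<le> E (\<lambda>\<omega>. k3 * norm (Xc s \<omega>) ^ 2) + E (\<lambda>\<omega>. k3 * norm (Xd s \<omega>))"
        unfolding R_def using s by (intro E_add_le cl) auto
      also have "E (\<lambda>\<omega>. k3 * norm (Xc s \<omega>) ^ 2) = k3 * m2 s" unfolding m2_def using s k3 by (intro pos_homogeneous cl) auto
      also have "E (\<lambda>\<omega>. k3 * norm (Xd s \<omega>)) = k3 * md s" unfolding md_def using s k3 by (intro pos_homogeneous cl) auto
      also have "k3 * m2 s + k3 * md s \<le> k3 * (C2 * s) + k3 * (C3 * s)"
        using C2(3)[of s] C3(2)[of s] s k3 by (intro add_mono mult_left_mono) auto
      finally have ER: "E R \<le> k3 * (C2 + C3) * s" by (simp add: algebra_simps)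
      have Ep: "E (\<lambda>\<omega>. q \<bullet> Xc s \<omega>) \<le> C1 * (k1 * norm y) * s" if "norm q = norm p" for q
      proof -
        have "E (\<lambda>\<omega>. q \<bullet> Xc s \<omega>) \<le> C1 * norm q * s" using C1(3) s by simp
        also have "\<dots> \<le> C1 * (k1 * norm y) * s" using p(1) that C1(1) s by (intro mult_right_mono mult_left_mono) auto
        finally show ?thesis .
      qed
      have tot: "E (\<lambda>\<omega>. q \<bullet> Xc s \<omega> + R \<omega>) \<le> C * s * norm y" if "norm q = norm p" for q
      proof -
        have "E (\<lambda>\<omega>. q \<bullet> Xc s \<omega> + R \<omega>) \<le> E (\<lambda>\<omega>. q \<bullet> Xc s \<omega>) + E R" using s by (intro E_add_le RH cl) auto
        also have "\<dots> \<le> C1 * (k1 * norm y) * s + k3 * (C2 + C3) * s" using Ep[OF that] ER by linarith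
        also have "\<dots> = C * s * norm y" by (simp add: C_def k3_def algebra_simps)
        finally show ?thesis .
      qed
      have qH: "(\<lambda>\<omega>. q \<bullet> Xc s \<omega> + R \<omega>) \<in> H" for q using s by (intro add_closed RH inner_closed) auto
      have fH: "(\<lambda>\<omega>. f (Xc s \<omega> + Xd s \<omega>)) \<in> H" using s by (intro cl) auto
      have pt: "\<bar>f (y + (Xc s \<omega> + Xd s \<omega>)) - f y - f (Xc s \<omega> + Xd s \<omega>) - p \<bullet> Xc s \<omega>\<bar> \<le> R \<omega>" for \<omega>
        using p(2)[of "Xc s \<omega>" "Xd s \<omega>"] by (simp add: R_def k3_def algebra_simps)
      have \<Phi>y: "\<Phi> (xc, xd) = E (\<lambda>\<omega>. f (y + (Xc s \<omega> + Xd s \<omega>)))" by (simp add: \<Phi>_def y_def)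
      have \<phi>H': "(\<lambda>\<omega>. f (y + (Xc s \<omega> + Xd s \<omega>))) \<in> H" using \<phi>H[of "(xc, xd)"] by (simp add: y_def)
      have up: "\<Phi> (xc, xd) \<le> (a s + f y) + C * s * norm y"
      proof -
        have "f (y + (Xc s \<omega> + Xd s \<omega>)) \<le> (f (Xc s \<omega> + Xd s \<omega>) + f y) + (p \<bullet> Xc s \<omega> + R \<omega>)" for \<omega>
          using pt[of \<omega>] by linarith
        from E_dominated[OF \<phi>H' add_closed[OF fH const_closed] qH this]
        show ?thesis unfolding \<Phi>y E_add_const[OF fH] a_def[symmetric] using tot[OF refl] by linarith
      qed
      have lo: "a s \<le> (\<Phi> (xc, xd) + - f y) + C * s * norm y"
      proof -
        have "f (Xc s \<omega> + Xd s \<omega>) \<le> (f (y + (Xc s \<omega> + Xd s \<omega>)) + - f y) + ((- p) \<bullet> Xc s \<omega> + R \<omega>)" for \<omega>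
          using pt[of \<omega>] by (simp add: abs_le_iff)
        from E_dominated[OF fH add_closed[OF \<phi>H' const_closed] qH this]
        show ?thesis unfolding \<Phi>y E_add_const[OF \<phi>H'] a_def[symmetric] using tot[OF norm_minus_cancel] by linarith
      qed
      show ?thesis using up lo unfolding y_def by linarith
    qed
    have fH: "(\<lambda>\<omega>. f (Xc t \<omega> + Xd t \<omega>)) \<in> H" using t by (intro cl) auto
    have "\<bar>E (\<lambda>\<omega>. \<Phi> (Xc t \<omega>, Xd t \<omega>)) - E (\<lambda>\<omega>. f (Xc t \<omega> + Xd t \<omega>) + a s)\<bar>
        \<le> E (\<lambda>\<omega>. C * s * (norm (Xc t \<omega>) + norm (Xd t \<omega>)))"
    proof (rule E_abs_diff[OF \<Phi>H add_closed[OF fH const_closed]])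
      show "(\<lambda>\<omega>. C * s * (norm (Xc t \<omega>) + norm (Xd t \<omega>))) \<in> H" using t by (intro cl) auto
      fix \<omega>
      have "C * s * norm (Xc t \<omega> + Xd t \<omega>) \<le> C * s * (norm (Xc t \<omega>) + norm (Xd t \<omega>))"
        using C s by (intro mult_left_mono norm_triangle_ineq) auto
      then show "\<bar>\<Phi> (Xc t \<omega>, Xd t \<omega>) - (f (Xc t \<omega> + Xd t \<omega>) + a s)\<bar> \<le> C * s * (norm (Xc t \<omega>) + norm (Xd t \<omega>))"
        using inner[of "Xc t \<omega>" "Xd t \<omega>"] by linarith
    qed
    also have "\<dots> = C * s * E (\<lambda>\<omega>. norm (Xc t \<omega>) + norm (Xd t \<omega>))" using t s C by (intro pos_homogeneous cl) auto
    also have "\<dots> \<le> C * s * (m1 t + md t)"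
      unfolding m1_def md_def using t s C by (intro mult_left_mono E_add_le cl) auto
    also have "E (\<lambda>\<omega>. \<Phi> (Xc t \<omega>, Xd t \<omega>)) = a (t + s)"
      using Levy_independent_increment[OF Levy t s(1) L4] by (simp add: \<Phi>_def a_def)
    also have "E (\<lambda>\<omega>. f (Xc t \<omega> + Xd t \<omega>) + a s) = a t + a s" unfolding a_def[of t] by (rule E_add_const[OF fH])
    finally show ?thesis by (simp add: algebra_simps)
  qed
  note bound = this
  show ?thesis
  proof (rule that[OF C])
    show "0 < min T1 T2" using C1(2) C2(2) by simp
  qed (rule bound[unfolded a_def])
qed

theorem generator_limit_exists:
  assumes f: "Sm 3 K f" and f0: "f 0 = 0"
  shows "\<exists>l. ((\<lambda>s. E (\<lambda>\<omega>. f (Xc s \<omega> + Xd s \<omega>)) / s) \<longlongrightarrow> l) (at_right 0)"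
proof -
  obtain C T where C: "0 \<le> C" "0 < T" "\<And>t s. 0 < t \<Longrightarrow> 0 < s \<Longrightarrow> s \<le> T \<Longrightarrow>
    \<bar>E (\<lambda>\<omega>. f (Xc (t + s) \<omega> + Xd (t + s) \<omega>)) - E (\<lambda>\<omega>. f (Xc t \<omega> + Xd t \<omega>)) - E (\<lambda>\<omega>. f (Xc s \<omega> + Xd s \<omega>))\<bar>
      \<le> C * s * (m1 t + md t)" by (rule almost_additive[OF f f0], rule that)
  define L where "L = real DIM('a) * K"
  have "Sm (Suc 2) K f" using f by (simp add: numeral_3_eq_3 numeral_2_eq_2)
  then have L: "L-lipschitz_on UNIV f" unfolding L_def by (rule Sm_Lipschitz_on)
  have L0: "0 \<le> L" by (rule lipschitz_on_nonneg[OF L])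
  have le: "\<bar>E (\<lambda>\<omega>. f (Xc s \<omega> + Xd s \<omega>))\<bar> \<le> L * (m1 s + md s)" if s: "0 < s" for s
  proof -
    have "\<bar>E (\<lambda>\<omega>. f (Xc s \<omega> + Xd s \<omega>)) - E (\<lambda>\<omega>. 0)\<bar> \<le> E (\<lambda>\<omega>. L * (norm (Xc s \<omega>) + norm (Xd s \<omega>)))"
    proof (rule E_abs_diff)
      show "\<bar>f (Xc s \<omega> + Xd s \<omega>) - 0\<bar> \<le> L * (norm (Xc s \<omega>) + norm (Xd s \<omega>))" for \<omega>
        using lipschitz_onD[OF L, of "Xc s \<omega> + Xd s \<omega>" 0] mult_left_mono[OF norm_triangle_ineq[of "Xc s \<omega>" "Xd s \<omega>"] L0]
        by (simp add: f0 dist_real_def)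
      show "(\<lambda>\<omega>. f (Xc s \<omega> + Xd s \<omega>)) \<in> H" using s by (intro sum_closed[OF L]) simp
      show "(\<lambda>\<omega>. L * (norm (Xc s \<omega>) + norm (Xd s \<omega>))) \<in> H"
        using s by (intro scale_closed add_closed norm_closed rv_c rv_d) auto
    qed (rule const_closed)
    also have "\<dots> = L * E (\<lambda>\<omega>. norm (Xc s \<omega>) + norm (Xd s \<omega>))"
      using s L0 by (intro pos_homogeneous add_closed norm_closed rv_c rv_d) auto
    also have "\<dots> \<le> L * (m1 s + md s)"
      unfolding m1_def md_def using s L0 by (intro mult_left_mono E_add_le norm_closed rv_c rv_d) auto
    finally show ?thesis by (simp add: const)
  qed
  have l0: "((\<lambda>s. L * (m1 s + md s)) \<longlongrightarrow> 0) (at_right 0)" by (rule tendsto_mult_right_zero[OF moments_tendsto_0])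
  have "((\<lambda>s. E (\<lambda>\<omega>. f (Xc s \<omega> + Xd s \<omega>))) \<longlongrightarrow> 0) (at_right 0)"
  proof (rule Lim_null_comparison[OF _ l0])
    show "\<forall>\<^sub>F s in at_right 0. norm (E (\<lambda>\<omega>. f (Xc s \<omega> + Xd s \<omega>))) \<le> L * (m1 s + md s)"
      by (rule eventually_mono[OF eventually_at_right_less]) (simp only: real_norm_def le)
  qed
  from almost_additive_limit[OF C(2,1) C(3) moments_tendsto_0 this] show ?thesis .
qed

lemma total_norm_tendsto_0: "((\<lambda>s. E (\<lambda>\<omega>. norm (Xc s \<omega> + Xd s \<omega>))) \<longlongrightarrow> 0) (at_right 0)"
proof (rule Lim_null_comparison[OF _ moments_tendsto_0])
  have nl: "1-lipschitz_on UNIV (norm :: 'a \<Rightarrow> real)"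
    by (auto intro!: lipschitz_onI simp: dist_norm dist_real_def norm_triangle_ineq3)
  have le: "norm (E (\<lambda>\<omega>. norm (Xc s \<omega> + Xd s \<omega>))) \<le> m1 s + md s" if s: "0 < s" for s
  proof -
    have "E (\<lambda>\<omega>. norm (Xc s \<omega> + Xd s \<omega>)) \<le> m1 s + md s" unfolding m1_def md_def
      using s by (intro E_dominated sum_closed[OF nl] norm_closed rv_c rv_d norm_triangle_ineq) auto
    moreover have "0 \<le> E (\<lambda>\<omega>. norm (Xc s \<omega> + Xd s \<omega>))"
      using s by (intro E_bounds(2) sum_closed[OF nl]) auto
    ultimately show ?thesis by simp
  qed
  show "\<forall>\<^sub>F s in at_right 0. norm (E (\<lambda>\<omega>. norm (Xc s \<omega> + Xd s \<omega>))) \<le> m1 s + md s"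
    by (rule eventually_mono[OF eventually_at_right_less]) (rule le)
qed

end

section \<open>The value function is a viscosity solution\<close>

lemma C_b_Sm: "f \<in> C_b k \<Longrightarrow> \<exists>K. Sm k K (f :: real^'d::finite \<Rightarrow> real)"
proof (induction k arbitrary: f)
  case 0
  then show ?case by (auto simp: Sm.simps bounded_iff)
next
  case (Suc k)
  then have f: "bounded (range f)" "\<And>x. f differentiable (at x)" "\<And>i. (\<lambda>x. gradient f x $ i) \<in> C_b k" by auto
  obtain K0 where K0: "\<And>x. \<bar>f x\<bar> \<le> K0" using f(1) by (auto simp: bounded_iff)
  have "\<exists>K. Sm k K (pd (axis i 1) f)" for i using Suc.IH[OF f(3)[of i]] by (simp add: gradient_nth)
  then obtain K where K: "\<And>i. Sm k (K i) (pd (axis i 1) f)" by metis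
  have nn: "0 \<le> K i" for i using Sm_nonneg[OF K] .
  define M where "M = \<bar>K0\<bar> + (\<Sum>i\<in>UNIV. K i)"
  have le: "K i \<le> M" for i
    using member_le_sum[of i UNIV K] nn by (simp add: M_def)
  have "Sm k M (pd b f)" if "b \<in> Basis" for b
  proof -
    have "\<exists>i. b = axis i 1" using that by (auto simp: Basis_vec_def)
    then obtain i where "b = axis i 1" by blast
    then show ?thesis using Sm_mono[OF K le] by simp
  qed
  moreover have "\<bar>f x\<bar> \<le> M" for x using K0[of x] sum_nonneg[of UNIV K] nn by (simp add: M_def)
  ultimately show ?case using f(2) by (auto simp: Sm.simps)
qed

lemma Sm_C_b: "Sm k K (f :: real^'d::finite \<Rightarrow> real) \<Longrightarrow> f \<in> C_b k"
proof (induction k arbitrary: f)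
  case 0
  then show ?case by (auto simp: Sm.simps bounded_iff)
next
  case (Suc k)
  have "(\<lambda>x. gradient f x $ i) \<in> C_b k" for i
    unfolding gradient_nth using Suc.prems by (intro Suc.IH Sm_pd_Basis) (auto simp: axis_in_Basis_iff)
  moreover have "bounded (range f)" using Sm_bound[OF Suc.prems] by (auto simp: bounded_iff)
  ultimately show ?case using Sm_differentiable[OF Suc.prems] by simp
qed

lemma C_b_cylinder_section: "\<psi> \<in> C_b_cylinder \<Longrightarrow> 0 < t \<Longrightarrow> \<psi> t \<in> C_b 0"
proof -
  assume p: "\<psi> \<in> C_b_cylinder" and t: "0 < t"
  have "continuous_on UNIV (\<lambda>x. (\<lambda>(t, x). \<psi> t x) (t, x))"
    by (rule continuous_on_compose2[of "{0<..} \<times> UNIV"]) (use p t in \<open>auto simp: C_b_cylinder_def intro!: continuous_intros\<close>)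
  moreover have "bounded (range (\<psi> t))"
    by (rule bounded_subset[of "(\<lambda>(t, x). \<psi> t x) ` ({0<..} \<times> UNIV)"]) (use p t in \<open>auto simp: C_b_cylinder_def\<close>)
  ultimately show ?thesis by simp
qed

lemma C_b_space_section: "\<psi> \<in> C_b_space k \<Longrightarrow> 0 < t \<Longrightarrow> \<psi> t \<in> C_b k"
proof (induction k arbitrary: \<psi>)
  case 0
  then show ?case using C_b_cylinder_section[of \<psi> t] by simp
next
  case (Suc k)
  then have p: "\<psi> \<in> C_b_cylinder" "\<And>x. \<psi> t differentiable (at x)" "\<And>i. (\<lambda>t x. gradient (\<psi> t) x $ i) \<in> C_b_space k" by auto
  have "bounded (range (\<psi> t))" using C_b_cylinder_section[OF p(1) Suc.prems(2)] by simp
  then show ?case using p(2) Suc.IH[OF p(3) Suc.prems(2)] by simp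
qed

text \<open>The derivative in time is taken at the fixed point \<open>x\<close> although the argument moves to \<open>x + z\<close>: for
  small \<open>z\<close> this is continuity, and otherwise the boundedness of the derivative is absorbed into
  the term \<open>C * norm z\<close>, whose mean vanishes with \<open>\<delta>\<close>.\<close>

lemma time_increment:
  fixes \<psi> :: "real \<Rightarrow> real^'d::finite \<Rightarrow> real"
  assumes \<psi>: "\<psi> \<in> C_b_2_3" and t: "0 < t" and eps: "0 < \<epsilon>"
  obtains C \<rho> where "0 \<le> C" "0 < \<rho>" "\<rho> \<le> t" "\<And>\<delta> z. 0 < \<delta> \<Longrightarrow> \<delta> < \<rho> \<Longrightarrow>
    \<bar>\<psi> (t - \<delta>) (x + z) - \<psi> t (x + z) + \<delta> * deriv (\<lambda>s. \<psi> s x) t\<bar> \<le> \<delta> * (\<epsilon> + C * norm z)"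
proof -
  define D where "D = (\<lambda>t x. deriv (\<lambda>s. \<psi> s x) t)"
  have "\<psi> \<in> C_b_time (Suc 1)" using \<psi> by (simp add: C_b_2_3_def numeral_2_eq_2)
  then have diff: "\<And>s y. 0 < s \<Longrightarrow> (\<lambda>s. \<psi> s y) differentiable (at s)" and "D \<in> C_b_time 1" by (auto simp: D_def)
  then have D: "D \<in> C_b_cylinder" by simp
  obtain K where K: "\<And>s y. 0 < s \<Longrightarrow> \<bar>D s y\<bar> \<le> K"
    using D unfolding C_b_cylinder_def bounded_iff by auto
  have K0: "0 \<le> K" using K[OF t, of x] by linarith
  have o: "open ({0<..} \<times> UNIV :: (real \<times> (real^'d)) set)" by (intro open_Times) auto
  have "isCont (\<lambda>(t, x). D t x) (t, x)"
    using D t continuous_on_eq_continuous_at[OF o, of "\<lambda>(t, x). D t x"] by (auto simp: C_b_cylinder_def)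
  then obtain r where r: "0 < r" "\<And>s y. dist (s, y) (t, x) < r \<Longrightarrow> \<bar>D s y - D t x\<bar> < \<epsilon>"
    using eps unfolding continuous_at_eps_delta by (auto simp: dist_real_def)
  define \<rho> where "\<rho> = min (r / 2) t"
  have \<rho>: "0 < \<rho>" "\<rho> \<le> t" "\<rho> \<le> r / 2" using r t unfolding \<rho>_def by linarith+
  define C where "C = 4 * K / r"
  have C: "0 \<le> C" using K0 r by (simp add: C_def)
  have "\<bar>\<psi> (t - \<delta>) (x + z) - \<psi> t (x + z) + \<delta> * D t x\<bar> \<le> \<delta> * (\<epsilon> + C * norm z)" if d: "0 < \<delta>" "\<delta> < \<rho>" for \<delta> z
  proof -
    have der: "((\<lambda>s. \<psi> s (x + z)) has_real_derivative D s (x + z)) (at s)" if "0 < s" for s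
      using diff[OF that] by (simp add: D_def DERIV_deriv_iff_real_differentiable)
    have "\<exists>s>t - \<delta>. s < t \<and> \<psi> t (x + z) - \<psi> (t - \<delta>) (x + z) = (t - (t - \<delta>)) * D s (x + z)"
      by (rule MVT2) (use d \<rho> der in auto)
    then obtain s where s: "t - \<delta> < s" "s < t" "\<psi> t (x + z) - \<psi> (t - \<delta>) (x + z) = \<delta> * D s (x + z)" by auto
    have "\<bar>D s (x + z) - D t x\<bar> \<le> \<epsilon> + C * norm z"
    proof (cases "norm z < r / 2")
      case True
      have "dist (s, x + z) (t, x) \<le> dist s t + dist (x + z) x"
        using sqrt_sum_squares_le_sum_abs[of "dist s t" "dist (x + z) x"] by (simp add: dist_Pair_Pair)
      also have "\<dots> < r" using s d \<rho> True by (simp add: dist_real_def dist_norm)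
      finally have "\<bar>D s (x + z) - D t x\<bar> < \<epsilon>" by (rule r(2))
      moreover have "0 \<le> C * norm z" using C by simp
      ultimately show ?thesis by linarith
    next
      case False
      have "0 < s" using s d \<rho> by linarith
      then have "\<bar>D s (x + z) - D t x\<bar> \<le> 2 * K" using K[of s "x + z"] K[OF t, of x] by linarith
      also have "\<dots> \<le> C * norm z"
      proof -
        have "C * (r / 2) \<le> C * norm z" using False C by (intro mult_left_mono) auto
        then show ?thesis using r by (simp add: C_def)
      qed
      finally show ?thesis using eps by linarith
    qed
    then have "\<delta> * \<bar>D s (x + z) - D t x\<bar> \<le> \<delta> * (\<epsilon> + C * norm z)" using d by (intro mult_left_mono) auto
    moreover have "\<psi> (t - \<delta>) (x + z) - \<psi> t (x + z) + \<delta> * D t x = - (\<delta> * (D s (x + z) - D t x))"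
      using s(3) by (simp add: algebra_simps)
    ultimately show ?thesis using d by (simp add: abs_mult)
  qed
  then show ?thesis using that[OF C \<rho>(1,2)] by (simp add: D_def)
qed

text \<open>Only three properties of the process enter: the Levy property, the existence of the generator limit,
  and the continuity in mean at time \<open>0\<close>.\<close>

theorem value_function_viscosity:
  fixes X :: "real \<Rightarrow> 'w \<Rightarrow> real^'d::finite"
  assumes S: "sublinear_expectation_space H E" and X: "Levy_process H E X"
    and lim: "\<And>f K. Sm 3 K f \<Longrightarrow> f 0 = 0 \<Longrightarrow> ((\<lambda>\<delta>. E (\<lambda>\<omega>. f (X \<delta> \<omega>)) / \<delta>) \<longlongrightarrow> G_X E X f) (at_right 0)"
    and em0: "((\<lambda>\<delta>. E (\<lambda>\<omega>. norm (X \<delta> \<omega>))) \<longlongrightarrow> 0) (at_right 0)"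
    and rep: "represents_G_X E X U"
    and \<phi>: "L-lipschitz_on UNIV \<phi>" and N: "\<And>x. \<bar>\<phi> x\<bar> \<le> N"
    and u: "\<And>t x. 0 \<le> t \<Longrightarrow> u t x = E (\<lambda>\<omega>. \<phi> (x + X t \<omega>))"
  shows "viscosity_solution U \<phi> u"
proof -
  interpret sublinear_expectation_space H E by (rule S)
  define em where "em = (\<lambda>\<delta>. E (\<lambda>\<omega>. norm (X \<delta> \<omega>)))"
  have rvX: "random_vector H (X t)" if "0 \<le> t" for t using X that by (simp add: Levy_process_def)
  have X0: "X 0 \<omega> = 0" for \<omega> using X by (simp add: Levy_process_def)
  have L0: "0 \<le> L" by (rule lipschitz_on_nonneg[OF \<phi>])
  have shift: "M-lipschitz_on UNIV (\<lambda>z. f (x + z))" if "M-lipschitz_on UNIV f" for f :: "real^'d \<Rightarrow> real" and M x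
    using lipschitz_onD[OF that] lipschitz_on_nonneg[OF that] by (auto intro!: lipschitz_onI) (metis UNIV_I dist_add_cancel)
  have cl: "(\<lambda>\<omega>. f (x + X t \<omega>)) \<in> H" if "M-lipschitz_on UNIV f" "0 \<le> t" for f M x t
    by (rule Lip_vector_closed[OF rvX[OF that(2)] shift[OF that(1)]])
  have nX: "(\<lambda>\<omega>. norm (X t \<omega>)) \<in> H" if "0 \<le> t" for t by (rule norm_closed[OF rvX[OF that]])
  have ub: "\<bar>u t x\<bar> \<le> N" if "0 \<le> t" for t x
  proof -
    have "\<phi> y \<le> N" "- N \<le> \<phi> y" for y using N[of y] by linarith+
    then have "u t x \<le> N" "- N \<le> u t x" unfolding u[OF that] using cl[OF \<phi> that] by (auto intro!: E_bounds)
    then show ?thesis by linarith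
  qed
  have u0: "u 0 x = \<phi> x" for x using u[of 0 x] by (simp add: X0 const)
  have uL: "L-lipschitz_on UNIV (u t)" if t: "0 \<le> t" for t
  proof (rule lipschitz_onI[OF _ L0])
    fix x y
    have "\<bar>u t x - u t y\<bar> \<le> E (\<lambda>\<omega>. L * dist x y)" unfolding u[OF t]
    proof (rule E_abs_diff[OF cl[OF \<phi> t] cl[OF \<phi> t] const_closed])
      show "\<bar>\<phi> (x + X t \<omega>) - \<phi> (y + X t \<omega>)\<bar> \<le> L * dist x y" for \<omega>
        using lipschitz_onD[OF \<phi>, of "x + X t \<omega>" "y + X t \<omega>"] by (simp add: dist_real_def)
    qed
    then show "dist (u t x) (u t y) \<le> L * dist x y" by (simp add: const dist_real_def)
  qed
  have dpp: "u (t + s) x = E (\<lambda>\<omega>. u t (x + X s \<omega>))" if t: "0 \<le> t" and s: "0 < s" for t s x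
  proof (cases "t = 0")
    case True
    then show ?thesis using u[of s x] s by (simp add: u0)
  next
    case False
    then have tp: "0 < t" using t by simp
    have L2: "(L * 2)-lipschitz_on UNIV (\<lambda>(y, z). \<phi> (x + y + z))"
    proof (rule lipschitz_onI)
      fix a b :: "(real^'d) \<times> (real^'d)"
      have "dist (x + fst a + snd a) (x + fst b + snd b) \<le> dist (fst a) (fst b) + dist (snd a) (snd b)"
        using dist_triangle_add[of "fst a" "snd a" "fst b" "snd b"] by (simp add: add.assoc)
      also have "\<dots> \<le> 2 * dist a b" using dist_fst_le[of a b] dist_snd_le[of a b] by linarith
      finally have "L * dist (x + fst a + snd a) (x + fst b + snd b) \<le> L * (2 * dist a b)" using L0 by (rule mult_left_mono)
      then show "dist ((\<lambda>(y, z). \<phi> (x + y + z)) a) ((\<lambda>(y, z). \<phi> (x + y + z)) b) \<le> (L * 2) * dist a b"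
        using lipschitz_onD[OF \<phi>, of "x + fst a + snd a" "x + fst b + snd b"] by (simp add: case_prod_unfold)
    qed (use L0 in simp)
    have "u (t + s) x = E (\<lambda>\<omega>. \<phi> (x + X s \<omega> + (X (s + t) \<omega> - X s \<omega>)))"
      using u[of "t + s" x] t s by (simp add: add.commute)
    also have "\<dots> = E (\<lambda>\<omega>. E (\<lambda>\<omega>'. \<phi> (x + X s \<omega> + X t \<omega>')))"
      by (rule Levy_independent_increment[OF X s tp L2])
    also have "\<dots> = E (\<lambda>\<omega>. u t (x + X s \<omega>))" using u[OF t] by simp
    finally show ?thesis .
  qed
  have ut: "\<bar>u (t + s) x - u t x\<bar> \<le> L * em s" if t: "0 \<le> t" and s: "0 < s" for t s x
  proof -
    have s0: "0 \<le> s" using s by simp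
    have "\<bar>E (\<lambda>\<omega>. u t (x + X s \<omega>)) - E (\<lambda>\<omega>. u t x)\<bar> \<le> E (\<lambda>\<omega>. L * norm (X s \<omega>))"
    proof (rule E_abs_diff[OF cl[OF uL[OF t] s0] const_closed scale_closed[OF nX[OF s0]]])
      show "\<bar>u t (x + X s \<omega>) - u t x\<bar> \<le> L * norm (X s \<omega>)" for \<omega>
        using lipschitz_onD[OF uL[OF t], of "x + X s \<omega>" x] by (simp add: dist_real_def dist_norm)
    qed
    also have "\<dots> = L * em s" unfolding em_def by (rule pos_homogeneous[OF nX[OF s0] L0])
    finally show ?thesis by (simp add: dpp[OF t s] const)
  qed
  have em_lim: "(em \<longlongrightarrow> 0) (at_right 0)" using em0 by (simp add: em_def[abs_def])
  have cont: "continuous_on ({0..} \<times> UNIV) (\<lambda>(t, x). u t x)"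
    unfolding continuous_on_iff
  proof (intro ballI allI impI)
    fix z :: "real \<times> (real^'d)" and e :: real assume z: "z \<in> {0..} \<times> UNIV" and e: "0 < e"
    define e' where "e' = e / (2 * (L + 1))"
    have ee: "e' * (2 * (L + 1)) = e" using L0 by (simp add: e'_def)
    have e'0: "0 < e'" using e L0 by (simp add: e'_def)
    moreover have "L * e' + L * e' < e" unfolding ee[symmetric] using e'0 by (simp add: algebra_simps)
    ultimately have e': "0 < e'" "L * e' + L * e' < e" by auto
    have "\<forall>\<^sub>F s in at_right 0. em s < e'" using em_lim e'(1) by (rule order_tendstoD)
    then obtain b where b: "0 < b" "\<And>s. 0 < s \<Longrightarrow> s < b \<Longrightarrow> em s < e'" by (auto simp: eventually_at_right_field)
    have tt: "\<bar>u t' y - u t y\<bar> \<le> L * e'" if "0 \<le> t" "0 \<le> t'" "\<bar>t' - t\<bar> < b" for t t' y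
    proof -
      consider "t' = t" | "t < t'" | "t' < t" by linarith
      then show ?thesis
      proof cases
        case 1 then show ?thesis using L0 e' by simp
      next
        case 2
        have "L * em (t' - t) \<le> L * e'" using b(2)[of "t' - t"] 2 that L0 by (intro mult_left_mono) auto
        then show ?thesis using ut[of t "t' - t" y] 2 that by simp
      next
        case 3
        have "L * em (t - t') \<le> L * e'" using b(2)[of "t - t'"] 3 that L0 by (intro mult_left_mono) auto
        then show ?thesis using ut[of t' "t - t'" y] 3 that by (simp add: abs_minus_commute)
      qed
    qed
    have "dist ((\<lambda>(t, x). u t x) y) ((\<lambda>(t, x). u t x) z) < e" if y: "y \<in> {0..} \<times> UNIV" "dist y z < min b e'" for y
    proof -
      obtain t x where zz: "z = (t, x)" by (cases z)
      obtain t' x' where yy: "y = (t', x')" by (cases y)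
      have d: "\<bar>t' - t\<bar> < b" "dist x' x < e'" using y(2) dist_fst_le[of y z] dist_snd_le[of y z] by (auto simp: yy zz dist_real_def)
      have "\<bar>u t' x' - u t x'\<bar> \<le> L * e'" using d(1) y z by (intro tt) (auto simp: yy zz)
      moreover have "\<bar>u t x' - u t x\<bar> \<le> L * e'"
        using lipschitz_onD[OF uL, of t x' x] mult_left_mono[OF less_imp_le[OF d(2)] L0] z by (auto simp: zz dist_real_def)
      ultimately show ?thesis using e' by (simp add: yy zz dist_real_def)
    qed
    then show "\<exists>d>0. \<forall>y\<in>{0..} \<times> UNIV. dist y z < d \<longrightarrow> dist ((\<lambda>(t, x). u t x) y) ((\<lambda>(t, x). u t x) z) < e"
      using b(1) e'(1) by (intro exI[of _ "min b e'"]) auto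
  qed
  have bdd: "bounded ((\<lambda>(t, x). u t x) ` ({0..} \<times> UNIV))"
    unfolding bounded_iff using ub by auto
  have usc: "upper_semicontinuous_on ({0..} \<times> UNIV) (\<lambda>(t, x). u t x)"
    unfolding upper_semicontinuous_on_def using cont by (auto simp: continuous_on_def intro: order_tendstoD(2))
  have lsc: "lower_semicontinuous_on ({0..} \<times> UNIV) (\<lambda>(t, x). u t x)"
    unfolding lower_semicontinuous_on_def using cont by (auto simp: continuous_on_def intro: order_tendstoD(1))
  \<comment> \<open>The increment of a test function over a short time, to first order; both halves of the proof use it.\<close>
  have touch: "\<exists>f. G_X E X f = sup_triples U (\<lambda>z. \<psi> t (x + z) - \<psi> t x) (gradient (\<psi> t) x) (hessian (\<psi> t) x) \<and>
      ((\<lambda>\<delta>. E (\<lambda>\<omega>. f (X \<delta> \<omega>)) / \<delta>) \<longlongrightarrow> G_X E X f) (at_right 0) \<and>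
      (\<forall>\<epsilon>>0. \<exists>C. \<forall>\<^sub>F \<delta> in at_right 0. 0 < \<delta> \<and> \<delta> < t \<and>
        \<bar>E (\<lambda>\<omega>. \<psi> (t - \<delta>) (x + X \<delta> \<omega>)) - \<psi> t x - E (\<lambda>\<omega>. f (X \<delta> \<omega>)) + \<delta> * deriv (\<lambda>s. \<psi> s x) t\<bar>
          \<le> \<delta> * (\<epsilon> + C * em \<delta>) \<and> (\<lambda>\<omega>. \<psi> (t - \<delta>) (x + X \<delta> \<omega>)) \<in> H)"
    if \<psi>: "\<psi> \<in> C_b_2_3" and t: "0 < t" for \<psi> t x
  proof -
    have sec: "\<exists>K. Sm 3 K (\<psi> s)" if "0 < s" for s
      using C_b_Sm[OF C_b_space_section[of \<psi> 3 s]] \<psi> that by (simp add: C_b_2_3_def)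
    obtain K where K: "Sm 3 K (\<psi> t)" using sec[OF t] by blast
    have K3: "Sm (Suc (Suc (Suc 0))) K (\<psi> t)" using K by (simp add: numeral_3_eq_3)
    have Lip: "\<exists>M. M-lipschitz_on UNIV (\<psi> s)" if s: "0 < s" for s
    proof -
      obtain K where "Sm (Suc 2) K (\<psi> s)" using sec[OF s] by (auto simp: numeral_3_eq_3 numeral_2_eq_2)
      then show ?thesis using Sm_Lipschitz_on by blast
    qed
    \<comment> \<open>The generator acts on functions that vanish at the origin, so \<open>\<psi> t\<close> is recentred at \<open>x\<close>.\<close>
    define f where "f = (\<lambda>z. \<psi> t (z + x) + - \<psi> t x)"
    have f: "Sm 3 (K + \<bar>\<psi> t x\<bar>) f" unfolding f_def by (rule Sm_add[OF Sm_translate[OF K]]) simp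
    have f0: "f 0 = 0" by (simp add: f_def)
    have D: "\<psi> t differentiable (at y)" for y using Sm_differentiable[OF K3] .
    have D2: "pd b (\<psi> t) differentiable (at y)" for b y using Sm_differentiable[OF Sm_pd[OF K3]] .
    have pf: "pd b f y = pd b (\<psi> t) (y + x)" for b y
      using pd_affine(1)[OF D, where b = b and e = 1 and c = x] pd_affine(2)[OF D, where e = 1 and c = x and y = y]
      unfolding f_def by (subst pd_add) auto
    have pf2: "pd c (pd b f) y = pd c (pd b (\<psi> t)) (y + x)" for b c y
      using pd_affine(1)[OF D2[of b], where b = c and e = 1 and c = x] unfolding pf by simp
    have gr: "gradient f 0 = gradient (\<psi> t) x" "hessian f 0 = hessian (\<psi> t) x"
      by (simp_all add: vec_eq_iff gradient_nth hessian_nth pf pf2)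
    have "f \<in> C_b 3" by (rule Sm_C_b[OF f])
    then have "G_X E X f = sup_triples U f (gradient f 0) (hessian f 0)"
      using rep f0 by (auto simp: represents_G_X_def)
    then have Gf: "G_X E X f = sup_triples U f (gradient (\<psi> t) x) (hessian (\<psi> t) x)" unfolding gr .
    have fz: "f = (\<lambda>z. \<psi> t (x + z) - \<psi> t x)" by (simp add: f_def add.commute)
    have G: "G_X E X f = sup_triples U (\<lambda>z. \<psi> t (x + z) - \<psi> t x) (gradient (\<psi> t) x) (hessian (\<psi> t) x)"
      using Gf unfolding fz .
    have fL: "\<exists>M. M-lipschitz_on UNIV f"
      using Sm_Lipschitz_on[of 2 _ f] f by (auto simp: numeral_3_eq_3 numeral_2_eq_2)
    define D0 where "D0 = deriv (\<lambda>s. \<psi> s x) t"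
    have "\<exists>C. \<forall>\<^sub>F \<delta> in at_right 0. 0 < \<delta> \<and> \<delta> < t \<and>
        \<bar>E (\<lambda>\<omega>. \<psi> (t - \<delta>) (x + X \<delta> \<omega>)) - \<psi> t x - E (\<lambda>\<omega>. f (X \<delta> \<omega>)) + \<delta> * D0\<bar>
          \<le> \<delta> * (\<epsilon> + C * em \<delta>) \<and> (\<lambda>\<omega>. \<psi> (t - \<delta>) (x + X \<delta> \<omega>)) \<in> H" if eps: "0 < \<epsilon>" for \<epsilon>
    proof -
      obtain C \<rho> where C: "0 \<le> C" "0 < \<rho>" "\<rho> \<le> t" "\<And>\<delta> z. 0 < \<delta> \<Longrightarrow> \<delta> < \<rho> \<Longrightarrow>
        \<bar>\<psi> (t - \<delta>) (x + z) - \<psi> t (x + z) + \<delta> * D0\<bar> \<le> \<delta> * (\<epsilon> + C * norm z)"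
        by (rule time_increment[OF \<psi> t eps, of x, folded D0_def], rule that)
      have "0 < \<delta> \<and> \<delta> < t \<and>
        \<bar>E (\<lambda>\<omega>. \<psi> (t - \<delta>) (x + X \<delta> \<omega>)) - \<psi> t x - E (\<lambda>\<omega>. f (X \<delta> \<omega>)) + \<delta> * D0\<bar>
          \<le> \<delta> * (\<epsilon> + C * em \<delta>) \<and> (\<lambda>\<omega>. \<psi> (t - \<delta>) (x + X \<delta> \<omega>)) \<in> H" if d: "0 < \<delta>" "\<delta> < \<rho>" for \<delta>
      proof -
        have d0: "0 \<le> \<delta>" and dt: "0 < t - \<delta>" using d C by auto
        have H1: "(\<lambda>\<omega>. \<psi> (t - \<delta>) (x + X \<delta> \<omega>)) \<in> H" using Lip[OF dt] cl d0 by blast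
        have H2: "(\<lambda>\<omega>. f (X \<delta> \<omega>)) \<in> H" using fL Lip_vector_closed[OF rvX[OF d0]] by blast
        have "\<bar>E (\<lambda>\<omega>. \<psi> (t - \<delta>) (x + X \<delta> \<omega>)) - E (\<lambda>\<omega>. f (X \<delta> \<omega>) + (\<psi> t x - \<delta> * D0))\<bar>
            \<le> E (\<lambda>\<omega>. (\<delta> * C) * norm (X \<delta> \<omega>) + \<delta> * \<epsilon>)"
        proof (rule E_abs_diff[OF H1 add_closed[OF H2 const_closed] add_closed[OF scale_closed[OF nX[OF d0]] const_closed]])
          fix \<omega>
          have "\<psi> (t - \<delta>) (x + X \<delta> \<omega>) - (f (X \<delta> \<omega>) + (\<psi> t x - \<delta> * D0)) = \<psi> (t - \<delta>) (x + X \<delta> \<omega>) - \<psi> t (x + X \<delta> \<omega>) + \<delta> * D0"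
            by (simp add: f_def add.commute)
          then show "\<bar>\<psi> (t - \<delta>) (x + X \<delta> \<omega>) - (f (X \<delta> \<omega>) + (\<psi> t x - \<delta> * D0))\<bar> \<le> (\<delta> * C) * norm (X \<delta> \<omega>) + \<delta> * \<epsilon>"
            using C(4)[OF d, of "X \<delta> \<omega>"] by (simp add: algebra_simps)
        qed
        also have "E (\<lambda>\<omega>. (\<delta> * C) * norm (X \<delta> \<omega>) + \<delta> * \<epsilon>) = (\<delta> * C) * em \<delta> + \<delta> * \<epsilon>"
          unfolding em_def by (rule E_affine[OF nX[OF d0]]) (use d C in simp)
        also have "E (\<lambda>\<omega>. f (X \<delta> \<omega>) + (\<psi> t x - \<delta> * D0)) = E (\<lambda>\<omega>. f (X \<delta> \<omega>)) + (\<psi> t x - \<delta> * D0)"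
          by (rule E_add_const[OF H2])
        finally have "\<bar>E (\<lambda>\<omega>. \<psi> (t - \<delta>) (x + X \<delta> \<omega>)) - \<psi> t x - E (\<lambda>\<omega>. f (X \<delta> \<omega>)) + \<delta> * D0\<bar> \<le> \<delta> * (\<epsilon> + C * em \<delta>)"
          by (simp add: algebra_simps)
        then show ?thesis using d C(3) H1 by simp
      qed
      note near = this
      show ?thesis by (rule exI[of _ C], rule eventually_at_rightI[OF _ C(2)], rule near) auto
    qed
    note error = this
    show ?thesis by (intro exI[of _ f] conjI G lim[OF f f0] allI impI error[unfolded D0_def]) assumption
  qed
  have err: "((\<lambda>\<delta>. \<epsilon> + C * em \<delta>) \<longlongrightarrow> \<epsilon> + C * 0) (at_right 0)" for \<epsilon> C :: real
    by (intro tendsto_intros em_lim)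
  have sub: "pde_lhs U \<psi> t x \<le> 0"
    if \<psi>: "\<psi> \<in> C_b_2_3" and t: "0 < t" and ge: "\<forall>s>0. \<forall>y. u s y \<le> \<psi> s y" and eq: "\<psi> t x = u t x" for \<psi> t x
  proof -
    obtain f where G: "G_X E X f = sup_triples U (\<lambda>z. \<psi> t (x + z) - \<psi> t x) (gradient (\<psi> t) x) (hessian (\<psi> t) x)"
      and l: "((\<lambda>\<delta>. E (\<lambda>\<omega>. f (X \<delta> \<omega>)) / \<delta>) \<longlongrightarrow> G_X E X f) (at_right 0)"
      and tou: "\<And>\<epsilon>. 0 < \<epsilon> \<Longrightarrow> \<exists>C. \<forall>\<^sub>F \<delta> in at_right 0. 0 < \<delta> \<and> \<delta> < t \<and>
        \<bar>E (\<lambda>\<omega>. \<psi> (t - \<delta>) (x + X \<delta> \<omega>)) - \<psi> t x - E (\<lambda>\<omega>. f (X \<delta> \<omega>)) + \<delta> * deriv (\<lambda>s. \<psi> s x) t\<bar>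
          \<le> \<delta> * (\<epsilon> + C * em \<delta>) \<and> (\<lambda>\<omega>. \<psi> (t - \<delta>) (x + X \<delta> \<omega>)) \<in> H"
      using touch[OF \<psi> t, of x] by blast
    have "deriv (\<lambda>s. \<psi> s x) t \<le> G_X E X f + \<epsilon>" if eps: "0 < \<epsilon>" for \<epsilon>
    proof -
      obtain C where C: "\<forall>\<^sub>F \<delta> in at_right 0. 0 < \<delta> \<and> \<delta> < t \<and>
        \<bar>E (\<lambda>\<omega>. \<psi> (t - \<delta>) (x + X \<delta> \<omega>)) - \<psi> t x - E (\<lambda>\<omega>. f (X \<delta> \<omega>)) + \<delta> * deriv (\<lambda>s. \<psi> s x) t\<bar>
          \<le> \<delta> * (\<epsilon> + C * em \<delta>) \<and> (\<lambda>\<omega>. \<psi> (t - \<delta>) (x + X \<delta> \<omega>)) \<in> H" using tou[OF eps] by blast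
      have "\<forall>\<^sub>F \<delta> in at_right 0. deriv (\<lambda>s. \<psi> s x) t \<le> E (\<lambda>\<omega>. f (X \<delta> \<omega>)) / \<delta> + (\<epsilon> + C * em \<delta>)"
        using C
      proof eventually_elim
        case (elim \<delta>)
        then have d: "0 < \<delta>" "\<delta> < t" and H1: "(\<lambda>\<omega>. \<psi> (t - \<delta>) (x + X \<delta> \<omega>)) \<in> H" by auto
        have "u t x = E (\<lambda>\<omega>. u (t - \<delta>) (x + X \<delta> \<omega>))" using dpp[of "t - \<delta>" \<delta> x] d by simp
        also have "\<dots> \<le> E (\<lambda>\<omega>. \<psi> (t - \<delta>) (x + X \<delta> \<omega>))"
          using ge d by (intro mono[OF H1] cl[OF uL]) auto
        finally have "0 \<le> E (\<lambda>\<omega>. f (X \<delta> \<omega>)) - \<delta> * deriv (\<lambda>s. \<psi> s x) t + \<delta> * (\<epsilon> + C * em \<delta>)"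
          using elim eq by linarith
        then have "\<delta> * deriv (\<lambda>s. \<psi> s x) t \<le> \<delta> * (E (\<lambda>\<omega>. f (X \<delta> \<omega>)) / \<delta> + (\<epsilon> + C * em \<delta>))"
          using d by (simp add: distrib_left)
        then show ?case using d by simp
      qed
      from tendsto_lowerbound[OF tendsto_add[OF l err] this]
      show ?thesis by (simp add: trivial_limit_at_right_real)
    qed
    then have "deriv (\<lambda>s. \<psi> s x) t \<le> G_X E X f" by (rule field_le_epsilon)
    then show ?thesis by (simp add: pde_lhs_def G)
  qed
  have super: "0 \<le> pde_lhs U \<psi> t x"
    if \<psi>: "\<psi> \<in> C_b_2_3" and t: "0 < t" and ge: "\<forall>s>0. \<forall>y. \<psi> s y \<le> u s y" and eq: "\<psi> t x = u t x" for \<psi> t x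
  proof -
    obtain f where G: "G_X E X f = sup_triples U (\<lambda>z. \<psi> t (x + z) - \<psi> t x) (gradient (\<psi> t) x) (hessian (\<psi> t) x)"
      and l: "((\<lambda>\<delta>. E (\<lambda>\<omega>. f (X \<delta> \<omega>)) / \<delta>) \<longlongrightarrow> G_X E X f) (at_right 0)"
      and tou: "\<And>\<epsilon>. 0 < \<epsilon> \<Longrightarrow> \<exists>C. \<forall>\<^sub>F \<delta> in at_right 0. 0 < \<delta> \<and> \<delta> < t \<and>
        \<bar>E (\<lambda>\<omega>. \<psi> (t - \<delta>) (x + X \<delta> \<omega>)) - \<psi> t x - E (\<lambda>\<omega>. f (X \<delta> \<omega>)) + \<delta> * deriv (\<lambda>s. \<psi> s x) t\<bar>
          \<le> \<delta> * (\<epsilon> + C * em \<delta>) \<and> (\<lambda>\<omega>. \<psi> (t - \<delta>) (x + X \<delta> \<omega>)) \<in> H"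
      using touch[OF \<psi> t, of x] by blast
    have "G_X E X f \<le> deriv (\<lambda>s. \<psi> s x) t + \<epsilon>" if eps: "0 < \<epsilon>" for \<epsilon>
    proof -
      obtain C where C: "\<forall>\<^sub>F \<delta> in at_right 0. 0 < \<delta> \<and> \<delta> < t \<and>
        \<bar>E (\<lambda>\<omega>. \<psi> (t - \<delta>) (x + X \<delta> \<omega>)) - \<psi> t x - E (\<lambda>\<omega>. f (X \<delta> \<omega>)) + \<delta> * deriv (\<lambda>s. \<psi> s x) t\<bar>
          \<le> \<delta> * (\<epsilon> + C * em \<delta>) \<and> (\<lambda>\<omega>. \<psi> (t - \<delta>) (x + X \<delta> \<omega>)) \<in> H" using tou[OF eps] by blast
      have "\<forall>\<^sub>F \<delta> in at_right 0. E (\<lambda>\<omega>. f (X \<delta> \<omega>)) / \<delta> - (\<epsilon> + C * em \<delta>) \<le> deriv (\<lambda>s. \<psi> s x) t"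
        using C
      proof eventually_elim
        case (elim \<delta>)
        then have d: "0 < \<delta>" "\<delta> < t" and H1: "(\<lambda>\<omega>. \<psi> (t - \<delta>) (x + X \<delta> \<omega>)) \<in> H" by auto
        have "E (\<lambda>\<omega>. \<psi> (t - \<delta>) (x + X \<delta> \<omega>)) \<le> E (\<lambda>\<omega>. u (t - \<delta>) (x + X \<delta> \<omega>))"
          using ge d by (intro mono[OF _ H1] cl[OF uL]) auto
        also have "\<dots> = u t x" using dpp[of "t - \<delta>" \<delta> x] d by simp
        finally have "E (\<lambda>\<omega>. f (X \<delta> \<omega>)) - \<delta> * (\<epsilon> + C * em \<delta>) \<le> \<delta> * deriv (\<lambda>s. \<psi> s x) t"
          using elim eq by linarith
        then have "\<delta> * (E (\<lambda>\<omega>. f (X \<delta> \<omega>)) / \<delta> - (\<epsilon> + C * em \<delta>)) \<le> \<delta> * deriv (\<lambda>s. \<psi> s x) t"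
          using d by (simp add: right_diff_distrib)
        then show ?case using d by simp
      qed
      from tendsto_upperbound[OF tendsto_diff[OF l err] this]
      show ?thesis by (simp add: trivial_limit_at_right_real algebra_simps)
    qed
    then have "G_X E X f \<le> deriv (\<lambda>s. \<psi> s x) t" by (rule field_le_epsilon)
    then show ?thesis by (simp add: pde_lhs_def G)
  qed
  show ?thesis
    unfolding viscosity_solution_def viscosity_subsolution_def viscosity_supersolution_def
    by (intro conjI allI ballI impI; (elim conjE)?) (simp_all add: bdd cont usc lsc u0 sub super)
qed

text \<open>The decomposition lives on a space of its own; it is used only through the limits that it provides,
  and these depend on the one-dimensional distributions alone.\<close>

theorem theorem36:
  fixes H :: "('w \<Rightarrow> real) set"
    and E :: "('w \<Rightarrow> real) \<Rightarrow> real"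
    and X :: "real \<Rightarrow> 'w \<Rightarrow> real^'d"
    and U :: "'d::finite triple set"
    and \<phi> :: "real^'d \<Rightarrow> real"
    and u :: "real \<Rightarrow> real^'d \<Rightarrow> real"
  assumes "sublinear_expectation_space H E"
    and "G_Levy_process TYPE('v) H E X"
    and "represents_G_X E X U"
    and "\<phi> \<in> C_b_Lip"
    and "\<forall>t\<ge>0. \<forall>x. u t x = E (\<lambda>\<omega>. \<phi> (x + X t \<omega>))"
  shows "viscosity_solution U \<phi> u \<and>
         (\<forall>w. viscosity_solution U \<phi> w \<longrightarrow> (\<forall>t\<ge>0. \<forall>x. w t x = u t x))"
proof -
  obtain L where L: "L-lipschitz_on UNIV \<phi>" using assms(4) by (auto simp: C_b_Lip_def C_Lip_def)
  obtain N where N: "\<And>x. \<bar>\<phi> x\<bar> \<le> N" using assms(4) by (auto simp: C_b_Lip_def bounded_iff)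
  have X: "Levy_process H E X" using assms(2) by (simp add: G_Levy_process_def)
  obtain H' :: "('v \<Rightarrow> real) set" and E' Xc Xd where sp: "sublinear_expectation_space H' E'"
    and dec: "G_Levy_decomposition H' E' Xc Xd"
    and fdd: "same_finite_dim_distributions E' (\<lambda>t \<omega>. Xc t \<omega> + Xd t \<omega>) E X"
    using assms(2) unfolding G_Levy_process_def by blast
  interpret D: G_Levy_decomp H' E' Xc Xd
    by (rule G_Levy_decomp.intro[OF sp]) (unfold_locales, rule dec)
  have transfer: "E' (\<lambda>\<omega>. f (Xc t \<omega> + Xd t \<omega>)) = E (\<lambda>\<omega>. f (X t \<omega>))"
    if "M-lipschitz_on UNIV f" "0 \<le> t" for f M t
  proof -
    have "(\<lambda>x. f (x 0)) \<in> C_Lip_tuple (Suc 0)"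
      unfolding C_Lip_tuple_def D.tuple_dist_1 using lipschitz_onD[OF that(1)] by (auto simp: dist_real_def)
    moreover have "\<forall>i<Suc 0. 0 \<le> (\<lambda>_. t) i" using that by simp
    ultimately show ?thesis using fdd unfolding same_finite_dim_distributions_def by fastforce
  qed
  have lim: "((\<lambda>\<delta>. E (\<lambda>\<omega>. f (X \<delta> \<omega>)) / \<delta>) \<longlongrightarrow> G_X E X f) (at_right 0)"
    if f: "Sm 3 K f" "f 0 = 0" for f K
  proof -
    have "Sm (Suc 2) K f" using f(1) by (simp add: numeral_3_eq_3 numeral_2_eq_2)
    from Sm_Lipschitz_on[OF this] have tr: "E' (\<lambda>\<omega>. f (Xc t \<omega> + Xd t \<omega>)) = E (\<lambda>\<omega>. f (X t \<omega>))" if "0 \<le> t" for t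
      using transfer that by blast
    obtain l where "((\<lambda>s. E' (\<lambda>\<omega>. f (Xc s \<omega> + Xd s \<omega>)) / s) \<longlongrightarrow> l) (at_right 0)"
      using D.generator_limit_exists[OF f] by blast
    moreover have "\<forall>\<^sub>F s in at_right 0. E' (\<lambda>\<omega>. f (Xc s \<omega> + Xd s \<omega>)) / s = E (\<lambda>\<omega>. f (X s \<omega>)) / s"
      using eventually_at_right_less[of "0 :: real"] by eventually_elim (simp add: tr)
    ultimately have l: "((\<lambda>s. E (\<lambda>\<omega>. f (X s \<omega>)) / s) \<longlongrightarrow> l) (at_right 0)"
      by (rule Lim_transform_eventually)
    then have "G_X E X f = l" unfolding G_X_def by (intro tendsto_Lim) (simp_all add: trivial_limit_at_right_real)
    then show ?thesis using l by simp
  qed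
  have em: "((\<lambda>\<delta>. E (\<lambda>\<omega>. norm (X \<delta> \<omega>))) \<longlongrightarrow> 0) (at_right 0)"
  proof -
    have nl: "1-lipschitz_on UNIV (norm :: real^'d \<Rightarrow> real)"
      by (auto intro!: lipschitz_onI simp: dist_norm dist_real_def norm_triangle_ineq3)
    have "\<forall>\<^sub>F s in at_right 0. E' (\<lambda>\<omega>. norm (Xc s \<omega> + Xd s \<omega>)) = E (\<lambda>\<omega>. norm (X s \<omega>))"
      using eventually_at_right_less[of "0 :: real"] by eventually_elim (rule transfer[OF nl], simp)
    with D.total_norm_tendsto_0 show ?thesis by (rule Lim_transform_eventually)
  qed
  have vu: "viscosity_solution U \<phi> u"
    by (rule value_function_viscosity[where L = L and N = N, OF assms(1) X lim em assms(3) L N]) (use assms(5) in auto)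
  obtain M where M: "0 \<le> M" "bounded_triples M U" by (rule represents_bounded_triples[OF assms(3)])
  have b\<phi>: "bounded_borel N \<phi>"
    using N borel_measurable_continuous_onI[OF lipschitz_on_continuous_on[OF L]] by (simp add: bounded_borel_def)
  have "w t x = u t x" if w: "viscosity_solution U \<phi> w" and t: "0 \<le> t" for w t x
  proof (rule antisym)
    show "w t x \<le> u t x"
      by (rule viscosity_comparison[OF M(2,1) _ _ _ L b\<phi> t]) (use w vu in \<open>auto simp: viscosity_solution_def\<close>)
    show "u t x \<le> w t x"
      by (rule viscosity_comparison[OF M(2,1) _ _ _ L b\<phi> t]) (use w vu in \<open>auto simp: viscosity_solution_def\<close>)
  qed
  then show ?thesis using vu by blast
qed

end
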